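(* The orbit space of $\mathcal J(\tilde A_n)$ carries a flat pencil of metrics: in the coordinates $(t^0,t^1,\dots,t^n,v_{n+1},\tau)$, the metrics $$g^{\alpha\beta}\qquad\text{and}\qquad\eta^{\alpha\beta}:=\frac{\partial g^{\alpha\beta}}{\partial t^0},$$ where $g^{\alpha\beta}$ are the coefficients of the intersection form $g^*$, form a flat pencil, with corresponding Christoffel symbols $\Gamma_\gamma^{\alpha\beta}$ (of $g^*$) and $\Gamma^{\alpha\beta}_{\gamma,\eta}:=\frac{\partial\Gamma_\gamma^{\alpha\beta}}{\partial t^0}$ (of $\eta^*$).
   Context: Let $n\ge1$ and consider $\Omega=\mathbb C\times\mathbb C^{n+1}\times\mathbb H$ ($\mathbb H$ the upper half-plane) with coordinates $(u,v_0,\dots,v_{n-1},v_{n+1},\tau)$, and $v_n=-\sum_{i=0}^{n-1}v_i$. $\mathcal J(\tilde A_n)$ is the group of transformations of $\Omega$ generated by permutations of $v_0,\dots,v_n$; by $(u,v,\tau)\mapsto(u-\langle\lambda,v\rangle-\frac12\langle\lambda,\lambda\rangle\tau+k,v+\lambda\tau+\mu,\tau)$ with $k\in\mathbb Z$ and integer vectors $\lambda,\mu$ with $\sum_{i=0}^n\lambda_i=\sum_{i=0}^n\mu_i=0$; and by $(u,v,\tau)\mapsto\left(u+\frac{c\langle v,v\rangle}{2(c\tau+d)},\frac v{c\tau+d},\frac{a\tau+b}{c\tau+d}\right)$ with $\begin{pmatrix}a&b\\c&d\end{pmatrix}\in SL_2(\mathbb Z)$, where $\langle v,w\rangle=\sum_{i=0}^nv_iw_i-n(n+1)v_{n+1}w_{n+1}$.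 The coordinates $t^\alpha$ below are local (multivalued) coordinates on the orbit space. $\theta_1(z)=\theta_1(z,\tau)=2\sum_{m\ge0}(-1)^me^{\pi i\tau(m+1/2)^2}\sin((2m+1)\pi z)$, $\theta_1'=\partial_z\theta_1$; $\wp,\zeta$ are the Weierstrass functions of $\mathbb Z+\tau\mathbb Z$; $g_1=\eta'/\eta$ with $\eta(\tau)$ the Dedekind eta function. The functions $\varphi_0,\dots,\varphi_n$ are defined by the identity in $z$ $$e^{-2\pi iu}\frac{\prod_{i=0}^n\theta_1(z-v_i+v_{n+1})}{\theta_1^n(z)\,\theta_1(z+(n+1)v_{n+1})}=\sum_{k=2}^n\frac{(-1)^k}{(k-1)!}\varphi_k\wp^{(k-2)}(z)+\varphi_1\left[\zeta(z)-\zeta(z+(n+1)v_{n+1})+\zeta((n+1)v_{n+1})\right]+\varphi_0,$$ with $\varphi_k=0$ for $k>n$. Then $t^\alpha=\frac{n}{n+1-\alpha}\varphi_n^{\frac{n+1-\alpha}n}\sum_{d\ge0}\binom{\frac{n+1-\alpha}n}{d}\sum_{i_1+\dots+i_d=n-\alpha,\ i_j\ge1}\frac{\varphi_{n-i_1}}{\varphi_n}\cdots\frac{\varphi_{n-i_d}}{\varphi_n}$ for $1\le\alpha\le n$ (for a chosen branch of $\varphi_n^{1/n}$) and $t^0=\varphi_0+\frac{\theta_1'((n+1)v_{n+1})}{\theta_1((n+1)v_{n+1})}\varphi_1+4\pi ig_1(\tau)\varphi_2$. The intersection form is $g^*=\sum_{i,j=0}^{n-1}(A^{-1})_{ij}\partial_{v_i}\otimes\partial_{v_j}-\frac1{n(n+1)}\partial_{v_{n+1}}\otimes\partial_{v_{n+1}}+\partial_u\otimes\partial_\tau+\partial_\tau\otimes\partial_u$,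 with $A$ the $n\times n$ matrix with $2$ on the diagonal and $1$ elsewhere. Contravariant Christoffel symbols of a metric $g$ are $\Gamma^{\alpha\beta}_\gamma=-g^{\alpha\sigma}\Gamma^\beta_{\sigma\gamma}$ with $\Gamma^\beta_{\sigma\gamma}$ those of its Levi-Civita connection. Two (contravariant) metrics $g^*,\eta^*$ form a flat pencil if for arbitrary $\kappa$ the metric $g^{\alpha\beta}+\kappa\eta^{\alpha\beta}$ is flat and its contravariant Christoffel symbols are $\Gamma^{\alpha\beta}_{\gamma,g}+\kappa\Gamma^{\alpha\beta}_{\gamma,\eta}$. *)

theory Defs
  imports "HOL-Analysis.Analysis" "HOL-Algebra.Bij" "HOL-Algebra.Generated_Groups"
begin

text \<open>
  Throughout, \<open>n = CARD('n)\<close>, and the finite linear order \<open>'n\<close> is identified with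
  \<open>{1..n}\<close> via \<open>rank\<close>. The type \<open>'n idx\<close> has \<open>n + 3\<close> elements and indexes both
  coordinate systems in use:
  \<^item> on \<open>\<Omega>\<close>, \<open>X0, XN i, Xv, Xtau\<close> stand for \<open>u\<close>, \<open>v\<close> with subscript
    \<open>rank i - 1\<close>, \<open>v\<close> with subscript \<open>n + 1\<close>, and \<open>\<tau>\<close>;
  \<^item> on the orbit space they stand for \<open>t\<close> with superscript \<open>0\<close>, \<open>t\<close> with superscript
    \<open>rank i\<close>, \<open>v\<close> with subscript \<open>n + 1\<close>, and \<open>\<tau>\<close>.
\<close>

datatype 'n idx = X0 | XN 'n | Xv | Xtau

instance idx :: (finite) finite
proof
  have "(UNIV :: 'a idx set) = {X0, Xv, Xtau} \<union> range XN"
    by (auto intro: idx.exhaust)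
  moreover have "finite ({X0, Xv, Xtau} \<union> range (XN :: 'a \<Rightarrow> 'a idx))"
    by simp
  ultimately show "finite (UNIV :: 'a idx set)"
    by metis
qed

type_synonym 'n point = "(complex, 'n idx) vec"

definition rank :: "'n::{finite,linorder} \<Rightarrow> nat" where
  "rank i = card {..i}"


section \<open>The extended affine Jacobi group and its orbits\<close>

definition Omega :: "'n::finite point set" where
  "Omega = {x. Im (x $ Xtau) > 0}"

text \<open>
  The vector \<open>(v\<^sub>0, \<dots>, v\<^sub>n)\<close>, indexed by \<open>'n option\<close>; the index \<open>None\<close> is the dependent
  entry \<open>v\<^sub>n\<close>.
\<close>
definition full_v :: "'n::finite point \<Rightarrow> 'n option \<Rightarrow> complex" where
  "full_v x i = (case i of Some j \<Rightarrow> x $ XN j | None \<Rightarrow> - (\<Sum>j\<in>UNIV. x $ XN j))"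

definition jform :: "('n::finite option \<Rightarrow> complex) \<times> complex \<Rightarrow> ('n option \<Rightarrow> complex) \<times> complex \<Rightarrow> complex"
  where "jform V W = (\<Sum>i\<in>UNIV. fst V i * fst W i)
            - of_nat CARD('n) * (of_nat CARD('n) + 1) * snd V * snd W"

definition v_part :: "'n::finite point \<Rightarrow> ('n option \<Rightarrow> complex) \<times> complex" where
  "v_part x = (full_v x, x $ Xv)"

definition perm_act :: "('n::finite option \<Rightarrow> 'n option) \<Rightarrow> 'n point \<Rightarrow> 'n point" where
  "perm_act \<pi> x = (\<chi> c. case c of
      X0 \<Rightarrow> x $ X0
    | XN j \<Rightarrow> full_v x (\<pi> (Some j))
    | Xv \<Rightarrow> x $ Xv
    | Xtau \<Rightarrow> x $ Xtau)"

text \<open>The last entries of \<open>\<lambda>\<close> and \<open>\<mu>\<close>, with subscript \<open>n + 1\<close>, are the arguments \<open>l\<close> and \<open>m\<close>.\<close>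
definition trans_act ::
    "('n::finite option \<Rightarrow> int) \<Rightarrow> int \<Rightarrow> ('n option \<Rightarrow> int) \<Rightarrow> int \<Rightarrow> int \<Rightarrow> 'n point \<Rightarrow> 'n point" where
  "trans_act lam l mu m k x =
     (let L = (\<lambda>i. of_int (lam i), of_int l); \<tau> = x $ Xtau in
      \<chi> c. case c of
        X0 \<Rightarrow> x $ X0 - jform L (v_part x) - 1/2 * jform L L * \<tau> + of_int k
      | XN j \<Rightarrow> x $ XN j + of_int (lam (Some j)) * \<tau> + of_int (mu (Some j))
      | Xv \<Rightarrow> x $ Xv + of_int l * \<tau> + of_int m
      | Xtau \<Rightarrow> \<tau>)"

definition sl2_act :: "int \<Rightarrow> int \<Rightarrow> int \<Rightarrow> int \<Rightarrow> 'n::finite point \<Rightarrow> 'n point" where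
  "sl2_act a b c d x =
     (let \<tau> = x $ Xtau; j = of_int c * \<tau> + of_int d in
      \<chi> e. case e of
        X0 \<Rightarrow> x $ X0 + of_int c * jform (v_part x) (v_part x) / (2 * j)
      | XN i \<Rightarrow> x $ XN i / j
      | Xv \<Rightarrow> x $ Xv / j
      | Xtau \<Rightarrow> (of_int a * \<tau> + of_int b) / j)"

definition jacobi_gens :: "('n::finite point \<Rightarrow> 'n point) set" where
  "jacobi_gens =
     {restrict (perm_act \<pi>) Omega | \<pi>. bij \<pi>}
   \<union> {restrict (trans_act lam l mu m k) Omega | lam l mu m k.
        (\<Sum>i\<in>UNIV. lam i) = 0 \<and> (\<Sum>i\<in>UNIV. mu i) = 0}
   \<union> {restrict (sl2_act a b c d) Omega | a b c d. a * d - b * c = 1}"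

definition jacobi_group :: "('n::finite point \<Rightarrow> 'n point) set" where
  "jacobi_group = generate (BijGroup Omega) jacobi_gens"

definition jacobi_orbit :: "'n::finite point \<Rightarrow> 'n point set" where
  "jacobi_orbit x = {f x | f. f \<in> jacobi_group}"


section \<open>Special functions\<close>

definition theta1 :: "complex \<Rightarrow> complex \<Rightarrow> complex" where
  "theta1 \<tau> z = 2 * (\<Sum>m. (-1) ^ m * exp (of_real pi * \<i> * \<tau> * (of_nat m + 1/2)\<^sup>2)
                         * sin ((2 * of_nat m + 1) * of_real pi * z))"

definition lattice_of :: "complex \<Rightarrow> complex set" where
  "lattice_of \<tau> = {of_int k + of_int l * \<tau> | k l. True}"

definition weier_p :: "complex \<Rightarrow> complex \<Rightarrow> complex" where
  "weier_p \<tau> z = 1 / z\<^sup>2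
     + infsum (\<lambda>\<omega>. 1 / (z - \<omega>)\<^sup>2 - 1 / \<omega>\<^sup>2) (lattice_of \<tau> - {0})"

definition weier_zeta :: "complex \<Rightarrow> complex \<Rightarrow> complex" where
  "weier_zeta \<tau> z = 1 / z
     + infsum (\<lambda>\<omega>. 1 / (z - \<omega>) + 1 / \<omega> + z / \<omega>\<^sup>2) (lattice_of \<tau> - {0})"

definition dedekind_eta :: "complex \<Rightarrow> complex" where
  "dedekind_eta \<tau> = exp (of_real pi * \<i> * \<tau> / 12)
     * prodinf (\<lambda>m. 1 - exp (2 * of_real pi * \<i> * of_nat (Suc m) * \<tau>))"

definition g1 :: "complex \<Rightarrow> complex" where
  "g1 \<tau> = deriv dedekind_eta \<tau> / dedekind_eta \<tau>"


section \<open>The invariants and the coordinates on the orbit space\<close>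

definition shift_v :: "'n::finite point \<Rightarrow> complex" where
  "shift_v x = (of_nat CARD('n) + 1) * x $ Xv"

definition phi_identity :: "'n::finite point \<Rightarrow> (nat \<Rightarrow> complex) \<Rightarrow> complex \<Rightarrow> bool" where
  "phi_identity x c z \<longleftrightarrow>
     (let n = CARD('n); \<tau> = x $ Xtau; w = shift_v x in
      exp (- 2 * of_real pi * \<i> * x $ X0)
        * (\<Prod>i\<in>UNIV. theta1 \<tau> (z - full_v x i + x $ Xv))
        / (theta1 \<tau> z ^ n * theta1 \<tau> (z + w))
      = (\<Sum>k=2..n. (-1) ^ k / fact (k - 1) * c k * (deriv ^^ (k - 2)) (weier_p \<tau>) z)
        + c 1 * (weier_zeta \<tau> z - weier_zeta \<tau> (z + w) + weier_zeta \<tau> w)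
        + c 0)"

text \<open>
  The coefficients exist and are unique as long as \<open>(n + 1) v\<close>, with \<open>v\<close> of subscript
  \<open>n + 1\<close>, is not a lattice point; elsewhere the value is unspecified.
\<close>
definition phi :: "'n::finite point \<Rightarrow> nat \<Rightarrow> complex" where
  "phi x = (THE c. (\<forall>k > CARD('n). c k = 0) \<and>
     (\<forall>z. z \<notin> lattice_of (x $ Xtau) \<and> z + shift_v x \<notin> lattice_of (x $ Xtau)
        \<longrightarrow> phi_identity x c z))"

definition t_zero :: "'n::finite point \<Rightarrow> complex" where
  "t_zero x = phi x 0
     + deriv (theta1 (x $ Xtau)) (shift_v x) / theta1 (x $ Xtau) (shift_v x) * phi x 1
     + 4 * of_real pi * \<i> * g1 (x $ Xtau) * phi x 2"

text \<open>
  Here \<open>r\<close> is the chosen branch of the \<open>n\<close>-th root of the invariant with index \<open>n\<close>. The inner sum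
  runs over compositions of \<open>n - \<alpha>\<close> into \<open>d\<close> positive parts, hence is empty for \<open>d > n - \<alpha>\<close>.
\<close>
definition t_pos :: "('n::finite point \<Rightarrow> complex) \<Rightarrow> nat \<Rightarrow> 'n point \<Rightarrow> complex" where
  "t_pos r \<alpha> x =
     (let n = CARD('n) in
      of_nat n / of_nat (n + 1 - \<alpha>) * r x ^ (n + 1 - \<alpha>)
        * (\<Sum>d\<le>n - \<alpha>. ((of_nat (n + 1 - \<alpha>) / of_nat n) gchoose d)
            * (\<Sum>ks\<in>{ks. length ks = d \<and> sum_list ks = n - \<alpha> \<and> (\<forall>k\<in>set ks. k \<ge> 1)}.
                 \<Prod>k\<leftarrow>ks. phi x (n - k) / phi x n)))"

definition t_coord :: "('n::{finite,linorder} point \<Rightarrow> complex) \<Rightarrow> 'n point \<Rightarrow> 'n point" where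
  "t_coord r x = (\<chi> c. case c of
      X0 \<Rightarrow> t_zero x
    | XN i \<Rightarrow> t_pos r (rank i) x
    | Xv \<Rightarrow> x $ Xv
    | Xtau \<Rightarrow> x $ Xtau)"

definition pdiff :: "((complex, 'm::finite) vec \<Rightarrow> complex) \<Rightarrow> 'm \<Rightarrow> (complex, 'm) vec \<Rightarrow> complex" where
  "pdiff f a x = deriv (\<lambda>s. f (x + axis a s)) 0"

definition jacobian :: "((complex, 'm::finite) vec \<Rightarrow> (complex, 'm) vec)
    \<Rightarrow> (complex, 'm) vec \<Rightarrow> complex ^ 'm ^ 'm" where
  "jacobian F x = (\<chi> \<alpha> a. pdiff (\<lambda>y. F y $ \<alpha>) a x)"

text \<open>
  An open piece of the orbit space on which the \<open>t\<close>-coordinates are local coordinates is given by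
  an open sheet \<open>U\<close> in \<open>\<Omega>\<close> mapping injectively to the orbit space, together with a
  branch \<open>r\<close> of the \<open>n\<close>-th root on it.
\<close>
definition orbit_chart :: "'n::{finite,linorder} point set \<Rightarrow> ('n point \<Rightarrow> complex) \<Rightarrow> bool" where
  "orbit_chart U r \<longleftrightarrow>
     open U \<and> U \<subseteq> Omega \<and> inj_on jacobi_orbit U \<and>
     (\<forall>x\<in>U. shift_v x \<notin> lattice_of (x $ Xtau)) \<and>
     continuous_on U r \<and> (\<forall>x\<in>U. r x \<noteq> 0 \<and> r x ^ CARD('n) = phi x CARD('n)) \<and>
     inj_on (t_coord r) U \<and> (\<forall>x\<in>U. invertible (jacobian (t_coord r) x))"


section \<open>The intersection form\<close>

definition A_mat :: "complex ^ 'n ^ 'n::finite" where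
  "A_mat = (\<chi> i j. if i = j then 2 else 1)"

text \<open>The constant coefficients of the intersection form in the coordinates of \<open>\<Omega>\<close>.\<close>
definition g_star :: "complex ^ ('n::finite idx) ^ ('n idx)" where
  "g_star = (\<chi> a b. case (a, b) of
      (XN i, XN j) \<Rightarrow> matrix_inv A_mat $ i $ j
    | (Xv, Xv) \<Rightarrow> - 1 / (of_nat CARD('n) * (of_nat CARD('n) + 1))
    | (X0, Xtau) \<Rightarrow> 1
    | (Xtau, X0) \<Rightarrow> 1
    | _ \<Rightarrow> 0)"

definition g_t :: "'n::{finite,linorder} point set \<Rightarrow> ('n point \<Rightarrow> complex) \<Rightarrow> 'n point
    \<Rightarrow> complex ^ ('n idx) ^ ('n idx)" where
  "g_t U r p =
     (let J = jacobian (t_coord r) (inv_into U (t_coord r) p) in J ** g_star ** transpose J)"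

definition eta_t :: "'n::{finite,linorder} point set \<Rightarrow> ('n point \<Rightarrow> complex) \<Rightarrow> 'n point
    \<Rightarrow> complex ^ ('n idx) ^ ('n idx)" where
  "eta_t U r p = (\<chi> \<alpha> \<beta>. pdiff (\<lambda>q. g_t U r q $ \<alpha> $ \<beta>) X0 p)"


section \<open>Contravariant metrics and flat pencils\<close>

definition holo_on :: "((complex, 'm::finite) vec \<Rightarrow> complex) \<Rightarrow> (complex, 'm) vec set \<Rightarrow> bool" where
  "holo_on f W \<longleftrightarrow>
     (\<forall>p\<in>W. \<exists>D. (f has_derivative D) (at p) \<and> (\<forall>c v. D (c *s v) = c * D v))"

definition contra_metric_on ::
    "(complex, 'm::finite) vec set \<Rightarrow> ((complex, 'm) vec \<Rightarrow> complex ^ 'm ^ 'm) \<Rightarrow> bool" where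
  "contra_metric_on W g \<longleftrightarrow>
     open W \<and> (\<forall>\<alpha> \<beta>. holo_on (\<lambda>p. g p $ \<alpha> $ \<beta>) W) \<and>
     (\<forall>p\<in>W. transpose (g p) = g p \<and> invertible (g p))"

text \<open>The arguments \<open>\<beta> \<sigma> \<gamma>\<close> are the upper index followed by the two lower ones.\<close>
definition levi_civita :: "((complex, 'm::finite) vec \<Rightarrow> complex ^ 'm ^ 'm) \<Rightarrow> (complex, 'm) vec
    \<Rightarrow> 'm \<Rightarrow> 'm \<Rightarrow> 'm \<Rightarrow> complex" where
  "levi_civita g p \<beta> \<sigma> \<gamma> =
     (let h = (\<lambda>a b q. matrix_inv (g q) $ a $ b) in
      1/2 * (\<Sum>\<delta>\<in>UNIV. g p $ \<beta> $ \<delta> *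
        (pdiff (h \<delta> \<gamma>) \<sigma> p + pdiff (h \<delta> \<sigma>) \<gamma> p - pdiff (h \<sigma> \<gamma>) \<delta> p)))"

text \<open>The arguments \<open>\<alpha> \<beta> \<gamma>\<close> are the two upper indices followed by the lower one.\<close>
definition contra_christoffel :: "((complex, 'm::finite) vec \<Rightarrow> complex ^ 'm ^ 'm)
    \<Rightarrow> (complex, 'm) vec \<Rightarrow> 'm \<Rightarrow> 'm \<Rightarrow> 'm \<Rightarrow> complex" where
  "contra_christoffel g p \<alpha> \<beta> \<gamma> = - (\<Sum>\<sigma>\<in>UNIV. g p $ \<alpha> $ \<sigma> * levi_civita g p \<beta> \<sigma> \<gamma>)"

definition riemann :: "((complex, 'm::finite) vec \<Rightarrow> complex ^ 'm ^ 'm)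
    \<Rightarrow> (complex, 'm) vec \<Rightarrow> 'm \<Rightarrow> 'm \<Rightarrow> 'm \<Rightarrow> 'm \<Rightarrow> complex" where
  "riemann g p \<alpha> \<beta> \<gamma> \<delta> =
     pdiff (\<lambda>q. levi_civita g q \<alpha> \<delta> \<beta>) \<gamma> p - pdiff (\<lambda>q. levi_civita g q \<alpha> \<gamma> \<beta>) \<delta> p
     + (\<Sum>\<epsilon>\<in>UNIV. levi_civita g p \<alpha> \<gamma> \<epsilon> * levi_civita g p \<epsilon> \<delta> \<beta>
                   - levi_civita g p \<alpha> \<delta> \<epsilon> * levi_civita g p \<epsilon> \<gamma> \<beta>)"

definition flat_at :: "((complex, 'm::finite) vec \<Rightarrow> complex ^ 'm ^ 'm) \<Rightarrow> (complex, 'm) vec \<Rightarrow> bool"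
  where "flat_at g p \<longleftrightarrow> (\<forall>\<alpha> \<beta> \<gamma> \<delta>. riemann g p \<alpha> \<beta> \<gamma> \<delta> = 0)"

definition pencil :: "((complex, 'm::finite) vec \<Rightarrow> complex ^ 'm ^ 'm)
    \<Rightarrow> ((complex, 'm) vec \<Rightarrow> complex ^ 'm ^ 'm) \<Rightarrow> complex
    \<Rightarrow> (complex, 'm) vec \<Rightarrow> complex ^ 'm ^ 'm" where
  "pencil g h \<kappa> p = (\<chi> \<alpha> \<beta>. g p $ \<alpha> $ \<beta> + \<kappa> * h p $ \<alpha> $ \<beta>)"

text \<open>
  For given \<open>\<kappa>\<close> the pencil may degenerate along a hypersurface, where it is not a metric; the
  conditions are imposed wherever it is one.
\<close>
definition flat_pencil :: "(complex, 'm::finite) vec set \<Rightarrow> ((complex, 'm) vec \<Rightarrow> complex ^ 'm ^ 'm)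
    \<Rightarrow> ((complex, 'm) vec \<Rightarrow> complex ^ 'm ^ 'm) \<Rightarrow> bool" where
  "flat_pencil W g h \<longleftrightarrow>
     contra_metric_on W g \<and> contra_metric_on W h \<and>
     (\<forall>\<kappa>. \<forall>p\<in>W. invertible (pencil g h \<kappa> p) \<longrightarrow>
        flat_at (pencil g h \<kappa>) p \<and>
        (\<forall>\<alpha> \<beta> \<gamma>. contra_christoffel (pencil g h \<kappa>) p \<alpha> \<beta> \<gamma> =
           contra_christoffel g p \<alpha> \<beta> \<gamma> + \<kappa> * contra_christoffel h p \<alpha> \<beta> \<gamma>))"

end

theory Submission
  imports Defs "HOL-Complex_Analysis.Complex_Analysis" "HOL-Real_Asymp.Real_Asymp"
begin

text \<open>
  The superpotential \<open>\<lambda>(z) = e\<^sup>-\<^sup>2\<^sup>\<pi>\<^sup>i\<^sup>u \<Prod>\<theta>(z - a\<^sub>i) / (\<theta>\<^sup>n(z) \<theta>(z + w))\<close>, where \<open>a\<^sub>i = v\<^sub>i - v\<^sub>n\<^sub>+\<^sub>1\<close> and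
  \<open>w = (n + 1) v\<^sub>n\<^sub>+\<^sub>1\<close>, generates the invariants. Its values \<open>\<lambda>(p\<^sub>j)\<close> at \<open>n + 1\<close> generic points, together with \<open>w\<close>
  and \<open>\<tau>\<close>, are local coordinates. By the addition theorem of theta, \<open>g\<^sup>*(d\<lambda>(p), d\<lambda>(q))\<close> and the contravariant
  connection applied to \<open>d\<lambda>(p)\<close>, \<open>d\<lambda>(q)\<close> are explicit in \<open>\<lambda>\<close>, \<open>\<lambda>'\<close>, \<open>\<psi> = \<theta>'/\<theta>\<close> and \<open>h = \<theta>''/(2\<theta>)\<close>. The derivation
  \<open>\<partial>/\<partial>t\<^sup>0\<close> sends \<open>\<lambda>\<close> to \<open>1\<close> and kills \<open>\<lambda>'\<close>, \<open>w\<close> and \<open>\<tau>\<close>, so the metric and its Christoffel symbols are affine in \<open>t\<^sup>0\<close>.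
  Symmetry and flatness are polynomial identities in these data; by translation along \<open>t\<^sup>0\<close> they hold for
  \<open>g + \<kappa>\<eta>\<close> with all small \<open>\<kappa>\<close>, hence coefficientwise. If \<open>\<eta>\<close> were degenerate, the explicit formula for
  \<open>\<eta>(d\<lambda>(p\<^sub>j), d\<lambda>(q))\<close> with \<open>q \<rightarrow> 0\<close>, where \<open>\<lambda>'\<close> has a pole of order \<open>n + 1\<close>, would give a linear relation
  between the rows of the invertible matrix expressing \<open>\<lambda>(p\<^sub>j)\<close> through \<open>\<phi>\<^sub>0, \<dots>, \<phi>\<^sub>n\<close>.
\<close>

text \<open>The coordinates \<open>t\<close> are awkward functions of the invariants, whereas values
  \<lambda>(p) pair in closed form under \<open>g_star\<close>. The pairing is rewritten through
  \<open>EE\<close>, the sum over the divisor of \<lambda> with multiplicities. This divisor has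
  degree zero, so whatever does not depend on the divisor point drops out, in particular the
  unspecified constant of the addition theorem. In the resulting formulas two undifferentiated
  values \<lambda>(p) and \<lambda>(q) never multiply each other, which is the source of the affine
  dependence. The price is a singularity at p = q from \<psi>(q - p): the metric is computed between
  two coframes attached to disjoint families of points, and affinity is carried back to the
  \<open>t\<close>-coframe by two inverse matrices that do not depend on \<open>t\<close> with
  superscript 0. Curvature is used with two indices raised, because it is then polynomial in the
  metric, the symbols and their first derivatives. Along the pencil it is quadratic in the
  parameter, and its leading coefficient is the statement for \<eta>.\<close>

no_notation fps_nth (infixl \<open>$\<close> 75)

abbreviation (input) sum_univ :: "('a => 'b::comm_monoid_add) => 'b"  (binder "\<Sum>!" 10)
  where "sum_univ f \<equiv> sum f UNIV"

abbreviation (input) tpi :: complex  where "tpi \<equiv> 2 * of_real pi * \<i>"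

abbreviation (input) tau :: "'n::finite point => complex"  where "tau x \<equiv> x $ Xtau"

section \<open>Holomorphic functions of several variables\<close>

lemma axis_smult: "axis a (c * s) = (c::complex) *s axis a s"
  by (simp add: vec_eq_iff axis_def)

lemma axis_add: "axis a (s + t :: complex) = axis a s + axis a t"
  by (simp add: vec_eq_iff axis_def)

lemma norm_axis: "norm (axis a s :: complex ^ 'm::finite) = norm s"
  by (simp add: norm_eq_sqrt_inner inner_axis_axis)

lemma bounded_linear_axis: "bounded_linear (axis a :: complex => complex ^ 'm::finite)"
  by (rule bounded_linear_intro[where K=1])
     (auto simp: axis_add norm_axis, simp add: axis_def vec_eq_iff)

lemma continuous_on_axis [continuous_intros]:
  "continuous_on S f ==> continuous_on S (\<lambda>x. axis a (f x) :: complex ^ 'm::finite)"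
  by (rule bounded_linear.continuous_on[OF bounded_linear_axis])

lemma vec_eq_sum_axis: "(v :: complex ^ 'm::finite) = (\<Sum>!a. v $ a *s axis a 1)"
  by (simp add: vec_eq_iff axis_def if_distrib[of "\<lambda>x. _ * x"] sum.delta' cong: if_cong)

lemma clinear_expand:
  assumes "bounded_linear D" "\<And>c v. D (c *s v) = c * D v"
  shows "D (v :: complex ^ 'm::finite) = (\<Sum>!a. v $ a * D (axis a 1))"
proof -
  interpret bounded_linear D by fact
  have "D v = D (\<Sum>!a. v $ a *s axis a 1)"
    by (subst vec_eq_sum_axis) simp
  thus ?thesis by (simp add: sum assms(2))
qed

lemma has_derivative_axis_line:
  assumes "(f has_derivative D) (at (x :: complex ^ 'm::finite))" "\<And>c v. D (c *s v) = c * D v"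
  shows "DERIV (\<lambda>s. f (x + axis a s)) (0::complex) :> D (axis a 1)"
proof -
  have *: "((\<lambda>s::complex. x + axis a s) has_derivative (\<lambda>s. axis a s)) (at 0)"
    by (auto intro!: derivative_eq_intros bounded_linear.has_derivative[OF bounded_linear_axis])
  have "((\<lambda>s. f (x + axis a s)) has_derivative (\<lambda>s. D (axis a s))) (at (0::complex))"
    by (rule has_derivative_compose[OF *, of f D]) (use assms(1) in \<open>simp add: axis_def zero_vec_def[symmetric]\<close>)
  moreover have "(\<lambda>s. D (axis a s)) = (*) (D (axis a 1))"
  proof
    fix s
    have "D (axis a s) = D (s *s axis a 1)" using axis_smult[of a s 1] by (simp only: mult_1_right)
    also have "... = D (axis a 1) * s" by (simp only: assms(2) mult.commute)
    finally show "D (axis a s) = D (axis a 1) * s" .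
  qed
  ultimately show ?thesis
    unfolding has_field_derivative_def by metis
qed

lemma pdiff_eq:
  assumes "(f has_derivative D) (at (x :: complex ^ 'm::finite))" "\<And>c v. D (c *s v) = c * D v"
  shows "pdiff f a x = D (axis a 1)"
  unfolding pdiff_def by (rule DERIV_imp_deriv has_derivative_axis_line assms)+

text \<open>The complex differential of \<open>f\<close> at \<open>x\<close> applied to
  \<open>v\<close>. Written through partial derivatives it is defined for every \<open>f\<close>;
  for holomorphic \<open>f\<close> it is the Frechet derivative by \<open>holo_onD\<close>.\<close>

definition Dsum :: "((complex, 'm::finite) vec => complex) => (complex, 'm) vec => (complex, 'm) vec => complex"
  where "Dsum f x v = (\<Sum>!a. v $ a * pdiff f a x)"

lemma Dsum_smult: "Dsum f x (c *s v) = c * Dsum f x v"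
  by (simp add: Dsum_def sum_distrib_left mult.assoc)

lemma Dsum_axis [simp]: "Dsum f x (axis a c) = c * pdiff f a x"
  by (simp add: Dsum_def axis_def if_distrib[of "\<lambda>x. x * _"] sum.delta cong: if_cong)

lemma holo_onD:
  assumes "holo_on f W" "x \<in> W"
  shows "(f has_derivative Dsum f x) (at x)"
proof -
  obtain D where D: "(f has_derivative D) (at x)" "\<And>c v. D (c *s v) = c * D v"
    using assms unfolding holo_on_def by blast
  have "D = Dsum f x"
  proof
    fix v
    show "D v = Dsum f x v"
      using clinear_expand[OF has_derivative_bounded_linear[OF D(1)] D(2), of v] pdiff_eq[OF D]
      by (simp add: Dsum_def)
  qed
  with D show ?thesis by simp
qed

lemma holo_on_subset: "holo_on f W ==> V \<subseteq> W ==> holo_on f V"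
  unfolding holo_on_def by blast

lemma holo_on_cong:
  assumes "holo_on f W" "open W" "\<And>x. x \<in> W ==> g x = f x"
  shows "holo_on g W"
  unfolding holo_on_def
proof
  fix p assume "p \<in> W"
  then obtain D where "(f has_derivative D) (at p)" "\<forall>c v. D (c *s v) = c * D v"
    using assms(1) unfolding holo_on_def by blast
  moreover from this(1) have "(g has_derivative D) (at p)"
    by (rule has_derivative_transform_within_open[OF _ assms(2) \<open>p \<in> W\<close>]) (simp add: assms(3))
  ultimately show "\<exists>D. (g has_derivative D) (at p) \<and> (\<forall>c v. D (c *s v) = c * D v)" by blast
qed

lemma holo_on_local:
  assumes "\<And>x. x \<in> W ==> \<exists>V. x \<in> V \<and> holo_on f V"
  shows "holo_on f W"
  using assms unfolding holo_on_def by blast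

lemma pdiff_has_field_derivative:
  assumes "holo_on f W" "x \<in> W"
  shows "DERIV (\<lambda>s. f (x + axis a s)) 0 :> pdiff f a x"
  using has_derivative_axis_line[OF holo_onD[OF assms] Dsum_smult] by simp

lemma holo_on_line:
  assumes "holo_on f W" "x + axis a s \<in> W"
  shows "DERIV (\<lambda>s. f (x + axis a s)) s :> pdiff f a (x + axis a s)"
proof -
  have "DERIV (\<lambda>t. f ((x + axis a s) + axis a t)) 0 :> pdiff f a (x + axis a s)"
    by (rule pdiff_has_field_derivative[OF assms])
  hence "DERIV (\<lambda>t. f (x + axis a (t + s))) 0 :> pdiff f a (x + axis a s)"
    by (simp add: axis_add add_ac)
  thus ?thesis using DERIV_shift[of "\<lambda>t. f (x + axis a t)" _ 0 s] by simp
qed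

lemma holo_on_imp_continuous_on: "holo_on f W ==> continuous_on W f"
  by (meson continuous_at_imp_continuous_on has_derivative_continuous holo_onD)

lemma pdiff_cong:
  assumes "open V" "x \<in> V" "\<And>y. y \<in> V ==> f y = g y"
  shows "pdiff f a x = pdiff g a x"
  unfolding pdiff_def
proof (rule deriv_cong_ev)
  have "open ((\<lambda>s::complex. x + axis a s) -` V)"
    by (intro open_vimage assms continuous_intros)
  hence "eventually (\<lambda>s::complex. s \<in> (\<lambda>s. x + axis a s) -` V) (nhds 0)"
    by (rule eventually_nhds_in_open) (use assms(2) in \<open>simp add: axis_def zero_vec_def[symmetric]\<close>)
  thus "\<forall>\<^sub>F s in nhds 0. f (x + axis a s) = g (x + axis a s)"
    by eventually_elim (use assms(3) in auto)
qed simp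

lemma holo_has_derivI:
  assumes "(f has_derivative D) (at x)" "\<And>c v. D (c *s v) = c * D v"
  shows "holo_on f {x}"
  using assms unfolding holo_on_def by auto

text \<open>The derivative in \<open>holo_on\<close> is taken at the point and not within the set,
  so the predicate is pointwise, and \<open>holo_on f {x}\<close> is complex differentiability at
  \<open>x\<close> alone. The calculus rules below are stated in that form.\<close>

lemma holo_on_pointwise: "holo_on f W \<longleftrightarrow> (\<forall>x\<in>W. holo_on f {x})"
  unfolding holo_on_def by auto

lemma holo_on_const [intro, simp]: "holo_on (\<lambda>x. c) W"
  unfolding holo_on_def by (auto intro!: exI[of _ "\<lambda>_. 0"])

lemma pdiff_const [simp]: "pdiff (\<lambda>x. c) a x = 0"
  by (simp add: pdiff_def)

lemma has_derivative_component: "((\<lambda>x. x $ i) has_derivative (\<lambda>v. v $ i)) (at (x :: complex ^ 'm::finite))"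
  by (intro bounded_linear.has_derivative[OF bounded_linear_vec_nth] has_derivative_ident)

lemma holo_on_component [intro, simp]: "holo_on (\<lambda>x. x $ i) W"
  unfolding holo_on_def by (auto intro!: exI[of _ "\<lambda>v. v $ i"] has_derivative_component)

lemma pdiff_component: "pdiff (\<lambda>x. x $ i) a x = (if i = a then 1 else 0)"
  by (subst pdiff_eq[OF has_derivative_component]) (auto simp: axis_def)

lemma holo_add_at:
  assumes "holo_on f {x}" "holo_on g {x}"
  shows "holo_on (\<lambda>x. f x + g x) {x}" "pdiff (\<lambda>x. f x + g x) a x = pdiff f a x + pdiff g a x"
proof -
  note d = holo_onD[OF assms(1) singletonI] holo_onD[OF assms(2) singletonI]
  have D: "((\<lambda>x. f x + g x) has_derivative (\<lambda>v. Dsum f x v + Dsum g x v)) (at x)"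
    by (intro has_derivative_add d)
  show "holo_on (\<lambda>x. f x + g x) {x}"
    by (rule holo_has_derivI[OF D]) (simp add: Dsum_smult algebra_simps)
  show "pdiff (\<lambda>x. f x + g x) a x = pdiff f a x + pdiff g a x"
    by (subst pdiff_eq[OF D]) (simp_all add: Dsum_smult algebra_simps)
qed

lemma holo_mult_at:
  assumes "holo_on f {x}" "holo_on g {x}"
  shows "holo_on (\<lambda>x. f x * g x) {x}" "pdiff (\<lambda>x. f x * g x) a x = pdiff f a x * g x + f x * pdiff g a x"
proof -
  note d = holo_onD[OF assms(1) singletonI] holo_onD[OF assms(2) singletonI]
  have D: "((\<lambda>x. f x * g x) has_derivative (\<lambda>v. f x * Dsum g x v + Dsum f x v * g x)) (at x)"
    by (intro has_derivative_mult d)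
  show "holo_on (\<lambda>x. f x * g x) {x}"
    by (rule holo_has_derivI[OF D]) (simp add: Dsum_smult algebra_simps)
  show "pdiff (\<lambda>x. f x * g x) a x = pdiff f a x * g x + f x * pdiff g a x"
    by (subst pdiff_eq[OF D]) (simp_all add: Dsum_smult algebra_simps)
qed

lemma holo_compose1_at:
  assumes "holo_on f {x}" "DERIV F (f x) :> F'"
  shows "holo_on (\<lambda>x. F (f x)) {x}" "pdiff (\<lambda>x. F (f x)) a x = F' * pdiff f a x"
proof -
  note d = holo_onD[OF assms(1) singletonI]
  have D: "((\<lambda>x. F (f x)) has_derivative (\<lambda>v. F' * Dsum f x v)) (at x)"
    by (rule has_derivative_compose[OF d]) (use assms(2) in \<open>simp add: has_field_derivative_def\<close>)
  show "holo_on (\<lambda>x. F (f x)) {x}"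
    by (rule holo_has_derivI[OF D]) (simp add: Dsum_smult algebra_simps)
  show "pdiff (\<lambda>x. F (f x)) a x = F' * pdiff f a x"
    by (subst pdiff_eq[OF D]) (simp_all add: Dsum_smult algebra_simps)
qed

lemma holo_on_add [intro]: "holo_on f W ==> holo_on g W ==> holo_on (\<lambda>x. f x + g x) W"
  by (subst holo_on_pointwise) (auto intro!: holo_add_at intro: holo_on_subset)

lemma holo_on_mult [intro]: "holo_on f W ==> holo_on g W ==> holo_on (\<lambda>x. f x * g x) W"
  by (subst holo_on_pointwise) (auto intro!: holo_mult_at intro: holo_on_subset)

lemma holo_on_minus [intro]: "holo_on f W ==> holo_on (\<lambda>x. - f x) W"
  using holo_on_mult[of "\<lambda>_. -1" W f] by simp

lemma holo_on_diff [intro]: "holo_on f W ==> holo_on g W ==> holo_on (\<lambda>x. f x - g x) W"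
  using holo_on_add[of f W "\<lambda>x. - g x"] by auto

lemma holo_on_sum [intro]: "(\<And>i. i \<in> I ==> holo_on (f i) W) ==> holo_on (\<lambda>x. \<Sum>i\<in>I. f i x) W"
  by (induction I rule: infinite_finite_induct) auto

lemma holo_on_prod [intro]: "(\<And>i. i \<in> I ==> holo_on (f i) W) ==> holo_on (\<lambda>x. \<Prod>i\<in>I. f i x) W"
  by (induction I rule: infinite_finite_induct) auto

lemma holo_on_power [intro]: "holo_on f W ==> holo_on (\<lambda>x. f x ^ n) W"
  by (induction n) auto

lemma holo_on_compose1:
  assumes "holo_on f W" "F holomorphic_on S" "open S" "\<And>x. x \<in> W ==> f x \<in> S"
  shows "holo_on (\<lambda>x. F (f x)) W"
proof (subst holo_on_pointwise, intro ballI)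
  fix x assume x: "x \<in> W"
  show "holo_on (\<lambda>x. F (f x)) {x}"
    by (rule holo_compose1_at(1)[OF holo_on_subset[OF assms(1)]])
       (use x assms in \<open>auto intro: holomorphic_derivI\<close>)
qed

lemma holo_on_inverse [intro]:
  "holo_on f W ==> (\<And>x. x \<in> W ==> f x ~= 0) ==> holo_on (\<lambda>x. inverse (f x)) W"
  by (rule holo_on_compose1[where S="-{0}"]) (auto intro!: holomorphic_intros)

lemma holo_on_divide [intro]:
  "holo_on f W ==> holo_on g W ==> (\<And>x. x \<in> W ==> g x ~= 0) ==> holo_on (\<lambda>x. f x / g x) W"
  by (simp add: divide_inverse holo_on_mult holo_on_inverse)

lemma holo_on_exp [intro]: "holo_on f W ==> holo_on (\<lambda>x. exp (f x)) W"
  by (rule holo_on_compose1[where S=UNIV]) (auto intro!: holomorphic_intros)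

lemma holo_at: "holo_on f W ==> x \<in> W ==> holo_on f {x}"
  by (erule holo_on_subset) simp

lemma pdiff_add:
  "holo_on f {x} ==> holo_on g {x} ==> pdiff (\<lambda>x. f x + g x) a x = pdiff f a x + pdiff g a x"
  by (rule holo_add_at)

lemma pdiff_mult:
  "holo_on f {x} ==> holo_on g {x} ==> pdiff (\<lambda>x. f x * g x) a x = pdiff f a x * g x + f x * pdiff g a x"
  by (rule holo_mult_at)

lemma pdiff_cmult: "holo_on f {x} ==> pdiff (\<lambda>x. c * f x) a x = c * pdiff f a x"
  by (subst pdiff_mult) auto

lemma pdiff_minus: "holo_on f {x} ==> pdiff (\<lambda>x. - f x) a x = - pdiff f a x"
  using pdiff_cmult[of f x "-1"] by simp

lemma pdiff_diff:
  "holo_on f {x} ==> holo_on g {x} ==> pdiff (\<lambda>x. f x - g x) a x = pdiff f a x - pdiff g a x"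
  using pdiff_add[of f x "\<lambda>x. - g x"] pdiff_minus[of g] by auto

lemma pdiff_sum:
  "(\<And>i. i \<in> I ==> holo_on (f i) {x}) ==> pdiff (\<lambda>x. \<Sum>i\<in>I. f i x) a x = (\<Sum>i\<in>I. pdiff (f i) a x)"
  by (induction I rule: infinite_finite_induct) (simp, simp, simp, subst pdiff_add, auto)

lemma pdiff_compose1:
  "holo_on f {x} ==> DERIV F (f x) :> F' ==> pdiff (\<lambda>x. F (f x)) a x = F' * pdiff f a x"
  by (rule holo_compose1_at)

lemma pdiff_power:
  assumes "holo_on f {x}" shows "pdiff (\<lambda>x. f x ^ n) a x = of_nat n * f x ^ (n - 1) * pdiff f a x"
  by (rule pdiff_compose1[OF assms, of "\<lambda>z. z ^ n"]) (auto intro!: derivative_eq_intros)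

lemma pdiff_inverse:
  assumes "holo_on f {x}" "f x ~= 0"
  shows "pdiff (\<lambda>x. inverse (f x)) a x = - pdiff f a x / (f x)\<^sup>2"
  by (subst pdiff_compose1[OF assms(1), of inverse])
     (use assms in \<open>auto intro!: derivative_eq_intros simp: field_simps power2_eq_square\<close>)

lemma pdiff_divide:
  assumes "holo_on f {x}" "holo_on g {x}" "g x ~= 0"
  shows "pdiff (\<lambda>x. f x / g x) a x = (pdiff f a x * g x - f x * pdiff g a x) / (g x)\<^sup>2"
proof -
  have "pdiff (\<lambda>x. f x / g x) a x = pdiff (\<lambda>x. f x * inverse (g x)) a x"
    by (simp add: divide_inverse)
  also have "... = pdiff f a x * inverse (g x) + f x * (- pdiff g a x / (g x)\<^sup>2)"
    using assms by (subst pdiff_mult) (auto simp: pdiff_inverse)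
  finally show ?thesis using assms(3) by (simp add: divide_simps power2_eq_square)
qed

lemma has_derivative_vecI:
  assumes "\<And>i. ((\<lambda>x. f x $ i) has_derivative (\<lambda>v. D v $ i)) (at x)"
  shows "(f has_derivative (D :: 'a::real_normed_vector => complex ^ 'm::finite)) (at x)"
  unfolding has_derivative_componentwise_within[of f D x UNIV]
proof
  fix b :: "complex ^ 'm" assume "b \<in> Basis"
  then obtain i u where b: "b = axis i u" by (auto simp: Basis_vec_def)
  show "((\<lambda>x. f x \<bullet> b) has_derivative (\<lambda>v. D v \<bullet> b)) (at x)"
    unfolding b inner_axis by (intro bounded_linear.has_derivative[OF bounded_linear_inner_left] assms)
qed

lemma has_derivative_holo_map:
  assumes "\<And>i. holo_on (\<lambda>x. s x $ i) {x}"
  shows "(s has_derivative (\<lambda>v. \<chi> i. Dsum (\<lambda>y. s y $ i) x v)) (at x)"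
  by (rule has_derivative_vecI) (use holo_onD[OF assms singletonI] in simp)

lemma holo_compose_at:
  fixes s :: "complex ^ 'k::finite => complex ^ 'm::finite"
  assumes "holo_on f {s x}" "\<And>i. holo_on (\<lambda>x. s x $ i) {x}"
  shows "holo_on (\<lambda>x. f (s x)) {x}"
    "pdiff (\<lambda>x. f (s x)) a x = (\<Sum>!b. pdiff f b (s x) * pdiff (\<lambda>x. s x $ b) a x)"
proof -
  have D: "((\<lambda>x. f (s x)) has_derivative (\<lambda>v. Dsum f (s x) (\<chi> i. Dsum (\<lambda>y. s y $ i) x v))) (at x)"
    by (rule has_derivative_compose[OF has_derivative_holo_map[OF assms(2)] holo_onD[OF assms(1) singletonI]])
  have L: "Dsum f (s x) (\<chi> i. Dsum (\<lambda>y. s y $ i) x (c *s v)) = c * Dsum f (s x) (\<chi> i. Dsum (\<lambda>y. s y $ i) x v)"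
    for c v unfolding Dsum_smult by (subst Dsum_smult[symmetric]) (simp add: vector_scalar_mult_def)
  show "holo_on (\<lambda>x. f (s x)) {x}"
    by (rule holo_has_derivI[OF D L])
  show "pdiff (\<lambda>x. f (s x)) a x = (\<Sum>!b. pdiff f b (s x) * pdiff (\<lambda>x. s x $ b) a x)"
    by (subst pdiff_eq[OF D L]) (simp add: Dsum_def[of f] mult.commute)
qed

lemma holo_on_compose:
  fixes s :: "complex ^ 'k::finite => complex ^ 'm::finite"
  assumes "holo_on f V" "\<And>i. holo_on (\<lambda>x. s x $ i) W" "\<And>x. x \<in> W ==> s x \<in> V"
  shows "holo_on (\<lambda>x. f (s x)) W"
proof (subst holo_on_pointwise, intro ballI)
  fix x assume "x \<in> W"
  thus "holo_on (\<lambda>x. f (s x)) {x}"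
    by (intro holo_compose_at(1)[OF holo_at[OF assms(1) assms(3)] holo_at[OF assms(2)]])
qed

section \<open>Cauchy's formula and higher partial derivatives\<close>

definition circ_pt :: "real => real => complex" where
  "circ_pt r t = of_real r * exp (tpi * of_real t)"

lemma norm_circ_pt [simp]: "norm (circ_pt r t) = \<bar>r\<bar>"
  by (simp add: circ_pt_def norm_mult)

lemma circ_pt_nonzero [simp]: "r ~= 0 ==> circ_pt r t ~= 0"
  by (simp add: circ_pt_def)

lemma continuous_on_circ_pt [continuous_intros]:
  "continuous_on S f ==> continuous_on S (\<lambda>x. circ_pt r (f x))"
  unfolding circ_pt_def by (intro continuous_intros)

text \<open>Cauchy's formula along the circle of radius \<open>r\<close> in direction
  \<open>a\<close>; the factor 2 pi i cancels against the derivative of the circle. The result is an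
  integral over a fixed interval with \<open>x\<close> only in the integrand, which allows
  differentiation under the integral sign.\<close>

lemma pdiff_cauchy:
  assumes "holo_on f W" "cball x r \<subseteq> W" "r > 0"
  shows "pdiff f a x = integral (cbox 0 1) (\<lambda>t. inverse (circ_pt r t) * f (x + axis a (circ_pt r t)))"
proof -
  define F where "F = (\<lambda>s. f (x + axis a s))"
  have der: "DERIV F s :> pdiff f a (x + axis a s)" if "s \<in> cball 0 r" for s
    unfolding F_def
    by (rule holo_on_line[OF assms(1)]) (use that assms(2) in \<open>auto simp: dist_norm norm_axis subset_iff\<close>)
  have "DERIV F 0 :> (1 / tpi *
      contour_integral (circlepath 0 r) (\<lambda>u. F u / (u - 0)\<^sup>2))"
  proof (rule Cauchy_derivative_integral_circlepath(2))
    show "continuous_on (cball 0 r) F"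
      using der by (meson DERIV_isCont continuous_at_imp_continuous_on)
    show "F holomorphic_on ball 0 r"
      using der by (subst holomorphic_on_open) (auto intro!: exI der)
  qed (use assms in auto)
  hence "pdiff f a x = 1 / tpi * contour_integral (circlepath 0 r) (\<lambda>u. F u / u\<^sup>2)"
    unfolding pdiff_def by (auto simp: F_def intro: DERIV_imp_deriv)
  also have "contour_integral (circlepath 0 r) (\<lambda>u. F u / u\<^sup>2)
      = integral {0..1} (\<lambda>t. 2 * of_real pi * \<i> * (inverse (circ_pt r t) * F (circ_pt r t)))"
    unfolding contour_integral_integral
  proof (rule integral_cong)
    fix t :: real assume "t \<in> {0..1}"
    show "F (circlepath 0 r t) / (circlepath 0 r t)\<^sup>2 * vector_derivative (circlepath 0 r) (at t)
        = tpi * (inverse (circ_pt r t) * F (circ_pt r t))"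
      using assms(3) unfolding vector_derivative_circlepath unfolding circlepath
      by (simp add: circ_pt_def field_simps power2_eq_square)
  qed
  finally show ?thesis by (simp add: F_def mult_ac)
qed

lemma obtain_cball2:
  assumes "open W" "(x :: 'a::metric_space) \<in> W"
  obtains r where "r > 0" "cball x (2 * r) \<subseteq> W"
proof -
  obtain e where "e > 0" "cball x e \<subseteq> W" using assms by (meson open_contains_cball)
  thus ?thesis using that[of "e / 2"] by simp
qed

text \<open>By Cauchy's formula the partial derivative is a parameter integral with jointly
  continuous integrand. A ball of radius \<open>2 * r\<close> inside \<open>W\<close> leaves room
  for circles of radius \<open>r\<close> about every point of \<open>ball x r\<close>.\<close>

lemma continuous_on_pdiff:
  assumes "holo_on f W" "open W"
  shows "continuous_on W (pdiff f a)"
proof (subst continuous_on_eq_continuous_at[OF assms(2)], intro ballI)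
  fix x assume "x \<in> W"
  then obtain r where r: "r > 0" "cball x (2 * r) \<subseteq> W"
    using obtain_cball2 assms(2) by blast
  have sub: "cball y r \<subseteq> W" if "y \<in> ball x r" for y
  proof
    fix z assume "z \<in> cball y r"
    with that have "dist x z \<le> 2 * r" using dist_triangle[of x z y] by auto
    with r show "z \<in> W" by auto
  qed
  have "continuous_on (ball x r) (\<lambda>y. integral (cbox 0 1) (\<lambda>t. inverse (circ_pt r t) * f (y + axis a (circ_pt r t))))"
  proof (rule integral_continuous_on_param)
    have "continuous_on (ball x r \<times> cbox 0 1) (\<lambda>p. f (fst p + axis a (circ_pt r (snd p))))"
    proof (rule continuous_on_compose2[OF holo_on_imp_continuous_on[OF assms(1)]])
      show "(\<lambda>p. fst p + axis a (circ_pt r (snd p))) ` (ball x r \<times> cbox 0 1) \<subseteq> W"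
      proof clarify
        fix y and t :: real assume "y \<in> ball x r"
        hence "y + axis a (circ_pt r t) \<in> cball y r" using r by (simp add: dist_norm norm_axis)
        thus "fst (y, t) + axis a (circ_pt r (snd (y, t))) \<in> W" using sub[OF \<open>y \<in> ball x r\<close>] by auto
      qed
    qed (intro continuous_intros)
    thus "continuous_on (ball x r \<times> cbox 0 1) (\<lambda>(y, t). inverse (circ_pt r t) * f (y + axis a (circ_pt r t)))"
      using r by (auto simp: case_prod_beta intro!: continuous_intros)
  qed
  hence "continuous_on (ball x r) (pdiff f a)"
    by (rule continuous_on_eq) (use pdiff_cauchy[OF assms(1) sub r(1)] in auto)
  thus "isCont (pdiff f a) x"
    using r(1) by (simp add: continuous_on_eq_continuous_at)
qed

lemma continuous_on_vec_nth [continuous_intros]: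
  "continuous_on S f ==> continuous_on S (\<lambda>x. f x $ i :: complex)"
  by (rule bounded_linear.continuous_on[OF bounded_linear_vec_nth])

lemma bounded_linear_Dsum_mult: "bounded_linear (\<lambda>v. c * Dsum f x v)"
  unfolding Dsum_def
  by (intro bounded_linear_const_mult bounded_linear_sum bounded_linear_mult_const bounded_linear_vec_nth)

text \<open>The Leibniz rule for the Cauchy integral; the integrand has a continuous derivative by
  \<open>continuous_on_pdiff\<close>. The second formula keeps the circle in direction
  \<open>a\<close> but has \<open>pdiff f b\<close> in the integrand, which is what makes mixed
  derivatives commute.\<close>

lemma pdiff_under_integral:
  assumes "holo_on f W" "open W" and r: "r > 0" "cball x (2 * r) \<subseteq> W"
  shows "holo_on (pdiff f a) {x}"
    "pdiff (pdiff f a) b x = integral (cbox 0 1) (\<lambda>t. inverse (circ_pt r t) * pdiff f b (x + axis a (circ_pt r t)))"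
proof -
  have sub: "cball y r \<subseteq> W" if "y \<in> ball x r" for y
  proof
    fix z assume "z \<in> cball y r"
    with that have "dist x z \<le> 2 * r" using dist_triangle[of x z y] by auto
    with r show "z \<in> W" by auto
  qed
  have inW: "y + axis a (circ_pt r t) \<in> W" if "y \<in> ball x r" for y t
    using sub[OF that] r by (auto simp: dist_norm norm_axis subset_iff)
  \<comment> \<open>The Leibniz rule wants the derivative as a bounded linear map depending
    continuously on base point and parameter.\<close>
  define fx where "fx = (\<lambda>y t. Blinfun (\<lambda>v. inverse (circ_pt r t) * Dsum f (y + axis a (circ_pt r t)) v))"
  have fx: "blinfun_apply (fx y t) v = inverse (circ_pt r t) * Dsum f (y + axis a (circ_pt r t)) v" for y t v
    unfolding fx_def by (subst bounded_linear_Blinfun_apply) (auto intro: bounded_linear_Dsum_mult)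
  have contf: "continuous_on (ball x r \<times> cbox 0 1) (\<lambda>p. g (fst p + axis a (circ_pt r (snd p))))"
    if "continuous_on W g" for g :: "(complex, 'a) vec => complex"
    by (rule continuous_on_compose2[OF that]) (use inW in \<open>auto intro!: continuous_intros\<close>)
  have cont_fx: "continuous_on (ball x r \<times> cbox 0 1) (\<lambda>(y, t). fx y t)"
    unfolding case_prod_beta
  proof (rule continuous_on_blinfun_componentwise)
    fix v :: "complex ^ 'a"
    show "continuous_on (ball x r \<times> cbox 0 1) (\<lambda>p. blinfun_apply (fx (fst p) (snd p)) v)"
      unfolding fx Dsum_def using r(1)
      by (intro continuous_intros contf continuous_on_pdiff[OF assms(1,2)]) auto
  qed
  define I where "I = (\<lambda>y. integral (cbox 0 1) (\<lambda>t. inverse (circ_pt r t) * f (y + axis a (circ_pt r t))))"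
  have "(I has_derivative integral (cbox 0 1) (fx x)) (at x within ball x r)"
    unfolding I_def
  proof (rule leibniz_rule)
    fix y and t :: real assume y: "y \<in> ball x r"
    have "((\<lambda>y. f (y + axis a (circ_pt r t))) has_derivative Dsum f (y + axis a (circ_pt r t))) (at y)"
      by (rule has_derivative_compose[where f="\<lambda>y. y + axis a (circ_pt r t)" and f'="\<lambda>v. v"
            and g=f, OF _ holo_onD[OF assms(1) inW[OF y]]])
         (auto intro!: derivative_eq_intros)
    hence "((\<lambda>y. f (y + axis a (circ_pt r t))) has_derivative Dsum f (y + axis a (circ_pt r t))) (at y within ball x r)"
      by (rule has_derivative_at_withinI)
    hence "((\<lambda>y. inverse (circ_pt r t) * f (y + axis a (circ_pt r t))) has_derivative
        (\<lambda>v. inverse (circ_pt r t) * Dsum f (y + axis a (circ_pt r t)) v)) (at y within ball x r)"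
      by (rule bounded_linear.has_derivative[OF bounded_linear_mult_right])
    thus "((\<lambda>y. inverse (circ_pt r t) * f (y + axis a (circ_pt r t))) has_derivative
        blinfun_apply (fx y t)) (at y within ball x r)"
      by (subst (asm) fx[symmetric])
  next
    fix y assume y: "y \<in> ball x r"
    have "continuous_on (cbox 0 1) (\<lambda>t. f (y + axis a (circ_pt r t)))"
      by (rule continuous_on_compose2[OF holo_on_imp_continuous_on[OF assms(1)]])
         (use inW[OF y] in \<open>auto intro!: continuous_intros\<close>)
    thus "(\<lambda>t. inverse (circ_pt r t) * f (y + axis a (circ_pt r t))) integrable_on cbox 0 1"
      using r(1) by (intro integrable_continuous continuous_intros) auto
  qed (use cont_fx r in auto)
  hence dI: "(I has_derivative integral (cbox 0 1) (fx x)) (at x)"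
    using r(1) by (simp add: at_within_open[of x "ball x r"])
  have "continuous_on (cbox 0 1) (\<lambda>t::real. (x, t))"
    by (intro continuous_intros)
  hence "continuous_on (cbox 0 1) (\<lambda>t. case (x, t) of (y, t) => fx y t)"
    by (rule continuous_on_compose2[OF cont_fx]) (use r(1) in auto)
  hence int: "fx x integrable_on cbox 0 1"
    by (intro integrable_continuous) simp
  have app: "blinfun_apply (integral (cbox 0 1) (fx x)) v = integral (cbox 0 1) (\<lambda>t. blinfun_apply (fx x t) v)" for v
    using integral_linear[OF int blinfun.bounded_linear_left, of v]
    by (simp add: o_def)
  have dP: "(pdiff f a has_derivative integral (cbox 0 1) (fx x)) (at x)"
    by (rule has_derivative_transform_within_open[OF dI, of "ball x r"])
       (use pdiff_cauchy[OF assms(1) sub r(1), of _ a] r(1) in \<open>auto simp: I_def\<close>)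
  have lin: "blinfun_apply (integral (cbox 0 1) (fx x)) (c *s v) = c * blinfun_apply (integral (cbox 0 1) (fx x)) v" for c v
    unfolding app fx Dsum_smult by (subst integral_mult_right[symmetric]) (simp add: mult_ac)
  show "holo_on (pdiff f a) {x}"
    by (rule holo_has_derivI[OF dP lin])
  show "pdiff (pdiff f a) b x = integral (cbox 0 1) (\<lambda>t. inverse (circ_pt r t) * pdiff f b (x + axis a (circ_pt r t)))"
    by (simp only: pdiff_eq[OF dP lin] app fx Dsum_axis mult_1_left)
qed

lemma holo_on_pdiff [intro]:
  assumes "holo_on f W" "open W"
  shows "holo_on (pdiff f a) W"
proof (subst holo_on_pointwise, intro ballI)
  fix x assume "x \<in> W"
  then obtain r where "r > 0" "cball x (2 * r) \<subseteq> W" using obtain_cball2 assms(2) by blast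
  thus "holo_on (pdiff f a) {x}" by (rule pdiff_under_integral(1)[OF assms])
qed

text \<open>The formula for \<open>pdiff (pdiff f a) b\<close> under the integral is literally
  Cauchy's formula for the function \<open>pdiff f b\<close> in direction \<open>a\<close>.\<close>

lemma pdiff_commute:
  assumes "holo_on f W" "open W" "x \<in> W"
  shows "pdiff (pdiff f a) b x = pdiff (pdiff f b) a x"
proof -
  obtain r where r: "r > 0" "cball x (2 * r) \<subseteq> W" using obtain_cball2 assms by blast
  moreover from r have "cball x r \<subseteq> W" using subset_cball[of r "2 * r" x] by auto
  ultimately show ?thesis
    using pdiff_under_integral(2)[OF assms(1,2) r, of a b]
      pdiff_cauchy[OF holo_on_pdiff[OF assms(1,2)], of x r b a] by simp
qed

subsection \<open>Matrices of holomorphic functions and the inverse function theorem\<close>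

lemma holo_on_det:
  fixes M :: "complex ^ 'k::finite => complex ^ 'm::finite ^ 'm"
  assumes "\<And>i j. holo_on (\<lambda>x. M x $ i $ j) W"
  shows "holo_on (\<lambda>x. det (M x)) W"
  unfolding det_def by (intro holo_on_sum holo_on_mult holo_on_prod holo_on_const assms)

lemma matrix_inv_left_right:
  fixes A :: "complex ^ 'm::finite ^ 'm"
  assumes "invertible A"
  shows matrix_inv_right: "A ** matrix_inv A = mat 1" and matrix_inv_left: "matrix_inv A ** A = mat 1"
  using someI_ex[OF assms[unfolded invertible_def]] unfolding matrix_inv_def by auto

lemma matrix_mult_axis: "(M *v axis j c) $ i = (M :: complex ^ 'm::finite ^ 'k) $ i $ j * c"
  by (simp add: matrix_vector_mult_def axis_def if_distrib[of "\<lambda>x. _ * x"] sum.delta cong: if_cong)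

text \<open>Cramer's rule for the \<open>j\<close>-th unit vector. It exhibits the entries of the
  inverse as rational functions of the entries of \<open>A\<close>, so that holomorphy, and later
  independence of a coordinate, passes to inverses.\<close>

lemma matrix_inv_cramer:
  fixes A :: "complex ^ 'm::finite ^ 'm"
  assumes "invertible A"
  shows "matrix_inv A $ i $ j = det (\<chi> k l. if l = i then (if k = j then 1 else 0) else A $ k $ l) / det A"
proof -
  have "A *v (matrix_inv A *v axis j 1) = axis j 1"
    using matrix_inv_right[OF assms] by (simp add: matrix_vector_mul_assoc)
  hence "matrix_inv A *v axis j 1 = (\<chi> i. det (\<chi> k l. if l = i then axis j 1 $ k else A $ k $ l) / det A)"
    using cramer[of A "matrix_inv A *v axis j 1" "axis j 1"] assms by (simp add: invertible_det_nz)
  hence "(matrix_inv A *v axis j 1) $ i = det (\<chi> k l. if l = i then axis j 1 $ k else A $ k $ l) / det A"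
    by simp
  hence "matrix_inv A $ i $ j = det (\<chi> k l. if l = i then axis j 1 $ k else A $ k $ l) / det A"
    by (simp add: matrix_mult_axis)
  thus ?thesis by (simp add: axis_def cong: if_cong)
qed

lemma holo_on_matrix_inv:
  fixes M :: "complex ^ 'k::finite => complex ^ 'm::finite ^ 'm"
  assumes "\<And>i j. holo_on (\<lambda>x. M x $ i $ j) W" "\<And>x. x \<in> W ==> invertible (M x)" "open W"
  shows "holo_on (\<lambda>x. matrix_inv (M x) $ i $ j) W"
proof (rule holo_on_cong[OF _ assms(3) matrix_inv_cramer])
  show "holo_on (\<lambda>x. det (\<chi> k l. if l = i then (if k = j then 1 else 0) else M x $ k $ l) / det (M x)) W"
  proof (intro holo_on_divide holo_on_det assms(1))
    show "holo_on (\<lambda>x. (\<chi> k l. if l = i then if k = j then 1 else 0 else M x $ k $ l) $ ia $ ja) W" for ia ja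
      using assms(1) by (cases "ja = i") simp_all
  qed (use assms(2) in \<open>simp add: invertible_det_nz\<close>)
qed (rule assms)

lemma open_invertible:
  fixes M :: "complex ^ 'k::finite => complex ^ 'm::finite ^ 'm"
  assumes "\<And>i j. holo_on (\<lambda>x. M x $ i $ j) W" "open W"
  shows "open {x \<in> W. invertible (M x)}"
proof -
  have "open (W \<inter> (\<lambda>x. det (M x)) -` (- {0}))"
    by (rule continuous_open_preimage[OF holo_on_imp_continuous_on[OF holo_on_det[OF assms(1)]] assms(2)]) auto
  moreover have "W \<inter> (\<lambda>x. det (M x)) -` (- {0}) = {x \<in> W. invertible (M x)}"
    by (auto simp: invertible_det_nz)
  ultimately show ?thesis by simp
qed

lemma has_derivative_jacobian:
  fixes F :: "complex ^ 'm::finite => complex ^ 'm"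
  assumes "\<And>i. holo_on (\<lambda>x. F x $ i) W" "x \<in> W"
  shows "(F has_derivative (\<lambda>v. jacobian F x *v v)) (at x)"
proof -
  have "(F has_derivative (\<lambda>v. \<chi> i. Dsum (\<lambda>y. F y $ i) x v)) (at x)"
    by (rule has_derivative_holo_map) (rule holo_at[OF assms])
  moreover have "(\<lambda>v. \<chi> i. Dsum (\<lambda>y. F y $ i) x v) = (\<lambda>v. jacobian F x *v v)"
    by (simp add: fun_eq_iff vec_eq_iff Dsum_def jacobian_def matrix_vector_mult_def mult.commute)
  ultimately show ?thesis by simp
qed

text \<open>Openness comes from the open mapping theorem for maps with right invertible derivative.
  The derivative of the inverse is given by the inverse of a complex matrix, hence is complex
  linear, which is the holomorphy claimed.\<close>

lemma holo_inverse_function: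
  fixes F :: "complex ^ 'm::finite => complex ^ 'm"
  assumes "open U" "\<And>i. holo_on (\<lambda>x. F x $ i) U" "inj_on F U"
    and "\<And>x. x \<in> U ==> invertible (jacobian F x)"
  shows "open (F ` U)" "\<And>i. holo_on (\<lambda>p. inv_into U F p $ i) (F ` U)"
    "\<And>x. x \<in> U ==> jacobian (inv_into U F) (F x) = matrix_inv (jacobian F x)"
proof -
  let ?G = "inv_into U F"
  have contF: "continuous_on U F"
    using has_derivative_jacobian[OF assms(2)]
    by (meson continuous_at_imp_continuous_on has_derivative_continuous)
  have inv: "?G (F x) = x" if "x \<in> U" for x by (rule inv_into_f_f[OF assms(3) that])
  have comp: "(\<lambda>v. jacobian F x *v v) \<circ> (\<lambda>v. matrix_inv (jacobian F x) *v v) = id" if "x \<in> U" for x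
    using matrix_inv_right[OF assms(4)[OF that]] by (auto simp: matrix_vector_mul_assoc)
  have bl: "bounded_linear (\<lambda>v. M *v v)" for M :: "complex ^ 'm ^ 'm"
    by (rule linear_conv_bounded_linear[THEN iffD1], rule linearI)
       (simp_all add: matrix_vector_right_distrib scaleR_matrix_vector_assoc matrix_vector_mult_def vec_eq_iff scaleR_right.sum distrib_left sum.distrib)
  show "open (F ` U)"
  proof (subst open_subopen, intro ballI)
    fix p assume "p \<in> F ` U"
    then obtain x where x: "x \<in> U" "p = F x" by blast
    have "F x \<in> interior (F ` U)"
      by (rule sussmann_open_mapping[OF assms(1) contF x(1) has_derivative_jacobian[OF assms(2) x(1)] bl comp[OF x(1)]])
         (use x assms(1) in \<open>auto simp: interior_open\<close>)
    thus "\<exists>T. open T \<and> p \<in> T \<and> T \<subseteq> F ` U" using x interior_subset open_interior by blast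
  qed
  have D: "(?G has_derivative (\<lambda>v. matrix_inv (jacobian F x) *v v)) (at (F x))" if "x \<in> U" for x
    by (rule has_derivative_inverse_strong[OF assms(1) that contF inv has_derivative_jacobian[OF assms(2) that] comp[OF that]])
  have Di: "((\<lambda>p. ?G p $ i) has_derivative (\<lambda>v. (matrix_inv (jacobian F x) *v v) $ i)) (at (F x))" if "x \<in> U" for x i
    by (rule bounded_linear.has_derivative[OF bounded_linear_vec_nth D[OF that]])
  have lin: "(M *v (c *s v)) $ i = c * (M *v v) $ i" for M :: "complex ^ 'm ^ 'm" and c v i
    by (simp add: matrix_vector_mult_def sum_distrib_left mult_ac)
  show "holo_on (\<lambda>p. ?G p $ i) (F ` U)" for i
    unfolding holo_on_def using Di lin by blast
  show "jacobian ?G (F x) = matrix_inv (jacobian F x)" if "x \<in> U" for x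
    by (simp add: vec_eq_iff jacobian_def pdiff_eq[OF Di[OF that] lin] matrix_mult_axis)
qed

section \<open>The theta function\<close>

text \<open>Each differentiation of a sine adds pi / 2 to its argument, so one formula covers the
  \<open>k\<close>-th \<open>z\<close>-derivative of the terms for all \<open>k\<close>.\<close>

definition theta_term :: "nat => nat => complex => complex => complex" where
  "theta_term k m t z = 2 * (-1) ^ m * exp (of_real pi * \<i> * t * (of_nat m + 1/2)\<^sup>2)
     * ((2 * of_nat m + 1) * of_real pi) ^ k
     * sin ((2 * of_nat m + 1) * of_real pi * z + of_nat k * of_real pi / 2)"

text \<open>\<open>Th k\<close> is the \<open>k\<close>-th derivative of \<open>theta1\<close> in \<open>z\<close>.\<close>
definition Th :: "nat => complex => complex => complex" where
  "Th k t z = (\<Sum>m. theta_term k m t z)"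

definition theta_bound :: "nat => real => real => nat => real" where
  "theta_bound k d R m = 2 * exp (- (pi * d * (real m + 1/2)\<^sup>2)) * ((2 * real m + 1) * pi) ^ k
     * exp ((2 * real m + 1) * pi * R)"

lemma power_le_fact_exp:
  assumes "(x :: real) \<ge> 0" shows "x ^ k \<le> fact k * exp x"
proof -
  have "(\<Sum>n\<in>{k}. x ^ n /\<^sub>R fact n) \<le> (\<Sum>n. x ^ n /\<^sub>R fact n)"
    by (rule sum_le_suminf[OF summable_exp_generic]) (use assms in auto)
  thus ?thesis by (simp add: exp_def field_simps)
qed

lemma gaussian_bigo:
  assumes "(c :: real) > 0"
  shows "(\<lambda>m. exp (- (c * (real m + 1/2)\<^sup>2)) * exp ((2 * real m + 1) * B)) \<in> O(\<lambda>m. (1/2) ^ m)"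
proof -
  consider "B > 0" | "B = 0" | "B < 0" by linarith
  thus ?thesis using assms by cases (simp_all, real_asymp+)
qed

text \<open>The factor x^k with x = (2m + 1) pi is at most k! e^x, which only replaces
  \<open>R\<close> by \<open>R + 1\<close>; the Gaussian factor beats the remaining linear
  exponent.\<close>

lemma summable_theta_bound:
  assumes "d > 0"
  shows "summable (theta_bound k d R)"
proof (rule summable_comparison_test)
  let ?f = "\<lambda>m. exp (- (pi * d * (real m + 1/2)\<^sup>2)) * exp ((2 * real m + 1) * pi * (R + 1))"
  have "summable ?f"
  proof (rule summable_comparison_test_bigo)
    show "summable (\<lambda>m. norm ((1/2::real) ^ m))" by simp
    show "?f \<in> O(\<lambda>m. (1/2) ^ m)"
      using gaussian_bigo[of "pi * d" "pi * (R + 1)"] assms by (simp add: mult.assoc)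
  qed
  thus "summable (\<lambda>m. 2 * fact k * ?f m)" by (rule summable_mult)
  have "theta_bound k d R m \<le> 2 * fact k * ?f m" for m
  proof -
    have "((2 * real m + 1) * pi) ^ k \<le> fact k * exp ((2 * real m + 1) * pi)"
      using power_le_fact_exp[of "(2 * real m + 1) * pi" k] by simp
    hence "2 * exp (- (pi * d * (real m + 1/2)\<^sup>2)) * ((2 * real m + 1) * pi) ^ k * exp ((2 * real m + 1) * pi * R)
      \<le> 2 * exp (- (pi * d * (real m + 1/2)\<^sup>2)) * (fact k * exp ((2 * real m + 1) * pi)) * exp ((2 * real m + 1) * pi * R)"
      by (intro mult_right_mono mult_left_mono) auto
    also have "... = 2 * fact k * ?f m" by (simp add: algebra_simps exp_add)
    finally show ?thesis by (simp add: theta_bound_def)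
  qed
  thus "\<exists>N. \<forall>m\<ge>N. norm (theta_bound k d R m) \<le> 2 * fact k * ?f m"
    by (auto simp: theta_bound_def)
qed

lemma norm_sin_le_exp: "norm (sin w :: complex) \<le> exp \<bar>Im w\<bar>"
proof -
  have "norm (sin w) \<le> (norm (exp (\<i> * w)) + norm (exp (- (\<i> * w)))) / 2"
    unfolding sin_exp_eq norm_divide norm_mult using norm_triangle_ineq4[of "exp (\<i> * w)" "exp (- (\<i> * w))"]
    by (auto intro: divide_right_mono)
  also have "... \<le> (exp \<bar>Im w\<bar> + exp \<bar>Im w\<bar>) / 2"
    by (intro divide_right_mono add_mono) auto
  finally show ?thesis by simp
qed

lemma norm_theta_term_le:
  assumes "Im t \<ge> d" "\<bar>Im z\<bar> \<le> R"
  shows "norm (theta_term k m t z) \<le> theta_bound k d R m"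
proof -
  have e: "of_real pi * \<i> * t * (of_nat m + 1/2)\<^sup>2 = of_real (pi * (real m + 1/2)\<^sup>2) * (\<i> * t)"
    by simp
  have 1: "norm (exp (of_real pi * \<i> * t * (of_nat m + 1/2)\<^sup>2)) \<le> exp (- (pi * d * (real m + 1/2)\<^sup>2))"
    unfolding e norm_exp_eq_Re using assms(1) by (simp add: mult_left_mono mult_right_mono)
  have im: "Im ((2 * of_nat m + 1) * of_real pi * z + of_nat k * of_real pi / 2) = (2 * real m + 1) * pi * Im z"
    by simp
  have 2: "norm (sin ((2 * of_nat m + 1) * of_real pi * z + of_nat k * of_real pi / 2)) \<le> exp ((2 * real m + 1) * pi * R)"
    by (rule order_trans[OF norm_sin_le_exp], unfold im abs_mult)
       (use assms(2) in \<open>auto intro!: mult_left_mono\<close>)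
  have 3: "norm ((2 * of_nat m + 1 :: complex) * of_real pi) = (2 * real m + 1) * pi"
  proof -
    have "(2 * of_nat m + 1 :: complex) * of_real pi = of_real ((2 * real m + 1) * pi)" by simp
    thus ?thesis by (simp only: norm_of_real) simp
  qed
  show ?thesis
    unfolding theta_term_def theta_bound_def norm_mult[of "_ * _ ^ _"] norm_mult[of _ "(_ * _) ^ _"] norm_power 3
      norm_mult[of _ "exp _"]
    using 1 2 by (intro mult_mono) (auto simp: norm_power norm_mult)
qed

lemma uniform_limit_theta:
  assumes "d > 0"
  shows "uniform_limit {p. Im (fst p) \<ge> d \<and> \<bar>Im (snd p)\<bar> \<le> R}
    (\<lambda>n p. \<Sum>m<n. theta_term k m (fst p) (snd p)) (\<lambda>p. Th k (fst p) (snd p)) sequentially"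
  unfolding Th_def
  by (rule Weierstrass_m_test[OF _ summable_theta_bound[OF assms]]) (auto intro: norm_theta_term_le)

lemma theta1_eq_Th: "theta1 t z = Th 0 t z" if "Im t > 0"
proof -
  let ?f = "\<lambda>m. (-1) ^ m * exp (of_real pi * \<i> * t * (of_nat m + 1/2)\<^sup>2) * sin ((2 * of_nat m + 1) * of_real pi * z)"
  have "summable (\<lambda>m. theta_term 0 m t z)"
    by (rule summable_comparison_test[OF _ summable_theta_bound[OF that, of 0 "\<bar>Im z\<bar>"]])
       (auto intro: norm_theta_term_le)
  hence "summable (\<lambda>m. 2 * ?f m)" by (simp add: theta_term_def mult.assoc)
  hence "summable ?f" using summable_mult_D[of 2 ?f] by simp
  hence "2 * suminf ?f = (\<Sum>m. 2 * ?f m)" by (rule suminf_mult[symmetric])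
  also have "... = Th 0 t z" by (simp add: Th_def theta_term_def mult.assoc)
  finally show ?thesis by (simp add: theta1_def)
qed

lemma continuous_on_Th: "continuous_on {p. Im (fst p) > 0} (\<lambda>p. Th k (fst p) (snd p))"
proof (subst continuous_on_eq_continuous_at)
  show o: "open {p :: complex \<times> complex. Im (fst p) > 0}"
    by (intro open_Collect_less continuous_intros)
  show "\<forall>p\<in>{p. 0 < Im (fst p)}. isCont (\<lambda>p. Th k (fst p) (snd p)) p"
  proof
    fix p :: "complex \<times> complex" assume p: "p \<in> {p. 0 < Im (fst p)}"
    define d R where "d = Im (fst p) / 2" and "R = \<bar>Im (snd p)\<bar> + 1"
    let ?S = "{p. Im (fst p) \<ge> d \<and> \<bar>Im (snd p)\<bar> \<le> R} :: (complex \<times> complex) set"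
    let ?T = "{p. Im (fst p) > d \<and> \<bar>Im (snd p)\<bar> < R} :: (complex \<times> complex) set"
    have d: "d > 0" using p by (simp add: d_def)
    have "continuous_on ?S (\<lambda>p. Th k (fst p) (snd p))"
      by (rule uniform_limit_theorem[OF _ uniform_limit_theta[OF d]])
         (auto intro!: always_eventually continuous_intros simp: theta_term_def)
    hence "continuous_on ?T (\<lambda>p. Th k (fst p) (snd p))"
      by (rule continuous_on_subset) auto
    moreover have "open ?T" "p \<in> ?T" using p by (auto simp: d_def R_def intro!: open_Collect_conj open_Collect_less continuous_intros)
    ultimately show "isCont (\<lambda>p. Th k (fst p) (snd p)) p"
      using continuous_on_eq_continuous_at by blast
  qed
qed

lemma theta_term_deriv_z:
  "((\<lambda>z. theta_term k m t z) has_field_derivative theta_term (Suc k) m t z) (at z within A)"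
proof -
  have "cos w = sin (w + of_real pi / 2)" for w :: complex
    by (simp add: sin_add flip: sin_of_real cos_of_real)
  hence *: "cos ((2 * of_nat m + 1) * of_real pi * z + of_nat k * of_real pi / 2)
      = sin ((2 * of_nat m + 1) * of_real pi * z + of_nat (Suc k) * of_real pi / 2)"
    by (simp add: algebra_simps add_divide_distrib)
  show ?thesis
    unfolding theta_term_def *[symmetric]
    by (auto intro!: derivative_eq_intros simp: mult_ac)
qed

text \<open>The heat equation, term by term: the \<open>t\<close>-derivative brings down pi i (m +
  1/2)^2, two \<open>z\<close>-derivatives bring down - (2m + 1)^2 pi^2, and the second factor is 4
  pi i times the first.\<close>

lemma theta_term_deriv_tau:
  "((\<lambda>t. theta_term k m t z) has_field_derivative theta_term (k + 2) m t z / (4 * of_real pi * \<i>)) (at t within A)"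
proof -
  have *: "sin ((2 * of_nat m + 1) * of_real pi * z + of_nat (k + 2) * of_real pi / 2)
      = - sin ((2 * of_nat m + 1) * of_real pi * z + of_nat k * of_real pi / 2)"
  proof -
    have "(2 * of_nat m + 1) * of_real pi * z + of_nat (k + 2) * of_real pi / 2
        = ((2 * of_nat m + 1) * of_real pi * z + of_nat k * of_real pi / 2) + complex_of_real pi"
      by (simp add: field_simps)
    thus ?thesis by (simp only: sin_add[of _ "complex_of_real pi"] sin_of_real cos_of_real sin_pi cos_pi) simp
  qed
  have i: "inverse \<i> = - \<i>" by simp
  show ?thesis
    unfolding theta_term_def *
    by (auto intro!: derivative_eq_intros simp: power_add power2_eq_square field_simps)
qed

lemma Th_deriv_z:
  assumes "Im t > 0"
  shows "DERIV (\<lambda>z. Th k t z) z :> Th (Suc k) t z"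
proof -
  define R where "R = \<bar>Im z\<bar> + 1"
  let ?S = "{z. \<bar>Im z\<bar> \<le> R}"
  have ul: "uniform_limit ?S (\<lambda>n z. \<Sum>m<n. theta_term (Suc k) m t z) (\<lambda>z. Th (Suc k) t z) sequentially"
    unfolding Th_def
    by (rule Weierstrass_m_test[OF _ summable_theta_bound[OF assms]]) (auto intro: norm_theta_term_le)
  have cvx: "convex ?S"
  proof -
    have "?S = {z. Im z \<le> R} \<inter> {z. Im z \<ge> - R}" by auto
    thus ?thesis by (simp add: convex_Int convex_halfspace_Im_le convex_halfspace_Im_ge)
  qed
  have "open {z. \<bar>Im z\<bar> < R}" by (intro open_Collect_less continuous_intros)
  hence int: "z \<in> interior ?S"
    by (rule interiorI) (auto simp: R_def)
  have sm: "summable (\<lambda>m. theta_term k m t z)"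
    by (rule summable_comparison_test[OF _ summable_theta_bound[OF assms, of k "\<bar>Im z\<bar>"]])
       (auto intro: norm_theta_term_le)
  show ?thesis
    unfolding Th_def
    by (rule has_field_derivative_series'(2)[OF cvx theta_term_deriv_z _ _ sm int])
       (use ul in \<open>auto simp: uniformly_convergent_on_def R_def\<close>)
qed

lemma Th_deriv_tau:
  assumes "Im t > 0"
  shows "DERIV (\<lambda>t. Th k t z) t :> Th (k + 2) t z / (4 * of_real pi * \<i>)"
proof -
  define d where "d = Im t / 2"
  let ?S = "{t. Im t \<ge> d}"
  have d: "d > 0" using assms by (simp add: d_def)
  have ul: "uniform_limit ?S (\<lambda>n t. \<Sum>m<n. theta_term (k + 2) m t z / (4 * of_real pi * \<i>))
      (\<lambda>t. \<Sum>m. theta_term (k + 2) m t z / (4 * of_real pi * \<i>)) sequentially"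
    by (rule Weierstrass_m_test[OF _ summable_divide[OF summable_theta_bound[OF d, of "k+2" "\<bar>Im z\<bar>"], of "4 * pi"]])
       (auto intro!: divide_right_mono norm_theta_term_le simp: norm_divide norm_mult)
  have "open {t. Im t > d}" by (intro open_Collect_less continuous_intros)
  hence int: "t \<in> interior ?S"
    by (rule interiorI) (use assms in \<open>auto simp: d_def\<close>)
  have sm: "summable (\<lambda>m. theta_term k m t z)" for k
    by (rule summable_comparison_test[OF _ summable_theta_bound[OF assms, of k "\<bar>Im z\<bar>"]])
       (auto intro: norm_theta_term_le)
  have "DERIV (\<lambda>t. \<Sum>m. theta_term k m t z) t :> (\<Sum>m. theta_term (k + 2) m t z / (4 * of_real pi * \<i>))"
    by (rule has_field_derivative_series'(2)[OF convex_halfspace_Im_ge theta_term_deriv_tau _ _ sm[of k] int])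
       (use ul assms in \<open>auto simp: uniformly_convergent_on_def d_def\<close>)
  thus ?thesis unfolding Th_def suminf_divide[OF sm] .
qed

text \<open>The two partial derivatives combine to a total derivative because the one in
  \<open>z\<close> is jointly continuous by \<open>continuous_on_Th\<close>.\<close>

lemma has_derivative_Th:
  assumes "Im t > 0"
  shows "((\<lambda>p. Th k (fst p) (snd p)) has_derivative
     (\<lambda>h. Th (k + 2) t z / (4 * of_real pi * \<i>) * fst h + Th (Suc k) t z * snd h)) (at (t, z))"
proof -
  let ?H = "{t. Im t > 0}"
  have oH: "open ?H" by (intro open_Collect_less continuous_intros)
  define fy where "fy = (\<lambda>t z. blinfun_mult_right (Th (Suc k) t z))"
  have fx: "((\<lambda>t. Th k t z) has_derivative (*) (Th (k + 2) t z / (4 * of_real pi * \<i>))) (at t within ?H)"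
    using Th_deriv_tau[OF assms, of k z] unfolding has_field_derivative_def by (rule has_derivative_at_withinI)
  have fy: "((\<lambda>z. Th k t z) has_derivative blinfun_apply (fy t z)) (at z within UNIV)" if "t \<in> ?H" for t z
    using Th_deriv_z[of t k z] that unfolding has_field_derivative_def fy_def by (auto simp: fun_eq_iff)
  have "isCont (\<lambda>p. Th (Suc k) (fst p) (snd p)) (t, z)"
    using continuous_on_Th[of "Suc k"] assms
    by (subst (asm) continuous_on_eq_continuous_at) (auto intro!: open_Collect_less continuous_intros)
  hence "isCont (\<lambda>p. fy (fst p) (snd p)) (t, z)"
    unfolding fy_def by (rule bounded_linear.isCont[OF bounded_linear_blinfun_mult_right, rotated])
  hence "isCont (\<lambda>(x, y). fy x y) (t, z)" by (simp only: case_prod_beta')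
  hence fyc: "continuous (at (t, z) within ?H \<times> UNIV) (\<lambda>(x, y). fy x y)"
    by (rule continuous_at_imp_continuous_at_within)
  have "((\<lambda>(t, z). Th k t z) has_derivative
     (\<lambda>(tx, ty). Th (k + 2) t z / (4 * of_real pi * \<i>) * tx + blinfun_apply (fy t z) ty)) (at (t, z) within ?H \<times> UNIV)"
    by (rule has_derivative_partialsI[OF fx fy fyc]) auto
  hence "((\<lambda>p. Th k (fst p) (snd p)) has_derivative
     (\<lambda>h. Th (k + 2) t z / (4 * of_real pi * \<i>) * fst h + Th (Suc k) t z * snd h)) (at (t, z) within ?H \<times> UNIV)"
    by (simp add: case_prod_beta' fy_def)
  thus ?thesis
    using assms oH by (simp add: at_within_open[OF _ open_Times[OF oH open_UNIV]])
qed

lemma holo_Th_at: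
  fixes f g :: "complex ^ 'm::finite => complex"
  assumes "holo_on f {x}" "holo_on g {x}" "Im (f x) > 0"
  shows "holo_on (\<lambda>x. Th k (f x) (g x)) {x}"
    "pdiff (\<lambda>x. Th k (f x) (g x)) a x
      = Th (k + 2) (f x) (g x) / (4 * of_real pi * \<i>) * pdiff f a x + Th (Suc k) (f x) (g x) * pdiff g a x"
proof -
  note d = holo_onD[OF assms(1) singletonI] holo_onD[OF assms(2) singletonI]
  let ?D = "\<lambda>v. Th (k + 2) (f x) (g x) / (4 * of_real pi * \<i>) * Dsum f x v + Th (Suc k) (f x) (g x) * Dsum g x v"
  have D: "((\<lambda>x. Th k (f x) (g x)) has_derivative ?D) (at x)"
    using has_derivative_compose[OF has_derivative_Pair[OF d] has_derivative_Th[OF assms(3), of k "g x"]] by simp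
  show "holo_on (\<lambda>x. Th k (f x) (g x)) {x}"
    by (rule holo_has_derivI[OF D]) (simp add: Dsum_smult algebra_simps)
  show "pdiff (\<lambda>x. Th k (f x) (g x)) a x
      = Th (k + 2) (f x) (g x) / (4 * of_real pi * \<i>) * pdiff f a x + Th (Suc k) (f x) (g x) * pdiff g a x"
    by (subst pdiff_eq[OF D]) (simp_all add: Dsum_smult algebra_simps)
qed

lemma holo_on_Th [intro]:
  "holo_on f W ==> holo_on g W ==> (\<And>x. x \<in> W ==> Im (f x) > 0) ==> holo_on (\<lambda>x. Th k (f x) (g x)) W"
  by (subst holo_on_pointwise) (auto intro!: holo_Th_at intro: holo_on_subset)

subsection \<open>Quasi-periodicity\<close>

lemma DERIV_shift_eq:
  assumes "DERIV f (z + c) :> f'"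
  shows "DERIV (\<lambda>z. f (z + c)) (z :: complex) :> f'"
  using assms by (simp add: DERIV_shift)

lemma Th_periodic_1:
  assumes "Im t > 0"
  shows "Th k t (z + 1) = - Th k t z"
proof (induction k arbitrary: z)
  case 0
  have "theta_term 0 m t (z + 1) = - theta_term 0 m t z" for m
  proof -
    have "(2 * of_nat m + 1) * of_real pi * (z + 1)
       = (2 * of_nat m + 1) * of_real pi * z + complex_of_real (real (2 * m + 1) * pi)"
      by (simp add: algebra_simps)
    hence "sin ((2 * of_nat m + 1) * of_real pi * (z + 1)) = - sin ((2 * of_nat m + 1) * of_real pi * z)"
      by (simp only: sin_add[of _ "complex_of_real _"] sin_of_real cos_of_real sin_npi cos_npi) simp
    thus ?thesis by (simp add: theta_term_def)
  qed
  moreover have "summable (\<lambda>m. theta_term 0 m t z)"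
    by (rule summable_comparison_test[OF _ summable_theta_bound[OF assms, of 0 "\<bar>Im z\<bar>"]])
       (auto intro: norm_theta_term_le)
  ultimately show ?case by (simp add: Th_def suminf_minus)
next
  case (Suc k)
  have "DERIV (\<lambda>z. Th k t (z + 1)) z :> Th (Suc k) t (z + 1)"
    by (rule DERIV_shift_eq[OF Th_deriv_z[OF assms]])
  moreover have "DERIV (\<lambda>z. Th k t (z + 1)) z :> - Th (Suc k) t z"
    unfolding Suc.IH by (rule DERIV_minus[OF Th_deriv_z[OF assms]])
  ultimately show ?case by (rule DERIV_unique)
qed

lemma Th_minus:
  assumes "Im t > 0"
  shows "Th k t (- z) = (-1) ^ Suc k * Th k t z"
proof (induction k arbitrary: z)
  case 0
  have "theta_term 0 m t (- z) = - theta_term 0 m t z" for m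
    by (simp add: theta_term_def)
  moreover have "summable (\<lambda>m. theta_term 0 m t z)"
    by (rule summable_comparison_test[OF _ summable_theta_bound[OF assms, of 0 "\<bar>Im z\<bar>"]])
       (auto intro: norm_theta_term_le)
  ultimately show ?case by (simp add: Th_def suminf_minus)
next
  case (Suc k)
  have "DERIV (\<lambda>z. Th k t (- z)) z :> - Th (Suc k) t (- z)"
    using DERIV_chain2[where f="Th k t" and g=uminus and x=z and s=UNIV, OF Th_deriv_z[OF assms], of "-1"]
      DERIV_minus[OF DERIV_ident, of z] by simp
  moreover have "DERIV (\<lambda>z. Th k t (- z)) z :> (-1) ^ Suc k * Th (Suc k) t z"
    unfolding Suc.IH by (rule DERIV_cmult[OF Th_deriv_z[OF assms]])
  ultimately have "- Th (Suc k) t (- z) = (-1) ^ Suc k * Th (Suc k) t z" by (rule DERIV_unique)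
  thus ?case by (simp add: minus_equation_iff[of _ "Th (Suc k) t z"] eq_commute)
qed

definition autf :: "complex => complex => complex" where
  "autf t z = exp (- (of_real pi * \<i> * t) - 2 * of_real pi * \<i> * z)"

lemma autf_nonzero [simp]: "autf t z ~= 0"
  by (simp add: autf_def)

lemma autf_deriv: "DERIV (\<lambda>z. autf t z) z :> - tpi * autf t z"
  unfolding autf_def by (auto intro!: derivative_eq_intros)

text \<open>One of the two exponentials into which the sine of a theta term splits; \<open>s\<close>
  is 1 or -1. The two families together form the bilateral theta series.\<close>

definition half_term :: "complex => complex => complex => nat => complex" where
  "half_term s t z m = (-1) ^ m * exp (of_real pi * \<i> * (t * (of_nat m + 1/2)\<^sup>2 + s * (2 * of_nat m + 1) * z))"

lemma theta_term_half:
  "\<i> * theta_term 0 m t z = half_term 1 t z m - half_term (-1) t z m"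
proof -
  define X where "X = (2 * of_nat m + 1) * of_real pi * z"
  have h: "half_term s t z m = (-1) ^ m * exp (of_real pi * \<i> * t * (of_nat m + 1/2)\<^sup>2) * exp (s * (\<i> * X))" for s
    unfolding half_term_def X_def by (simp add: algebra_simps flip: exp_add)
  have "theta_term 0 m t z = 2 * (-1) ^ m * exp (of_real pi * \<i> * t * (of_nat m + 1/2)\<^sup>2) * sin X"
    by (simp add: theta_term_def X_def)
  thus ?thesis
  proof -
    have "2 * (\<i> * sin X) = exp (\<i> * X) - exp (- (\<i> * X))" by (simp add: sin_exp_eq field_simps)
    hence "(-1) ^ m * exp (of_real pi * \<i> * t * (of_nat m + 1/2)\<^sup>2) * (2 * (\<i> * sin X)) =
      (-1) ^ m * exp (of_real pi * \<i> * t * (of_nat m + 1/2)\<^sup>2) * (exp (\<i> * X) - exp (- (\<i> * X)))"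
      by simp
    thus ?thesis using \<open>theta_term 0 m t z = _\<close> unfolding h by (simp add: algebra_simps)
  qed
qed

lemma summable_half_term:
  assumes "Im t > 0" "s = 1 \<or> s = -1"
  shows "summable (half_term s t z)"
proof (rule summable_comparison_test[OF _ summable_theta_bound[OF assms(1), of 0 "\<bar>Im z\<bar>"]])
  have "norm (half_term s t z m) \<le> theta_bound 0 (Im t) \<bar>Im z\<bar> m" for m
  proof -
    define w where "w = s * z"
    have e: "of_real pi * \<i> * (t * (of_nat m + 1/2)\<^sup>2 + s * (2 * of_nat m + 1) * z)
      = of_real (pi * (real m + 1/2)\<^sup>2) * (\<i> * t) + of_real ((2 * real m + 1) * pi) * (\<i> * w)"
      by (simp add: algebra_simps w_def)
    have "- Im w \<le> \<bar>Im z\<bar>" using assms(2) by (auto simp: w_def)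
    hence "(2 * real m + 1) * pi * - Im w \<le> (2 * real m + 1) * pi * \<bar>Im z\<bar>"
      by (intro mult_left_mono) auto
    moreover have "Re (of_real (pi * (real m + 1/2)\<^sup>2) * (\<i> * t) + of_real ((2 * real m + 1) * pi) * (\<i> * w))
        = - (pi * Im t * (real m + 1/2)\<^sup>2) + (2 * real m + 1) * pi * - Im w"
      by simp
    ultimately have "norm (half_term s t z m) \<le> exp (- (pi * Im t * (real m + 1/2)\<^sup>2)) * exp ((2 * real m + 1) * pi * \<bar>Im z\<bar>)"
      unfolding half_term_def e norm_mult norm_power norm_exp_eq_Re
      by (simp flip: exp_add)
    also have "... \<le> theta_bound 0 (Im t) \<bar>Im z\<bar> m"
      unfolding theta_bound_def by (intro mult_right_mono) auto
    finally show ?thesis .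
  qed
  thus "\<exists>N. \<forall>m\<ge>N. norm (half_term s t z m) \<le> theta_bound 0 (Im t) \<bar>Im z\<bar> m" by blast
qed

lemma Th0_half:
  assumes "Im t > 0"
  shows "\<i> * Th 0 t z = suminf (half_term 1 t z) - suminf (half_term (-1) t z)"
proof -
  have "summable (\<lambda>m. theta_term 0 m t z)"
    by (rule summable_comparison_test[OF _ summable_theta_bound[OF assms, of 0 "\<bar>Im z\<bar>"]])
       (auto intro: norm_theta_term_le)
  hence "\<i> * Th 0 t z = (\<Sum>m. \<i> * theta_term 0 m t z)"
    by (simp add: Th_def suminf_mult)
  also have "... = suminf (half_term 1 t z) - suminf (half_term (-1) t z)"
    unfolding theta_term_half by (rule suminf_diff[symmetric]) (auto intro!: summable_half_term assms)
  finally show ?thesis .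
qed

text \<open>Translation by \<open>t\<close> shifts the index up in one half series and down in the
  other; the boundary term of index 0 crosses from one half to the other, as in reindexing the
  bilateral series.\<close>

lemma Th0_periodic_tau:
  assumes "Im t > 0"
  shows "Th 0 t (z + t) = - autf t z * Th 0 t z"
proof -
  have sm: "summable (half_term 1 t z)" "summable (half_term (-1) t z)" for z
    by (auto intro!: summable_half_term assms)
  have 1: "half_term 1 t (z + t) m = - autf t z * half_term 1 t z (Suc m)" for m
    unfolding half_term_def autf_def
    by (simp add: exp_add[symmetric] power2_eq_square field_simps)
  have 2: "half_term (-1) t (z + t) (Suc m) = - autf t z * half_term (-1) t z m" for m
    unfolding half_term_def autf_def
    by (simp add: exp_add[symmetric] power2_eq_square field_simps)
  have 3: "half_term (-1) t (z + t) 0 = autf t z * half_term 1 t z 0"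
    unfolding half_term_def autf_def
    by (simp add: exp_add[symmetric] power2_eq_square field_simps)
  have "suminf (half_term 1 t (z + t)) = - autf t z * (suminf (half_term 1 t z) - half_term 1 t z 0)"
    unfolding 1[abs_def] using sm(1)[of z] by (subst suminf_mult) (simp_all add: summable_Suc_iff suminf_split_head)
  moreover have "suminf (half_term (-1) t (z + t)) = autf t z * half_term 1 t z 0 - autf t z * suminf (half_term (-1) t z)"
    using suminf_split_head[OF sm(2)[of "z + t"]] sm(2)[of z] unfolding 2 3
    by (simp add: suminf_mult suminf_minus algebra_simps)
  ultimately have "\<i> * Th 0 t (z + t) = - autf t z * (\<i> * Th 0 t z)"
    unfolding Th0_half[OF assms] by (simp add: algebra_simps)
  hence "\<i> * Th 0 t (z + t) = \<i> * (- autf t z * Th 0 t z)" by (simp only: mult.left_commute)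
  thus ?thesis unfolding mult_left_cancel[OF complex_i_not_zero] .
qed

lemma Th1_periodic_tau:
  assumes "Im t > 0"
  shows "Th 1 t (z + t) = - autf t z * (Th 1 t z - 2 * of_real pi * \<i> * Th 0 t z)"
proof -
  have "DERIV (\<lambda>z. Th 0 t (z + t)) z :> Th 1 t (z + t)"
    using DERIV_shift_eq[OF Th_deriv_z[OF assms, of 0 "z + t"]] by simp
  moreover have "((\<lambda>z. Th 0 t (z + t)) has_field_derivative
      - autf t z * (Th 1 t z - 2 * of_real pi * \<i> * Th 0 t z)) (at z)"
    unfolding Th0_periodic_tau[OF assms]
    by (auto intro!: derivative_eq_intros autf_deriv Th_deriv_z[OF assms] simp: algebra_simps)
  ultimately show ?thesis by (rule DERIV_unique)
qed

lemma Th2_periodic_tau: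
  assumes "Im t > 0"
  shows "Th 2 t (z + t) = - autf t z * (Th 2 t z - 4 * of_real pi * \<i> * Th 1 t z
           + tpi\<^sup>2 * Th 0 t z)"
proof -
  have "DERIV (\<lambda>z. Th 1 t (z + t)) z :> Th 2 t (z + t)"
    using DERIV_shift_eq[OF Th_deriv_z[OF assms, of 1 "z + t"]] by (simp add: numeral_2_eq_2)
  moreover have "((\<lambda>z. Th 1 t (z + t)) has_field_derivative
      - autf t z * (Th 2 t z - 4 * of_real pi * \<i> * Th 1 t z + tpi\<^sup>2 * Th 0 t z)) (at z)"
    unfolding Th1_periodic_tau[OF assms]
    by (auto intro!: derivative_eq_intros autf_deriv Th_deriv_z[OF assms]
        simp: algebra_simps numeral_2_eq_2 power2_eq_square)
  ultimately show ?thesis by (rule DERIV_unique)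
qed

subsection \<open>Liouville's theorem for elliptic functions\<close>

text \<open>Fractional parts move every point into the closed period parallelogram, whose image is
  compact; Liouville's theorem applies.\<close>

lemma entire_doubly_periodic_const:
  assumes "f holomorphic_on UNIV" "Im t > 0" "\<And>z. f (z + 1) = f z" "\<And>z. f (z + t) = f z"
  shows "\<exists>c. \<forall>z. f z = c"
proof -
  have per: "f (z + of_int k * p) = f z" if "\<And>z. f (z + p) = f z" for k z and p :: complex
  proof (induction k rule: int_induct[where k=0])
    case (step1 i)
    thus ?case using that[of "z + of_int i * p"] by (simp add: algebra_simps)
  next
    case (step2 i)
    thus ?case using that[of "z + of_int (i - 1) * p"] by (simp add: algebra_simps)
  qed simp
  let ?K = "(\<lambda>(s, u). of_real s + of_real u * t) ` (cbox (0, 0) (1, 1 :: real))"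
  have "compact (f ` ?K)"
    by (intro compact_continuous_image holomorphic_on_imp_continuous_on[OF holomorphic_on_subset[OF assms(1)]])
       (auto intro!: continuous_intros compact_continuous_image simp: case_prod_beta')
  moreover have "range f \<subseteq> f ` ?K"
  proof clarify
    fix z
    define y where "y = Im z / Im t"
    define x where "x = Re z - y * Re t"
    have z: "z = of_real x + of_real y * t"
      using assms(2) by (simp add: complex_eq_iff x_def y_def)
    have "f (of_real (frac x) + of_real (frac y) * t)
        = f ((of_real (frac x) + of_real (frac y) * t + of_int \<lfloor>y\<rfloor> * t) + of_int \<lfloor>x\<rfloor> * 1)"
      by (simp only: per[OF assms(3)] per[OF assms(4)])
    also have "(of_real (frac x) + of_real (frac y) * t + of_int \<lfloor>y\<rfloor> * t) + of_int \<lfloor>x\<rfloor> * 1 = z"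
      by (simp add: frac_def z algebra_simps)
    finally have "f z = f (of_real (frac x) + of_real (frac y) * t)" ..
    moreover have "(frac x, frac y) \<in> cbox (0, 0) (1, 1)"
      using frac_lt_1[of x] frac_lt_1[of y] by (simp add: less_imp_le)
    ultimately show "f z \<in> f ` ?K" by (metis (mono_tags, lifting) case_prod_conv image_eqI)
  qed
  ultimately have "bounded (range f)" by (meson bounded_subset compact_imp_bounded)
  hence "f constant_on UNIV" by (rule Liouville_theorem[OF assms(1)])
  thus ?thesis by (auto simp: constant_on_def)
qed

text \<open>Filling in the removable singularities yields an entire doubly periodic function. The
  conclusion speaks of limits because the values of \<open>f\<close> at the singularities are
  arbitrary.\<close>

lemma elliptic_const:
  assumes "\<And>z. isolated_singularity_at f z" "\<And>z. \<exists>l. f \<midarrow>z\<rightarrow> l" "Im t > 0"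
    "\<And>z. eventually (\<lambda>w. f (w + 1) = f w) (at z)" "\<And>z. eventually (\<lambda>w. f (w + t) = f w) (at z)"
  obtains c where "\<And>z. f \<midarrow>z\<rightarrow> c"
proof -
  have lim: "f \<midarrow>z\<rightarrow> remove_sings f z" for z
    using assms(2)[of z] remove_sings_eqI by metis
  have "remove_sings f analytic_on {z}" for z
    using assms(1) lim by (rule remove_sings_analytic_at)
  hence "remove_sings f analytic_on UNIV" using analytic_on_analytic_at by blast
  hence hol: "remove_sings f holomorphic_on UNIV" by (rule analytic_imp_holomorphic)
  have per: "remove_sings f (z + p) = remove_sings f z" if "\<And>z. eventually (\<lambda>w. f (w + p) = f w) (at z)" for p z
  proof (rule remove_sings_eqI)
    have "(\<lambda>w. f (w + p)) \<midarrow>z\<rightarrow> remove_sings f z"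
      by (rule Lim_transform_eventually[OF lim]) (use eventually_mono[OF that[of z]] in auto)
    thus "f \<midarrow>z + p\<rightarrow> remove_sings f z"
      using LIM_offset[of "\<lambda>w. f (w + p)" "remove_sings f z" z "- p"] by simp
  qed
  obtain c where "\<And>z. remove_sings f z = c"
    using entire_doubly_periodic_const[OF hol assms(3) per[OF assms(4)] per[OF assms(5)]] by blast
  with that lim show ?thesis by metis
qed

subsection \<open>Infinite products and the zeros of the theta function\<close>

lemma holomorphic_prodinf:
  fixes f :: "nat => complex => complex"
  assumes "open S" "\<And>n. f n holomorphic_on S"
    and bound: "\<And>x. x \<in> S ==> \<exists>d M. d > 0 \<and> cball x d \<subseteq> S \<and> summable M \<and> (\<forall>n. \<forall>y\<in>cball x d. norm (f n y - 1) \<le> M n)"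
  shows "(\<lambda>x. prodinf (\<lambda>n. f n x)) holomorphic_on S"
proof (rule holomorphic_uniform_sequence[OF assms(1), of "\<lambda>N x. \<Prod>n<N. f n x"])
  show "(\<lambda>x. \<Prod>n<N. f n x) holomorphic_on S" for N
    using assms(2) by (intro holomorphic_intros)
  fix x assume "x \<in> S"
  from bound[OF this] obtain d M where d: "d > 0" "cball x d \<subseteq> S" "summable M"
    and dM: "\<forall>n. \<forall>y\<in>cball x d. norm (f n y - 1) \<le> M n" by blast
  have "uniformly_convergent_on (cball x d) (\<lambda>N x. \<Prod>n<N. f n x)"
  proof (rule uniformly_convergent_on_prod')
    show "continuous_on (cball x d) (f n)" for n
      by (rule continuous_on_subset[OF holomorphic_on_imp_continuous_on[OF assms(2)] d(2)])
    show "uniformly_convergent_on (cball x d) (\<lambda>N x. \<Sum>n<N. norm (f n x - 1))"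
    proof -
      have "uniform_limit (cball x d) (\<lambda>N x. \<Sum>n<N. norm (f n x - 1)) (\<lambda>x. \<Sum>n. norm (f n x - 1)) sequentially"
        by (rule Weierstrass_m_test[OF _ d(3)]) (use dM in simp)
      thus ?thesis unfolding uniformly_convergent_on_def by blast
    qed
  qed auto
  then obtain l where l: "uniform_limit (cball x d) (\<lambda>N x. \<Prod>n<N. f n x) l sequentially"
    by (auto simp: uniformly_convergent_on_def)
  have "l y = prodinf (\<lambda>n. f n y)" if y: "y \<in> cball x d" for y
  proof -
    have "(\<lambda>N. \<Prod>n<N. f n y) \<longlonglongrightarrow> l y" by (rule tendsto_uniform_limitI[OF l y])
    moreover have "convergent_prod (\<lambda>n. f n y)"
      by (intro abs_convergent_prod_imp_convergent_prod, subst abs_convergent_prod_conv_summable)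
         (rule summable_comparison_test'[OF d(3)], use dM y in simp)
    hence "(\<lambda>N. \<Prod>n<N. f n y) \<longlonglongrightarrow> prodinf (\<lambda>n. f n y)"
      using has_prod_imp_tendsto' by blast
    ultimately show ?thesis by (rule LIMSEQ_unique)
  qed
  with l have "uniform_limit (cball x d) (\<lambda>N x. \<Prod>n<N. f n x) (\<lambda>x. prodinf (\<lambda>n. f n x)) sequentially"
    by (subst uniform_limit_cong'[where i=l]) auto
  with d show "\<exists>d>0. cball x d \<subseteq> S \<and> uniform_limit (cball x d) (\<lambda>N x. \<Prod>n<N. f n x) (\<lambda>x. prodinf (\<lambda>n. f n x)) sequentially"
    by blast
qed

text \<open>The q-Pochhammer symbol (x; q) of infinite length.\<close>

definition euler_prod :: "complex => complex => complex" where
  "euler_prod q x = prodinf (\<lambda>m. 1 - q ^ m * x)"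

lemma convergent_euler_prod:
  fixes q x :: complex
  assumes "norm q < 1"
  shows "convergent_prod (\<lambda>m. 1 - q ^ m * x)"
proof -
  have "summable (\<lambda>m. norm q ^ m * norm x)"
    using assms by (intro summable_mult2 summable_geometric) auto
  hence "abs_convergent_prod (\<lambda>m. 1 - q ^ m * x)"
    by (subst abs_convergent_prod_conv_summable) (simp add: norm_mult norm_power)
  thus ?thesis by (rule abs_convergent_prod_imp_convergent_prod)
qed

lemma euler_prod_eq_0_iff:
  assumes "norm q < 1"
  shows "euler_prod q x = 0 \<longleftrightarrow> (\<exists>m. q ^ m * x = 1)"
  using has_prod_eq_0_iff[OF convergent_prod_has_prod[OF convergent_euler_prod[OF assms, of x]]]
  unfolding euler_prod_def by (auto simp: image_iff)

lemma euler_prod_step: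
  assumes "norm q < 1"
  shows "euler_prod q x = (1 - x) * euler_prod q (q * x)"
proof -
  have "(\<lambda>m. 1 - q ^ m * (q * x)) has_prod euler_prod q (q * x)"
    unfolding euler_prod_def by (rule convergent_prod_has_prod[OF convergent_euler_prod[OF assms]])
  hence "(\<lambda>m. 1 - q ^ Suc m * x) has_prod euler_prod q (q * x)" by (simp add: mult_ac)
  from has_prod_Suc_imp[of "\<lambda>m. 1 - q ^ m * x", OF this]
  have "(\<lambda>m. 1 - q ^ m * x) has_prod (euler_prod q (q * x) * (1 - x))" by simp
  from has_prod_unique[OF this] show ?thesis by (simp add: euler_prod_def mult.commute)
qed

lemma holomorphic_euler_prod:
  assumes "norm q < 1"
  shows "euler_prod q holomorphic_on UNIV"
  unfolding euler_prod_def[abs_def]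
proof (rule holomorphic_prodinf)
  fix x :: complex
  have "norm (1 - q ^ n * y - 1) \<le> norm q ^ n * (norm x + 1)" if "y \<in> cball x 1" for n y
  proof -
    have "norm y \<le> norm x + 1" using that norm_triangle_ineq[of x "y - x"] by (simp add: dist_norm norm_minus_commute)
    thus ?thesis by (simp add: norm_mult norm_power mult_left_mono)
  qed
  moreover have "summable (\<lambda>m. norm q ^ m * (norm x + 1))"
    using assms by (intro summable_mult2 summable_geometric) auto
  ultimately show "\<exists>d M. d > 0 \<and> cball x d \<subseteq> UNIV \<and> summable M \<and> (\<forall>n. \<forall>y\<in>cball x d. norm (1 - q ^ n * y - 1) \<le> M n)"
    by (intro exI[of _ 1] exI[of _ "\<lambda>m. norm q ^ m * (norm x + 1)"]) auto
qed (auto intro!: holomorphic_intros)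

lemma holomorphic_dedekind_eta: "dedekind_eta holomorphic_on {t. Im t > 0}"
proof -
  have "(\<lambda>t. prodinf (\<lambda>m. 1 - exp (tpi * of_nat (Suc m) * t))) holomorphic_on {t. Im t > 0}"
  proof (rule holomorphic_prodinf)
    fix x assume x: "x \<in> {t. Im t > 0}"
    define d where "d = Im x / 2"
    have d: "d > 0" using x by (simp add: d_def)
    have im: "Im y \<ge> d" if "y \<in> cball x d" for y
      using that abs_Im_le_cmod[of "x - y"] by (simp add: dist_norm d_def)
    have "norm (1 - exp (tpi * of_nat (Suc m) * y) - 1) \<le> exp (- (2 * pi * d)) ^ Suc m"
      if "y \<in> cball x d" for m y
    proof -
      have e: "tpi * of_nat (Suc m) * y = of_real (2 * pi * real (Suc m)) * (\<i> * y)" by simp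
      have "norm (exp (tpi * of_nat (Suc m) * y)) = exp (- (2 * pi * real (Suc m) * Im y))"
        unfolding e norm_exp_eq_Re by simp
      also have "... \<le> exp (- (2 * pi * real (Suc m) * d))"
        using im[OF that] by (simp add: mult_left_mono)
      also have "... = exp (real (Suc m) * - (2 * pi * d))" by (simp add: mult_ac)
      also have "... = exp (- (2 * pi * d)) ^ Suc m" by (rule exp_of_nat_mult)
      finally show ?thesis by simp
    qed
    moreover have "summable (\<lambda>m. exp (- (2 * pi * d)) ^ Suc m)"
      using d by (subst summable_Suc_iff) (auto intro!: summable_geometric)
    moreover have "cball x d \<subseteq> {t. Im t > 0}" using im d by fastforce
    ultimately show "\<exists>d M. d > 0 \<and> cball x d \<subseteq> {t. Im t > 0} \<and> summable M \<and>
        (\<forall>n. \<forall>y\<in>cball x d. norm (1 - exp (tpi * of_nat (Suc n) * y) - 1) \<le> M n)"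
      using d by blast
  qed (auto intro!: holomorphic_intros open_Collect_less continuous_intros)
  thus ?thesis unfolding dedekind_eta_def by (intro holomorphic_intros) auto
qed

lemma norm_nome_less_1: "Im t > 0 ==> norm (exp (tpi * t)) < 1"
proof -
  have "tpi * t = of_real (2 * pi) * (\<i> * t)" by simp
  thus "Im t > 0 ==> ?thesis" unfolding norm_exp_eq_Re by simp
qed

lemma dedekind_eta_nonzero:
  assumes "Im t > 0"
  shows "dedekind_eta t ~= 0"
proof -
  define q where "q = exp (tpi * t)"
  have q: "norm q < 1" using norm_nome_less_1[OF assms] by (simp add: q_def)
  have "exp (tpi * of_nat (Suc m) * t) = q ^ m * q" for m
    unfolding q_def by (simp add: exp_of_nat_mult[symmetric] exp_add[symmetric] algebra_simps)
  hence "dedekind_eta t = exp (of_real pi * \<i> * t / 12) * euler_prod q q"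
    by (simp add: dedekind_eta_def euler_prod_def)
  moreover have "euler_prod q q ~= 0"
  proof -
    have "q ^ m * q ~= 1" for m
    proof
      assume "q ^ m * q = 1"
      hence "norm q ^ Suc m = 1" by (metis mult.commute norm_one norm_power power_Suc)
      with q show False using power_less_one_iff[of "norm q" "Suc m"] by simp
    qed
    thus ?thesis by (simp add: euler_prod_eq_0_iff[OF q])
  qed
  ultimately show ?thesis by simp
qed

lemma holomorphic_g1: "g1 holomorphic_on {t. Im t > 0}"
  unfolding g1_def[abs_def] using dedekind_eta_nonzero
  by (intro holomorphic_intros holomorphic_dedekind_eta holomorphic_deriv)
     (auto intro!: open_Collect_less continuous_intros)

lemma Th_holomorphic:
  assumes "Im t > 0" shows "Th k t holomorphic_on S"
  by (rule holomorphic_on_subset[of _ UNIV])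
     (use Th_deriv_z[OF assms] in \<open>auto simp: holomorphic_on_open\<close>)

text \<open>Only the Fourier coefficient of index one is needed to see that the theta function does not vanish.\<close>
lemma Th0_not_identically_0:
  assumes "Im t > 0"
  shows "\<exists>z. Th 0 t z ~= 0"
proof (rule ccontr)
  assume "\<not> ?thesis"
  hence zero: "Th 0 t z = 0" for z by blast
  define E where "E = (\<lambda>(k::int) (x::real). exp (tpi * of_int k * of_real x) :: complex)"
  define c where "c = (\<lambda>m::nat. (-1) ^ m * exp (of_real pi * \<i> * t * (of_nat m + 1/2)\<^sup>2))"
  define f where "f = (\<lambda>n x. \<Sum>m<n. c m * (E (int m) x - E (- int m - 1) x))"
  have intE: "(E k has_integral (if k = 0 then 1 else 0)) {0..1}" for k
  proof (cases "k = 0")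
    case True
    thus ?thesis using has_integral_const_real[of "1::complex" 0 1] by (simp add: E_def)
  next
    case False
    define b where "b = tpi * of_int k"
    have b: "b ~= 0" using False by (simp add: b_def)
    have "((\<lambda>x. exp (b * of_real x)) has_integral exp (b * of_real 1) / b - exp (b * of_real 0) / b) {0..1}"
    proof (rule fundamental_theorem_of_calculus)
      fix x :: real
      have "DERIV (\<lambda>z. exp (b * z) / b) (of_real x) :> exp (b * of_real x)"
        using b by (auto intro!: derivative_eq_intros)
      thus "((\<lambda>x. exp (b * of_real x) / b) has_vector_derivative exp (b * of_real x)) (at x within {0..1})"
        by (rule has_vector_derivative_real_field)
    qed simp
    moreover have "exp b = 1" unfolding b_def by (auto simp: exp_eq_1)
    ultimately show ?thesis using False by (simp add: E_def b_def)
  qed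
  \<comment> \<open>Multiplication by exp(- pi i x) makes all frequencies integral, namely
    \<open>m\<close> and \<open>- m - 1\<close>; frequency 0 then occurs in the term
    \<open>m = 0\<close> only.\<close>
  have trm: "c m * (E (int m) x - E (- int m - 1) x) = \<i> * exp (- (of_real pi * \<i> * of_real x)) * theta_term 0 m t (of_real x)" for m x
  proof -
    have h: "exp (- (of_real pi * \<i> * of_real x)) * half_term s t (of_real x) m
        = c m * exp (of_real pi * \<i> * of_real x * (s * (2 * of_nat m + 1) - 1))" for s
      unfolding half_term_def c_def by (simp add: algebra_simps flip: exp_add)
    have "E (int m) x = exp (of_real pi * \<i> * of_real x * (1 * (2 * of_nat m + 1) - 1))"
      "E (- int m - 1) x = exp (of_real pi * \<i> * of_real x * ((-1) * (2 * of_nat m + 1) - 1))"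
      unfolding E_def by (intro arg_cong[where f=exp], simp add: algebra_simps)+
    hence "c m * (E (int m) x - E (- int m - 1) x) = exp (- (of_real pi * \<i> * of_real x)) * (half_term 1 t (of_real x) m - half_term (-1) t (of_real x) m)"
      by (simp only: right_diff_distrib h)
    thus ?thesis by (simp only: theta_term_half[symmetric] mult_ac)
  qed
  have "uniform_limit {0..1} (\<lambda>n x. \<Sum>m<n. c m * (E (int m) x - E (- int m - 1) x))
      (\<lambda>x. \<Sum>m. c m * (E (int m) x - E (- int m - 1) x)) sequentially"
    by (rule Weierstrass_m_test[OF _ summable_theta_bound[OF assms, of 0 0]])
       (auto simp: trm norm_mult intro: norm_theta_term_le)
  moreover have "(\<Sum>m. c m * (E (int m) x - E (- int m - 1) x)) = 0" for x
  proof -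
    have "summable (\<lambda>m. theta_term 0 m t (of_real x))"
      by (rule summable_comparison_test[OF _ summable_theta_bound[OF assms, of 0 0]])
         (intro exI[of _ 0] allI impI norm_theta_term_le, auto)
    thus ?thesis unfolding trm using zero by (simp add: suminf_mult Th_def)
  qed
  ultimately have ul: "uniform_limit {0..1} f (\<lambda>x. 0) sequentially" unfolding f_def by simp
  have cont: "continuous_on {0..1} (f n)" for n
    unfolding f_def E_def by (intro continuous_intros)
  obtain I J where IJ: "\<And>n. (f n has_integral I n) {0..1}" "((\<lambda>x::real. 0::complex) has_integral J) {0..1}" "I \<longlonglongrightarrow> J"
    using uniform_limit_integral[OF ul cont] by auto
  have J: "J = 0" using IJ(2) by simp
  \<comment> \<open>Integration over a period leaves the coefficient of frequency 0, which is
    \<open>c 0\<close> and would have to vanish.\<close>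
  have "(f n has_integral (\<Sum>m<n. c m * ((if int m = 0 then 1 else 0) - (if - int m - 1 = 0 then 1 else 0)))) {0..1}" for n
    unfolding f_def by (intro has_integral_sum has_integral_mult_right has_integral_diff intE) auto
  hence "I n = (\<Sum>m<n. c m * ((if int m = 0 then 1 else 0) - (if - int m - 1 = 0 then 1 else 0)))" for n
    using IJ(1) has_integral_unique by blast
  moreover have "(\<Sum>m<Suc n. c m * ((if int m = 0 then 1 else 0) - (if - int m - 1 = 0 then 1 else 0))) = c 0" for n
    by (subst sum.lessThan_Suc_shift) (simp)
  ultimately have I: "I (Suc n) = c 0" for n by simp
  have "(\<lambda>n. I (Suc n)) \<longlonglongrightarrow> 0" using IJ(3) J by (simp add: filterlim_sequentially_Suc)
  hence "c 0 = 0" unfolding I by (simp add: LIMSEQ_const_iff)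
  thus False by (simp add: c_def)
qed

text \<open>Up to a factor depending on \<open>t\<close> only, the product side of the Jacobi triple product.\<close>
definition theta_prod :: "complex => complex => complex" where
  "theta_prod t z = (let q = exp (tpi * t) in
     exp (- (of_real pi * \<i> * z)) * euler_prod q (exp (tpi * z))
       * euler_prod q (q * exp (- (tpi * z))))"

lemma theta_prod_1: "theta_prod t (z + 1) = - theta_prod t z"
proof -
  have 1: "exp (tpi * (z + 1)) = exp (tpi * z)"
    by (simp add: exp_add ring_distribs)
  have 2: "exp (- (tpi * (z + 1))) = exp (- (tpi * z))"
    using 1 by (simp only: exp_minus)
  have 3: "exp (- (of_real pi * \<i> * (z + 1))) = - exp (- (of_real pi * \<i> * z))"
  proof -
    have "exp (- (of_real pi * \<i> * (z + 1))) = exp (- (of_real pi * \<i> * z)) * exp (- (of_real pi * \<i>))"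
      by (simp add: algebra_simps flip: exp_add)
    also have "exp (- (of_real pi * \<i>)) = (-1 :: complex)" by (simp add: exp_minus)
    finally show ?thesis by simp
  qed
  show ?thesis unfolding theta_prod_def Let_def 1 2 3 by simp
qed

text \<open>With x = e^(2 pi i z), translation replaces the products at x and q/x by those at qx and
  1/x; the quotient (1 - 1/x) / (1 - x) = - 1/x supplies the multiplier.\<close>

lemma theta_prod_tau:
  assumes "Im t > 0"
  shows "theta_prod t (z + t) = - autf t z * theta_prod t z"
proof -
  define q x where "q = exp (tpi * t)" and "x = exp (tpi * z)"
  note q = norm_nome_less_1[OF assms, folded q_def]
  have x0: "x ~= 0" "q ~= 0" by (simp_all add: x_def q_def)
  have 1: "exp (tpi * (z + t)) = q * x"
    by (simp add: x_def q_def algebra_simps flip: exp_add)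
  have 2: "exp (- (tpi * z)) = 1 / x"
    by (simp add: x_def exp_minus inverse_eq_divide)
  have 3: "exp (- (tpi * (z + t))) = 1 / (q * x)"
    using 1 by (metis exp_minus inverse_eq_divide)
  have 4: "exp (- (of_real pi * \<i> * (z + t))) = exp (- (of_real pi * \<i> * t)) * exp (- (of_real pi * \<i> * z))"
    by (simp add: algebra_simps flip: exp_add)
  have 5: "autf t z = exp (- (of_real pi * \<i> * t)) / x"
    by (simp add: autf_def x_def exp_diff)
  have e: "euler_prod q x = (1 - x) * euler_prod q (q * x)"
    "euler_prod q (1 / x) = (1 - 1 / x) * euler_prod q (q * (1 / x))"
    by (rule euler_prod_step[OF q])+
  have "theta_prod t (z + t) = exp (- (of_real pi * \<i> * t)) * exp (- (of_real pi * \<i> * z)) * euler_prod q (q * x) * euler_prod q (1 / x)"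
    unfolding theta_prod_def Let_def q_def[symmetric] 1 3 4 using x0 by simp
  also have "... = - autf t z * (exp (- (of_real pi * \<i> * z)) * euler_prod q x * euler_prod q (q * (1 / x)))"
    unfolding e 5 using x0 by (simp add: field_simps)
  also have "... = - autf t z * theta_prod t z"
    unfolding theta_prod_def Let_def q_def[symmetric] x_def[symmetric] 2 by simp
  finally show ?thesis .
qed

lemma theta_prod_holomorphic:
  assumes "Im t > 0" shows "theta_prod t holomorphic_on S"
proof -
  define q where "q = exp (tpi * t)"
  have q: "norm q < 1" using norm_nome_less_1[OF assms] by (simp add: q_def)
  have *: "(\<lambda>z. euler_prod q (g z)) holomorphic_on S" if "g holomorphic_on S" for g
    using holomorphic_on_compose_gen[OF that holomorphic_euler_prod[OF q]] by (simp add: o_def)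
  show ?thesis unfolding theta_prod_def[abs_def] Let_def q_def[symmetric]
    by (intro holomorphic_intros *)
qed

text \<open>The two products vanish when q^m x = 1 and q^(m+1) = x respectively, that is at the
  lattice points with nonpositive and with positive coefficient of \<open>t\<close>.\<close>

lemma theta_prod_eq_0_iff:
  assumes "Im t > 0"
  shows "theta_prod t z = 0 \<longleftrightarrow> z \<in> lattice_of t"
proof -
  define q x where "q = exp (tpi * t)" and "x = exp (tpi * z)"
  note q = norm_nome_less_1[OF assms, folded q_def]
  have qm: "q ^ m = exp (tpi * (of_nat m * t))" for m
    unfolding q_def by (simp add: exp_of_nat_mult[symmetric] mult_ac)
  have e1: "exp (tpi * w) = 1 \<longleftrightarrow> (\<exists>k::int. w = of_int k)" for w
  proof -
    have "exp (tpi * w) = 1 \<longleftrightarrow> Im w = 0 \<and> (\<exists>n::int. Re w = of_int n)"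
      by (simp add: exp_eq_1)
    also have "... \<longleftrightarrow> (\<exists>k::int. w = of_int k)" by (auto simp: complex_eq_iff)
    finally show ?thesis .
  qed
  have "theta_prod t z = 0 \<longleftrightarrow> (\<exists>m. q ^ m * x = 1) \<or> (\<exists>m. q ^ m * (q * exp (- (tpi * z))) = 1)"
    unfolding theta_prod_def Let_def q_def[symmetric] x_def[symmetric]
    by (simp add: euler_prod_eq_0_iff[OF q])
  also have "... \<longleftrightarrow> (\<exists>m. q ^ m * x = 1) \<or> (\<exists>m. q ^ Suc m * exp (- (tpi * z)) = 1)"
    by (simp add: mult_ac)
  also have "... \<longleftrightarrow> (\<exists>m k. of_nat m * t + z = of_int k) \<or> (\<exists>m k. of_nat (Suc m) * t - z = of_int k)"
  proof -
    have "q ^ m * x = exp (tpi * (of_nat m * t + z))" for m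
      unfolding qm x_def by (simp add: ring_distribs flip: exp_add)
    moreover have "q ^ Suc m * exp (- (tpi * z)) = exp (tpi * (of_nat (Suc m) * t - z))" for m
      unfolding qm by (simp only: ring_distribs exp_add[symmetric]) (simp add: algebra_simps)
    ultimately show ?thesis by (simp only: e1)
  qed
  also have "... \<longleftrightarrow> z \<in> lattice_of t"
  proof
    assume "(\<exists>m k. of_nat m * t + z = of_int k) \<or> (\<exists>m k. of_nat (Suc m) * t - z = of_int k)"
    thus "z \<in> lattice_of t"
    proof
      assume "\<exists>m k. of_nat m * t + z = of_int k"
      then obtain m k where "of_nat m * t + z = of_int k" by blast
      hence "z = of_int k + of_int (- int m) * t" by (simp add: algebra_simps)
      thus ?thesis unfolding lattice_of_def by blast
    next
      assume "\<exists>m k. of_nat (Suc m) * t - z = of_int k"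
      then obtain m k where "of_nat (Suc m) * t - z = of_int k" by blast
      hence "z = of_int (- k) + of_int (int (Suc m)) * t" by (simp add: algebra_simps)
      thus ?thesis unfolding lattice_of_def by blast
    qed
  next
    assume "z \<in> lattice_of t"
    then obtain k l where z: "z = of_int k + of_int l * t" unfolding lattice_of_def by blast
    show "(\<exists>m k. of_nat m * t + z = of_int k) \<or> (\<exists>m k. of_nat (Suc m) * t - z = of_int k)"
    proof (cases "l \<le> 0")
      case True
      hence "of_nat (nat (- l)) * t + z = of_int k" by (simp add: z)
      thus ?thesis by blast
    next
      case False
      hence "of_nat (Suc (nat (l - 1))) * t - z = of_int (- k)" by (simp add: z of_nat_diff)
      thus ?thesis by blast
    qed
  qed
  finally show ?thesis .
qed

text \<open>Splitting off the factor 1 - e^(2 pi i z) leaves a function that is nonzero at the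
  origin, so the zero there is simple.\<close>

lemma theta_prod_deriv_0:
  assumes "Im t > 0"
  shows "\<exists>d. d ~= 0 \<and> DERIV (theta_prod t) 0 :> d"
proof -
  define q where "q = exp (tpi * t)"
  note q = norm_nome_less_1[OF assms, folded q_def]
  define G where "G = (\<lambda>z. exp (- (of_real pi * \<i> * z)) * euler_prod q (q * exp (tpi * z))
       * euler_prod q (q * exp (- (tpi * z))))"
  have eq: "theta_prod t = (\<lambda>z. (1 - exp (tpi * z)) * G z)"
    unfolding theta_prod_def Let_def q_def[symmetric] G_def by (subst (1) euler_prod_step[OF q]) (simp add: mult_ac)
  have *: "(\<lambda>z. euler_prod q (g z)) holomorphic_on UNIV" if "g holomorphic_on UNIV" for g
    using holomorphic_on_compose_gen[OF that holomorphic_euler_prod[OF q]] by (simp add: o_def)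
  have "G holomorphic_on UNIV" unfolding G_def by (intro holomorphic_intros *)
  then obtain G' where G': "DERIV G 0 :> G'"
    by (meson UNIV_I holomorphic_derivI open_UNIV)
  have "q ^ m * q ~= 1" for m
  proof
    assume "q ^ m * q = 1"
    hence "norm q ^ Suc m = 1" by (metis mult.commute norm_one norm_power power_Suc)
    with q show False using power_less_one_iff[of "norm q" "Suc m"] by simp
  qed
  hence "G 0 ~= 0" unfolding G_def by (simp add: euler_prod_eq_0_iff[OF q])
  moreover have "DERIV (theta_prod t) 0 :> - tpi * G 0"
    unfolding eq by (auto intro!: derivative_eq_intros G')
  ultimately show ?thesis by (intro exI[of _ "- tpi * G 0"]) auto
qed

lemma lattice_of_0 [simp]: "0 \<in> lattice_of t"
  unfolding lattice_of_def by (auto intro!: exI[of _ 0])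

lemma lattice_periodic:
  assumes "\<And>z. f (z + 1) = f z" "\<And>z. f (z + t) = f (z :: complex)" "v \<in> lattice_of t"
  shows "f (z + v) = f z"
proof -
  have per: "f (z + of_int k * p) = f z" if "\<And>z. f (z + p) = f z" for k z and p :: complex
  proof (induction k rule: int_induct[where k=0])
    case (step1 i)
    thus ?case using that[of "z + of_int i * p"] by (simp add: algebra_simps)
  next
    case (step2 i)
    thus ?case using that[of "z + of_int (i - 1) * p"] by (simp add: algebra_simps)
  qed simp
  obtain k l where "v = of_int k + of_int l * t" using assms(3) unfolding lattice_of_def by blast
  hence "f (z + v) = f ((z + of_int l * t) + of_int k * 1)" by (simp add: add_ac)
  also have "... = f z" by (simp only: per[OF assms(1)] per[OF assms(2)])
  finally show ?thesis .
qed

lemma eventually_nonzero_at: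
  assumes "f holomorphic_on UNIV" "\<exists>z. f z ~= 0"
  shows "eventually (\<lambda>w. f w ~= 0) (at z)"
  using non_zero_neighbour_alt[of f UNIV z] assms by (auto elim: eventually_mono)

lemma Th0_0 [simp]: "Im t > 0 ==> Th 0 t 0 = 0"
  using Th_minus[of t 0 0] by simp

lemma Th2_0 [simp]: "Im t > 0 ==> Th 2 t 0 = 0"
  using Th_minus[of t 2 0] by simp

text \<open>Both functions have the same multipliers under translation by 1 and \<open>t\<close>.
  The zeros of \<open>theta_prod\<close> are the lattice points, simple at the origin, where
  \<open>Th 0\<close> vanishes by oddness; so the quotient is elliptic without poles, hence
  constant. This locates the zeros of theta.\<close>

lemma Th0_eq_theta_prod:
  assumes "Im t > 0"
  shows "\<exists>c. c ~= 0 \<and> (\<forall>z. Th 0 t z = c * theta_prod t z)"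
proof -
  define f where "f = (\<lambda>z. Th 0 t z / theta_prod t z)"
  have f1: "f (z + 1) = f z" for z
    by (simp add: f_def Th_periodic_1[OF assms] theta_prod_1)
  have f2: "f (z + t) = f z" for z
    by (simp add: f_def Th0_periodic_tau[OF assms] theta_prod_tau[OF assms])
  obtain d where d: "d ~= 0" "DERIV (theta_prod t) 0 :> d"
    using theta_prod_deriv_0[OF assms] by blast
  have tp: "theta_prod t 0 = 0" using theta_prod_eq_0_iff[OF assms] by simp
  have lim0: "f \<midarrow>0\<rightarrow> Th 1 t 0 / d"
    unfolding f_def
    by (rule lhopital_complex_simple[OF Th_deriv_z[OF assms, of 0 0, unfolded One_nat_def[symmetric]] d(2)])
       (use assms tp d(1) in auto)
  have lim: "\<exists>l. f \<midarrow>z\<rightarrow> l" for z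
  proof (cases "z \<in> lattice_of t")
    case True
    have "f (w + z) = f w" for w by (rule lattice_periodic[OF f1 f2 True])
    hence "f (w + - z) = f w" for w using \<open>\<And>w. f (w + z) = f w\<close>[of "w + - z"] by simp
    hence "f \<midarrow>z\<rightarrow> Th 1 t 0 / d" using LIM_offset[OF lim0, of "- z"] by simp
    thus ?thesis by blast
  next
    case False
    hence "theta_prod t z ~= 0" by (simp add: theta_prod_eq_0_iff[OF assms])
    moreover have "isCont (Th 0 t) z" "isCont (theta_prod t) z"
      using Th_holomorphic[OF assms, of 0 UNIV] theta_prod_holomorphic[OF assms, of UNIV]
      by (auto dest!: holomorphic_on_imp_continuous_on simp: continuous_on_eq_continuous_at)
    ultimately have "isCont f z" unfolding f_def by (intro continuous_intros) auto
    thus ?thesis by (auto simp: isCont_def)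
  qed
  have tpne: "\<exists>z. theta_prod t z ~= 0"
  proof (rule ccontr)
    assume "\<not> ?thesis"
    hence "theta_prod t = (\<lambda>_. 0)" by auto
    hence "DERIV (theta_prod t) 0 :> 0" by simp
    with d show False using DERIV_unique by blast
  qed
  have ev: "eventually (\<lambda>w. theta_prod t w ~= 0) (at z)" for z
    by (rule eventually_nonzero_at[OF theta_prod_holomorphic[OF assms] tpne])
  have iso: "isolated_singularity_at f z" for z
  proof -
    obtain r where r: "r > 0" "\<And>w. w \<in> ball z r - {z} ==> theta_prod t w ~= 0"
      using ev[of z] unfolding eventually_at by (auto simp: dist_commute)
    have "f holomorphic_on ball z r - {z}"
      unfolding f_def using r by (intro holomorphic_intros Th_holomorphic theta_prod_holomorphic assms) auto
    thus ?thesis using r(1) unfolding isolated_singularity_at_def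
      by (auto simp: analytic_on_open open_delete)
  qed
  obtain c where c: "\<And>z. f \<midarrow>z\<rightarrow> c"
    using elliptic_const[OF iso lim assms] f1 f2 by auto
  have cont: "isCont (\<lambda>z. Th 0 t z - c * theta_prod t z) z" for z
    using Th_holomorphic[OF assms, of 0 UNIV] theta_prod_holomorphic[OF assms, of UNIV]
    by (auto dest!: holomorphic_on_imp_continuous_on simp: continuous_on_eq_continuous_at intro!: continuous_intros)
  have eq: "Th 0 t z = c * theta_prod t z" for z
  proof -
    have tpc: "theta_prod t \<midarrow>z\<rightarrow> theta_prod t z"
      using theta_prod_holomorphic[OF assms, of UNIV]
      by (auto dest!: holomorphic_on_imp_continuous_on simp: continuous_on_eq_continuous_at isCont_def)
    have "(\<lambda>w. f w * theta_prod t w) \<midarrow>z\<rightarrow> c * theta_prod t z"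
      by (intro tendsto_mult c tpc)
    hence "Th 0 t \<midarrow>z\<rightarrow> c * theta_prod t z"
      by (rule Lim_transform_eventually) (use ev[of z] in \<open>auto simp: f_def elim!: eventually_mono\<close>)
    moreover have "Th 0 t \<midarrow>z\<rightarrow> Th 0 t z"
      using Th_holomorphic[OF assms, of 0 UNIV]
      by (auto dest!: holomorphic_on_imp_continuous_on simp: continuous_on_eq_continuous_at isCont_def)
    ultimately show ?thesis by (rule LIM_unique[symmetric])
  qed
  moreover have "c ~= 0" using eq Th0_not_identically_0[OF assms] by auto
  ultimately show ?thesis by blast
qed

lemma Th0_eq_0_iff:
  assumes "Im t > 0"
  shows "Th 0 t z = 0 \<longleftrightarrow> z \<in> lattice_of t"
  using Th0_eq_theta_prod[OF assms] theta_prod_eq_0_iff[OF assms] by auto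

lemma Th1_0_nonzero:
  assumes "Im t > 0"
  shows "Th 1 t 0 ~= 0"
proof -
  obtain c where c: "c ~= 0" "\<And>z. Th 0 t z = c * theta_prod t z" using Th0_eq_theta_prod[OF assms] by blast
  obtain d where d: "d ~= 0" "DERIV (theta_prod t) 0 :> d"
    using theta_prod_deriv_0[OF assms] by blast
  have "DERIV (\<lambda>z. c * theta_prod t z) 0 :> c * d" by (rule DERIV_cmult[OF d(2)])
  hence "DERIV (Th 0 t) 0 :> c * d" unfolding c(2)[symmetric] .
  moreover have "DERIV (Th 0 t) 0 :> Th 1 t 0"
    using Th_deriv_z[OF assms, of 0 0] by simp
  ultimately have "c * d = Th 1 t 0" by (rule DERIV_unique)
  with c d show ?thesis by (metis mult_eq_0_iff)
qed

section \<open>The logarithmic derivative of the theta function\<close>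

definition psi :: "complex => complex => complex" where
  "psi t z = Th 1 t z / Th 0 t z"

text \<open>Here and below a digit after \<open>psi\<close> or \<open>hh\<close> counts derivatives
  in \<open>z\<close>. They are given in closed form through \<open>Th\<close>, so that derivatives
  in \<open>t\<close> can be read off as well.\<close>

definition psi1 :: "complex => complex => complex" where
  "psi1 t z = Th 2 t z / Th 0 t z - (psi t z)\<^sup>2"

text \<open>By the heat equation \<open>hh\<close> is \<open>2 \<pi> i\<close> times the logarithmic \<open>t\<close>-derivative of theta.\<close>
definition hh :: "complex => complex => complex" where
  "hh t z = Th 2 t z / (2 * Th 0 t z)"

definition hh1 :: "complex => complex => complex" where
  "hh1 t z = Th 3 t z / (2 * Th 0 t z) - hh t z * psi t z"

definition psi2 :: "complex => complex => complex" where
  "psi2 t z = 2 * hh1 t z - 2 * psi t z * psi1 t z"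

definition hh2 :: "complex => complex => complex" where
  "hh2 t z = Th 4 t z / (2 * Th 0 t z) - Th 3 t z * psi t z / (2 * Th 0 t z)
     - hh1 t z * psi t z - hh t z * psi1 t z"

lemma psi1_eq: "psi1 t z = 2 * hh t z - (psi t z)\<^sup>2"
  by (simp add: psi1_def hh_def)

context
  fixes t :: complex
  assumes tau: "Im t > 0"
begin

lemma Th_derivs:
  "DERIV (Th 0 t) z :> Th 1 t z"
  "DERIV (Th 1 t) z :> Th 2 t z"
  "DERIV (Th 2 t) z :> Th 3 t z"
  "DERIV (Th 3 t) z :> Th 4 t z"
  using Th_deriv_z[OF tau, of 0 z] Th_deriv_z[OF tau, of 1 z] Th_deriv_z[OF tau, of 2 z] Th_deriv_z[OF tau, of 3 z]
  by (simp_all add: eval_nat_numeral)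

lemma psi_deriv: "Th 0 t z ~= 0 ==> DERIV (psi t) z :> psi1 t z"
  unfolding psi_def[abs_def]
  by (rule DERIV_cong[OF DERIV_divide[OF Th_derivs(2) Th_derivs(1)]])
     (auto simp: psi1_def psi_def field_simps power2_eq_square)

lemma hh_deriv: "Th 0 t z ~= 0 ==> DERIV (hh t) z :> hh1 t z"
  unfolding hh_def[abs_def]
  by (rule DERIV_cong[OF DERIV_divide[OF Th_derivs(3) DERIV_cmult[OF Th_derivs(1)]]])
     (auto simp: hh1_def hh_def psi_def field_simps power2_eq_square)

lemma psi1_deriv: "Th 0 t z ~= 0 ==> DERIV (psi1 t) z :> psi2 t z"
  unfolding psi1_eq[abs_def]
  by (auto intro!: derivative_eq_intros hh_deriv psi_deriv simp: psi2_def)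

lemma hh1_deriv: "Th 0 t z ~= 0 ==> DERIV (hh1 t) z :> hh2 t z"
  unfolding hh1_def[abs_def]
  by (rule DERIV_cong[OF DERIV_diff[OF DERIV_divide[OF Th_derivs(4) DERIV_cmult[OF Th_derivs(1)]] DERIV_mult[OF hh_deriv psi_deriv]]])
     (auto simp: hh2_def psi_def field_simps power2_eq_square)

lemma psi_minus: "psi t (- z) = - psi t z"
  using Th_minus[OF tau, of 0 z] Th_minus[OF tau, of 1 z] by (simp add: psi_def)

lemma hh_minus: "hh t (- z) = hh t z"
  using Th_minus[OF tau, of 0 z] Th_minus[OF tau, of 2 z] by (simp add: hh_def)

lemma psi1_minus: "psi1 t (- z) = psi1 t z"
  by (simp add: psi1_eq psi_minus hh_minus)

lemma hh1_minus: "hh1 t (- z) = - hh1 t z"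
  using Th_minus[OF tau, of 0 z] Th_minus[OF tau, of 3 z] by (simp add: hh1_def hh_minus psi_minus)

lemma psi_1: "psi t (z + 1) = psi t z"
  by (simp add: psi_def Th_periodic_1[OF tau])

lemma hh_1: "hh t (z + 1) = hh t z"
  by (simp add: hh_def Th_periodic_1[OF tau])

lemma psi_tau: "Th 0 t z ~= 0 ==> psi t (z + t) = psi t z - 2 * of_real pi * \<i>"
  unfolding psi_def Th0_periodic_tau[OF tau] Th1_periodic_tau[OF tau] by (simp add: diff_divide_distrib right_diff_distrib)

lemma hh_tau: "Th 0 t z ~= 0 ==> hh t (z + t) = hh t z - 2 * of_real pi * \<i> * psi t z + tpi\<^sup>2 / 2"
  unfolding hh_def psi_def Th0_periodic_tau[OF tau] Th2_periodic_tau[OF tau]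
  by (simp add: diff_divide_distrib add_divide_distrib distrib_left right_diff_distrib)

lemma Th0_1_iff: "Th 0 t (z + 1) = 0 \<longleftrightarrow> Th 0 t z = 0"
  by (simp add: Th_periodic_1[OF tau])

lemma Th0_tau_iff: "Th 0 t (z + t) = 0 \<longleftrightarrow> Th 0 t z = 0"
  by (simp add: Th0_periodic_tau[OF tau])

lemma Th0_minus_iff: "Th 0 t (- z) = 0 \<longleftrightarrow> Th 0 t z = 0"
  using Th_minus[OF tau, of 0 z] by simp

lemma isCont_Th: "isCont (Th k t) z"
  using Th_deriv_z[OF tau] by (rule DERIV_isCont)

lemma ev_Th0: "eventually (\<lambda>w. Th 0 t w ~= 0) (at z)"
  by (rule eventually_nonzero_at[OF Th_holomorphic[OF tau] Th0_not_identically_0[OF tau]])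

lemma ev_Th0_shift: "eventually (\<lambda>w. Th 0 t (w + b) ~= 0) (at z)"
proof (rule eventually_nonzero_at)
  have "(\<lambda>w. Th 0 t (w + b)) holomorphic_on UNIV"
    using DERIV_shift_eq[OF Th_deriv_z[OF tau]] by (auto simp: holomorphic_on_open)
  thus "(\<lambda>w. Th 0 t (w + b)) holomorphic_on UNIV" .
  obtain z where "Th 0 t z ~= 0" using Th0_not_identically_0[OF tau] by blast
  thus "\<exists>z. Th 0 t (z + b) ~= 0" by (intro exI[of _ "z - b"]) simp
qed

lemma open_Th0_shift: "open {w. Th 0 t (w + b) ~= 0}"
proof -
  have "continuous_on UNIV (\<lambda>w. Th 0 t (w + b))"
    by (rule continuous_on_compose2[OF holomorphic_on_imp_continuous_on[OF Th_holomorphic[OF tau, of 0 UNIV]]])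
       (auto intro!: continuous_intros)
  thus ?thesis by (intro open_Collect_neq) auto
qed

lemma open_Th0: "open {w. Th 0 t w ~= 0}"
  using open_Th0_shift[of 0] by simp

end

lemma isolated_singularityI:
  assumes "eventually P (at z)" "\<And>w. P w ==> f field_differentiable (at w)"
  shows "isolated_singularity_at f z"
proof -
  obtain r where r: "r > 0" "\<And>w. w \<in> ball z r - {z} ==> P w"
    using assms(1) unfolding eventually_at by (auto simp: dist_commute)
  hence "f holomorphic_on ball z r - {z}"
    unfolding holomorphic_on_def using assms(2) field_differentiable_at_within by blast
  hence "f analytic_on ball z r - {z}"
    using analytic_on_open[OF open_delete[OF open_ball]] by blast
  with r(1) show ?thesis unfolding isolated_singularity_at_def by blast
qed

subsection \<open>The addition theorem\<close>

text \<open>Since 2 hh = psi1 + psi^2, twice the left side is the square of psi(a) + psi(b) - psi(a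
  + b) plus the values of psi1 at a, b and a + b: this is the Frobenius-Stickelberger identity. In
  \<open>a\<close> the quasi-periods cancel. At a = 0 the pole of psi(a) meets the zero of psi(b) -
  psi(a + b), and the reflection sending a to - a - b carries this to a = - b.\<close>

lemma addition_theorem_aux:
  assumes tau: "Im t > 0" and b: "Th 0 t b ~= 0"
  shows "\<exists>c. \<forall>a. Th 0 t a ~= 0 \<longrightarrow> Th 0 t (a + b) ~= 0 \<longrightarrow>
    hh t a + hh t b + hh t (a + b) + psi t a * psi t b - (psi t a + psi t b) * psi t (a + b) = c"
proof -
  define F where "F = (\<lambda>a. hh t a + hh t b + hh t (a + b) + psi t a * psi t b - (psi t a + psi t b) * psi t (a + b))"
  define P where "P = (\<lambda>a. Th 0 t a ~= 0 \<and> Th 0 t (a + b) ~= 0)"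
  \<comment> \<open>The value 0 at the excluded points makes periodicity and the reflection hold for
    every argument.\<close>
  define G where "G = (\<lambda>a. if P a then F a else 0)"
  note simps = Th0_1_iff[OF tau] Th0_tau_iff[OF tau] Th0_minus_iff[OF tau]
  have sh: "a + p + b = a + b + p" for a p by simp
  have evP: "eventually P (at z)" for z
    unfolding P_def by (intro eventually_conj ev_Th0[OF tau] ev_Th0_shift[OF tau])
  have openP: "open {a. P a}"
    unfolding P_def Collect_conj_eq by (intro open_Int open_Th0[OF tau] open_Th0_shift[OF tau])
  have diffF: "F field_differentiable (at a)" if "P a" for a
  proof -
    note d = hh_deriv[OF tau] psi_deriv[OF tau]
    have "\<exists>D. DERIV F a :> D"
      using that unfolding F_def P_def
      by (intro exI) (rule derivative_eq_intros d DERIV_shift_eq[OF d(1)] DERIV_shift_eq[OF d(2)] | assumption | simp)+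
    thus ?thesis by (simp add: field_differentiable_def)
  qed
  have diffG: "G field_differentiable (at a)" if "P a" for a
  proof -
    obtain D where "DERIV F a :> D" using diffF[OF \<open>P a\<close>] by (auto simp: field_differentiable_def)
    hence "DERIV G a :> D"
      by (rule has_field_derivative_transform_within_open[OF _ openP]) (use that in \<open>auto simp: G_def\<close>)
    thus ?thesis by (auto simp: field_differentiable_def)
  qed
  have per1: "G (a + 1) = G a" for a
    unfolding G_def P_def F_def sh[of a 1] by (simp add: simps psi_1[OF tau] hh_1[OF tau])
  have per2: "G (a + t) = G a" for a
    unfolding G_def P_def F_def sh[of a t]
    by (simp add: simps psi_tau[OF tau] hh_tau[OF tau]) (simp add: algebra_simps power2_eq_square)
  have refl: "G (- a - b) = G a" for a
  proof -
    have "- a - b = - (a + b)" "- a - b + b = - a" by simp_all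
    thus ?thesis unfolding G_def P_def F_def
      by (simp only: simps psi_minus[OF tau] hh_minus[OF tau]) (auto simp: algebra_simps)
  qed
  have "\<exists>l. F \<midarrow>0\<rightarrow> l"
  proof -
    have T1: "Th 1 t 0 ~= 0" by (rule Th1_0_nonzero[OF tau])
    have 1: "hh t \<midarrow>0\<rightarrow> Th 3 t 0 / (2 * Th 1 t 0)"
      unfolding hh_def[abs_def]
      by (rule lhopital_complex_simple[OF Th_derivs(3)[OF tau] DERIV_cmult[OF Th_derivs(1)[OF tau]]])
         (use tau T1 in auto)
    have contpsi: "isCont (psi t) b" "isCont (hh t) b" using b psi_deriv[OF tau] hh_deriv[OF tau] DERIV_isCont by blast+
    have 2: "(\<lambda>a. psi t (a + b)) \<midarrow>0\<rightarrow> psi t b" "(\<lambda>a. hh t (a + b)) \<midarrow>0\<rightarrow> hh t b"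
      using LIM_offset[of "psi t" _ b b] LIM_offset[of "hh t" _ b b] contpsi by (simp_all add: isCont_def)
    have 3: "(\<lambda>a. (psi t b - psi t (a + b)) / Th 0 t a) \<midarrow>0\<rightarrow> (- psi1 t b) / Th 1 t 0"
    proof (rule lhopital_complex_simple[OF _ Th_derivs(1)[OF tau]])
      show "DERIV (\<lambda>a. psi t b - psi t (a + b)) 0 :> - psi1 t b"
        using DERIV_diff[OF DERIV_const DERIV_shift_eq[of "psi t" _ 0 b], of "psi1 t b" "psi t b"] psi_deriv[OF tau b] by simp
    qed (use tau T1 in auto)
    have 4: "Th 1 t \<midarrow>0\<rightarrow> Th 1 t 0" using isCont_Th[OF tau] by (simp add: isCont_def)
    have "(\<lambda>a. hh t a + hh t b + hh t (a + b) + Th 1 t a * ((psi t b - psi t (a + b)) / Th 0 t a) - psi t b * psi t (a + b))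
       \<midarrow>0\<rightarrow> Th 3 t 0 / (2 * Th 1 t 0) + hh t b + hh t b + Th 1 t 0 * ((- psi1 t b) / Th 1 t 0) - psi t b * psi t b"
      by (intro tendsto_intros 1 2 3 4)
    moreover have "F = (\<lambda>a. hh t a + hh t b + hh t (a + b) + Th 1 t a * ((psi t b - psi t (a + b)) / Th 0 t a) - psi t b * psi t (a + b))"
      unfolding F_def psi_def[of t "_ :: complex"] by (rule ext) (simp add: algebra_simps diff_divide_distrib)
    ultimately show ?thesis by metis
  qed
  then obtain l where l: "F \<midarrow>0\<rightarrow> l" by blast
  have G0: "G \<midarrow>0\<rightarrow> l"
    by (rule Lim_transform_eventually[OF l]) (rule eventually_mono[OF evP], simp add: G_def)
  have GL: "G \<midarrow>z\<rightarrow> l" if "Th 0 t z = 0" for z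
  proof -
    have "z \<in> lattice_of t" using that Th0_eq_0_iff[OF tau] by simp
    hence "G (w + z) = G w" for w using lattice_periodic[OF per1 per2] by blast
    from this[of "_ - z"] have "G (w + - z) = G w" for w by simp
    thus ?thesis using LIM_offset[OF G0, of "- z"] by simp
  qed
  have lim: "\<exists>l. G \<midarrow>z\<rightarrow> l" for z
  proof -
    consider "P z" | "Th 0 t z = 0" | "Th 0 t (z + b) = 0" unfolding P_def by blast
    thus ?thesis
    proof cases
      case 1
      thus ?thesis using diffG field_differentiable_imp_continuous_at isCont_def by blast
    next
      case 2
      thus ?thesis using GL by blast
    next
      case 3
      hence "Th 0 t (- z - b) = 0" using Th0_minus_iff[OF tau, of "z + b"] by simp
      hence g: "G \<midarrow>- z - b\<rightarrow> l" by (rule GL)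
      have "filterlim (\<lambda>w. - w - b) (at (- z - b)) (at z)"
        unfolding filterlim_at by (auto intro!: tendsto_intros simp: eventually_at_filter)
      from filterlim_compose[OF g this] show ?thesis unfolding refl by blast
    qed
  qed
  obtain c where c: "\<And>z. G \<midarrow>z\<rightarrow> c"
    using elliptic_const[OF isolated_singularityI[OF evP diffG] lim tau] per1 per2 by auto
  have "F a = c" if "P a" for a
  proof -
    have "isCont G a" using diffG[OF that] by (rule field_differentiable_imp_continuous_at)
    hence "G \<midarrow>a\<rightarrow> G a" by (simp add: isCont_def)
    with c[of a] have "G a = c" by (rule LIM_unique[symmetric])
    with that show ?thesis by (simp add: G_def)
  qed
  thus ?thesis unfolding F_def P_def by blast
qed

text \<open>For fixed \<open>b\<close> the expression does not depend on \<open>a\<close>; as it is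
  symmetric, it does not depend on \<open>b\<close> either. The constants for two values of
  \<open>b\<close> are compared at an \<open>a\<close> that is admissible for both.\<close>

lemma addition_theorem:
  assumes tau: "Im t > 0"
  shows "\<exists>K. \<forall>a b. Th 0 t a ~= 0 \<longrightarrow> Th 0 t b ~= 0 \<longrightarrow> Th 0 t (a + b) ~= 0 \<longrightarrow>
    hh t a + hh t b + hh t (a + b) + psi t a * psi t b - (psi t a + psi t b) * psi t (a + b) = K"
proof -
  define F where "F = (\<lambda>a b. hh t a + hh t b + hh t (a + b) + psi t a * psi t b - (psi t a + psi t b) * psi t (a + b))"
  define c where "c = (\<lambda>b. SOME c. \<forall>a. Th 0 t a ~= 0 \<longrightarrow> Th 0 t (a + b) ~= 0 \<longrightarrow> F a b = c)"
  have c: "F a b = c b" if "Th 0 t a ~= 0" "Th 0 t b ~= 0" "Th 0 t (a + b) ~= 0" for a b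
    using someI_ex[OF addition_theorem_aux[OF tau that(2)]] that unfolding c_def F_def by blast
  have sym: "F a b = F b a" for a b unfolding F_def by (simp add: add_ac mult_ac)
  have "c b = c b'" if "Th 0 t b ~= 0" "Th 0 t b' ~= 0" for b b'
  proof -
    have "eventually (\<lambda>a. Th 0 t a ~= 0 \<and> Th 0 t (a + b) ~= 0 \<and> Th 0 t (a + b') ~= 0) (at 0)"
      by (intro eventually_conj ev_Th0[OF tau] ev_Th0_shift[OF tau])
    then obtain a where a: "Th 0 t a ~= 0" "Th 0 t (a + b) ~= 0" "Th 0 t (a + b') ~= 0"
      using eventually_happens'[OF at_neq_bot] by blast
    have "c b = F a b" "c b' = F a b'" using c a that by metis+
    moreover have "F b a = c a" "F b' a = c a" using c a that by (metis add.commute)+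
    ultimately show ?thesis using sym by metis
  qed
  moreover obtain b0 where "Th 0 t b0 ~= 0" using Th0_not_identically_0[OF tau] by blast
  ultimately have "\<forall>a b. Th 0 t a ~= 0 \<longrightarrow> Th 0 t b ~= 0 \<longrightarrow> Th 0 t (a + b) ~= 0 \<longrightarrow> F a b = c b0"
    using c by metis
  thus ?thesis unfolding F_def by blast
qed

text \<open>The constant of the addition theorem. Its existence suffices: it only occurs in terms
  that do not depend on the divisor point, and those are annihilated by
  \<open>EE_const\<close>.\<close>

definition fay_const :: "complex => complex" where
  "fay_const t = (SOME K. \<forall>a b. Th 0 t a ~= 0 \<longrightarrow> Th 0 t b ~= 0 \<longrightarrow> Th 0 t (a + b) ~= 0 \<longrightarrow>
    hh t a + hh t b + hh t (a + b) + psi t a * psi t b - (psi t a + psi t b) * psi t (a + b) = K)"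

context
  fixes t x y :: complex
  assumes tau: "Im t > 0"
    and nz: "Th 0 t x ~= 0" "Th 0 t y ~= 0" "Th 0 t (y - x) ~= 0"
begin

text \<open>The addition theorem at \<open>x\<close> and \<open>y - x\<close>. This form suits
  arguments p - a and q - a, because the coefficient psi(y - x) = psi(q - p) does not depend on
  a.\<close>

lemma fay:
  "psi t x * psi t y = psi t (y - x) * (psi t x - psi t y) + hh t x + hh t y + hh t (y - x) - fay_const t"
proof -
  have "hh t x + hh t (y - x) + hh t (x + (y - x)) + psi t x * psi t (y - x) - (psi t x + psi t (y - x)) * psi t (x + (y - x)) = fay_const t"
    using someI_ex[OF addition_theorem[OF tau], folded fay_const_def, rule_format, of x "y - x"] nz by simp
  thus ?thesis by (simp add: algebra_simps)
qed

end

text \<open>Differentiating \<open>fay\<close> in \<open>y\<close> removes the constant and the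
  terms in \<open>x\<close> alone.\<close>

lemma fay_deriv:
  assumes tau: "Im t > 0"
    and nz: "Th 0 t x ~= 0" "Th 0 t y ~= 0" "Th 0 t (y - x) ~= 0"
  shows "psi t x * psi1 t y = psi1 t (y - x) * (psi t x - psi t y) - psi t (y - x) * psi1 t y + hh1 t y + hh1 t (y - x)"
proof -
  let ?S = "{w. Th 0 t w ~= 0} \<inter> {w. Th 0 t (w + - x) ~= 0}"
  have S: "open ?S" "y \<in> ?S" using nz open_Th0[OF tau] open_Th0_shift[OF tau, of "- x"] by auto
  have nz': "Th 0 t (y + - x) ~= 0" using nz by simp
  note d = psi_deriv[OF tau nz(2)] hh_deriv[OF tau nz(2)] DERIV_shift_eq[OF psi_deriv[OF tau nz']] DERIV_shift_eq[OF hh_deriv[OF tau nz']]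
  have "DERIV (\<lambda>y. psi t x * psi t y) y :> psi t x * psi1 t y"
    by (rule DERIV_cmult[OF d(1)])
  moreover have "DERIV (\<lambda>y. psi t (y + - x) * (psi t x - psi t y) + hh t x + hh t y + hh t (y + - x) - fay_const t) y :> psi1 t (y + - x) * (psi t x - psi t y) - psi t (y + - x) * psi1 t y + hh1 t y + hh1 t (y + - x)"
    by (auto intro!: derivative_eq_intros d[simplified] simp: algebra_simps)
  hence "DERIV (\<lambda>y. psi t x * psi t y) y :> psi1 t (y + - x) * (psi t x - psi t y) - psi t (y + - x) * psi1 t y + hh1 t y + hh1 t (y + - x)"
    by (rule has_field_derivative_transform_within_open[OF _ S]) (use fay[OF tau nz(1)] in simp)
  ultimately show ?thesis using DERIV_unique by fastforce
qed

lemma fay_deriv2: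
  assumes tau: "Im t > 0"
    and nz: "Th 0 t x ~= 0" "Th 0 t y ~= 0" "Th 0 t (y - x) ~= 0"
  shows "psi t x * psi2 t y = psi2 t (y - x) * (psi t x - psi t y) - 2 * psi1 t (y - x) * psi1 t y
     - psi t (y - x) * psi2 t y + hh2 t y + hh2 t (y - x)"
proof -
  let ?S = "{w. Th 0 t w ~= 0} \<inter> {w. Th 0 t (w + - x) ~= 0}"
  have S: "open ?S" "y \<in> ?S" using nz open_Th0[OF tau] open_Th0_shift[OF tau, of "- x"] by auto
  have nz': "Th 0 t (y + - x) ~= 0" using nz by simp
  note d = psi_deriv[OF tau nz(2)] hh1_deriv[OF tau nz(2)] psi1_deriv[OF tau nz(2)] DERIV_shift_eq[OF psi_deriv[OF tau nz']]
    DERIV_shift_eq[OF hh1_deriv[OF tau nz']] DERIV_shift_eq[OF psi1_deriv[OF tau nz']]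
  have "DERIV (\<lambda>y. psi t x * psi1 t y) y :> psi t x * psi2 t y"
    by (rule DERIV_cmult[OF d(3)])
  moreover have "DERIV (\<lambda>y. psi1 t (y + - x) * (psi t x - psi t y) - psi t (y + - x) * psi1 t y + hh1 t y + hh1 t (y + - x)) y :> psi2 t (y + - x) * (psi t x - psi t y) - 2 * psi1 t (y + - x) * psi1 t y
     - psi t (y + - x) * psi2 t y + hh2 t y + hh2 t (y + - x)"
    by (auto intro!: derivative_eq_intros d[simplified] simp: algebra_simps)
  hence "DERIV (\<lambda>y. psi t x * psi1 t y) y :> psi2 t (y + - x) * (psi t x - psi t y) - 2 * psi1 t (y + - x) * psi1 t y
     - psi t (y + - x) * psi2 t y + hh2 t y + hh2 t (y + - x)"
    by (rule has_field_derivative_transform_within_open[OF _ S]) (use fay_deriv[OF tau nz(1)] in simp)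
  ultimately show ?thesis using DERIV_unique by fastforce
qed

text \<open>The second derivative of \<open>fay\<close> solved for psi(x) hh1(y): psi2 = 2 hh1 - 2
  psi psi1 splits the product, the first derivative replaces psi(x) psi1(y), and \<open>fay\<close>
  itself replaces the remaining psi(x) psi(y). The identity governs \<open>t\<close>-derivatives,
  because hh1 is 2 pi i times the \<open>t\<close>-derivative of psi.\<close>

lemma fay_hh1:
  assumes tau: "Im t > 0"
    and nz: "Th 0 t x ~= 0" "Th 0 t y ~= 0" "Th 0 t (y - x) ~= 0"
  shows "psi t x * hh1 t y = hh1 t (y - x) * psi t x - psi t (y - x) * hh1 t y + (hh2 t y / 2 + psi t y * hh1 t y)
     + psi1 t (y - x) * (hh t x - hh t y) + (hh2 t (y - x) / 2 + psi1 t (y - x) * (hh t (y - x) - fay_const t))"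
proof -
  define P Q s where "P = psi t x" and "Q = psi t y" and "s = psi t (y - x)"
  define Q1 s1 hP hQ hs where "Q1 = psi1 t y" and "s1 = psi1 t (y - x)" and "hP = hh t x" and "hQ = hh t y" and "hs = hh t (y - x)"
  define hQ1 hs1 hQ2 hs2 K where "hQ1 = hh1 t y" and "hs1 = hh1 t (y - x)" and "hQ2 = hh2 t y" and "hs2 = hh2 t (y - x)" and "K = fay_const t"
  have Q2: "psi2 t y = 2 * hQ1 - 2 * Q * Q1" "psi2 t (y - x) = 2 * hs1 - 2 * s * s1"
    by (simp_all add: psi2_def hQ1_def Q_def Q1_def hs1_def s_def s1_def)
  have q1: "Q1 = 2 * hQ - Q * Q" by (simp add: Q1_def hQ_def Q_def psi1_eq power2_eq_square)
  have f1: "P * Q = s * (P - Q) + hP + hQ + hs - K"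
    using fay[OF assms] by (simp add: P_def Q_def s_def hP_def hQ_def hs_def K_def)
  have f2: "P * Q1 = s1 * (P - Q) - s * Q1 + hQ1 + hs1"
    using fay_deriv[OF assms] by (simp add: P_def Q_def s_def Q1_def s1_def hQ1_def hs1_def)
  have f3: "P * (2 * hQ1 - 2 * Q * Q1) = (2 * hs1 - 2 * s * s1) * (P - Q) - 2 * s1 * Q1 - s * (2 * hQ1 - 2 * Q * Q1) + hQ2 + hs2"
    using fay_deriv2[OF assms] unfolding Q2 by (simp add: P_def Q_def s_def Q1_def s1_def hQ1_def hs1_def hQ2_def hs2_def)
  have "2 * (P * hQ1) = P * (2 * hQ1 - 2 * Q * Q1) + 2 * Q * (P * Q1)" by (simp add: algebra_simps)
  also have "... = (2 * hs1 - 2 * s * s1) * (P - Q) - 2 * s1 * Q1 - s * (2 * hQ1 - 2 * Q * Q1) + hQ2 + hs2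
      + 2 * Q * (s1 * (P - Q) - s * Q1 + hQ1 + hs1)" by (simp only: f2 f3)
  also have "... = 2 * s1 * (P * Q) + ((2 * hs1 - 2 * s * s1) * (P - Q) - 2 * s1 * Q1 - s * (2 * hQ1 - 2 * Q * Q1) + hQ2 + hs2
      + 2 * Q * (- s1 * Q - s * Q1 + hQ1 + hs1))" by (simp add: algebra_simps)
  also have "... = 2 * (hs1 * P - s * hQ1 + (hQ2 / 2 + Q * hQ1) + s1 * (hP - hQ) + (hs2 / 2 + s1 * (hs - K)))"
    unfolding f1 q1 by (simp add: field_simps)
  finally have "P * hQ1 = hs1 * P - s * hQ1 + (hQ2 / 2 + Q * hQ1) + s1 * (hP - hQ) + (hs2 / 2 + s1 * (hs - K))"
    unfolding mult_left_cancel[OF zero_neq_numeral[symmetric]] .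
  thus ?thesis
    unfolding P_def Q_def s_def Q1_def s1_def hQ1_def hs1_def hQ2_def hs2_def hP_def hQ_def hs_def K_def .
qed

subsection \<open>Dependence on parameters\<close>

context
  fixes f g W
  assumes fg: "holo_on f W" "holo_on g W" "\<And>x. x \<in> W ==> Im (f x) > 0" "\<And>x. x \<in> W ==> Th 0 (f x) (g x) ~= 0"
begin

lemma holo_on_psi [intro]: "holo_on (\<lambda>x. psi (f x) (g x)) W"
  unfolding psi_def by (intro holo_on_divide holo_on_Th fg)

lemma holo_on_hh [intro]: "holo_on (\<lambda>x. hh (f x) (g x)) W"
  unfolding hh_def by (intro holo_on_divide holo_on_Th holo_on_mult fg holo_on_const) (use fg in auto)

lemma holo_on_psi1 [intro]: "holo_on (\<lambda>x. psi1 (f x) (g x)) W"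
  unfolding psi1_eq by (intro holo_on_diff holo_on_mult holo_on_power holo_on_hh holo_on_psi fg holo_on_const)

lemma holo_on_hh1 [intro]: "holo_on (\<lambda>x. hh1 (f x) (g x)) W"
  unfolding hh1_def
  by (intro holo_on_diff holo_on_divide holo_on_Th holo_on_mult holo_on_hh holo_on_psi fg holo_on_const) (use fg in auto)

end

lemma psi_tau_algebra:
  fixes T0 T1 T2 T3 c f g :: complex
  assumes "T0 ~= 0"
  shows "((T3 / (4 * c * \<i>) * f + T2 * g) * T0 - T1 * (T2 / (4 * c * \<i>) * f + T1 * g)) / T0\<^sup>2
    = (T2 / T0 - (T1 / T0)\<^sup>2) * g + (T3 / (2 * T0) - T2 / (2 * T0) * (T1 / T0)) / (2 * c * \<i>) * f"
proof -
  define p u v where "p = T1 / T0" and "u = T2 / T0" and "v = T3 / T0"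
  have T: "T1 = p * T0" "T2 = u * T0" "T3 = v * T0" using assms by (simp_all add: p_def u_def v_def)
  define e where "e = 1 / (c * \<i>)"
  have e: "x / (4 * c * \<i>) = x * e / 4" "x / (2 * c * \<i>) = x * e / 2" for x by (simp_all add: e_def)
  show ?thesis unfolding T e using assms by (simp add: field_simps power2_eq_square)
qed

lemma hh_tau_algebra:
  fixes T0 T1 T2 T3 T4 c f g :: complex
  assumes "T0 ~= 0"
  shows "((T4 / (4 * c * \<i>) * f + T3 * g) * (2 * T0) - T2 * (2 * (T2 / (4 * c * \<i>) * f + T1 * g))) / (2 * T0)\<^sup>2
    = (T3 / (2 * T0) - T2 / (2 * T0) * (T1 / T0)) * g
     + ((T4 / (2 * T0) - T3 * (T1 / T0) / (2 * T0) - (T3 / (2 * T0) - T2 / (2 * T0) * (T1 / T0)) * (T1 / T0)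
          - T2 / (2 * T0) * (T2 / T0 - (T1 / T0)\<^sup>2)) / 2
        + T1 / T0 * (T3 / (2 * T0) - T2 / (2 * T0) * (T1 / T0))) / (2 * c * \<i>) * f"
proof -
  define p u v w where "p = T1 / T0" and "u = T2 / T0" and "v = T3 / T0" and "w = T4 / T0"
  have T: "T1 = p * T0" "T2 = u * T0" "T3 = v * T0" "T4 = w * T0" using assms by (simp_all add: p_def u_def v_def w_def)
  define e where "e = 1 / (c * \<i>)"
  have e: "x / (4 * c * \<i>) = x * e / 4" "x / (2 * c * \<i>) = x * e / 2" for x by (simp_all add: e_def)
  show ?thesis unfolding T e using assms by (simp add: field_simps power2_eq_square)
qed

text \<open>By the heat equation 2 pi i times the \<open>t\<close>-derivative of log theta is hh;
  one more derivative in \<open>z\<close> turns this into hh1 for psi.\<close>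

lemma pdiff_psi:
  assumes "holo_on f {x}" "holo_on g {x}" "Im (f x) > 0" "Th 0 (f x) (g x) ~= 0"
  shows "pdiff (\<lambda>x. psi (f x) (g x)) a x
    = psi1 (f x) (g x) * pdiff g a x + hh1 (f x) (g x) / tpi * pdiff f a x"
proof -
  have *: "holo_on (\<lambda>x. Th k (f x) (g x)) {x}" for k by (intro holo_on_Th assms) (use assms in auto)
  have "pdiff (\<lambda>x. psi (f x) (g x)) a x =
    ((Th 3 (f x) (g x) / (4 * of_real pi * \<i>) * pdiff f a x + Th 2 (f x) (g x) * pdiff g a x) * Th 0 (f x) (g x)
     - Th 1 (f x) (g x) * (Th 2 (f x) (g x) / (4 * of_real pi * \<i>) * pdiff f a x + Th 1 (f x) (g x) * pdiff g a x)) / (Th 0 (f x) (g x))\<^sup>2"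
    unfolding psi_def using assms
    by (subst pdiff_divide[OF * *]) (simp_all add: holo_Th_at(2) eval_nat_numeral)
  also have "... = psi1 (f x) (g x) * pdiff g a x + hh1 (f x) (g x) / tpi * pdiff f a x"
    unfolding psi1_def hh1_def hh_def psi_def by (rule psi_tau_algebra[OF assms(4)])
  finally show ?thesis .
qed

text \<open>The \<open>t\<close>-coefficient is what 2 hh = psi1 + psi^2 predicts when the
  \<open>t\<close>-derivatives of psi and psi1 are hh1 and hh2 over 2 pi i.\<close>

lemma pdiff_hh:
  assumes "holo_on f {x}" "holo_on g {x}" "Im (f x) > 0" "Th 0 (f x) (g x) ~= 0"
  shows "pdiff (\<lambda>x. hh (f x) (g x)) a x
    = hh1 (f x) (g x) * pdiff g a x
      + (hh2 (f x) (g x) / 2 + psi (f x) (g x) * hh1 (f x) (g x)) / tpi * pdiff f a x"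
proof -
  have *: "holo_on (\<lambda>x. Th k (f x) (g x)) {x}" for k by (intro holo_on_Th assms) (use assms in auto)
  have **: "holo_on (\<lambda>x. 2 * Th k (f x) (g x)) {x}" for k by (intro holo_on_mult * holo_on_const)
  have "pdiff (\<lambda>x. hh (f x) (g x)) a x =
    ((Th 4 (f x) (g x) / (4 * of_real pi * \<i>) * pdiff f a x + Th 3 (f x) (g x) * pdiff g a x) * (2 * Th 0 (f x) (g x))
     - Th 2 (f x) (g x) * (2 * (Th 2 (f x) (g x) / (4 * of_real pi * \<i>) * pdiff f a x + Th 1 (f x) (g x) * pdiff g a x))) / (2 * Th 0 (f x) (g x))\<^sup>2"
    unfolding hh_def using assms
    by (subst pdiff_divide[OF * **]) (simp_all add: holo_Th_at(2) pdiff_cmult[OF *] eval_nat_numeral)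
  also have "... = hh1 (f x) (g x) * pdiff g a x
      + (hh2 (f x) (g x) / 2 + psi (f x) (g x) * hh1 (f x) (g x)) / tpi * pdiff f a x"
    unfolding psi1_def hh2_def hh1_def hh_def psi_def by (rule hh_tau_algebra[OF assms(4)])
  finally show ?thesis .
qed

section \<open>The Weierstrass functions\<close>

lemma summable_on_int_powr:
  "(\<lambda>k::int. (1 + \<bar>real_of_int k\<bar>) powr (-3/2)) summable_on UNIV"
proof -
  let ?f = "\<lambda>k::int. (1 + \<bar>real_of_int k\<bar>) powr (-3/2)"
  have "summable (\<lambda>n. real (Suc n) powr (-3/2))"
    using summable_Suc_iff[of "\<lambda>n. real n powr (-3/2)"] summable_real_powr_iff[of "-3/2"] by simp
  hence nat: "(\<lambda>n::nat. real (Suc n) powr (-3/2)) summable_on UNIV"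
    by (subst summable_on_UNIV_nonneg_real_iff) auto
  have "?f summable_on range int"
    by (subst summable_on_reindex) (use nat in \<open>auto simp: o_def add.commute\<close>)
  moreover have "?f summable_on range (\<lambda>n. - int n)"
    by (subst summable_on_reindex) (use nat in \<open>auto simp: o_def add.commute inj_on_def\<close>)
  hence "?f summable_on range (\<lambda>n. - int n) - range int"
    by (rule summable_on_subset_banach) auto
  ultimately have "?f summable_on (range int \<union> (range (\<lambda>n. - int n) - range int))"
    by (intro summable_on_Un_disjoint) auto
  moreover have "range int \<union> (range (\<lambda>n. - int n) - range int) = UNIV"
    by (auto simp: image_iff) (metis int_cases2)
  ultimately show ?thesis by simp
qed

text \<open>Im(k + l t) = l Im t bounds |l|, and then |k| \<le> |k + l t| + |l| |t|; the constant is
  large enough for both bounds.\<close>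

definition lat_bd :: "complex => real" where
  "lat_bd t = 1 + (1 + norm t) / Im t"

lemma lattice_coeff_bound:
  assumes "Im t > 0"
  shows "\<bar>real_of_int k\<bar> \<le> lat_bd t * norm (of_int k + of_int l * t)"
    "\<bar>real_of_int l\<bar> \<le> lat_bd t * norm (of_int k + of_int l * t)"
proof -
  let ?w = "of_int k + of_int l * t"
  have "\<bar>real_of_int l\<bar> * Im t \<le> norm ?w"
    using abs_Im_le_cmod[of ?w] assms by (simp add: abs_mult)
  hence l: "\<bar>real_of_int l\<bar> \<le> norm ?w / Im t" using assms by (simp add: field_simps)
  have "norm (of_int k :: complex) \<le> norm ?w + norm (of_int l * t)"
    using norm_triangle_ineq4[of ?w "of_int l * t"] by simp
  hence "\<bar>real_of_int k\<bar> \<le> norm ?w + \<bar>real_of_int l\<bar> * norm t" by (simp add: norm_mult)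
  also have "... \<le> norm ?w + norm ?w / Im t * norm t" using l by (intro add_left_mono mult_right_mono) auto
  also have "... \<le> lat_bd t * norm ?w" using assms by (simp add: lat_bd_def field_simps)
  finally show "\<bar>real_of_int k\<bar> \<le> lat_bd t * norm ?w" .
  have "norm ?w / Im t \<le> lat_bd t * norm ?w" using assms by (simp add: lat_bd_def field_simps)
  with l show "\<bar>real_of_int l\<bar> \<le> lat_bd t * norm ?w" by linarith
qed

lemma lat_bd_pos: "Im t > 0 ==> lat_bd t > 0"
  by (simp add: lat_bd_def add_pos_nonneg)

lemma lattice_norm_bound:
  assumes "Im t > 0" "v \<in> lattice_of t - {0}"
  shows "1 \<le> lat_bd t * norm v"
proof -
  obtain k l where w: "v = of_int k + of_int l * t" using assms(2) unfolding lattice_of_def by blast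
  have "k ~= 0 \<or> l ~= 0" using assms(2) w by auto
  hence "1 \<le> \<bar>real_of_int k\<bar> \<or> 1 \<le> \<bar>real_of_int l\<bar>"
    by linarith
  thus ?thesis using lattice_coeff_bound[OF assms(1), where k=k and l=l] w by fastforce
qed

text \<open>Both 1 + |k| and 1 + |l| are at most a multiple of the norm of the lattice point, so its
  inverse cube is dominated by the product of (1 + |k|)^(-3/2) and (1 + |l|)^(-3/2), two separately
  summable families.\<close>

lemma summable_lattice:
  assumes "Im t > 0"
  shows "(\<lambda>v. 1 / norm v ^ 3) summable_on (lattice_of t - {0})"
proof -
  let ?h = "\<lambda>(k, l). of_int k + of_int l * t"
  let ?X = "UNIV - {(0::int, 0::int)}"
  let ?g = "\<lambda>(k::int, l::int). (1 + \<bar>real_of_int k\<bar>) powr (-3/2) * (1 + \<bar>real_of_int l\<bar>) powr (-3/2)"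
  have inj: "inj ?h"
  proof (rule injI, clarify)
    fix k l k' l' assume "of_int k + of_int l * t = of_int k' + of_int l' * t"
    hence e: "of_int (k - k') + of_int (l - l') * t = 0" by (simp add: algebra_simps)
    from lattice_coeff_bound[OF assms, where k = "k - k'" and l = "l - l'"] show "k = k' \<and> l = l'"
      unfolding e by simp
  qed
  have img: "?h ` ?X = lattice_of t - {0}"
  proof -
    have "range ?h = lattice_of t" by (auto simp: lattice_of_def image_iff)
    moreover have "?h ` ?X = range ?h - ?h ` {(0, 0)}" using inj by (intro image_set_diff)
    ultimately show ?thesis by simp
  qed
  let ?c = "\<lambda>k::int. (1 + \<bar>real_of_int k\<bar>) powr (-3/2)"
  have "?g summable_on UNIV \<times> UNIV"
  proof (rule summable_on_SigmaI)
    fix k :: int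
    show "((\<lambda>l. ?g (k, l)) has_sum (?c k * infsum ?c UNIV)) UNIV"
      using has_sum_cmult_right[OF has_sum_infsum[OF summable_on_int_powr], of "?c k"] by simp
  next
    show "(\<lambda>k. ?c k * infsum ?c UNIV) summable_on UNIV"
      by (rule summable_on_cmult_left[OF summable_on_int_powr])
  qed auto
  hence "?g summable_on ?X" by (rule summable_on_subset_banach) auto
  hence "(\<lambda>x. (2 * lat_bd t) ^ 3 * ?g x) summable_on ?X" by (rule summable_on_cmult_right)
  hence "((\<lambda>v. 1 / norm v ^ 3) \<circ> ?h) summable_on ?X"
  proof (rule summable_on_comparison_test)
    fix x assume "x \<in> ?X"
    then obtain k l where x: "x = (k, l)" "(k, l) ~= (0, 0)" by (cases x) auto
    define w where "w = of_int k + of_int l * t"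
    define N where "N = lat_bd t * norm w"
    have "?h (k, l) \<in> ?h ` ?X" by (rule imageI) (use x(2) in simp)
    hence "w \<in> lattice_of t - {0}" unfolding img by (simp add: w_def)
    hence N1: "1 \<le> N" unfolding N_def by (rule lattice_norm_bound[OF assms])
    have kl: "1 + \<bar>real_of_int k\<bar> \<le> 2 * N" "1 + \<bar>real_of_int l\<bar> \<le> 2 * N"
      using lattice_coeff_bound[OF assms, where k=k and l=l] N1 unfolding N_def w_def by auto
    have "(2 * N) powr (-3) = (2 * N) powr (-3/2) * (2 * N) powr (-3/2)"
      by (simp flip: powr_add)
    also have "... \<le> ?c k * ?c l"
      using kl N1 by (intro mult_mono powr_mono2') auto
    finally have "(2 * N) powr (-3) \<le> ?g x" by (simp add: x)
    moreover have "(2 * N) powr (-3) = 1 / (2 * N) ^ 3"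
      by (rule powr_neg_numeral) (use N1 in simp)
    moreover have "1 / norm w ^ 3 = (2 * lat_bd t) ^ 3 * (1 / (2 * N) ^ 3)"
      using lat_bd_pos[OF assms] by (simp add: N_def field_simps)
    ultimately have "1 / norm w ^ 3 \<le> (2 * lat_bd t) ^ 3 * ?g x"
      using lat_bd_pos[OF assms] mult_left_mono[of "1 / (2 * N) ^ 3" "?g x" "(2 * lat_bd t) ^ 3"] by simp
    thus "((\<lambda>v. 1 / norm v ^ 3) \<circ> ?h) x \<le> (2 * lat_bd t) ^ 3 * ?g x"
      by (simp add: x w_def)
  qed auto
  thus ?thesis
    using summable_on_reindex[of ?h ?X "\<lambda>v. 1 / norm v ^ 3"] inj_on_subset[OF inj] img by auto
qed

text \<open>Weierstrass' theorem for the net of finite subsums: a bound on the terms is enough,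
  because uniform limits of holomorphic functions may be differentiated.\<close>

lemma has_field_derivative_infsum:
  fixes f :: "'a => complex => complex"
  assumes "d > 0" "\<And>v z. v \<in> X ==> z \<in> cball z0 d ==> DERIV (f v) z :> f' v z"
    and "\<And>v z. v \<in> X ==> z \<in> cball z0 d ==> norm (f v z) \<le> M v" "M summable_on X"
  shows "DERIV (\<lambda>z. \<Sum>\<^sub>\<infinity>v\<in>X. f v z) z0 :> (\<Sum>\<^sub>\<infinity>v\<in>X. f' v z0)"
proof -
  have ul: "uniform_limit (cball z0 d) (\<lambda>Y z. \<Sum>v\<in>Y. f v z) (\<lambda>z. \<Sum>\<^sub>\<infinity>v\<in>X. f v z) (finite_subsets_at_top X)"
    by (rule Weierstrass_m_test_general[OF assms(3,4)])
  have ev: "eventually (\<lambda>Y. continuous_on (cball z0 d) (\<lambda>z. \<Sum>v\<in>Y. f v z) \<and>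
      (\<forall>w\<in>ball z0 d. DERIV (\<lambda>z. \<Sum>v\<in>Y. f v z) w :> (\<Sum>v\<in>Y. f' v w))) (finite_subsets_at_top X)"
  proof (rule eventually_finite_subsets_at_top_weakI)
    fix Y assume Y: "finite Y" "Y \<subseteq> X"
    have D: "DERIV (\<lambda>z. \<Sum>v\<in>Y. f v z) w :> (\<Sum>v\<in>Y. f' v w)" if "w \<in> cball z0 d" for w
      using Y that by (intro DERIV_sum assms(2)) auto
    hence "continuous_on (cball z0 d) (\<lambda>z. \<Sum>v\<in>Y. f v z)"
      by (meson DERIV_isCont continuous_at_imp_continuous_on)
    with D show "continuous_on (cball z0 d) (\<lambda>z. \<Sum>v\<in>Y. f v z) \<and>
      (\<forall>w\<in>ball z0 d. DERIV (\<lambda>z. \<Sum>v\<in>Y. f v z) w :> (\<Sum>v\<in>Y. f' v w))" by auto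
  qed
  obtain g' where g': "\<And>w. w \<in> ball z0 d ==> DERIV (\<lambda>z. \<Sum>\<^sub>\<infinity>v\<in>X. f v z) w :> g' w
     \<and> ((\<lambda>Y. \<Sum>v\<in>Y. f' v w) \<longlongrightarrow> g' w) (finite_subsets_at_top X)"
    using has_complex_derivative_uniform_limit[OF ev ul finite_subsets_at_top_neq_bot assms(1)] by metis
  have z0: "z0 \<in> ball z0 d" using assms(1) by simp
  have "((\<lambda>v. f' v z0) has_sum g' z0) X" using g'[OF z0] by (simp add: has_sum_def)
  hence "(\<Sum>\<^sub>\<infinity>v\<in>X. f' v z0) = g' z0" by (rule infsumI)
  with g'[OF z0] show ?thesis by simp
qed

lemma DERIV_inverse_power_diff:
  fixes w :: complex
  assumes "w ~= a"
  shows "DERIV (\<lambda>z. 1 / (z - a) ^ n) w :> - of_nat n / (w - a) ^ Suc n"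
proof -
  have nz: "w - a ~= 0" using assms by simp
  have "((\<lambda>z. inverse ((z - a) ^ n)) has_field_derivative
      - (inverse ((w - a) ^ n) * (of_nat n * (w - a) ^ (n - 1)) * inverse ((w - a) ^ n))) (at w)"
    using nz by (auto intro!: derivative_eq_intros)
  moreover have "- (inverse ((w - a) ^ n) * (of_nat n * (w - a) ^ (n - 1)) * inverse ((w - a) ^ n)) = - of_nat n / (w - a) ^ Suc n"
  proof (cases n)
    case (Suc m)
    have "- (inverse (x ^ Suc m) * (of_nat (Suc m) * x ^ m) * inverse (x ^ Suc m)) = - of_nat (Suc m) / x ^ Suc (Suc m)"
      if "x ~= 0" for x :: complex using that by (simp add: field_simps)
    from this[OF nz] show ?thesis by (simp add: Suc)
  qed simp
  ultimately show ?thesis by (simp add: inverse_eq_divide)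
qed

context
  fixes t :: complex
  assumes tau: "Im t > 0"
begin

lemma lattice_minus_iff: "- v \<in> lattice_of t \<longleftrightarrow> v \<in> lattice_of t"
proof -
  have "- v \<in> lattice_of t" if "v \<in> lattice_of t" for v
  proof -
    from that obtain k l where "v = of_int k + of_int l * t" unfolding lattice_of_def by blast
    hence "- v = of_int (- k) + of_int (- l) * t" by simp
    thus ?thesis unfolding lattice_of_def by blast
  qed
  from this[of v] this[of "- v"] show ?thesis by auto
qed

lemma lattice_add_iff: "p \<in> {1, t} ==> v + p \<in> lattice_of t \<longleftrightarrow> v \<in> lattice_of t"
  using Th0_eq_0_iff[OF tau] Th0_1_iff[OF tau] Th0_tau_iff[OF tau] by auto

definition reg_pt :: "complex => bool" where
  "reg_pt z \<longleftrightarrow> z \<notin> lattice_of t - {0}"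

lemma reg_pt_ball:
  assumes "reg_pt z"
  obtains d where "d > 0" "\<And>w v. w \<in> cball z d ==> v \<in> lattice_of t - {0} ==> norm (w - v) \<ge> d"
proof -
  obtain r where r: "r > 0" "\<And>w. w ~= z ==> dist w z < r ==> Th 0 t w ~= 0"
    using ev_Th0[OF tau, of z] unfolding eventually_at by auto
  have far: "dist v z \<ge> r" if "v \<in> lattice_of t - {0}" for v
    using r(2)[of v] that assms Th0_eq_0_iff[OF tau] unfolding reg_pt_def by (cases "v = z") force+
  show ?thesis
  proof
    show "r / 2 > 0" using r by simp
    fix w v assume w: "w \<in> cball z (r / 2)" and "v \<in> lattice_of t - {0}"
    hence "r \<le> dist v z" using far by blast
    also have "... \<le> dist v w + dist w z" by (rule dist_triangle)
    also have "... \<le> dist v w + r / 2" using w by (simp add: dist_commute)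
    finally show "norm (w - v) \<ge> r / 2" by (simp add: dist_norm norm_minus_commute)
  qed
qed

abbreviation (input) lat_dom :: "real => complex => complex => bool" where
  "lat_dom C w v \<equiv> w ~= v \<and> v ~= 0 \<and>
       norm (1 / (w - v) + 1 / v + w / v\<^sup>2) \<le> C * (1 / norm v ^ 3) \<and>
       norm (1 / (w - v)\<^sup>2 - 1 / v\<^sup>2) \<le> C * (1 / norm v ^ 3) \<and>
       norm (1 / (w - v) ^ 3) \<le> C * (1 / norm v ^ 3)"

text \<open>The correction terms of the Weierstrass series cancel the slowly decaying parts: the
  combined summands are w^2 / ((w - v) v^2) and w (2 v - w) / ((w - v)^2 v^2), both of order
  |v|^(-3) uniformly near \<open>z\<close>.\<close>

lemma lattice_terms_bound:
  assumes "reg_pt z"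
  obtains d C where "d > 0" "C > 0"
    "\<And>w v. w \<in> cball z d ==> v \<in> lattice_of t - {0} ==> lat_dom C w v"
proof -
  obtain d where d: "d > 0" "\<And>w v. w \<in> cball z d ==> v \<in> lattice_of t - {0} ==> norm (w - v) \<ge> d"
    using reg_pt_ball[OF assms] by blast
  define R where "R = norm z + d"
  \<comment> \<open>From |w| \<le> R and |w - v| \<ge> d follows |v| \<le> B |w - v|, which trades
    |w - v| for |v| in the denominators.\<close>
  define B where "B = 1 + R / d"
  define L where "L = lat_bd t"
  have R: "R > 0" "norm w \<le> R" if "w \<in> cball z d" for w
    using that d(1) norm_triangle_ineq[of z "w - z"] by (auto simp: R_def dist_norm norm_minus_commute add_nonneg_pos)
  have R0: "R > 0" using d(1) by (simp add: R_def add_nonneg_pos)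
  have B: "B \<ge> 1" using R0 d(1) by (simp add: B_def)
  have L: "L > 0" unfolding L_def by (rule lat_bd_pos[OF tau])
  define C where "C = B * R\<^sup>2 + (2 + R * L) * R * B\<^sup>2 + B ^ 3"
  have Cs: "C \<ge> B * R\<^sup>2" "C \<ge> (2 + R * L) * R * B\<^sup>2" "C \<ge> B ^ 3" "C > 0"
    using B R0 L by (auto simp: C_def intro!: add_nonneg_nonneg add_nonneg_pos)
  show ?thesis
  proof (rule that[OF d(1) Cs(4)])
    fix w v assume w: "w \<in> cball z d" and om: "v \<in> lattice_of t - {0}"
    define a b where "a = norm (w - v)" and "b = norm v"
    have b1: "1 \<le> L * b" unfolding L_def b_def by (rule lattice_norm_bound[OF tau om])
    have ad: "a \<ge> d" unfolding a_def by (rule d(2)[OF w om])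
    have a0: "a > 0" using ad d(1) by linarith
    have b0: "b > 0" using om by (simp add: b_def)
    have wR: "norm w \<le> R" using R(2)[OF w] .
    have "b \<le> a + norm w" unfolding a_def b_def using norm_triangle_ineq4[of w "w - v"] by simp
    also have "... \<le> a + R / d * a"
    proof -
      have "R / d * d \<le> R / d * a" using ad R0 d(1) by (intro mult_left_mono) auto
      thus ?thesis using wR d(1) by simp
    qed
    finally have bB: "b \<le> B * a" by (simp add: B_def algebra_simps)
    hence ia: "1 / a \<le> B / b" using a0 b0 by (simp add: field_simps)
    have ne: "w ~= v" "v ~= 0" using a0 b0 by (auto simp: a_def b_def)
    have e1: "1 / (w - v) + 1 / v + w / v\<^sup>2 = w\<^sup>2 / ((w - v) * v\<^sup>2)"
      using ne by (simp add: field_simps power2_eq_square)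
    have e2: "1 / (w - v)\<^sup>2 - 1 / v\<^sup>2 = w * (2 * v - w) / ((w - v)\<^sup>2 * v\<^sup>2)"
    proof -
      have "1 / (w - v)\<^sup>2 - 1 / v\<^sup>2 = (1 * v\<^sup>2 - 1 * (w - v)\<^sup>2) / ((w - v)\<^sup>2 * v\<^sup>2)"
        using ne by (intro diff_frac_eq) auto
      also have "1 * v\<^sup>2 - 1 * (w - v)\<^sup>2 = w * (2 * v - w)" by (simp add: power2_eq_square algebra_simps)
      finally show ?thesis .
    qed
    have "norm (w\<^sup>2 / ((w - v) * v\<^sup>2)) = (norm w)\<^sup>2 * (1 / a) * (1 / b\<^sup>2)"
      by (simp add: norm_divide norm_mult norm_power a_def b_def)
    also have "... \<le> R\<^sup>2 * (B / b) * (1 / b\<^sup>2)"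
      using wR ia a0 b0 R0 B by (intro mult_mono power_mono) auto
    also have "... = B * R\<^sup>2 * (1 / b ^ 3)" by (simp add: power2_eq_square power3_eq_cube mult_ac)
    also have "... \<le> C * (1 / b ^ 3)" using Cs(1) b0 by (intro mult_right_mono) auto
    finally have 1: "norm (1 / (w - v) + 1 / v + w / v\<^sup>2) \<le> C * (1 / b ^ 3)" unfolding e1 .
    have n2: "norm (2 * v - w) \<le> (2 + R * L) * b"
    proof -
      have "norm (2 * v - w) \<le> 2 * b + norm w" using norm_triangle_ineq4[of "2 * v" w] by (simp add: b_def norm_mult)
      also have "norm w \<le> R * (L * b)"
      proof -
        have "R * 1 \<le> R * (L * b)" using b1 R0 by (intro mult_left_mono) auto
        with wR show ?thesis by simp
      qed
      finally show ?thesis by (simp add: algebra_simps)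
    qed
    have "norm (w * (2 * v - w) / ((w - v)\<^sup>2 * v\<^sup>2)) = norm w * norm (2 * v - w) * (1 / a)\<^sup>2 * (1 / b\<^sup>2)"
      by (simp add: norm_divide norm_mult norm_power a_def b_def power_one_over)
    also have "... \<le> R * ((2 + R * L) * b) * (B / b)\<^sup>2 * (1 / b\<^sup>2)"
      using wR n2 ia a0 b0 R0 L by (intro mult_mono power_mono) auto
    also have "... = (2 + R * L) * R * B\<^sup>2 * (1 / b ^ 3)" using b0 by (simp add: field_simps power2_eq_square power3_eq_cube)
    also have "... \<le> C * (1 / b ^ 3)" using Cs(2) b0 by (intro mult_right_mono) auto
    finally have 2: "norm (1 / (w - v)\<^sup>2 - 1 / v\<^sup>2) \<le> C * (1 / b ^ 3)" unfolding e2 .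
    have "norm (1 / (w - v) ^ 3) = (1 / a) ^ 3" by (simp add: norm_divide norm_power a_def power_one_over)
    also have "... \<le> (B / b) ^ 3" using ia a0 by (intro power_mono) auto
    also have "... = B ^ 3 * (1 / b ^ 3)" by (simp add: power_divide)
    also have "... \<le> C * (1 / b ^ 3)" using Cs(3) b0 by (intro mult_right_mono) auto
    finally have 3: "norm (1 / (w - v) ^ 3) \<le> C * (1 / b ^ 3)" .
    show "lat_dom C w v"
      using 1 2 3 ne unfolding b_def by blast
  qed
qed

text \<open>\<open>zeta0\<close> and \<open>wp0\<close> are the Weierstrass zeta and wp functions,
  and \<open>wp1\<close> is minus half the derivative of wp, each with the summand of the lattice
  point 0 left out.\<close>

definition zeta0 :: "complex => complex" where
  "zeta0 z = (\<Sum>\<^sub>\<infinity>v\<in>lattice_of t - {0}. 1 / (z - v) + 1 / v + z / v\<^sup>2)"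

definition wp0 :: "complex => complex" where
  "wp0 z = (\<Sum>\<^sub>\<infinity>v\<in>lattice_of t - {0}. 1 / (z - v)\<^sup>2 - 1 / v\<^sup>2)"

definition wp1 :: "complex => complex" where
  "wp1 z = (\<Sum>\<^sub>\<infinity>v\<in>lattice_of t - {0}. 1 / (z - v) ^ 3)"

lemma zeta0_deriv:
  assumes "reg_pt z" shows "DERIV zeta0 z :> - wp0 z"
proof -
  obtain d C where dC: "d > 0" "C > 0" "\<And>w v. w \<in> cball z d ==> v \<in> lattice_of t - {0} ==> lat_dom C w v"
    using lattice_terms_bound[OF assms] by blast
  have "DERIV zeta0 z :> (\<Sum>\<^sub>\<infinity>v\<in>lattice_of t - {0}. - (1 / (z - v)\<^sup>2 - 1 / v\<^sup>2))"
    unfolding zeta0_def[abs_def]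
  proof (rule has_field_derivative_infsum[OF dC(1) _ _ summable_on_cmult_right[OF summable_lattice[OF tau]]])
    fix v w assume *: "v \<in> lattice_of t - {0}" "w \<in> cball z d"
    hence "w - v ~= 0" "v ~= 0" using dC(3) by auto
    thus "DERIV (\<lambda>z. 1 / (z - v) + 1 / v + z / v\<^sup>2) w :> - (1 / (w - v)\<^sup>2 - 1 / v\<^sup>2)"
      using DERIV_inverse_power_diff[of w v 1]
      by (auto intro!: derivative_eq_intros simp: eval_nat_numeral)
  qed (use dC(3) in blast)
  thus ?thesis by (simp only: infsum_uminus wp0_def)
qed

lemma wp0_deriv:
  assumes "reg_pt z" shows "DERIV wp0 z :> - 2 * wp1 z"
proof -
  obtain d C where dC: "d > 0" "C > 0" "\<And>w v. w \<in> cball z d ==> v \<in> lattice_of t - {0} ==> lat_dom C w v"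
    using lattice_terms_bound[OF assms] by blast
  have "DERIV wp0 z :> (\<Sum>\<^sub>\<infinity>v\<in>lattice_of t - {0}. - 2 * (1 / (z - v) ^ 3))"
    unfolding wp0_def[abs_def]
  proof (rule has_field_derivative_infsum[OF dC(1) _ _ summable_on_cmult_right[OF summable_lattice[OF tau]]])
    fix v w assume *: "v \<in> lattice_of t - {0}" "w \<in> cball z d"
    hence "w - v ~= 0" "v ~= 0" using dC(3) by auto
    thus "DERIV (\<lambda>z. 1 / (z - v)\<^sup>2 - 1 / v\<^sup>2) w :> - 2 * (1 / (w - v) ^ 3)"
      using DERIV_diff[OF DERIV_inverse_power_diff[of w v 2] DERIV_const] by simp
  qed (use dC(3) in blast)
  thus ?thesis by (simp only: infsum_cmult_right' wp1_def)
qed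

lemma isCont_wp1:
  assumes "reg_pt z" shows "isCont wp1 z"
proof -
  obtain d C where dC: "d > 0" "C > 0" "\<And>w v. w \<in> cball z d ==> v \<in> lattice_of t - {0} ==> lat_dom C w v"
    using lattice_terms_bound[OF assms] by blast
  have "DERIV wp1 z :> (\<Sum>\<^sub>\<infinity>v\<in>lattice_of t - {0}. - 3 / (z - v) ^ 4)"
    unfolding wp1_def[abs_def]
  proof (rule has_field_derivative_infsum[OF dC(1) _ _ summable_on_cmult_right[OF summable_lattice[OF tau]]])
    fix v w assume *: "v \<in> lattice_of t - {0}" "w \<in> cball z d"
    hence "w - v ~= 0" "v ~= 0" using dC(3) by auto
    thus "DERIV (\<lambda>z. 1 / (z - v) ^ 3) w :> - 3 / (w - v) ^ 4"
      using DERIV_inverse_power_diff[of w v 3] by simp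
  qed (use dC(3) in blast)
  thus ?thesis by (rule DERIV_isCont)
qed

lemma summable_wp1:
  assumes "reg_pt z" shows "(\<lambda>v. 1 / (z - v) ^ 3) summable_on (lattice_of t - {0})"
proof -
  obtain d C where dC: "d > 0" "C > 0" "\<And>w v. w \<in> cball z d ==> v \<in> lattice_of t - {0} ==> lat_dom C w v"
    using lattice_terms_bound[OF assms] by blast
  have "(\<lambda>v. norm (1 / (z - v) ^ 3)) summable_on (lattice_of t - {0})"
    by (rule summable_on_comparison_test[OF summable_on_cmult_right[OF summable_lattice[OF tau], of C]])
       (use dC in auto)
  thus ?thesis by (rule abs_summable_summable)
qed

definition wp' :: "complex => complex" where
  "wp' z = - 2 * (\<Sum>\<^sub>\<infinity>v\<in>lattice_of t. 1 / (z - v) ^ 3)"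

lemma wp'_eq:
  assumes "z \<notin> lattice_of t" shows "wp' z = - 2 / z ^ 3 - 2 * wp1 z"
proof -
  have "lattice_of t = insert 0 (lattice_of t - {0})" by auto
  hence "(\<Sum>\<^sub>\<infinity>v\<in>lattice_of t. 1 / (z - v) ^ 3) = 1 / (z - 0) ^ 3 + wp1 z"
    unfolding wp1_def using infsum_insert[OF summable_wp1, of z 0] assms by (simp add: reg_pt_def)
  thus ?thesis by (simp add: wp'_def)
qed

text \<open>The series of the derivative has no correction terms, so translation by a period merely
  permutes its summands. This is why the comparison with theta starts from the derivative.\<close>

lemma wp'_periodic: "p \<in> {1, t} ==> wp' (z + p) = wp' z"
  unfolding wp'_def
  by (subst infsum_reindex_bij_witness[of "lattice_of t" "\<lambda>w. w + p" "\<lambda>w. w - p" "lattice_of t" "\<lambda>v. 1 / (z - v) ^ 3"])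
     (use lattice_add_iff[of p] lattice_add_iff[of p "_ - p"] in \<open>auto simp: algebra_simps\<close>)

lemma wp'_minus: "wp' (- z) = - wp' z"
proof -
  have "(\<Sum>\<^sub>\<infinity>v\<in>lattice_of t. 1 / (- z - v) ^ 3) = (\<Sum>\<^sub>\<infinity>v\<in>lattice_of t. - (1 / (z - v) ^ 3))"
  proof (rule infsum_reindex_bij_witness[of _ uminus uminus])
    fix a
    have "(z - - a) ^ 3 = - ((- z - a) ^ 3)" by (simp add: power3_eq_cube algebra_simps)
    thus "- (1 / (z - - a) ^ 3) = 1 / (- z - a) ^ 3" by simp
  qed (use lattice_minus_iff in auto)
  thus ?thesis by (simp add: wp'_def infsum_uminus)
qed

lemma zeta0_minus: "zeta0 (- z) = - zeta0 z"
proof -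
  have "zeta0 (- z) = (\<Sum>\<^sub>\<infinity>v\<in>lattice_of t - {0}. - (1 / (z - v) + 1 / v + z / v\<^sup>2))"
    unfolding zeta0_def
  proof (rule infsum_reindex_bij_witness[of _ uminus uminus])
    fix a
    have "1 / (z + a) = - (1 / (- z - a))" by (metis minus_add_distrib minus_divide_right minus_minus uminus_add_conv_diff add.commute diff_conv_add_uminus)
    thus "- (1 / (z - - a) + 1 / (- a) + z / (- a)\<^sup>2) = 1 / (- z - a) + 1 / a + - z / a\<^sup>2" by simp
  qed (use lattice_minus_iff in auto)
  thus ?thesis by (simp only: infsum_uminus zeta0_def)
qed

lemma weier_p_eq: "weier_p t z = 1 / z\<^sup>2 + wp0 z"
  by (simp add: weier_p_def wp0_def)

lemma weier_zeta_eq: "weier_zeta t z = 1 / z + zeta0 z"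
  by (simp add: weier_zeta_def zeta0_def)

lemma weier_p_deriv:
  assumes "z \<notin> lattice_of t" shows "DERIV (weier_p t) z :> wp' z"
proof -
  have "z ~= 0" "reg_pt z" using assms by (auto simp: reg_pt_def)
  hence "DERIV (\<lambda>z. 1 / z\<^sup>2 + wp0 z) z :> - 2 / z ^ 3 + - 2 * wp1 z"
    using DERIV_add[OF DERIV_inverse_power_diff[of z 0 2] wp0_deriv[of z]] by simp
  thus ?thesis unfolding weier_p_eq[abs_def] wp'_eq[OF assms] by simp
qed

lemma weier_zeta_deriv:
  assumes "z \<notin> lattice_of t" shows "DERIV (weier_zeta t) z :> - weier_p t z"
proof -
  have "z ~= 0" "reg_pt z" using assms by (auto simp: reg_pt_def)
  hence "DERIV (\<lambda>z. 1 / z + zeta0 z) z :> - 1 / z\<^sup>2 + - wp0 z"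
    using DERIV_add[OF DERIV_inverse_power_diff[of z 0 1] zeta0_deriv[of z]] by (simp add: power2_eq_square)
  thus ?thesis unfolding weier_zeta_eq[abs_def] weier_p_eq by simp
qed

section \<open>The Weierstrass functions in terms of theta\<close>

lemma theta_div_z:
  obtains k where "k holomorphic_on UNIV" "\<And>z. Th 0 t z = z * k z"
proof -
  define k where "k = (\<lambda>z. if z = 0 then Th 1 t 0 else Th 0 t z / z)"
  have lim: "(\<lambda>z. Th 0 t z / z) \<midarrow>0\<rightarrow> Th 1 t 0"
    by (rule lhopital_complex_simple[OF Th_derivs(1)[OF tau] DERIV_ident]) (use tau in auto)
  have "k holomorphic_on UNIV"
    unfolding k_def
    by (rule removable_singularity[OF _ open_UNIV lim]) (auto intro!: holomorphic_intros Th_holomorphic tau)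
  moreover have "Th 0 t z = z * k z" for z using tau by (simp add: k_def)
  ultimately show ?thesis using that by blast
qed

text \<open>Writing theta as z k(z) gives psi = 1/z + k'/k, so the regular part is m = k'/k. Oddness
  of theta enters through \<open>Th 2 t 0 = 0\<close>, which forces k'(0) = 0; then m'(0) = k''(0) /
  k(0), and k''(0) is a third of \<open>Th 3 t 0\<close>.\<close>

lemma psi_principal_part:
  obtains U m where "open U" "0 \<in> U" "m holomorphic_on U" "deriv m 0 = Th 3 t 0 / (3 * Th 1 t 0)"
    "\<And>z. z \<in> U ==> z ~= 0 ==> Th 0 t z ~= 0 \<and> psi t z = 1 / z + m z \<and> psi1 t z = - 1 / z\<^sup>2 + deriv m z
        \<and> psi2 t z = 2 / z ^ 3 + deriv (deriv m) z"
proof -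
  obtain k where k: "k holomorphic_on UNIV" "\<And>z. Th 0 t z = z * k z" using theta_div_z by blast
  define k1 k2 k3 where "k1 = deriv k" and "k2 = deriv k1" and "k3 = deriv k2"
  have hol: "k1 holomorphic_on UNIV" "k2 holomorphic_on UNIV"
    unfolding k2_def k1_def by (intro holomorphic_deriv k(1) open_UNIV)+
  have dk: "DERIV k z :> k1 z" "DERIV k1 z :> k2 z" "DERIV k2 z :> k3 z" for z
    unfolding k1_def k2_def k3_def
    by (rule holomorphic_derivI[of _ UNIV]; use hol k(1) in \<open>auto simp: k1_def k2_def\<close>)+
  have T0: "Th 0 t = (\<lambda>z. z * k z)" using k(2) by auto
  have T1: "Th 1 t z = k z + z * k1 z" for z
  proof -
    have "DERIV (\<lambda>z. z * k z) z :> k z + z * k1 z"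
      by (auto intro!: derivative_eq_intros dk)
    thus ?thesis using Th_derivs(1)[OF tau, of z] unfolding T0 by (rule DERIV_unique[symmetric])
  qed
  have T2: "Th 2 t z = 2 * k1 z + z * k2 z" for z
  proof -
    have "DERIV (\<lambda>z. k z + z * k1 z) z :> 2 * k1 z + z * k2 z"
      by (auto intro!: derivative_eq_intros dk)
    thus ?thesis using Th_derivs(2)[OF tau, of z] unfolding T1[abs_def] by (rule DERIV_unique[symmetric])
  qed
  have T3: "Th 3 t z = 3 * k2 z + z * k3 z" for z
  proof -
    have "DERIV (\<lambda>z. 2 * k1 z + z * k2 z) z :> 3 * k2 z + z * k3 z"
      by (auto intro!: derivative_eq_intros dk)
    thus ?thesis using Th_derivs(3)[OF tau, of z] unfolding T2[abs_def] by (rule DERIV_unique[symmetric])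
  qed
  have k0: "k 0 = Th 1 t 0" "k1 0 = 0" "k2 0 = Th 3 t 0 / 3"
    using T1[of 0] T2[of 0] T3[of 0] tau by auto
  define U where "U = {z. k z ~= 0}"
  have U: "open U" unfolding U_def
    by (rule open_Collect_neq) (auto intro: holomorphic_on_imp_continuous_on k(1))
  have U0: "0 \<in> U" unfolding U_def using k0 Th1_0_nonzero[OF tau] by simp
  define m where "m = (\<lambda>z. k1 z / k z)"
  have m: "m holomorphic_on U"
    unfolding m_def by (intro holomorphic_intros) (auto simp: U_def intro: holomorphic_on_subset[OF hol(1)] holomorphic_on_subset[OF k(1)])
  have m1: "deriv m holomorphic_on U" using m U by (rule holomorphic_deriv)
  have "DERIV m 0 :> (k2 0 * k 0 - k1 0 * k1 0) / (k 0 * k 0)"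
    unfolding m_def by (rule DERIV_divide[OF dk(2) dk(1)]) (use U0 in \<open>simp add: U_def\<close>)
  hence dm: "deriv m 0 = Th 3 t 0 / (3 * Th 1 t 0)"
    using Th1_0_nonzero[OF tau] by (simp add: DERIV_imp_deriv k0)
  have nz: "Th 0 t z ~= 0" if "z \<in> U - {0}" for z using that by (simp add: T0 U_def)
  have p0: "psi t z = 1 / z + m z" if "z \<in> U - {0}" for z
    using that unfolding psi_def T1 k(2) m_def U_def by (simp add: field_simps)
  have op: "open (U - {0})" using U by (rule open_delete)
  have p1: "psi1 t z = - 1 / z\<^sup>2 + deriv m z" if z: "z \<in> U - {0}" for z
  proof -
    have "DERIV (\<lambda>z. 1 / z + m z) z :> - 1 / z\<^sup>2 + deriv m z"
      using DERIV_add[OF DERIV_inverse_power_diff[of z 0 1] holomorphic_derivI[OF m U, of z]] z by (simp add: power2_eq_square)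
    hence "DERIV (psi t) z :> - 1 / z\<^sup>2 + deriv m z"
      by (rule has_field_derivative_transform_within_open[OF _ op z]) (use p0 in simp)
    thus ?thesis using psi_deriv[OF tau nz[OF z]] by (rule DERIV_unique[symmetric])
  qed
  have p2: "psi2 t z = 2 / z ^ 3 + deriv (deriv m) z" if z: "z \<in> U - {0}" for z
  proof -
    have "DERIV (\<lambda>z. - (1 / z\<^sup>2) + deriv m z) z :> 2 / z ^ 3 + deriv (deriv m) z"
      using DERIV_add[OF DERIV_minus[OF DERIV_inverse_power_diff[of z 0 2]] holomorphic_derivI[OF m1 U, of z]] z by simp
    hence "DERIV (psi1 t) z :> 2 / z ^ 3 + deriv (deriv m) z"
      by (rule has_field_derivative_transform_within_open[OF _ op z]) (use p1 in simp)
    thus ?thesis using psi1_deriv[OF tau nz[OF z]] by (rule DERIV_unique[symmetric])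
  qed
  show ?thesis
    by (rule that[OF U U0 m dm]) (use nz p0 p1 p2 in auto)
qed

lemma psi2_periodic: "p \<in> {1, t} ==> Th 0 t z ~= 0 ==> psi2 t (z + p) = psi2 t z"
proof -
  assume p: "p \<in> {1, t}" and nz: "Th 0 t z ~= 0"
  have iff: "Th 0 t (z + p) = 0 \<longleftrightarrow> Th 0 t z = 0" for z
    using p Th0_1_iff[OF tau] Th0_tau_iff[OF tau] by auto
  have 1: "psi1 t (z + p) = psi1 t z" if "Th 0 t z ~= 0" for z
    using p that unfolding psi1_eq
    by (auto simp: psi_1[OF tau] hh_1[OF tau] psi_tau[OF tau] hh_tau[OF tau]) (simp add: power2_eq_square algebra_simps)
  have "DERIV (\<lambda>z. psi1 t (z + p)) z :> psi2 t (z + p)"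
    by (rule DERIV_shift_eq[OF psi1_deriv[OF tau]]) (use nz iff in simp)
  moreover have "DERIV (\<lambda>z. psi1 t (z + p)) z :> psi2 t z"
    by (rule has_field_derivative_transform_within_open[OF psi1_deriv[OF tau nz] open_Th0[OF tau]])
       (use nz 1 in auto)
  ultimately show ?thesis by (rule DERIV_unique)
qed

lemma psi2_minus: "psi2 t (- z) = - psi2 t z"
  by (simp add: psi2_def hh1_minus[OF tau] psi_minus[OF tau] psi1_minus[OF tau])

text \<open>The poles - 2 / z^3 and 2 / z^3 cancel, so the sum of both functions is elliptic without
  poles and constant; being odd, it is zero.\<close>

lemma wp'_eq_psi2:
  assumes "z \<notin> lattice_of t"
  shows "wp' z = - psi2 t z"
proof -
  define f where "f = (\<lambda>z. if Th 0 t z ~= 0 then wp' z + psi2 t z else 0)"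
  have fp: "f (z + p) = f z" if "p \<in> {1, t}" for p z
    using that Th0_1_iff[OF tau] Th0_tau_iff[OF tau] wp'_periodic[OF that] psi2_periodic[OF that]
    by (auto simp: f_def)
  have per1: "f (z + 1) = f z" and per2: "f (z + t) = f z" for z using fp by auto
  obtain U m where Um: "open U" "0 \<in> U" "m holomorphic_on U" "\<And>z. z \<in> U ==> z ~= 0 ==> Th 0 t z ~= 0 \<and> psi2 t z = 2 / z ^ 3 + deriv (deriv m) z"
    using psi_principal_part by metis
  have "deriv (deriv m) holomorphic_on U" using Um by (intro holomorphic_deriv)
  hence cm: "isCont (deriv (deriv m)) 0"
    using Um(1,2) by (auto dest!: holomorphic_on_imp_continuous_on simp: continuous_on_eq_continuous_at)
  have "isCont wp1 0" by (rule isCont_wp1) (simp add: reg_pt_def)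
  hence "(\<lambda>z. - 2 * wp1 z + deriv (deriv m) z) \<midarrow>0\<rightarrow> - 2 * wp1 0 + deriv (deriv m) 0"
    using cm by (intro tendsto_intros) (auto simp: isCont_def)
  hence f0: "f \<midarrow>0\<rightarrow> - 2 * wp1 0 + deriv (deriv m) 0"
  proof (rule Lim_transform_within_open[OF _ Um(1,2)])
    fix z assume z: "z \<in> U" "z ~= 0"
    have "z \<notin> lattice_of t" using Um(4)[OF z] Th0_eq_0_iff[OF tau] by blast
    thus "- 2 * wp1 z + deriv (deriv m) z = f z" using Um(4)[OF z] wp'_eq[of z] by (simp add: f_def)
  qed
  have diff: "f field_differentiable (at z)" if "Th 0 t z ~= 0" for z
  proof -
    have zL: "z \<notin> lattice_of t" using that Th0_eq_0_iff[OF tau] by simp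
    have hol: "weier_p t holomorphic_on {w. Th 0 t w ~= 0}" "psi1 t holomorphic_on {w. Th 0 t w ~= 0}"
      using weier_p_deriv psi1_deriv[OF tau] Th0_eq_0_iff[OF tau] open_Th0[OF tau] by (auto simp: holomorphic_on_open)
    have "(\<lambda>w. deriv (weier_p t) w + deriv (psi1 t) w) holomorphic_on {w. Th 0 t w ~= 0}"
      by (intro holomorphic_intros holomorphic_deriv hol open_Th0[OF tau])
    moreover have "deriv (weier_p t) w + deriv (psi1 t) w = f w" if "w \<in> {w. Th 0 t w ~= 0}" for w
      using that weier_p_deriv[of w] psi1_deriv[OF tau, of w] Th0_eq_0_iff[OF tau, of w]
      by (simp add: f_def DERIV_imp_deriv)
    ultimately have "f holomorphic_on {w. Th 0 t w ~= 0}" by (rule holomorphic_transform)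
    thus ?thesis using that open_Th0[OF tau] holomorphic_on_imp_differentiable_at by blast
  qed
  have lim: "\<exists>l. f \<midarrow>z\<rightarrow> l" for z
  proof (cases "Th 0 t z = 0")
    case True
    hence "f (w + z) = f w" for w using lattice_periodic[OF per1 per2] Th0_eq_0_iff[OF tau] by blast
    from this[of "_ - z"] have "f (w + - z) = f w" for w by simp
    thus ?thesis using LIM_offset[OF f0, of "- z"] by auto
  next
    case False
    thus ?thesis using diff field_differentiable_imp_continuous_at isCont_def by blast
  qed
  obtain c where c: "\<And>z. f \<midarrow>z\<rightarrow> c"
    using elliptic_const[OF isolated_singularityI[OF ev_Th0[OF tau] diff] lim tau] per1 per2 by auto
  have fc: "f z = c" if "Th 0 t z ~= 0" for z
  proof -
    have "f \<midarrow>z\<rightarrow> f z" using diff[OF that] field_differentiable_imp_continuous_at isCont_def by blast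
    with c[of z] show ?thesis by (rule LIM_unique[symmetric])
  qed
  have nz: "Th 0 t z ~= 0" "Th 0 t (- z) ~= 0" using assms Th0_eq_0_iff[OF tau] Th0_minus_iff[OF tau] by auto
  have "f (- z) = - f z" using nz by (simp add: f_def wp'_minus psi2_minus)
  hence "c = - c" using fc[OF nz(1)] fc[OF nz(2)] by simp
  hence "c = 0" by (simp add: eq_neg_iff_add_eq_0)
  thus ?thesis using fc[OF nz(1)] nz(1) by (simp add: f_def eq_neg_iff_add_eq_0)
qed

lemma connected_minus_lattice: "connected (- lattice_of t)"
proof -
  have "lattice_of t = range (\<lambda>(k, l). of_int k + of_int l * t)"
    by (auto simp: lattice_of_def image_iff)
  hence "countable (lattice_of t)" by simp
  hence "connected (UNIV - lattice_of t)"
    by (intro connected_open_diff_countable) auto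
  thus ?thesis by (simp add: Compl_eq_Diff_UNIV)
qed

lemma open_minus_lattice: "open (- lattice_of t)"
proof -
  have "- lattice_of t = {w. Th 0 t w ~= 0}" using Th0_eq_0_iff[OF tau] by auto
  thus ?thesis using open_Th0[OF tau] by simp
qed

text \<open>Minus the derivative at 0 of the regular part of psi. It is the quasi-period of the
  Weierstrass zeta function along 1.\<close>

definition wp_const :: complex where
  "wp_const = - Th 3 t 0 / (3 * Th 1 t 0)"

text \<open>Equal derivatives on the connected complement of the lattice leave a constant. It is
  read off at 0, where the double poles cancel and \<open>wp0\<close> vanishes.\<close>

lemma weier_p_eq_psi1:
  assumes "z \<notin> lattice_of t"
  shows "weier_p t z = - psi1 t z - wp_const"
proof -
  have "(\<lambda>z. weier_p t z + psi1 t z) constant_on (- lattice_of t)"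
  proof (rule has_field_derivative_0_imp_constant_on[OF _ connected_minus_lattice open_minus_lattice])
    fix z assume "z \<in> - lattice_of t"
    hence "DERIV (\<lambda>z. weier_p t z + psi1 t z) z :> wp' z + psi2 t z"
      using Th0_eq_0_iff[OF tau] by (intro DERIV_add weier_p_deriv psi1_deriv[OF tau]) auto
    thus "DERIV (\<lambda>z. weier_p t z + psi1 t z) z :> 0"
      using wp'_eq_psi2[of z] \<open>z \<in> - lattice_of t\<close> by simp
  qed
  then obtain c where c: "\<And>z. z \<notin> lattice_of t ==> weier_p t z + psi1 t z = c"
    unfolding constant_on_def by auto
  obtain U m where Um: "open U" "0 \<in> U" "m holomorphic_on U" "deriv m 0 = Th 3 t 0 / (3 * Th 1 t 0)"
      "\<And>z. z \<in> U ==> z ~= 0 ==> Th 0 t z ~= 0 \<and> psi1 t z = - 1 / z\<^sup>2 + deriv m z"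
    using psi_principal_part by metis
  have "deriv m holomorphic_on U" using Um by (intro holomorphic_deriv)
  hence cm: "isCont (deriv m) 0"
    using Um(1,2) by (auto dest!: holomorphic_on_imp_continuous_on simp: continuous_on_eq_continuous_at)
  have "isCont wp0 0" by (rule DERIV_isCont[OF wp0_deriv]) (simp add: reg_pt_def)
  hence "(\<lambda>z. wp0 z + deriv m z) \<midarrow>0\<rightarrow> wp0 0 + deriv m 0"
    using cm by (intro tendsto_intros) (auto simp: isCont_def)
  hence "(\<lambda>z::complex. c) \<midarrow>0\<rightarrow> wp0 0 + deriv m 0"
  proof (rule Lim_transform_within_open[OF _ Um(1,2)])
    fix z assume z: "z \<in> U" "z ~= 0"
    have "z \<notin> lattice_of t" using Um(5)[OF z] Th0_eq_0_iff[OF tau] by blast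
    from c[OF this] show "wp0 z + deriv m z = c" using Um(5)[OF z] by (simp add: weier_p_eq)
  qed
  hence "c = wp0 0 + deriv m 0" by (simp add: LIM_const_eq)
  also have "wp0 0 = 0" by (simp add: wp0_def)
  finally show ?thesis using c[OF assms] Um(4) by (simp add: wp_const_def algebra_simps)
qed

lemma weier_zeta_eq_psi:
  assumes "z \<notin> lattice_of t"
  shows "weier_zeta t z = psi t z + wp_const * z"
proof -
  have "(\<lambda>z. weier_zeta t z - psi t z - wp_const * z) constant_on (- lattice_of t)"
  proof (rule has_field_derivative_0_imp_constant_on[OF _ connected_minus_lattice open_minus_lattice])
    fix z assume z: "z \<in> - lattice_of t"
    hence nz: "z \<notin> lattice_of t" "Th 0 t z ~= 0" using Th0_eq_0_iff[OF tau] by auto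
    have "DERIV (\<lambda>z. weier_zeta t z - psi t z - wp_const * z) z :> - weier_p t z - psi1 t z - wp_const * 1"
      by (intro DERIV_diff weier_zeta_deriv[OF nz(1)] psi_deriv[OF tau nz(2)] DERIV_cmult DERIV_ident)
    thus "DERIV (\<lambda>z. weier_zeta t z - psi t z - wp_const * z) z :> 0"
      using weier_p_eq_psi1[OF nz(1)] by simp
  qed
  then obtain c where c: "\<And>z. z \<notin> lattice_of t ==> weier_zeta t z - psi t z - wp_const * z = c"
    unfolding constant_on_def by auto
  have m: "- z \<notin> lattice_of t" using assms lattice_minus_iff by simp
  have odd: "weier_zeta t (- z) = - weier_zeta t z" by (simp add: weier_zeta_eq zeta0_minus)
  have "c + c = (weier_zeta t z - psi t z - wp_const * z) + (weier_zeta t (- z) - psi t (- z) - wp_const * (- z))"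
    by (simp only: c[OF assms] c[OF m])
  also have "... = 0" by (simp add: odd psi_minus[OF tau])
  finally have "c = 0" by simp
  thus ?thesis using c[OF assms] by (simp add: algebra_simps)
qed

end

section \<open>Expansion of elliptic functions\<close>

definition psid :: "nat => complex => complex => complex" where
  "psid j t z = (deriv ^^ j) (psi t) z"

text \<open>The functions multiplying the invariants in their defining identity, expressed through
  psi; for k \<ge> 1 the leading term at 0 is z^(-k). In case 1 the linear terms of the three zeta
  values cancel. The constant \<open>wp_const\<close> occurs for k = 2 only, since the later
  functions are derivatives of wp.\<close>

definition bas :: "nat => complex => complex => complex => complex" where
  "bas k t w z = (if k = 0 then 1 else if k = 1 then psi t z - psi t (z + w) + psi t w
     else (-1) ^ k / fact (k - 1) * (- psid (k - 1) t z - (if k = 2 then wp_const t else 0)))"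

context
  fixes t :: complex
  assumes tau: "Im t > 0"
begin

lemma psi_holomorphic: "psi t holomorphic_on {z. Th 0 t z ~= 0}"
  using psi_deriv[OF tau] open_Th0[OF tau] by (auto simp: holomorphic_on_open)

lemma psid_deriv: "Th 0 t z ~= 0 ==> DERIV (psid j t) z :> psid (Suc j) t z"
  using holomorphic_derivI[OF holomorphic_higher_deriv[OF psi_holomorphic open_Th0[OF tau], of j] open_Th0[OF tau], of z]
  by (simp add: psid_def[abs_def])

lemma psid_1: "Th 0 t z ~= 0 ==> psid 1 t z = psi1 t z"
  by (simp add: psid_def DERIV_imp_deriv[OF psi_deriv[OF tau]])

lemma higher_deriv_weier_p:
  assumes "z \<notin> lattice_of t"
  shows "(deriv ^^ j) (weier_p t) z = - psid (Suc j) t z - (if j = 0 then wp_const t else 0)"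
  using assms
proof (induction j arbitrary: z)
  case 0
  thus ?case using weier_p_eq_psi1[OF tau 0] psid_1[of z] Th0_eq_0_iff[OF tau, of z] by simp
next
  case (Suc j)
  have nz: "Th 0 t z ~= 0" using Suc.prems Th0_eq_0_iff[OF tau] by simp
  have "DERIV (\<lambda>z. - psid (Suc j) t z - (if j = 0 then wp_const t else 0)) z :> - psid (Suc (Suc j)) t z - 0"
    by (intro DERIV_diff DERIV_minus psid_deriv nz DERIV_const)
  hence "DERIV ((deriv ^^ j) (weier_p t)) z :> - psid (Suc (Suc j)) t z"
    by (simp, elim has_field_derivative_transform_within_open[OF _ open_minus_lattice[OF tau]])
       (use Suc in auto)
  thus ?case by (simp add: DERIV_imp_deriv)
qed

lemma psid_periodic: "p \<in> {1, t} ==> Th 0 t z ~= 0 ==> psid (Suc j) t (z + p) = psid (Suc j) t z"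
proof (induction j arbitrary: z)
  case 0
  hence nz: "Th 0 t (z + p) ~= 0" using Th0_1_iff[OF tau] Th0_tau_iff[OF tau] by auto
  have "psi1 t (z + p) = psi1 t z"
    using 0 unfolding psi1_eq by (auto simp: psi_1[OF tau] hh_1[OF tau] psi_tau[OF tau] hh_tau[OF tau])
      (simp add: power2_eq_square algebra_simps)
  thus ?case using psid_1[OF 0(2)] psid_1[OF nz] by simp
next
  case (Suc j)
  hence nz: "Th 0 t (z + p) ~= 0" using Th0_1_iff[OF tau] Th0_tau_iff[OF tau] by auto
  have "DERIV (\<lambda>z. psid (Suc j) t (z + p)) z :> psid (Suc (Suc j)) t (z + p)"
    by (rule DERIV_shift_eq[OF psid_deriv[OF nz]])
  moreover have "DERIV (\<lambda>z. psid (Suc j) t (z + p)) z :> psid (Suc (Suc j)) t z"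
    by (rule has_field_derivative_transform_within_open[OF psid_deriv[OF Suc.prems(2)] open_Th0[OF tau]])
       (use Suc in auto)
  ultimately show ?case by (rule DERIV_unique)
qed

context
  fixes w :: complex
  assumes w: "Th 0 t w ~= 0"
begin

definition goodz :: "complex => bool" where
  "goodz z \<longleftrightarrow> Th 0 t z ~= 0 \<and> Th 0 t (z + w) ~= 0"

lemma ev_goodz: "eventually goodz (at z)"
  unfolding goodz_def by (intro eventually_conj ev_Th0[OF tau] ev_Th0_shift[OF tau])

lemma open_goodz: "open {z. goodz z}"
  unfolding goodz_def Collect_conj_eq by (intro open_Int open_Th0[OF tau] open_Th0_shift[OF tau])

lemma goodz_shift: "p \<in> {1, t} ==> goodz (z + p) \<longleftrightarrow> goodz z"
proof -
  assume p: "p \<in> {1, t}"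
  have e: "z + p + w = z + w + p" by simp
  show ?thesis
    unfolding goodz_def e using p by (auto simp: Th0_1_iff[OF tau] Th0_tau_iff[OF tau])
qed

lemma connected_goodz: "connected {z. goodz z}"
proof -
  have "lattice_of t = range (\<lambda>(k, l). of_int k + of_int l * t)"
    by (auto simp: lattice_of_def image_iff)
  hence c: "countable (lattice_of t)" by simp
  have "{z. goodz z} = UNIV - (lattice_of t \<union> (\<lambda>z. z - w) ` lattice_of t)"
  proof -
    have "z + w \<in> lattice_of t \<longleftrightarrow> z \<in> (\<lambda>z. z - w) ` lattice_of t" for z
      by (auto simp: image_iff) (metis add_diff_cancel)
    thus ?thesis unfolding goodz_def by (auto simp: Th0_eq_0_iff[OF tau])
  qed
  moreover have "connected (UNIV - (lattice_of t \<union> (\<lambda>z. z - w) ` lattice_of t))"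
    using c by (intro connected_open_diff_countable) auto
  ultimately show ?thesis by simp
qed

lemma bas_differentiable: "goodz z ==> bas k t w field_differentiable (at z)"
proof -
  assume g: "goodz z"
  have 1: "psi t field_differentiable (at z)" "psid j t field_differentiable (at z)"
     "(\<lambda>z. psi t (z + w)) field_differentiable (at z)" for j
    using g psi_deriv[OF tau, of z] psid_deriv[of z j] DERIV_shift_eq[OF psi_deriv[OF tau, of "z + w"]]
    unfolding goodz_def field_differentiable_def by blast+
  consider "k = 0" | "k = 1" | "k \<ge> 2" by linarith
  thus ?thesis
  proof cases
    case 3
    hence "bas k t w = (\<lambda>z. (-1) ^ k / fact (k - 1) * (- psid (k - 1) t z - (if k = 2 then wp_const t else 0)))"
      by (auto simp: bas_def)
    thus ?thesis
      by (simp only:) (intro field_differentiable_mult field_differentiable_diff field_differentiable_minus 1 field_differentiable_const)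
  qed (auto simp: bas_def[abs_def] intro!: field_differentiable_add field_differentiable_diff 1 field_differentiable_const)
qed

lemma bas_differentiable_minus_w:
  assumes "k \<ge> 2" shows "bas k t w field_differentiable (at (- w))"
proof -
  have "Th 0 t (- w) ~= 0" using w Th0_minus_iff[OF tau] by simp
  hence "psid j t field_differentiable (at (- w))" for j
    using psid_deriv field_differentiable_def by blast
  moreover have "bas k t w = (\<lambda>z. (-1) ^ k / fact (k - 1) * (- psid (k - 1) t z - (if k = 2 then wp_const t else 0)))"
    using assms by (auto simp: bas_def)
  ultimately show ?thesis
    by (simp only:) (intro field_differentiable_mult field_differentiable_diff field_differentiable_minus field_differentiable_const, assumption)
qed

lemma bas_periodic:
  assumes "p \<in> {1, t}" "goodz z" shows "bas k t w (z + p) = bas k t w z"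
proof -
  consider "k = 0" | "k = 1" | j where "k = Suc (Suc j)" by (metis One_nat_def not0_implies_Suc)
  thus ?thesis
  proof cases
    case 2
    have e: "z + p + w = z + w + p" by simp
    have "psi t (z + p) - psi t (z + w + p) = psi t z - psi t (z + w)"
      using assms by (auto simp: goodz_def psi_1[OF tau] psi_tau[OF tau])
    thus ?thesis using 2 unfolding bas_def e by simp
  next
    case 3
    thus ?thesis using psid_periodic[of p z j] assms by (simp add: bas_def goodz_def)
  qed (simp add: bas_def)
qed

lemma psid_principal_part:
  obtains U m where "open U" "0 \<in> U" "m holomorphic_on U"
    "\<And>z. z \<in> U - {0} ==> Th 0 t z ~= 0"
    "\<And>z j. z \<in> U - {0} ==> psid j t z = (-1) ^ j * fact j / z ^ Suc j + (deriv ^^ j) m z"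
proof -
  obtain U m where U: "open U" "0 \<in> U" "m holomorphic_on U"
    "\<And>z. z \<in> U ==> z ~= 0 ==> Th 0 t z ~= 0 \<and> psi t z = 1 / z + m z"
    using psi_principal_part[OF tau] by metis
  have op: "open (U - {0})" using U(1) by (rule open_delete)
  have "psid j t z = (-1) ^ j * fact j / z ^ Suc j + (deriv ^^ j) m z" if "z \<in> U - {0}" for z j
    using that
  proof (induction j arbitrary: z)
    case 0
    thus ?case using U(4)[of z] by (simp add: psid_def)
  next
    case (Suc j)
    have "((\<lambda>z. (-1) ^ j * fact j * (1 / (z - 0) ^ Suc j) + (deriv ^^ j) m z) has_field_derivative
        (-1) ^ j * fact j * (- of_nat (Suc j) / (z - 0) ^ Suc (Suc j)) + (deriv ^^ Suc j) m z) (at z)"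
      using Suc.prems holomorphic_derivI[OF holomorphic_higher_deriv[OF U(3,1), of j] U(1), of z]
      by (intro DERIV_add DERIV_cmult DERIV_inverse_power_diff) auto
    hence "DERIV (psid j t) z :> (-1) ^ j * fact j * (- of_nat (Suc j) / (z - 0) ^ Suc (Suc j)) + (deriv ^^ Suc j) m z"
      by (rule has_field_derivative_transform_within_open[OF _ op Suc.prems]) (use Suc.IH in simp)
    hence "psid (Suc j) t z = (-1) ^ j * fact j * (- of_nat (Suc j) / (z - 0) ^ Suc (Suc j)) + (deriv ^^ Suc j) m z"
      using psid_deriv[of z j] U(4)[of z] Suc.prems DERIV_unique by blast
    thus ?case by (simp add: algebra_simps)
  qed
  with U show ?thesis using that by blast
qed

lemma bas_limit:
  assumes "k \<ge> 1" shows "(\<lambda>z. z ^ k * bas k t w z) \<midarrow>0\<rightarrow> 1"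
proof -
  obtain U m where U: "open U" "0 \<in> U" "m holomorphic_on U"
    "\<And>z. z \<in> U - {0} ==> Th 0 t z ~= 0"
    "\<And>z j. z \<in> U - {0} ==> psid j t z = (-1) ^ j * fact j / z ^ Suc j + (deriv ^^ j) m z"
    using psid_principal_part by blast
  have lim: "(\<lambda>z. (deriv ^^ j) m z) \<midarrow>0\<rightarrow> (deriv ^^ j) m 0" for j
    using holomorphic_higher_deriv[OF U(3,1), of j] U(1,2)
    by (auto dest!: holomorphic_on_imp_continuous_on simp: continuous_on_eq_continuous_at isCont_def)
  show ?thesis
  proof (cases "k = 1")
    case True
    have "isCont (psi t) w" using psi_deriv[OF tau w] by (rule DERIV_isCont)
    hence pw: "(\<lambda>z. psi t (z + w)) \<midarrow>0\<rightarrow> psi t w"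
      using LIM_offset[of "psi t" _ w w] by (simp add: isCont_def)
    have "(\<lambda>z. 1 + z * ((deriv ^^ 0) m z - psi t (z + w) + psi t w)) \<midarrow>0\<rightarrow> 1 + 0 * ((deriv ^^ 0) m 0 - psi t w + psi t w)"
      by (intro tendsto_intros lim pw)
    hence "(\<lambda>z. z ^ k * bas k t w z) \<midarrow>0\<rightarrow> 1 + 0 * ((deriv ^^ 0) m 0 - psi t w + psi t w)"
    proof (rule Lim_transform_within_open[OF _ U(1,2)])
      fix z assume "z \<in> U" "z ~= 0"
      thus "1 + z * ((deriv ^^ 0) m z - psi t (z + w) + psi t w) = z ^ k * bas k t w z"
        using U(5)[of z 0] True by (simp add: bas_def psid_def algebra_simps)
    qed
    thus ?thesis by simp
  next
    case False
    hence k2: "k \<ge> 2" using assms by simp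
    define C where "C = (if k = 2 then wp_const t else 0)"
    have "(\<lambda>z. 1 + z ^ k * ((-1) ^ k / fact (k - 1) * (- (deriv ^^ (k - 1)) m z - C))) \<midarrow>0\<rightarrow>
       1 + 0 ^ k * ((-1) ^ k / fact (k - 1) * (- (deriv ^^ (k - 1)) m 0 - C))"
      by (intro tendsto_intros lim)
    hence "(\<lambda>z. z ^ k * bas k t w z) \<midarrow>0\<rightarrow> 1 + 0 ^ k * ((-1) ^ k / fact (k - 1) * (- (deriv ^^ (k - 1)) m 0 - C))"
    proof (rule Lim_transform_within_open[OF _ U(1,2)])
      fix z assume z: "z \<in> U" "z ~= 0"
      have k: "Suc (k - 1) = k" using k2 by simp
      have p: "psid (k - 1) t z = (-1) ^ (k - 1) * fact (k - 1) / z ^ k + (deriv ^^ (k - 1)) m z"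
        using U(5)[of z "k - 1"] z unfolding k by simp
      have s: "(-1 :: complex) ^ k * (-1) ^ (k - 1) = -1"
        by (subst (1) k[symmetric]) (simp only: power_Suc mult.assoc power_mult_distrib[symmetric], simp)
      have "z ^ k * ((-1) ^ k / fact (k - 1) * (- ((-1) ^ (k - 1) * fact (k - 1) / z ^ k)))
          = - ((-1) ^ k * (-1) ^ (k - 1))" using z by (simp add: field_simps)
      also have "... = 1" by (simp only: s) simp
      finally have e: "z ^ k * ((-1) ^ k / fact (k - 1) * (- ((-1) ^ (k - 1) * fact (k - 1) / z ^ k))) = 1" .
      have "z ^ k * bas k t w z = z ^ k * ((-1) ^ k / fact (k - 1) * (- ((-1) ^ (k - 1) * fact (k - 1) / z ^ k)))
         + z ^ k * ((-1) ^ k / fact (k - 1) * (- (deriv ^^ (k - 1)) m z - C))"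
      proof -
        have b: "bas k t w z = (-1) ^ k / fact (k - 1) * (- psid (k - 1) t z - C)"
          using k2 by (simp add: bas_def C_def)
        have gen: "Z * (A * (- (q + R) - C)) = Z * (A * (- q)) + Z * (A * (- R - C))" for Z A q R :: complex
          by (simp add: algebra_simps)
        show ?thesis unfolding b p by (rule gen)
      qed
      thus "1 + z ^ k * ((-1) ^ k / fact (k - 1) * (- (deriv ^^ (k - 1)) m z - C)) = z ^ k * bas k t w z"
        unfolding e by simp
    qed
    thus ?thesis using k2 by (simp add: power_0_left)
  qed
qed

text \<open>The functions have different orders of pole at 0. Multiplication by z^n with the highest
  order n isolates the top coefficient, and induction deals with the others.\<close>

lemma bas_independent:
  assumes "eventually (\<lambda>z. (\<Sum>k\<le>n. c k * bas k t w z) = 0) (at 0)" "k \<le> n"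
  shows "c k = 0"
  using assms
proof (induction n arbitrary: k)
  case 0
  then obtain z where "(\<Sum>k\<le>0. c k * bas k t w z) = 0" using eventually_happens'[OF at_neq_bot] by blast
  thus ?case using 0 by (simp add: bas_def)
next
  case (Suc n)
  have lim: "(\<lambda>z. z ^ Suc n * bas k t w z) \<midarrow>0\<rightarrow> 0" if "k \<le> n" for k
  proof (cases "k = 0")
    case True
    have "(\<lambda>z::complex. z ^ Suc n) \<midarrow>0\<rightarrow> 0 ^ Suc n" by (intro tendsto_intros)
    thus ?thesis using True by (simp add: bas_def)
  next
    case False
    have "(\<lambda>z. z ^ (Suc n - k) * (z ^ k * bas k t w z)) \<midarrow>0\<rightarrow> 0 ^ (Suc n - k) * 1"
      using False by (intro tendsto_intros bas_limit) auto
    moreover have "z ^ (Suc n - k) * (z ^ k * bas k t w z) = z ^ Suc n * bas k t w z" for z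
      using that by (simp only: mult.assoc[symmetric] power_add[symmetric]) simp
    ultimately show ?thesis using that by (simp add: power_0_left)
  qed
  have "(\<lambda>z. (\<Sum>k\<le>n. c k * (z ^ Suc n * bas k t w z)) + c (Suc n) * (z ^ Suc n * bas (Suc n) t w z)) \<midarrow>0\<rightarrow> (\<Sum>k\<le>n. c k * 0) + c (Suc n) * 1"
    by (intro tendsto_add tendsto_sum tendsto_mult tendsto_const lim bas_limit) auto
  hence "(\<lambda>z. z ^ Suc n * (\<Sum>k\<le>Suc n. c k * bas k t w z)) \<midarrow>0\<rightarrow> c (Suc n)"
    by (simp add: sum_distrib_left algebra_simps)
  moreover have "(\<lambda>z. z ^ Suc n * (\<Sum>k\<le>Suc n. c k * bas k t w z)) \<midarrow>0\<rightarrow> 0"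
    by (rule tendsto_eventually) (use Suc.prems(1) in \<open>auto elim!: eventually_mono\<close>)
  ultimately have 0: "c (Suc n) = 0" by (rule LIM_unique)
  hence "eventually (\<lambda>z. (\<Sum>k\<le>n. c k * bas k t w z) = 0) (at 0)" using Suc.prems(1) by simp
  thus ?case using Suc.IH[of k] Suc.prems(2) 0 by (cases "k = Suc n") auto
qed

text \<open>A function with limit 0 at an isolated singularity extends holomorphically with a zero
  there, and its difference quotient has a limit. This is how subtracting a leading term lowers the
  order of a pole.\<close>

lemma tendsto_divide_factor:
  fixes g :: "complex => complex"
  assumes "eventually P (at a)" "\<And>z. P z ==> g field_differentiable (at z)" "(\<lambda>z. (z - a) ^ Suc k * g z) \<midarrow>a\<rightarrow> 0"
  shows "\<exists>l. (\<lambda>z. (z - a) ^ k * g z) \<midarrow>a\<rightarrow> l"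
proof -
  define G where "G = (\<lambda>z. (z - a) ^ Suc k * g z)"
  obtain r where r: "r > 0" "\<And>w. w \<in> ball a r - {a} ==> P w"
    using assms(1) unfolding eventually_at by (auto simp: dist_commute)
  have "g holomorphic_on ball a r - {a}"
    unfolding holomorphic_on_def using r(2) assms(2) field_differentiable_at_within by blast
  hence "G holomorphic_on ball a r - {a}" unfolding G_def by (intro holomorphic_intros)
  hence H: "(\<lambda>z. if z = a then 0 else G z) holomorphic_on ball a r"
    by (rule removable_singularity[OF _ open_ball]) (use assms(3) in \<open>simp add: G_def\<close>)
  define H where "H = (\<lambda>z. if z = a then 0 else G z)"
  obtain D where D: "DERIV H a :> D"
    using holomorphic_derivI[OF H open_ball, of a] r(1) by (auto simp: H_def)
  have "(\<lambda>z. H z / (z - a)) \<midarrow>a\<rightarrow> D / 1"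
    by (rule lhopital_complex_simple[OF D, of "\<lambda>z. z - a" 1]) (auto intro!: derivative_eq_intros simp: H_def)
  hence "(\<lambda>z. (z - a) ^ k * g z) \<midarrow>a\<rightarrow> D / 1"
    by (rule Lim_transform_within_open[OF _ open_UNIV]) (auto simp: H_def G_def)
  thus ?thesis by blast
qed

text \<open>An elliptic function with at most simple poles at \<open>-w\<close> has no residue there: subtracting \<open>R \<psi>(z + w)\<close>
  leaves a function whose derivative is constant.\<close>
lemma elliptic_simple_pole_const:
  assumes d: "\<And>z. goodz z ==> f field_differentiable (at z)"
    and per: "\<And>p z. p \<in> {1, t} ==> goodz z ==> f (z + p) = f z"
    and l0: "\<exists>l. f \<midarrow>0\<rightarrow> l" and lw: "\<exists>l. (\<lambda>z. (z + w) * f z) \<midarrow>- w\<rightarrow> l"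
  shows "\<exists>c. \<forall>z. goodz z \<longrightarrow> f z = c"
proof -
  define f' where "f' = deriv f"
  obtain rho where rho: "(\<lambda>z. (z + w) * f z) \<midarrow>- w\<rightarrow> rho" using lw by blast
  have fhol: "f holomorphic_on {z. goodz z}"
    unfolding holomorphic_on_def using d field_differentiable_at_within by blast
  \<comment> \<open>Subtracting the possible simple pole at \<open>- w\<close> costs periodicity:
    \<open>E\<close> is invariant under 1 and gains a multiple of \<open>rho\<close> under
    \<open>t\<close>. Its derivative \<open>E1\<close> is elliptic.\<close>
  define E where "E = (\<lambda>z. f z - rho * psi t (z + w))"
  define E1 where "E1 = (\<lambda>z. if goodz z then f' z - rho * psi1 t (z + w) else 0)"
  have dE: "DERIV E z :> E1 z" if "goodz z" for z
  proof -
    have "DERIV f z :> f' z"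
      unfolding f'_def using d[OF that] by (simp add: field_differentiable_derivI)
    moreover have "Th 0 t (z + w) ~= 0" using that by (simp add: goodz_def)
    ultimately have "DERIV (\<lambda>z. f z - rho * psi t (z + w)) z :> f' z - rho * psi1 t (z + w)"
      by (intro DERIV_diff DERIV_cmult DERIV_shift_eq psi_deriv[OF tau])
    thus ?thesis using that by (simp add: E_def[abs_def] E1_def)
  qed
  have Ed: "E field_differentiable (at z)" if "goodz z" for z using dE[OF that] field_differentiable_def by blast
  have Ehol: "E holomorphic_on {z. goodz z}"
    unfolding holomorphic_on_def using Ed field_differentiable_at_within by blast
  have E1eq: "E1 z = deriv E z" if "goodz z" for z using DERIV_imp_deriv[OF dE[OF that]] by simp
  have E1d: "E1 field_differentiable (at z)" if "goodz z" for z
  proof -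
    have "deriv E holomorphic_on {z. goodz z}" by (rule holomorphic_deriv[OF Ehol open_goodz])
    hence "E1 holomorphic_on {z. goodz z}" by (rule holomorphic_transform) (simp add: E1eq)
    thus ?thesis using that open_goodz holomorphic_on_imp_differentiable_at by blast
  qed
  have E_limit_deriv: "\<exists>l. E1 \<midarrow>a\<rightarrow> l" if lim: "E \<midarrow>a\<rightarrow> l" for a l
  proof -
    obtain r where r: "r > 0" "\<And>w. w \<in> ball a r - {a} ==> goodz w"
      using ev_goodz[of a] unfolding eventually_at by (auto simp: dist_commute)
    have "E holomorphic_on ball a r - {a}" by (rule holomorphic_on_subset[OF Ehol]) (use r(2) in auto)
    hence H: "(\<lambda>z. if z = a then l else E z) holomorphic_on ball a r"
      by (rule removable_singularity[OF _ open_ball lim])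
    define H where "H = (\<lambda>z. if z = a then l else E z)"
    have "deriv H holomorphic_on ball a r" using H unfolding H_def by (intro holomorphic_deriv) auto
    hence "deriv H \<midarrow>a\<rightarrow> deriv H a"
      using r(1) by (auto dest!: holomorphic_on_imp_continuous_on simp: continuous_on_eq_continuous_at isCont_def)
    hence "E1 \<midarrow>a\<rightarrow> deriv H a"
    proof (rule Lim_transform_within_open[OF _ open_ball[of a r]])
      fix z assume z: "z \<in> ball a r" "z ~= a"
      hence "DERIV H z :> E1 z"
        by (intro has_field_derivative_transform_within_open[OF dE[OF r(2)] open_delete[OF open_ball[of a r], of a]])
           (auto simp: H_def)
      thus "deriv H z = E1 z" by (rule DERIV_imp_deriv)
    qed (use r(1) in auto)
    thus ?thesis by blast
  qed
  have perE: "E1 (z + p) = E1 z" if p: "p \<in> {1, t}" for p z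
  proof (cases "goodz z")
    case True
    define K where "K = (if p = 1 then 0 else 2 * of_real pi * \<i> * rho)"
    have E: "E (u + p) = E u + K" if "goodz u" for u
    proof -
      have e: "u + p + w = u + w + p" by simp
      have ps: "psi t (u + w + p) = psi t (u + w) - (if p = 1 then 0 else 2 * of_real pi * \<i>)"
        using p that by (auto simp: psi_1[OF tau] psi_tau[OF tau] goodz_def)
      show ?thesis unfolding E_def e K_def per[OF p that] ps by (simp add: algebra_simps)
    qed
    have g: "goodz (z + p)" using True goodz_shift[OF p] by simp
    have "DERIV (\<lambda>u. E (u + p)) z :> E1 (z + p)" by (rule DERIV_shift_eq[OF dE[OF g]])
    moreover have "DERIV (\<lambda>u. E u + K) z :> E1 z + 0" by (intro DERIV_add dE[OF True] DERIV_const)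
    hence "DERIV (\<lambda>u. E (u + p)) z :> E1 z"
      by (simp, elim has_field_derivative_transform_within_open[OF _ open_goodz]) (use True E in auto)
    ultimately show ?thesis by (rule DERIV_unique)
  next
    case False
    thus ?thesis using goodz_shift[OF p, of z] by (simp add: E1_def)
  qed
  have per1: "E1 (z + 1) = E1 z" and per2: "E1 (z + t) = E1 z" for z using perE by auto
  have w': "Th 0 t (- w) ~= 0" using w Th0_minus_iff[OF tau] by simp
  have psiw: "(\<lambda>z. psi t (z + w)) \<midarrow>0\<rightarrow> psi t w"
    using LIM_offset[of "psi t" _ w w] DERIV_isCont[OF psi_deriv[OF tau w]] by (simp add: isCont_def)
  obtain l where "f \<midarrow>0\<rightarrow> l" using l0 by blast
  hence "E \<midarrow>0\<rightarrow> l - rho * psi t w" unfolding E_def by (intro tendsto_intros psiw)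
  then obtain a0 where a0: "E1 \<midarrow>0\<rightarrow> a0" using E_limit_deriv by blast
  have "(\<lambda>z. (z - - w) ^ Suc 0 * E z) \<midarrow>- w\<rightarrow> 0"
  proof -
    have "(\<lambda>z. z ^ 1 * bas 1 t w z - z * (- psi t (z + w) + psi t w)) \<midarrow>0\<rightarrow> 1 - 0 * (- psi t w + psi t w)"
      by (intro tendsto_intros bas_limit psiw) simp
    hence "(\<lambda>z. z * psi t z) \<midarrow>0\<rightarrow> 1" by (simp add: bas_def algebra_simps)
    from LIM_offset[OF this, of w] have "(\<lambda>z. (z + w) * psi t (z + w)) \<midarrow>- w\<rightarrow> 1" by simp
    hence "(\<lambda>z. (z + w) * f z - rho * ((z + w) * psi t (z + w))) \<midarrow>- w\<rightarrow> rho - rho * 1"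
      by (intro tendsto_intros rho)
    thus ?thesis by (simp add: E_def algebra_simps)
  qed
  hence "\<exists>l. (\<lambda>z. (z - - w) ^ 0 * E z) \<midarrow>- w\<rightarrow> l"
    using tendsto_divide_factor[OF ev_goodz Ed, where a="- w" and k=0] by blast
  then obtain a1 where a1: "E1 \<midarrow>- w\<rightarrow> a1" using E_limit_deriv by auto
  have lim: "\<exists>l. E1 \<midarrow>z\<rightarrow> l" for z
  proof -
    consider "goodz z" | "Th 0 t z = 0" | "Th 0 t (z + w) = 0" unfolding goodz_def by blast
    thus ?thesis
    proof cases
      case 1
      thus ?thesis using E1d field_differentiable_imp_continuous_at isCont_def by blast
    next
      case 2
      hence "E1 (u + z) = E1 u" for u using lattice_periodic[OF per1 per2] Th0_eq_0_iff[OF tau] by blast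
      from this[of "_ - z"] have "E1 (u + - z) = E1 u" for u by simp
      thus ?thesis using LIM_offset[OF a0, of "- z"] by auto
    next
      case 3
      hence h: "E1 (u + (z + w)) = E1 u" for u using lattice_periodic[OF per1 per2] Th0_eq_0_iff[OF tau] by blast
      have "E1 (u + - (z + w)) = E1 u" for u
        using h[of "u + - (z + w)"] by (simp only: add.assoc left_minus add_0_right)
      hence "(\<lambda>u. E1 (u + - (z + w))) = E1" by (rule ext)
      thus ?thesis using LIM_offset[OF a1, of "- (z + w)"] by auto
    qed
  qed
  obtain c where c: "\<And>z. E1 \<midarrow>z\<rightarrow> c"
    using elliptic_const[OF isolated_singularityI[OF ev_goodz E1d] lim tau] per1 per2 by auto
  have E1c: "E1 z = c" if "goodz z" for z
  proof -
    have "E1 \<midarrow>z\<rightarrow> E1 z" using E1d[OF that] field_differentiable_imp_continuous_at isCont_def by blast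
    with c[of z] show ?thesis by (rule LIM_unique[symmetric])
  qed
  have "(\<lambda>z. E z - c * z) constant_on {z. goodz z}"
  proof (rule has_field_derivative_0_imp_constant_on[OF _ connected_goodz open_goodz])
    fix z assume "z \<in> {z. goodz z}"
    hence "DERIV (\<lambda>z. E z - c * z) z :> E1 z - c * 1"
      by (intro DERIV_diff dE DERIV_cmult DERIV_ident) auto
    thus "DERIV (\<lambda>z. E z - c * z) z :> 0" using E1c \<open>z \<in> _\<close> by simp
  qed
  then obtain b where b: "\<And>z. goodz z ==> E z - c * z = b" unfolding constant_on_def by auto
  \<comment> \<open>\<open>E\<close> has the form c z + b; invariance under 1 gives c = 0, and the
    increment under \<open>t\<close> then gives rho = 0.\<close>
  obtain z0 where z0: "goodz z0" using eventually_happens'[OF at_neq_bot ev_goodz] by blast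
  have e: "z0 + 1 + w = z0 + w + 1" "z0 + t + w = z0 + w + t" by simp_all
  have ps: "psi t (z0 + w + t) = psi t (z0 + w) - 2 * of_real pi * \<i>"
    using z0 by (intro psi_tau[OF tau]) (simp add: goodz_def)
  have "E (z0 + 1) = E z0"
    unfolding E_def e psi_1[OF tau] using per[of 1 z0] z0 by simp
  moreover have "E (z0 + t) = E z0 + tpi * rho"
    unfolding E_def e ps using per[of t z0] z0 by (simp add: algebra_simps)
  ultimately have c0: "c = 0" "rho = 0"
    using b[OF z0] b[of "z0 + 1"] b[of "z0 + t"] goodz_shift[of 1 z0] goodz_shift[of t z0] z0
    by (auto simp: algebra_simps)
  thus ?thesis using b by (auto simp: E_def)
qed

text \<open>Induction on the order of the pole at 0: subtracting a multiple of the basis function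
  with the same leading term lowers it by one. In the base case \<open>bas 1\<close> brings its own
  simple pole at \<open>- w\<close>, which \<open>elliptic_simple_pole_const\<close> can
  absorb.\<close>

lemma elliptic_expansion:
  assumes d: "\<And>z. goodz z ==> f field_differentiable (at z)"
    and per: "\<And>p z. p \<in> {1, t} ==> goodz z ==> f (z + p) = f z"
    and l0: "\<exists>l. (\<lambda>z. z ^ Suc n * f z) \<midarrow>0\<rightarrow> l" and lw: "\<exists>l. (\<lambda>z. (z + w) * f z) \<midarrow>- w\<rightarrow> l"
  shows "\<exists>c. \<forall>z. goodz z \<longrightarrow> f z = (\<Sum>k\<le>Suc n. c k * bas k t w z)"
  using assms
proof (induction n arbitrary: f)
  case 0
  then obtain l where l: "(\<lambda>z. z ^ Suc 0 * f z) \<midarrow>0\<rightarrow> l" by blast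
  define g where "g = (\<lambda>z. f z - l * bas 1 t w z)"
  have dg: "g field_differentiable (at z)" if "goodz z" for z
    unfolding g_def using 0(1)[OF that] bas_differentiable[OF that, of 1]
    by (intro field_differentiable_diff field_differentiable_mult field_differentiable_const)
  have perg: "g (z + p) = g z" if "p \<in> {1, t}" "goodz z" for p z
    unfolding g_def using 0(2)[OF that] bas_periodic[OF that] by simp
  have "(\<lambda>z. z ^ Suc 0 * f z - l * (z ^ 1 * bas 1 t w z)) \<midarrow>0\<rightarrow> l - l * 1"
    by (intro tendsto_intros l bas_limit) simp
  hence "(\<lambda>z. (z - 0) ^ Suc 0 * g z) \<midarrow>0\<rightarrow> 0" by (simp add: g_def algebra_simps)
  hence l0: "\<exists>l. g \<midarrow>0\<rightarrow> l" using tendsto_divide_factor[OF ev_goodz dg, where k=0 and a=0] by simp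
  have psiw: "(\<lambda>z. psi t (z + w)) \<midarrow>0\<rightarrow> psi t w"
    using LIM_offset[of "psi t" _ w w] DERIV_isCont[OF psi_deriv[OF tau w]] by (simp add: isCont_def)
  have "\<exists>l. (\<lambda>z. (z + w) * bas 1 t w z) \<midarrow>- w\<rightarrow> l"
  proof -
    have w': "Th 0 t (- w) ~= 0" using w Th0_minus_iff[OF tau] by simp
    have 1: "psi t \<midarrow>- w\<rightarrow> psi t (- w)" using DERIV_isCont[OF psi_deriv[OF tau w']] by (simp add: isCont_def)
    have "(\<lambda>z. z ^ 1 * bas 1 t w z - z * (- psi t (z + w) + psi t w)) \<midarrow>0\<rightarrow> 1 - 0 * (- psi t w + psi t w)"
      by (intro tendsto_intros bas_limit psiw) simp
    hence "(\<lambda>z. z * psi t z) \<midarrow>0\<rightarrow> 1" by (simp add: bas_def algebra_simps)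
    from LIM_offset[OF this, of w] have 2: "(\<lambda>z. (z + w) * psi t (z + w)) \<midarrow>- w\<rightarrow> 1" by simp
    have "(\<lambda>z. (z + w) * (psi t z + psi t w) - (z + w) * psi t (z + w)) \<midarrow>- w\<rightarrow> (- w + w) * (psi t (- w) + psi t w) - 1"
      by (intro tendsto_intros 1 2)
    thus ?thesis by (auto simp: bas_def algebra_simps)
  qed
  then obtain l1 l2 where "(\<lambda>z. (z + w) * bas 1 t w z) \<midarrow>- w\<rightarrow> l1" "(\<lambda>z. (z + w) * f z) \<midarrow>- w\<rightarrow> l2" using 0(4) by blast
  hence "(\<lambda>z. (z + w) * f z - l * ((z + w) * bas 1 t w z)) \<midarrow>- w\<rightarrow> l2 - l * l1" by (intro tendsto_intros)
  hence lw: "\<exists>l. (\<lambda>z. (z + w) * g z) \<midarrow>- w\<rightarrow> l" by (auto simp: g_def algebra_simps)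
  obtain c where c: "\<And>z. goodz z ==> g z = c" using elliptic_simple_pole_const[OF dg perg l0 lw] by blast
  show ?case
    by (rule exI[of _ "\<lambda>k. if k = 0 then c else l"]) (use c in \<open>auto simp: g_def bas_def algebra_simps\<close>)
next
  case (Suc n)
  then obtain l where l: "(\<lambda>z. z ^ Suc (Suc n) * f z) \<midarrow>0\<rightarrow> l" by blast
  let ?b = "bas (Suc (Suc n)) t w"
  define g where "g = (\<lambda>z. f z - l * ?b z)"
  have dg: "g field_differentiable (at z)" if "goodz z" for z
    unfolding g_def using Suc.prems(1)[OF that] bas_differentiable[OF that, of "Suc (Suc n)"]
    by (intro field_differentiable_diff field_differentiable_mult field_differentiable_const)
  have perg: "g (z + p) = g z" if "p \<in> {1, t}" "goodz z" for p z
    unfolding g_def using Suc.prems(2)[OF that] bas_periodic[OF that] by simp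
  have "(\<lambda>z. z ^ Suc (Suc n) * f z - l * (z ^ Suc (Suc n) * ?b z)) \<midarrow>0\<rightarrow> l - l * 1"
    by (intro tendsto_intros l bas_limit) simp
  hence "(\<lambda>z. (z - 0) ^ Suc (Suc n) * g z) \<midarrow>0\<rightarrow> 0" by (simp add: g_def algebra_simps)
  hence l0: "\<exists>l. (\<lambda>z. z ^ Suc n * g z) \<midarrow>0\<rightarrow> l" using tendsto_divide_factor[OF ev_goodz dg, where k="Suc n" and a=0] by (simp only: diff_zero)
  have "isCont ?b (- w)" using bas_differentiable_minus_w[of "Suc (Suc n)"] field_differentiable_imp_continuous_at by simp
  hence b: "?b \<midarrow>- w\<rightarrow> ?b (- w)" by (simp add: isCont_def)
  obtain l2 where l2: "(\<lambda>z. (z + w) * f z) \<midarrow>- w\<rightarrow> l2" using Suc.prems(4) by blast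
  have "(\<lambda>z. (z + w) * f z - l * ((z + w) * ?b z)) \<midarrow>- w\<rightarrow> l2 - l * ((- w + w) * ?b (- w))" by (intro tendsto_intros l2 b)
  hence lw: "\<exists>l. (\<lambda>z. (z + w) * g z) \<midarrow>- w\<rightarrow> l" by (auto simp: g_def algebra_simps)
  obtain c where c: "\<And>z. goodz z ==> g z = (\<Sum>k\<le>Suc n. c k * bas k t w z)" using Suc.IH[OF dg perg l0 lw] by blast
  have "f z = (\<Sum>k\<le>Suc (Suc n). (if k = Suc (Suc n) then l else c k) * bas k t w z)" if "goodz z" for z
  proof -
    have "f z = (\<Sum>k\<le>Suc n. c k * bas k t w z) + l * ?b z" using c[OF that] by (simp add: g_def algebra_simps)
    also have "(\<Sum>k\<le>Suc n. c k * bas k t w z) = (\<Sum>k\<le>Suc n. (if k = Suc (Suc n) then l else c k) * bas k t w z)"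
      by (intro sum.cong) auto
    finally show ?thesis by simp
  qed
  thus ?case by (intro exI[of _ "\<lambda>k. if k = Suc (Suc n) then l else c k"]) blast
qed

end

end

subsection \<open>The superpotential and its coefficients\<close>

definition lam :: "'n::finite point => complex => complex" where
  "lam x z = exp (- 2 * of_real pi * \<i> * x $ X0)
     * (\<Prod>i\<in>UNIV. Th 0 (tau x) (z - full_v x i + x $ Xv))
     / (Th 0 (tau x) z ^ CARD('n) * Th 0 (tau x) (z + shift_v x))"

definition reg_x :: "'n::finite point => bool" where
  "reg_x x \<longleftrightarrow> Im (tau x) > 0 \<and> Th 0 (tau x) (shift_v x) ~= 0"

lemma sum_full_v: "(\<Sum>!i. full_v x i) = 0"
  by (simp add: full_v_def UNIV_option_conv sum.reindex)

lemma phi_identity_iff: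
  fixes x :: "'n::finite point"
  assumes "reg_x x" "goodz (tau x) (shift_v x) z"
  shows "phi_identity x c z \<longleftrightarrow> lam x z = (\<Sum>k\<le>CARD('n). c k * bas k (tau x) (shift_v x) z)"
proof -
  define t w n where "t = x $ Xtau" and "w = shift_v x" and "n = CARD('n)"
  have tau: "Im t > 0" and w: "Th 0 t w ~= 0" using assms(1) by (auto simp: reg_x_def t_def w_def)
  have n: "n \<ge> 1" unfolding n_def by (simp add: Suc_le_eq)
  have nz: "z \<notin> lattice_of t" "z + w \<notin> lattice_of t" "w \<notin> lattice_of t"
    using assms(2) w Th0_eq_0_iff[OF tau] by (auto simp: goodz_def[OF tau w] t_def[symmetric] w_def[symmetric])
  have l: "exp (- 2 * of_real pi * \<i> * x $ X0) * (\<Prod>i\<in>UNIV. theta1 t (z - full_v x i + x $ Xv))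
        / (theta1 t z ^ n * theta1 t (z + w)) = lam x z"
    unfolding theta1_eq_Th[OF tau] lam_def by (simp add: t_def w_def n_def)
  have z1: "weier_zeta t z - weier_zeta t (z + w) + weier_zeta t w = bas 1 t w z"
    using nz by (simp add: weier_zeta_eq_psi[OF tau] bas_def algebra_simps)
  have zk: "(-1) ^ k / fact (k - 1) * c k * (deriv ^^ (k - 2)) (weier_p t) z = c k * bas k t w z" if "k \<in> {2..n}" for k
  proof -
    have "Suc (k - 2) = k - 1" "k - 2 = 0 \<longleftrightarrow> k = 2" using that by auto
    hence "(deriv ^^ (k - 2)) (weier_p t) z = - psid (k - 1) t z - (if k = 2 then wp_const t else 0)"
      using higher_deriv_weier_p[OF tau nz(1), of "k - 2"] by simp
    thus ?thesis using that by (simp add: bas_def)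
  qed
  have "{..n} = insert 0 (insert 1 {2..n})" using n by auto
  hence "(\<Sum>k\<le>n. c k * bas k t w z) = c 0 * bas 0 t w z + (c 1 * bas 1 t w z + (\<Sum>k=2..n. c k * bas k t w z))"
    by simp
  also have "... = (\<Sum>k=2..n. (-1) ^ k / fact (k - 1) * c k * (deriv ^^ (k - 2)) (weier_p t) z)
        + c 1 * (weier_zeta t z - weier_zeta t (z + w) + weier_zeta t w) + c 0"
    unfolding z1 using zk by (simp add: bas_def[of 0])
  finally show ?thesis
    unfolding phi_identity_def Let_def t_def[symmetric] w_def[symmetric] n_def[symmetric] l by simp
qed

text \<open>The multipliers of numerator and denominator of the superpotential agree because its
  zeros add up to \<open>- w\<close>, the sum of its poles with multiplicity.\<close>

lemma prod_autf:
  fixes x :: "'n::finite point"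
  shows "(\<Prod>i\<in>UNIV. - autf t (z - full_v x i + x $ Xv)) = (- autf t z) ^ CARD('n) * (- autf t (z + shift_v x))"
proof -
  let ?N = "UNIV :: 'n option set"
  have 1: "autf t (z - full_v x i + x $ Xv) = autf t z * exp (tpi * (full_v x i - x $ Xv))" for i
    unfolding autf_def exp_add[symmetric] by (rule arg_cong[where f=exp]) (simp add: algebra_simps)
  have "(\<Prod>i\<in>?N. - autf t (z - full_v x i + x $ Xv)) = (\<Prod>i\<in>?N. - autf t z) * (\<Prod>i\<in>?N. exp (tpi * (full_v x i - x $ Xv)))"
    unfolding 1 prod.distrib[symmetric] by simp
  also have "(\<Prod>i\<in>?N. exp (tpi * (full_v x i - x $ Xv))) = exp (\<Sum>i\<in>?N. 2 * of_real pi * \<i> * (full_v x i - x $ Xv))"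
    by (simp add: exp_sum)
  also have "(\<Sum>i\<in>?N. 2 * of_real pi * \<i> * (full_v x i - x $ Xv)) = tpi * (\<Sum>i\<in>?N. full_v x i - x $ Xv)"
    by (simp add: sum_distrib_left)
  also have "(\<Sum>i\<in>?N. full_v x i - x $ Xv) = - shift_v x"
    by (simp add: sum_subtractf sum_full_v shift_v_def card_UNIV_option algebra_simps)
  also have "(\<Prod>i\<in>?N. - autf t z) = (- autf t z) ^ CARD('n) * (- autf t z)"
    by (simp add: card_UNIV_option mult.commute)
  also have "(- autf t z) ^ CARD('n) * (- autf t z) * exp (tpi * - shift_v x)
      = (- autf t z) ^ CARD('n) * (- (autf t z * exp (tpi * - shift_v x)))" by simp
  also have "autf t z * exp (tpi * - shift_v x) = autf t (z + shift_v x)"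
    unfolding autf_def exp_add[symmetric] by (rule arg_cong[where f=exp]) (simp add: algebra_simps)
  finally show ?thesis .
qed

context
  fixes x :: "'n::finite point"
  assumes reg: "reg_x x"
begin

lemma reg_tau: "Im (tau x) > 0" and reg_w: "Th 0 (tau x) (shift_v x) ~= 0"
  using reg by (auto simp: reg_x_def)

lemma lam_periodic:
  assumes "p \<in> {1, x $ Xtau}" "goodz (tau x) (shift_v x) z"
  shows "lam x (z + p) = lam x z"
proof -
  have s: "z + p - full_v x i + x $ Xv = (z - full_v x i + x $ Xv) + p" "z + p + shift_v x = (z + shift_v x) + p" for i
    by simp_all
  consider "p = 1" | "p = x $ Xtau" using assms(1) by blast
  thus ?thesis
  proof cases
    case 1
    have "(\<Prod>i\<in>UNIV. Th 0 (tau x) (z + p - full_v x i + x $ Xv)) = (\<Prod>i\<in>(UNIV::'n option set). -1) * (\<Prod>i\<in>UNIV. Th 0 (tau x) (z - full_v x i + x $ Xv))"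
      unfolding s unfolding prod.distrib[symmetric] 1 Th_periodic_1[OF reg_tau] by simp
    also have "(\<Prod>i\<in>(UNIV::'n option set). -1) = ((-1) ^ CARD('n) * (-1) :: complex)" by (simp add: card_UNIV_option)
    finally have n: "(\<Prod>i\<in>UNIV. Th 0 (tau x) (z + p - full_v x i + x $ Xv)) = (-1) ^ CARD('n) * (-1) * (\<Prod>i\<in>UNIV. Th 0 (tau x) (z - full_v x i + x $ Xv))" .
    have d: "Th 0 (tau x) (z + p) ^ CARD('n) * Th 0 (tau x) (z + p + shift_v x)
       = (-1) ^ CARD('n) * (-1) * (Th 0 (tau x) z ^ CARD('n) * Th 0 (tau x) (z + shift_v x))"
      unfolding s unfolding 1 Th_periodic_1[OF reg_tau] by (simp add: power_minus')
    have "(-1) ^ CARD('n) * (-1) ~= (0::complex)" by simp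
    thus ?thesis unfolding lam_def n d mult.left_commute[of "exp _"]
      by (rule mult_divide_mult_cancel_left)
  next
    case 2
    let ?F = "(- autf (tau x) z) ^ CARD('n) * (- autf (tau x) (z + shift_v x))"
    have n: "(\<Prod>i\<in>UNIV. Th 0 (tau x) (z + p - full_v x i + x $ Xv)) = ?F * (\<Prod>i\<in>UNIV. Th 0 (tau x) (z - full_v x i + x $ Xv))"
      unfolding s unfolding 2 Th0_periodic_tau[OF reg_tau] prod.distrib prod_autf ..
    have d: "Th 0 (tau x) (z + p) ^ CARD('n) * Th 0 (tau x) (z + p + shift_v x)
       = ?F * (Th 0 (tau x) z ^ CARD('n) * Th 0 (tau x) (z + shift_v x))"
      unfolding s unfolding 2 Th0_periodic_tau[OF reg_tau] power_mult_distrib by (simp only: mult_ac)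
    have "?F ~= 0" by simp
    thus ?thesis unfolding lam_def n d mult.left_commute[of "exp _"]
      by (rule mult_divide_mult_cancel_left)
  qed
qed

lemma isCont_num: "isCont (\<lambda>z. exp (- 2 * of_real pi * \<i> * x $ X0) * (\<Prod>i\<in>UNIV. Th 0 (tau x) (z - full_v x i + x $ Xv))) z"
  by (intro continuous_intros isCont_o2[OF _ isCont_Th[OF reg_tau]])

lemma num_differentiable: "(\<lambda>z. \<Prod>i\<in>UNIV. Th 0 (tau x) (z - full_v x i + x $ Xv)) field_differentiable (at z)"
proof -
  have e: "z - full_v x i + x $ Xv = z + (x $ Xv - full_v x i)" for z i by simp
  have "(\<lambda>z. Th 0 (tau x) (z + c)) holomorphic_on UNIV" for c
    using DERIV_shift_eq[OF Th_deriv_z[OF reg_tau]] by (auto simp: holomorphic_on_open)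
  hence "(\<lambda>z. \<Prod>i\<in>(UNIV::'n option set). Th 0 (tau x) (z + (x $ Xv - full_v x i))) holomorphic_on UNIV"
    by (intro holomorphic_intros)
  thus ?thesis unfolding e using holomorphic_on_imp_differentiable_at by blast
qed

lemma lam_differentiable:
  assumes "goodz (tau x) (shift_v x) z"
  shows "lam x field_differentiable (at z)"
proof -
  have 1: "Th 0 (tau x) field_differentiable (at z)" "(\<lambda>z. Th 0 (tau x) (z + shift_v x)) field_differentiable (at z)"
    using Th_deriv_z[OF reg_tau, of 0 z] DERIV_shift_eq[OF Th_deriv_z[OF reg_tau, of 0 "z + shift_v x"]]
    unfolding field_differentiable_def by blast+
  have "lam x = (\<lambda>z. exp (- 2 * of_real pi * \<i> * x $ X0) * (\<Prod>i\<in>UNIV. Th 0 (tau x) (z - full_v x i + x $ Xv))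
     / (Th 0 (tau x) z ^ CARD('n) * Th 0 (tau x) (z + shift_v x)))"
    by (simp add: lam_def fun_eq_iff)
  moreover have "... field_differentiable (at z)"
    using assms unfolding goodz_def[OF reg_tau reg_w]
    by (intro field_differentiable_divide field_differentiable_mult field_differentiable_power num_differentiable 1 field_differentiable_const) auto
  ultimately show ?thesis by simp
qed

lemma z_over_theta: "(\<lambda>z. z / Th 0 (tau x) z) \<midarrow>0\<rightarrow> 1 / Th 1 (tau x) 0"
  by (rule lhopital_complex_simple[OF DERIV_ident Th_derivs(1)[OF reg_tau]])
     (use reg_tau Th1_0_nonzero[OF reg_tau] in auto)

lemma lam_expansion: "\<exists>c. \<forall>z. goodz (tau x) (shift_v x) z \<longrightarrow> lam x z = (\<Sum>k\<le>CARD('n). c k * bas k (tau x) (shift_v x) z)"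
proof -
  define t w N where "t = x $ Xtau" and "w = shift_v x"
    and "N = (\<lambda>z. exp (- 2 * of_real pi * \<i> * x $ X0) * (\<Prod>i\<in>UNIV. Th 0 t (z - full_v x i + x $ Xv)))"
  have tau: "Im t > 0" and w: "Th 0 t w ~= 0" using reg_tau reg_w by (auto simp: t_def w_def)
  have l: "lam x z = N z / (Th 0 t z ^ CARD('n) * Th 0 t (z + w))" for z
    by (simp add: lam_def N_def t_def w_def)
  have N: "N \<midarrow>z\<rightarrow> N z" for z using isCont_num[of z] unfolding isCont_def N_def t_def .
  have Tc: "Th 0 t \<midarrow>z\<rightarrow> Th 0 t z" for z using isCont_Th[OF tau] by (simp add: isCont_def)
  have Tw: "(\<lambda>z. Th 0 t (z + w)) \<midarrow>0\<rightarrow> Th 0 t w" using LIM_offset[OF Tc[of w], of w] by simp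
  obtain n where n: "CARD('n) = Suc n" by (metis not0_implies_Suc zero_less_card_finite less_irrefl)
  have "(\<lambda>z. (z / Th 0 t z) ^ CARD('n) * (N z / Th 0 t (z + w))) \<midarrow>0\<rightarrow> (1 / Th 1 t 0) ^ CARD('n) * (N 0 / Th 0 t w)"
    using w by (intro tendsto_intros z_over_theta[folded t_def] N Tw)
  moreover have "(z / Th 0 t z) ^ CARD('n) * (N z / Th 0 t (z + w)) = z ^ Suc n * lam x z" for z
    unfolding l n[symmetric] by (simp add: power_divide)
  ultimately have l0: "\<exists>l. (\<lambda>z. z ^ Suc n * lam x z) \<midarrow>0\<rightarrow> l" by auto
  have w': "Th 0 t (- w) ~= 0" using w Th0_minus_iff[OF tau] by simp
  have "(\<lambda>z. (z + w) / Th 0 t (z + w)) \<midarrow>- w\<rightarrow> 1 / Th 1 t 0"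
    using LIM_offset[OF z_over_theta[folded t_def], of w] by simp
  hence "(\<lambda>z. (z + w) / Th 0 t (z + w) * (N z / Th 0 t z ^ CARD('n))) \<midarrow>- w\<rightarrow> 1 / Th 1 t 0 * (N (- w) / Th 0 t (- w) ^ CARD('n))"
    by (rule tendsto_mult[OF _ tendsto_divide[OF N tendsto_power[OF Tc]]]) (use w' in simp)
  moreover have "(z + w) / Th 0 t (z + w) * (N z / Th 0 t z ^ CARD('n)) = (z + w) * lam x z" for z
    unfolding l by simp
  ultimately have lw: "\<exists>l. (\<lambda>z. (z + w) * lam x z) \<midarrow>- w\<rightarrow> l" by auto
  show ?thesis
    unfolding n using elliptic_expansion[OF reg_tau reg_w lam_differentiable lam_periodic l0 lw[unfolded w_def]] .
qed

text \<open>Justifies the definite description in \<open>phi\<close>: existence is the expansion of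
  the superpotential, uniqueness the independence of the basis functions near 0.\<close>

lemma phi_props:
  "k > CARD('n) ==> phi x k = 0"
  "goodz (tau x) (shift_v x) z ==> lam x z = (\<Sum>k\<le>CARD('n). phi x k * bas k (tau x) (shift_v x) z)"
proof -
  let ?g = "goodz (tau x) (shift_v x)"
  let ?Q = "\<lambda>c. (\<forall>k > CARD('n). c k = 0) \<and> (\<forall>z. ?g z \<longrightarrow> lam x z = (\<Sum>k\<le>CARD('n). c k * bas k (tau x) (shift_v x) z))"
  have g: "?g z \<longleftrightarrow> z \<notin> lattice_of (tau x) \<and> z + shift_v x \<notin> lattice_of (tau x)" for z
    unfolding goodz_def[OF reg_tau reg_w] by (simp add: Th0_eq_0_iff[OF reg_tau])
  have Q: "((\<forall>k > CARD('n). c k = 0) \<and>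
     (\<forall>z. z \<notin> lattice_of (tau x) \<and> z + shift_v x \<notin> lattice_of (tau x) \<longrightarrow> phi_identity x c z)) \<longleftrightarrow> ?Q c" for c
    unfolding g[symmetric] using phi_identity_iff[OF reg] by blast
  obtain c0 where c0: "\<forall>z. ?g z \<longrightarrow> lam x z = (\<Sum>k\<le>CARD('n). c0 k * bas k (tau x) (shift_v x) z)"
    using lam_expansion by blast
  have ex: "?Q (\<lambda>k. if k \<le> CARD('n) then c0 k else 0)" using c0 by (auto intro!: sum.cong)
  have uniq: "c = c'" if "?Q c" "?Q c'" for c c'
  proof
    fix k
    show "c k = c' k"
    proof (cases "k \<le> CARD('n)")
      case True
      have "eventually (\<lambda>z. (\<Sum>k\<le>CARD('n). (c k - c' k) * bas k (tau x) (shift_v x) z) = 0) (at 0)"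
        using ev_goodz[OF reg_tau reg_w, of 0]
      proof eventually_elim
        case (elim z)
        hence "(\<Sum>k\<le>CARD('n). c k * bas k (tau x) (shift_v x) z) = (\<Sum>k\<le>CARD('n). c' k * bas k (tau x) (shift_v x) z)"
          using that by metis
        thus ?case by (simp add: left_diff_distrib sum_subtractf)
      qed
      from bas_independent[OF reg_tau reg_w this True] show ?thesis by simp
    qed (use that in auto)
  qed
  have "\<exists>!c. ?Q c"
  proof (rule ex1I)
    show "?Q (\<lambda>k. if k \<le> CARD('n) then c0 k else 0)" by (rule ex)
    show "c = (\<lambda>k. if k \<le> CARD('n) then c0 k else 0)" if "?Q c" for c by (rule uniq[OF that ex])
  qed
  hence "?Q (THE c. ?Q c)" by (rule theI')
  moreover have "(THE c. ?Q c) = phi x"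
    unfolding phi_def by (rule arg_cong[where f=The]) (rule ext, rule Q[symmetric])
  ultimately have "?Q (phi x)" by (simp only:)
  thus "k > CARD('n) ==> phi x k = 0"
    "?g z ==> lam x z = (\<Sum>k\<le>CARD('n). phi x k * bas k (tau x) (shift_v x) z)" by blast+
qed

end

section \<open>Holomorphy of the invariants\<close>

text \<open>If the vectors did not span, a linear map killing their span and fixing some vector
  outside would have a nonzero coordinate functional vanishing on all of them. So they span, and a
  basis chosen among them supplies the rows.\<close>

lemma exists_invertible_rows:
  fixes v :: "'z => complex ^ 'm::finite"
  assumes "\<And>c. (\<And>z. z \<in> Z ==> (\<Sum>!k. c k * v z $ k) = 0) ==> (\<forall>k. c k = 0)"
  shows "\<exists>p. (\<forall>j. p j \<in> Z) \<and> invertible ((\<chi> j. v (p j)) :: complex ^ 'm ^ 'm)"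
proof -
  obtain Bs where Bs: "Bs \<subseteq> v ` Z" "vec.independent Bs" "v ` Z \<subseteq> vec.span Bs"
    using vec.maximal_independent_subset[of "v ` Z"] by blast
  have span: "vec.span Bs = UNIV"
  proof (rule ccontr)
    assume "vec.span Bs ~= UNIV"
    then obtain e where e: "e \<notin> vec.span Bs" by blast
    hence ind: "vec.independent (insert e Bs)" using Bs(2) by (simp add: vec.independent_insert)
    have eB: "e \<notin> Bs" using e vec.span_base by blast
    obtain g where g: "Vector_Spaces.linear (*s) (*s) g" "\<And>b. b \<in> insert e Bs ==> g b = (if b = e then e else 0)"
      using vec.linear_independent_extend[OF ind, of "\<lambda>b. if b = e then e else 0"] by blast
    interpret g: Vector_Spaces.linear "(*s)" "(*s)" g by (rule g(1))
    have "e ~= 0" using e vec.span_zero by metis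
    then obtain i where i: "e $ i ~= 0" by (auto simp: vec_eq_iff)
    define c where "c = (\<lambda>k. g (axis k 1) $ i)"
    have gx: "g x $ i = (\<Sum>!k. c k * x $ k)" for x
    proof -
      have "g x = g (\<Sum>!k. x $ k *s axis k 1)" by (subst vec_eq_sum_axis) simp
      also have "... = (\<Sum>!k. x $ k *s g (axis k 1))" by (simp add: g.sum g.scale)
      finally show ?thesis by (simp add: c_def mult.commute)
    qed
    have gs: "g x = 0" if "x \<in> vec.span Bs" for x
      using that
    proof (induction rule: vec.span_induct_alt)
      case base
      thus ?case by (simp add: g.zero)
    next
      case (step a x y)
      thus ?case using g(2)[of x] eB by (auto simp: g.add g.scale)
    qed
    have "(\<Sum>!k. c k * v z $ k) = 0" if "z \<in> Z" for z
      using gs[of "v z"] gx[of "v z"] Bs(3) that by auto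
    hence "\<forall>k. c k = 0" by (rule assms)
    hence "g e $ i = 0" using gx[of e] by simp
    with g(2)[of e] i show False by simp
  qed
  have fin: "finite Bs" using vec.finiteI_independent Bs(2) by blast
  have "card Bs = vec.dim (UNIV :: (complex ^ 'm) set)"
    using vec.dim_eq_card[of Bs UNIV] span Bs(2) by (metis vec.span_UNIV)
  hence "card Bs = CARD('m)" by (simp add: card_cart_basis)
  then obtain h where h: "bij_betw h (UNIV :: 'm set) Bs"
    using finite_same_card_bij[of "UNIV :: 'm set" Bs] fin by auto
  have "\<exists>z\<in>Z. h j = v z" for j using h Bs(1) bij_betwE[OF h] by fastforce
  then obtain p where p: "\<And>j. p j \<in> Z" "\<And>j. h j = v (p j)" by metis
  have "rows (\<chi> j. v (p j)) = Bs"
  proof -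
    have "row j (\<chi> j. v (p j)) = h j" for j by (simp add: row_def p(2) vec_eq_iff)
    thus ?thesis using h unfolding rows_def bij_betw_def by auto
  qed
  then obtain A where "A ** (\<chi> j. v (p j)) = mat 1"
    using matrix_left_invertible_span_rows_gen[of "\<chi> j. v (p j)"] span by auto
  hence "invertible (\<chi> j. v (p j))" unfolding invertible_left_inverse by (rule exI)
  with p(1) have "(\<forall>j. p j \<in> Z) \<and> invertible (\<chi> j. v (p j))" by simp
  thus ?thesis by (intro exI[of _ p])
qed

text \<open>The n + 1 invariants are indexed by \<open>'n option\<close>, with \<open>None\<close>
  for index 0, so that they match n + 1 evaluation points in a square matrix.\<close>

definition kidx :: "'n::{finite,linorder} option => nat" where
  "kidx i = (case i of None => 0 | Some j => rank j)"

lemma rank_bij: "bij_betw rank (UNIV :: 'n::{finite,linorder} set) {1..CARD('n)}"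
proof -
  have mono: "rank i < rank j" if "i < j" for i j :: 'n
    unfolding rank_def by (rule psubset_card_mono) (use that in auto)
  have inj: "inj (rank :: 'n => nat)"
  proof (rule injI)
    fix i j :: 'n assume "rank i = rank j"
    thus "i = j" using mono[of i j] mono[of j i] by (cases i j rule: linorder_cases) auto
  qed
  have "rank i \<in> {1..CARD('n)}" for i :: 'n
    unfolding rank_def by (auto intro!: card_mono simp: Suc_le_eq card_gt_0_iff)
  hence "rank ` (UNIV :: 'n set) \<subseteq> {1..CARD('n)}" by blast
  moreover have "card (rank ` (UNIV :: 'n set)) = card {1..CARD('n)}"
    using card_image[OF inj] by simp
  ultimately have "rank ` (UNIV :: 'n set) = {1..CARD('n)}"
    by (intro card_subset_eq) auto
  with inj show ?thesis by (simp add: bij_betw_def)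
qed

lemma kidx_bij: "bij_betw kidx (UNIV :: 'n::{finite,linorder} option set) {..CARD('n)}"
proof -
  have "inj (kidx :: 'n option => nat)"
  proof (rule injI)
    fix i j :: "'n option" assume *: "kidx i = kidx j"
    have "rank a \<ge> 1" for a :: 'n using bspec[OF bij_betwE[OF rank_bij], of a] by auto
    hence "rank a ~= 0" for a :: 'n by (metis not_one_le_zero)
    moreover have "x = y" if "rank x = rank y" for x y :: 'n
      by (rule injD[OF bij_betw_imp_inj_on[OF rank_bij] that])
    ultimately show "i = j" using *
      by (cases i; cases j) (simp_all add: kidx_def)
  qed
  moreover have "kidx ` (UNIV :: 'n option set) = {..CARD('n)}"
  proof -
    have "kidx ` (UNIV :: 'n option set) = insert 0 (rank ` (UNIV :: 'n set))"
      by (auto simp: kidx_def UNIV_option_conv image_image)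
    also have "... = {..CARD('n)}" using bij_betw_imp_surj_on[OF rank_bij] by auto
    finally show ?thesis .
  qed
  ultimately show ?thesis by (simp add: bij_betw_def)
qed

lemma sum_kidx: "(\<Sum>k\<in>(UNIV::'n::{finite,linorder} option set). f (kidx k)) = (\<Sum>k\<le>CARD('n). f k)"
  by (rule sum.reindex_bij_betw[OF kidx_bij])

text \<open>The matrix that turns the vector of invariants into the values of the superpotential at
  the points \<open>p j\<close>.\<close>

definition Bmat :: "'n::{finite,linorder} point => ('n option => complex) => complex ^ 'n option ^ 'n option" where
  "Bmat x p = (\<chi> j k. bas (kidx k) (tau x) (shift_v x) (p j))"

lemma exists_points:
  fixes x :: "'n::{finite,linorder} point"
  assumes "reg_x x" "eventually P (at 0)"
  shows "\<exists>p. (\<forall>j. P (p j)) \<and> invertible (Bmat x p)"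
proof -
  have "\<exists>p. (\<forall>j. p j \<in> {z. P z}) \<and> invertible ((\<chi> j. (\<lambda>z. \<chi> k. bas (kidx k) (tau x) (shift_v x) z) (p j)) :: complex ^ 'n option ^ 'n option)"
  proof (rule exists_invertible_rows, intro allI)
    fix c :: "'n option => complex" and k :: "'n option"
    assume *: "\<And>z. z \<in> {z. P z} ==> (\<Sum>!k. c k * (\<chi> k::'n option. bas (kidx k) (tau x) (shift_v x) z) $ k) = 0"
    define d where "d = (\<lambda>i. c (inv_into UNIV kidx i))"
    have dk: "d (kidx k) = c k" for k
      unfolding d_def by (simp add: inv_into_f_f[OF bij_betw_imp_inj_on[OF kidx_bij]])
    have "eventually (\<lambda>z. (\<Sum>i\<le>CARD('n). d i * bas i (tau x) (shift_v x) z) = 0) (at 0)"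
      using assms(2)
    proof eventually_elim
      case (elim z)
      thus ?case using *[of z] unfolding sum_kidx[symmetric] by (simp add: dk)
    qed
    moreover have "kidx k \<le> CARD('n)" using bspec[OF bij_betwE[OF kidx_bij], of k] by simp
    ultimately have "d (kidx k) = 0"
      using assms(1) by (intro bas_independent) (auto simp: reg_x_def)
    thus "c k = 0" by (simp add: dk)
  qed
  thus ?thesis by (simp add: Bmat_def)
qed

section \<open>Joint holomorphy in tau and z\<close>

definition psi_dom :: "(complex ^ 2) set" where
  "psi_dom = {v. Im (v $ 1) > 0 \<and> Th 0 (v $ 1) (v $ 2) ~= 0}"

lemma open_Th_nonzero:
  assumes "holo_on f W" "holo_on g W" "open W" "\<And>x. x \<in> W ==> Im (f x) > 0"
  shows "open {x \<in> W. Th 0 (f x) (g x) ~= 0}"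
proof -
  have "open (W \<inter> (\<lambda>x. Th 0 (f x) (g x)) -` (- {0}))"
    by (rule continuous_open_preimage[OF holo_on_imp_continuous_on[OF holo_on_Th[OF assms(1,2)]]])
       (use assms in auto)
  moreover have "W \<inter> (\<lambda>x. Th 0 (f x) (g x)) -` (- {0}) = {x \<in> W. Th 0 (f x) (g x) ~= 0}" by auto
  ultimately show ?thesis by simp
qed

lemma open_Im_pos: "open {x :: complex ^ 'm::finite. Im (x $ i) > 0}"
  by (intro open_Collect_less continuous_intros)

lemma open_psi_dom: "open psi_dom"
  using open_Th_nonzero[of "\<lambda>v. v $ 1" "{v. Im (v $ 1) > 0}" "\<lambda>v. v $ 2"] open_Im_pos
  by (auto simp: psi_dom_def)

text \<open>A higher \<open>z\<close>-derivative of psi is a partial derivative of a function of two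
  variables, so joint holomorphy follows inductively from \<open>holo_on_pdiff\<close>.\<close>

lemma holo_psid_aux: "holo_on (\<lambda>v. psid j (v $ 1) (v $ 2)) psi_dom"
proof (induction j)
  case 0
  have "holo_on (\<lambda>v. psi (v $ 1) (v $ 2)) psi_dom"
    by (rule holo_on_psi) (auto simp: psi_dom_def)
  thus ?case by (simp add: psid_def)
next
  case (Suc j)
  have "pdiff (\<lambda>v. psid j (v $ 1) (v $ 2)) 2 v = psid (Suc j) (v $ 1) (v $ 2)" if "v \<in> psi_dom" for v
  proof -
    have v: "Im (v $ 1) > 0" "Th 0 (v $ 1) (v $ 2) ~= 0" using that by (auto simp: psi_dom_def)
    have "(v + axis 2 s) $ 1 = v $ 1" "(v + axis 2 s) $ 2 = s + v $ 2" for s by (simp_all add: axis_def)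
    hence "pdiff (\<lambda>v. psid j (v $ 1) (v $ 2)) 2 v = deriv (\<lambda>s. psid j (v $ 1) (s + v $ 2)) 0"
      unfolding pdiff_def by presburger
    also have "... = psid (Suc j) (v $ 1) (v $ 2)"
      by (rule DERIV_imp_deriv, rule DERIV_shift_eq) (use psid_deriv[OF v] in simp)
    finally show ?thesis .
  qed
  thus ?case
    by (intro holo_on_cong[OF holo_on_pdiff[OF Suc.IH open_psi_dom, of 2] open_psi_dom]) simp
qed

lemma holo_on_psid [intro]:
  assumes "holo_on f W" "holo_on g W" "\<And>x. x \<in> W ==> Im (f x) > 0" "\<And>x. x \<in> W ==> Th 0 (f x) (g x) ~= 0"
  shows "holo_on (\<lambda>x. psid j (f x) (g x)) W"
proof -
  define s :: "_ => complex ^ 2" where "s = (\<lambda>x. vector [f x, g x])"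
  have s: "s x $ 1 = f x" "s x $ 2 = g x" for x by (simp_all add: s_def)
  have "holo_on (\<lambda>x. s x $ i) W" for i
    using exhaust_2[of i] assms(1,2) s by auto
  hence "holo_on (\<lambda>x. psid j (s x $ 1) (s x $ 2)) W"
    by (rule holo_on_compose[OF holo_psid_aux]) (use assms in \<open>auto simp: psi_dom_def s\<close>)
  thus ?thesis by (simp add: s)
qed

lemma holomorphic_wp_const: "wp_const holomorphic_on {t. Im t > 0}"
proof -
  have o: "open {t. Im t > 0}" by (intro open_Collect_less continuous_intros)
  have T: "(\<lambda>t. Th k t z) holomorphic_on {t. Im t > 0}" for k z
    using Th_deriv_tau by (auto simp: holomorphic_on_open[OF o])
  have "(\<lambda>t. - Th 3 t 0 / (3 * Th 1 t 0)) holomorphic_on {t. Im t > 0}"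
    by (intro holomorphic_intros T) (use Th1_0_nonzero in auto)
  thus ?thesis by (rule holomorphic_transform) (simp add: wp_const_def)
qed

lemma holo_on_wp_const [intro]:
  assumes "holo_on f W" "\<And>x. x \<in> W ==> Im (f x) > 0"
  shows "holo_on (\<lambda>x. wp_const (f x)) W"
  by (rule holo_on_compose1[OF assms(1) holomorphic_wp_const])
     (use assms(2) in \<open>auto intro!: open_Collect_less continuous_intros\<close>)

lemma holo_on_bas [intro]:
  assumes "holo_on f W" "holo_on g W" "\<And>x. x \<in> W ==> Im (f x) > 0" "\<And>x. x \<in> W ==> Th 0 (f x) (g x) ~= 0"
    "\<And>x. x \<in> W ==> Th 0 (f x) z ~= 0" "\<And>x. x \<in> W ==> Th 0 (f x) (z + g x) ~= 0"
  shows "holo_on (\<lambda>x. bas k (f x) (g x) z) W"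
proof -
  consider "k = 0" | "k = 1" | "k = 2" | "k > 2" by linarith
  thus ?thesis
    by cases (auto simp: bas_def intro!: holo_on_diff holo_on_add holo_on_mult holo_on_minus holo_on_psi holo_on_psid
        holo_on_wp_const assms)
qed

lemma holo_shift_v [intro, simp]: "holo_on shift_v W"
  unfolding shift_v_def by auto

lemma holo_full_v [intro, simp]: "holo_on (\<lambda>x. full_v x i) W"
  by (cases i) (auto simp: full_v_def intro!: holo_on_minus holo_on_sum)

lemma holo_on_lam:
  assumes "\<And>x. x \<in> W ==> Im (tau x) > 0" "\<And>x. x \<in> W ==> Th 0 (tau x) z ~= 0"
    "\<And>x. x \<in> W ==> Th 0 (tau x) (z + shift_v x) ~= 0"
  shows "holo_on (\<lambda>x. lam x z) W"
  unfolding lam_def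
  by (intro holo_on_divide holo_on_mult holo_on_exp holo_on_prod holo_on_Th holo_on_power holo_on_const holo_on_diff holo_on_add
      holo_on_component holo_full_v holo_shift_v) (use assms in auto)

lemma open_reg_x: "open {x :: 'n::finite point. reg_x x}"
  using open_Th_nonzero[of "\<lambda>x. x $ Xtau" "{x. Im (tau x) > 0}" shift_v] open_Im_pos
  by (auto simp: reg_x_def)

lemma phi_eq_Binv:
  fixes x :: "'n::{finite,linorder} point"
  assumes "reg_x x" "invertible (Bmat x p)" "\<And>j. goodz (tau x) (shift_v x) (p j)"
  shows "phi x (kidx k) = (\<Sum>!j. matrix_inv (Bmat x p) $ k $ j * lam x (p j))"
proof -
  define f :: "complex ^ 'n option" where "f = (\<chi> k. phi x (kidx k))"
  have "(Bmat x p *v f) $ j = lam x (p j)" for j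
    using phi_props(2)[OF assms(1) assms(3)[of j]] sum_kidx[of "\<lambda>i. phi x i * bas i (tau x) (shift_v x) (p j)"]
    by (simp add: matrix_vector_mult_def Bmat_def f_def mult.commute)
  hence "Bmat x p *v f = (\<chi> j. lam x (p j))" by (simp add: vec_eq_iff)
  hence "matrix_inv (Bmat x p) *v (\<chi> j. lam x (p j)) = f"
    using matrix_inv_left[OF assms(2)] by (metis matrix_vector_mul_assoc matrix_vector_mul_lid)
  hence "f $ k = (matrix_inv (Bmat x p) *v (\<chi> j. lam x (p j))) $ k" by simp
  thus ?thesis by (simp add: f_def matrix_vector_mult_def)
qed

text \<open>Near a given point the evaluation points can be kept fixed while the matrix stays
  invertible. The invariants are then the inverse matrix applied to values of the superpotential,
  which depend holomorphically on \<open>x\<close>.\<close>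

lemma holo_phi: "holo_on (\<lambda>x. phi x i) {x :: 'n::{finite,linorder} point. reg_x x}"
proof (cases "i \<le> CARD('n)")
  case False
  have "holo_on (\<lambda>x::'n point. 0) {x. reg_x x}" by simp
  thus ?thesis by (rule holo_on_cong[OF _ open_reg_x]) (use False in \<open>auto simp: phi_props(1)\<close>)
next
  case True
  then obtain k :: "'n option" where k: "i = kidx k" using bij_betw_imp_surj_on[OF kidx_bij] by auto
  show ?thesis
  proof (rule holo_on_local)
    fix x0 :: "'n point" assume "x0 \<in> {x. reg_x x}"
    hence reg: "reg_x x0" by simp
    have tw: "Im (x0 $ Xtau) > 0" "Th 0 (x0 $ Xtau) (shift_v x0) ~= 0" using reg by (auto simp: reg_x_def)
    obtain p where p: "\<And>j::'n option. goodz (x0 $ Xtau) (shift_v x0) (p j)" "invertible (Bmat x0 p)"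
      using exists_points[OF reg ev_goodz[OF tw, of 0]] by blast
    define V1 where "V1 = {x :: 'n point. reg_x x} \<inter> (\<Inter>j. {x \<in> {x. reg_x x}. Th 0 (tau x) (p j) ~= 0})
      \<inter> (\<Inter>j. {x \<in> {x. reg_x x}. Th 0 (tau x) (p j + shift_v x) ~= 0})"
    have oV1: "open V1"
      unfolding V1_def by (intro open_Int open_INT finite ballI open_reg_x open_Th_nonzero holo_on_component holo_on_const holo_on_add holo_shift_v)
         (auto simp: reg_x_def)
    have V1: "reg_x x" "Im (tau x) > 0" "Th 0 (tau x) (shift_v x) ~= 0" "Th 0 (tau x) (p j) ~= 0" "Th 0 (tau x) (p j + shift_v x) ~= 0"
      if "x \<in> V1" for x j using that by (auto simp: V1_def reg_x_def)
    have gz: "goodz (tau x) (shift_v x) (p j)" if "x \<in> V1" for x j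
      using V1[OF that] by (simp add: goodz_def)
    have x0: "x0 \<in> V1" using reg p(1) tw by (auto simp: V1_def goodz_def[OF tw])
    have hB: "holo_on (\<lambda>x. Bmat x p $ i $ j) V1" for i j
      using V1 by (auto simp: Bmat_def intro!: holo_on_bas)
    define V where "V = {x \<in> V1. invertible (Bmat x p)}"
    have oV: "open V" unfolding V_def by (rule open_invertible[OF hB oV1])
    have "holo_on (\<lambda>x. \<Sum>!j. matrix_inv (Bmat x p) $ k $ j * lam x (p j)) V"
    proof (intro holo_on_sum holo_on_mult holo_on_matrix_inv oV)
      show "holo_on (\<lambda>x. Bmat x p $ i $ j) V" for i j using hB by (rule holo_on_subset) (auto simp: V_def)
      show "holo_on (\<lambda>x. lam x (p j)) V" for j by (rule holo_on_lam) (use V1 in \<open>auto simp: V_def\<close>)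
    qed (auto simp: V_def)
    hence "holo_on (\<lambda>x. phi x i) V"
      by (rule holo_on_cong[OF _ oV]) (use phi_eq_Binv[of _ p k] V1 gz k in \<open>auto simp: V_def\<close>)
    moreover have "x0 \<in> V" using x0 p(2) by (simp add: V_def)
    ultimately show "\<exists>V. x0 \<in> V \<and> holo_on (\<lambda>x. phi x i) V" by blast
  qed
qed

text \<open>A branch built from the principal logarithm and normalised at \<open>x\<close> is
  holomorphic. Its quotient with \<open>r\<close> is continuous with values in the finite set of
  roots of unity, hence 1 near \<open>x\<close>.\<close>

lemma holo_root:
  fixes r f :: "(complex, 'm::finite) vec => complex"
  assumes "open U" "continuous_on U r" "holo_on f U" "\<And>x. x \<in> U ==> r x ~= 0 \<and> r x ^ n = f x" "n > 0"
  shows "holo_on r U"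
proof (rule holo_on_local)
  fix x assume x: "x \<in> U"
  define a where "a = f x"
  have a0: "a ~= 0" "r x ~= 0" "r x ^ n = a" using assms(4)[OF x] by (auto simp: a_def)
  define S where "S = (\<lambda>w. w / a) -` (- \<real>\<^sub>\<le>\<^sub>0)"
  define R where "R = (\<lambda>w. r x * exp (Ln (w / a) / of_nat n))"
  have oS: "open S" unfolding S_def by (intro open_vimage continuous_intros) (auto simp: a0 closed_nonpos_Reals_complex)
  have hol: "R holomorphic_on S" unfolding R_def S_def by (intro holomorphic_intros) (use a0 assms(5) in auto)
  have \<rho>n: "R w ^ n = w" if "w \<in> S" for w
  proof -
    have "w / a ~= 0" using that by (auto simp: S_def)
    hence "exp (Ln (w / a)) = w / a" by simp
    moreover have "exp (Ln (w / a) / of_nat n) ^ n = exp (Ln (w / a))"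
      using assms(5) by (simp flip: exp_of_nat_mult)
    ultimately show ?thesis using a0 by (simp add: R_def power_mult_distrib)
  qed
  have aS: "a \<in> S" and \<rho>a: "R a = r x" using a0 by (auto simp: S_def R_def)
  have contf: "continuous_on U f" using assms(3) by (rule holo_on_imp_continuous_on)
  have oU1: "open (U \<inter> f -` S)" by (rule continuous_open_preimage[OF contf assms(1) oS])
  define c where "c = (\<lambda>y. r y / R (f y))"
  have \<rho>0: "R w ~= 0" for w using a0 by (simp add: R_def)
  have "continuous_on (U \<inter> f -` S) c"
    unfolding c_def
    by (intro continuous_intros continuous_on_subset[OF assms(2)]
        continuous_on_compose2[OF holomorphic_on_imp_continuous_on[OF hol] continuous_on_subset[OF contf]])
       (auto simp: \<rho>0)
  \<comment> \<open>Removing the other roots of unity leaves an open set containing 1; its preimage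
    is the neighbourhood on which both branches agree.\<close>
  moreover have "open (- ({z::complex. z ^ n = 1} - {1}))"
    using assms(5) by (intro open_Compl finite_imp_closed finite_Diff finite_roots_unity) auto
  ultimately have oV: "open ((U \<inter> f -` S) \<inter> c -` (- ({z::complex. z ^ n = 1} - {1})))"
    using continuous_open_preimage oU1 by blast
  let ?V = "(U \<inter> f -` S) \<inter> c -` (- ({z::complex. z ^ n = 1} - {1}))"
  have "x \<in> ?V" using x aS \<rho>a a0 by (auto simp: c_def a_def[symmetric])
  moreover have "holo_on (\<lambda>y. R (f y)) ?V"
    by (rule holo_on_compose1[OF holo_on_subset[OF assms(3)] hol oS]) auto
  hence "holo_on r ?V"
  proof (rule holo_on_cong[OF _ oV])
    fix y assume y: "y \<in> ?V"
    have "c y ^ n = 1" using assms(4)[of y] y \<rho>n[of "f y"] \<rho>0[of "f y"] by (auto simp: c_def power_divide)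
    hence "c y = 1" using y by auto
    thus "r y = R (f y)" using \<rho>0[of "f y"] by (simp add: c_def)
  qed
  ultimately show "\<exists>V. x \<in> V \<and> holo_on r V" by (intro exI[of _ ?V] conjI)
qed

section \<open>The intersection form of the superpotential\<close>

text \<open>\<open>bpt\<close> enumerates the divisor of the superpotential: \<open>None\<close> is the pole \<open>0\<close> of order \<open>n\<close>, \<open>Some None\<close> the pole \<open>-w\<close>,
  \<open>Some (Some i)\<close> the zero \<open>a\<^sub>i\<close>.\<close>
definition bpt :: "'n::finite point => 'n option option option => complex" where
  "bpt x j = (case j of None => 0 | Some None => - shift_v x | Some (Some i) => full_v x i - x $ Xv)"

definition dbpt :: "'n::finite option option option => 'n idx => complex" where
  "dbpt j c = (case j of None => 0
     | Some None => (if c = Xv then - (of_nat CARD('n) + 1) else 0)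
     | Some (Some i) => (case c of XN k => (if i = Some k then 1 else 0) - (if i = None then 1 else 0)
          | Xv => - 1 | _ => 0))"

text \<open>The sum over the divisor of the superpotential with multiplicities: 1 at each zero, -1
  at \<open>- w\<close>, -n at 0.\<close>

definition EE :: "('n::finite option option option => complex) => complex" where
  "EE F = (\<Sum>!i. F (Some (Some i))) - F (Some None) - of_nat CARD('n) * F None"

lemma EE_add: "EE (\<lambda>j. F j + G j) = EE F + EE G"
  by (simp add: EE_def sum.distrib algebra_simps)

lemma EE_diff: "EE (\<lambda>j. F j - G j) = EE F - EE G"
  by (simp add: EE_def sum_subtractf algebra_simps)

lemma EE_cmult: "EE (\<lambda>j. c * F j) = c * EE F"
  by (simp add: EE_def sum_distrib_left algebra_simps)

text \<open>The divisor has degree (n + 1) - 1 - n = 0.\<close>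

lemma EE_const: "EE (\<lambda>j :: 'n::finite option option option. c) = 0"
  by (simp add: EE_def algebra_simps)

lemma sum_idx: "(\<Sum>c\<in>(UNIV :: 'n::finite idx set). f c) = f X0 + (\<Sum>!k. f (XN k)) + f Xv + f Xtau"
proof -
  have U: "(UNIV :: 'n idx set) = insert X0 (insert Xv (insert Xtau (range XN)))"
    by (auto intro: idx.exhaust)
  have "inj (XN :: 'n => 'n idx)" by (auto intro: injI)
  hence "sum f (range XN) = (\<Sum>!k. f (XN k))" by (simp add: sum.reindex)
  moreover have "sum f UNIV = f X0 + (f Xv + (f Xtau + sum f (range XN)))"
    unfolding U by (subst sum.insert; simp add: image_iff)+
  ultimately show ?thesis by (simp add: algebra_simps)
qed

lemma sum_option: "(\<Sum>i\<in>(UNIV :: 'n::finite option set). f i) = f None + (\<Sum>!k. f (Some k))"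
  by (simp add: UNIV_option_conv sum.reindex)

text \<open>The derivative of Abel's relation: zeros minus poles add up to 0 for every
  \<open>x\<close>.\<close>

lemma EE_dbpt: "EE (\<lambda>j. dbpt j c) = 0"
  by (cases c) (simp_all add: EE_def dbpt_def sum_option)

text \<open>\<open>A_mat\<close> is the identity plus the all-ones matrix J, and J^2 = n J makes I -
  J / (n + 1) its inverse.\<close>

lemma matrix_inv_A_mat:
  "matrix_inv (A_mat :: complex ^ 'n ^ 'n::finite) $ i $ j = (if i = j then 1 else 0) - 1 / (of_nat CARD('n) + 1)"
proof -
  define B :: "complex ^ 'n ^ 'n" where "B = (\<chi> i j. (if i = j then 1 else 0) - 1 / (of_nat CARD('n) + 1))"
  have n1: "(of_nat CARD('n) + 1 :: complex) ~= 0" by (metis of_nat_Suc of_nat_eq_0_iff nat.distinct(1) add.commute)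
  have A: "A_mat $ i $ j = (if i = j then 1 else 0) + 1" for i j :: 'n by (simp add: A_mat_def)
  have 1: "A_mat ** B = mat 1"
  proof -
    have "(A_mat ** B) $ i $ j = (if i = j then 1 else 0)" for i j
    proof -
      have "(A_mat ** B) $ i $ j = (\<Sum>!k. ((if i = k then 1 else 0) + 1) * ((if k = j then 1 else 0) - 1 / (of_nat CARD('n) + 1)))"
        by (simp add: matrix_matrix_mult_def A B_def)
      also have "... = (\<Sum>!k. (if i = k then (if k = j then 1 else 0) else 0) + (if k = j then 1 else 0)
          - (if i = k then 1 / (of_nat CARD('n) + 1) else 0) - 1 / (of_nat CARD('n) + 1))"
        by (intro sum.cong refl) (auto simp: algebra_simps)
      also have "... = (if i = j then 1 else 0) + 1 - 1 / (of_nat CARD('n) + 1) - of_nat CARD('n) * (1 / (of_nat CARD('n) + 1))"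
        by (simp add: sum.distrib sum_subtractf)
      also have "... = (if i = j then 1 else 0)"
      proof -
        have "1 - 1 / (m + 1) - m * (1 / (m + 1)) = 0" if "m + 1 ~= 0" for m :: complex
          using that by (simp add: divide_simps)
        from this[OF n1] show ?thesis by (simp add: algebra_simps)
      qed
      finally show ?thesis .
    qed
    thus ?thesis by (simp add: vec_eq_iff mat_def)
  qed
  hence inv: "invertible (A_mat :: complex ^ 'n ^ 'n)" unfolding invertible_right_inverse by (rule exI)
  have "matrix_inv A_mat = matrix_inv A_mat ** (A_mat ** B)" by (simp add: 1)
  also have "... = B" by (simp add: matrix_mul_assoc matrix_inv_left[OF inv])
  finally show ?thesis by (simp add: B_def)
qed

definition gf :: "('n::finite idx => complex) => ('n idx => complex) => complex" where
  "gf f h = (\<Sum>!a b. g_star $ a $ b * f a * h b)"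

lemma g_star_simps [simp]:
  "g_star $ X0 $ X0 = 0" "g_star $ X0 $ XN k = 0" "g_star $ X0 $ Xv = 0" "g_star $ X0 $ Xtau = 1"
  "g_star $ XN l $ X0 = 0" "g_star $ XN l $ Xv = 0" "g_star $ XN l $ Xtau = 0"
  "g_star $ Xv $ X0 = 0" "g_star $ Xv $ XN k = 0" "g_star $ Xv $ Xtau = 0"
  "g_star $ Xtau $ X0 = 1" "g_star $ Xtau $ XN k = 0" "g_star $ Xtau $ Xv = 0" "g_star $ Xtau $ Xtau = 0"
  "(g_star :: complex ^ ('n::finite idx) ^ ('n idx)) $ XN i $ XN j = (if i = j then 1 else 0) - 1 / (of_nat CARD('n) + 1)"
  "(g_star :: complex ^ ('n::finite idx) ^ ('n idx)) $ Xv $ Xv = - 1 / (of_nat CARD('n) * (of_nat CARD('n) + 1))"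
  by (simp_all add: g_star_def matrix_inv_A_mat)

lemma gf_expand:
  fixes f h :: "'n::finite idx => complex"
  shows "gf f h = f X0 * h Xtau + f Xtau * h X0
    + (\<Sum>!k. f (XN k) * h (XN k)) - (\<Sum>!k. f (XN k)) * (\<Sum>!k. h (XN k)) / (of_nat CARD('n) + 1)
    - f Xv * h Xv / (of_nat CARD('n) * (of_nat CARD('n) + 1))"
proof -
  have "(\<Sum>!i j. g_star $ XN i $ XN j * f (XN i) * h (XN j))
    = (\<Sum>!i j. (if i = j then f (XN i) * h (XN j) else 0) - f (XN i) * h (XN j) / (of_nat CARD('n) + 1))"
    by (intro sum.cong refl) (simp add: algebra_simps)
  also have "... = (\<Sum>!k. f (XN k) * h (XN k)) - (\<Sum>!i j. f (XN i) * h (XN j)) / (of_nat CARD('n) + 1)"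
    by (simp add: sum_subtractf sum_divide_distrib)
  finally show ?thesis
    by (simp add: gf_def sum_idx[where 'n='n] sum_product algebra_simps)
qed

text \<open>The covector u du + t dtau minus the weighted sum of i_j times the differential of the
  divisor point b_j. All differentials paired below have this form; for log \<lambda>(z) the
  coefficient i_j is psi(z - b_j).\<close>

definition co :: "('n::finite option option option => complex) => complex => complex => 'n idx => complex" where
  "co i u t c = - EE (\<lambda>j. i j * dbpt j c) + (if c = X0 then u else 0) + (if c = Xtau then t else 0)"

lemma gf_algebra:
  fixes n A B a0 b0 a1 b1 az bz s Sa Sb ut :: complex
  assumes "n ~= 0" "n + 1 ~= 0"
  shows "ut + (s - a0 * Sb - b0 * Sa + n * a0 * b0) - (Sa - n * a0) * (Sb - n * b0) / (n + 1)
       - ((Sa + a0) - (n + 1) * a1) * ((Sb + b0) - (n + 1) * b1) / (n * (n + 1))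
    = ((s + a0 * b0) - a1 * b1 - n * (az * bz)) - az * ((Sb + b0) - b1 - n * bz) - bz * ((Sa + a0) - a1 - n * az)
       - ((Sa + a0) - a1 - n * az) * ((Sb + b0) - b1 - n * bz) / n + ut"
  using assms by (simp add: divide_simps) algebra

text \<open>The intersection form in terms of divisor coefficients. The right side does not change
  when a constant is added to \<open>i\<close> or to \<open>b\<close>, as it must be because
  \<open>EE_dbpt\<close> makes such constants invisible in \<open>co\<close>.\<close>

lemma gf_co:
  fixes i b :: "'n::finite option option option => complex"
  shows "gf (co i u t) (co b u' t') = EE (\<lambda>j. i j * b j) - i None * EE b - b None * EE i
     - EE i * EE b / of_nat CARD('n) + (u * t' + t * u')"
proof -
  have co: "co i u t X0 = u" "co i u t Xtau = t" "co i u t (XN k) = i (Some (Some None)) - i (Some (Some (Some k)))"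
    "co i u t Xv = (\<Sum>!k. i (Some (Some (Some k)))) + i (Some (Some None)) - (of_nat CARD('n) + 1) * i (Some None)"
    for i :: "'n option option option => complex" and u t and k :: 'n
    by (simp_all add: co_def EE_def dbpt_def sum_option if_distrib[of "\<lambda>x. _ * x"] sum_negf algebra_simps cong: if_cong)
  have n: "(of_nat CARD('n) :: complex) ~= 0" "(of_nat CARD('n) + 1 :: complex) ~= 0"
    by (simp, metis of_nat_Suc of_nat_eq_0_iff nat.distinct(1) add.commute)
  let ?f = "\<lambda>i::'n option option option => complex. \<lambda>k. i (Some (Some (Some k)))"
  have 1: "(\<Sum>!k. co i u t (XN k) * co b u' t' (XN k)) = (\<Sum>!k. ?f i k * ?f b k)
     - i (Some (Some None)) * (\<Sum>!k. ?f b k) - b (Some (Some None)) * (\<Sum>!k. ?f i k)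
     + of_nat CARD('n) * i (Some (Some None)) * b (Some (Some None))"
    by (simp add: co algebra_simps sum.distrib sum_subtractf sum_distrib_left)
  have 2: "(\<Sum>!k. co i u t (XN k)) = - ((\<Sum>!k. ?f i k) - of_nat CARD('n) * i (Some (Some None)))"
    for i :: "'n option option option => complex" and u t
    by (simp add: co sum_subtractf)
  show ?thesis
    unfolding gf_expand 1 2 co(1,2,4) EE_def sum_option
    using gf_algebra[OF n, of "u * t' + t * u'" "\<Sum>!k. ?f i k * ?f b k" "i (Some (Some None))" "\<Sum>!k. ?f b k" "b (Some (Some None))"
        "\<Sum>!k. ?f i k" "i (Some None)" "b (Some None)" "i None" "b None"]
    by (simp add: algebra_simps)
qed

subsection \<open>Derivatives of the superpotential\<close>

lemma holo_shift_full [intro, simp]: "holo_on (\<lambda>x. bpt x j) W"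
proof -
  consider "j = None" | "j = Some None" | i where "j = Some (Some i)" by (metis option.exhaust)
  thus ?thesis
    by cases (simp_all add: bpt_def holo_on_minus holo_on_diff)
qed

lemma pdiff_bpt: "pdiff (\<lambda>x. bpt x j) c x = dbpt j c"
proof -
  consider "j = None" | "j = Some None" | i where "j = Some (Some i)" by (metis option.exhaust)
  thus ?thesis
  proof cases
    case 2
    have "pdiff (\<lambda>x :: 'a point. - ((of_nat CARD('a) + 1) * x $ Xv)) c x = - ((of_nat CARD('a) + 1) * pdiff (\<lambda>x. x $ Xv) c x)"
      by (subst pdiff_minus, intro holo_on_mult holo_on_const holo_on_component, subst pdiff_cmult) auto
    thus ?thesis using 2 by (auto simp: bpt_def dbpt_def shift_v_def pdiff_component)
  next
    case 3
    have 1: "pdiff (\<lambda>x. full_v x i - x $ Xv) c x = pdiff (\<lambda>x. full_v x i) c x - pdiff (\<lambda>x. x $ Xv) c x"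
      by (rule pdiff_diff) auto
    have 2: "pdiff (\<lambda>x. full_v x i) c x = (case c of XN k => (if i = Some k then 1 else 0) - (if i = None then 1 else 0) | _ => 0)"
    proof (cases i)
      case None
      have "pdiff (\<lambda>x :: 'a point. - (\<Sum>!j. x $ XN j)) c x = - (\<Sum>!j. pdiff (\<lambda>x. x $ XN j) c x)"
        by (subst pdiff_minus, intro holo_on_sum holo_on_component, subst pdiff_sum) auto
      thus ?thesis using None by (auto simp: full_v_def pdiff_component split: idx.splits)
    next
      case (Some k)
      thus ?thesis by (auto simp: full_v_def pdiff_component split: idx.splits)
    qed
    show ?thesis using 3 unfolding bpt_def dbpt_def by (simp add: 1 2 pdiff_component split: idx.splits)
  qed (auto simp: bpt_def dbpt_def)
qed

lemma holo_EE: "(\<And>j. holo_on (\<lambda>x. F x j) W) ==> holo_on (\<lambda>x. EE (F x)) W"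
  unfolding EE_def by (intro holo_on_diff holo_on_sum holo_on_mult holo_on_const)

lemma pdiff_EE:
  assumes "\<And>j. holo_on (\<lambda>x. F x j) {x}"
  shows "pdiff (\<lambda>x. EE (F x)) c x = EE (\<lambda>j. pdiff (\<lambda>x. F x j) c x)"
proof -
  have "pdiff (\<lambda>x. EE (F x)) c x = pdiff (\<lambda>x. (\<Sum>!i. F x (Some (Some i))) - F x (Some None)) c x
       - pdiff (\<lambda>x. of_nat CARD('a) * F x None) c x"
    unfolding EE_def by (rule pdiff_diff) (intro holo_on_diff holo_on_sum holo_on_mult holo_on_const assms)+
  also have "pdiff (\<lambda>x. (\<Sum>!i. F x (Some (Some i))) - F x (Some None)) c x
      = pdiff (\<lambda>x. \<Sum>!i. F x (Some (Some i))) c x - pdiff (\<lambda>x. F x (Some None)) c x"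
    by (rule pdiff_diff) (intro holo_on_sum assms)+
  also have "pdiff (\<lambda>x. \<Sum>!i. F x (Some (Some i))) c x = (\<Sum>!i. pdiff (\<lambda>x. F x (Some (Some i))) c x)"
    by (rule pdiff_sum) (rule assms)
  also have "pdiff (\<lambda>x. of_nat CARD('a) * F x None) c x = of_nat CARD('a) * pdiff (\<lambda>x. F x None) c x"
    by (rule pdiff_cmult) (rule assms)
  finally show ?thesis by (simp add: EE_def)
qed

text \<open>The point \<open>z\<close> is neither a zero nor a pole of the superpotential, so
  logarithmic derivatives make sense.\<close>

definition regz :: "'n::finite point => complex => bool" where
  "regz x z \<longleftrightarrow> Im (tau x) > 0 \<and> (\<forall>j. Th 0 (tau x) (z - bpt x j) ~= 0)"

text \<open>The differential of tau / (2 pi i), the unit in which the heat equation measures changes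
  of tau.\<close>

definition dT :: "'n idx => complex" where
  "dT c = (if c = Xtau then 1 / tpi else 0)"

lemma pdiff_psib:
  assumes "regz x z"
  shows "pdiff (\<lambda>x. psi (tau x) (z - bpt x j)) c x
    = hh1 (tau x) (z - bpt x j) * dT c - psi1 (tau x) (z - bpt x j) * dbpt j c"
proof -
  have "pdiff (\<lambda>x. z - bpt x j) c x = - dbpt j c"
    by (subst pdiff_diff) (auto simp: pdiff_bpt)
  thus ?thesis
    using assms by (subst pdiff_psi) (auto simp: regz_def pdiff_component dT_def intro!: holo_on_diff)
qed

lemma pdiff_hhb:
  assumes "regz x z"
  shows "pdiff (\<lambda>x. hh (tau x) (z - bpt x j)) c x
    = (hh2 (tau x) (z - bpt x j) / 2 + psi (tau x) (z - bpt x j) * hh1 (tau x) (z - bpt x j)) * dT c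
      - hh1 (tau x) (z - bpt x j) * dbpt j c"
proof -
  have "pdiff (\<lambda>x. z - bpt x j) c x = - dbpt j c"
    by (subst pdiff_diff) (auto simp: pdiff_bpt)
  thus ?thesis
    using assms by (subst pdiff_hh) (auto simp: regz_def pdiff_component dT_def intro!: holo_on_diff)
qed

text \<open>A logarithmic derivative with the denominator multiplied out; products of functions
  become sums.\<close>

definition ldiff :: "((complex, 'm::finite) vec => complex) => 'm => (complex, 'm) vec => complex => bool" where
  "ldiff f c x l \<longleftrightarrow> holo_on f {x} \<and> pdiff f c x = f x * l"

lemma ldiff_mult: "ldiff f c x l ==> ldiff g c x m ==> ldiff (\<lambda>x. f x * g x) c x (l + m)"
  by (auto simp: ldiff_def pdiff_mult algebra_simps)

lemma ldiff_divide: "ldiff f c x l ==> ldiff g c x m ==> g x ~= 0 ==> ldiff (\<lambda>x. f x / g x) c x (l - m)"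
  by (auto simp: ldiff_def pdiff_divide power2_eq_square divide_simps) (simp add: algebra_simps)

lemma ldiff_power: "ldiff f c x l ==> ldiff (\<lambda>x. f x ^ n) c x (of_nat n * l)"
  by (cases n) (use pdiff_power[of f x n c] in \<open>auto simp: ldiff_def\<close>)

lemma ldiff_prod:
  "finite I ==> (\<And>i. i \<in> I ==> ldiff (f i) c x (l i)) ==> ldiff (\<lambda>x. \<Prod>i\<in>I. f i x) c x (\<Sum>i\<in>I. l i)"
proof (induction I rule: finite_induct)
  case empty
  thus ?case by (simp add: ldiff_def)
next
  case (insert i I)
  thus ?case using ldiff_mult[of "f i" c x "l i" "\<lambda>x. \<Prod>i\<in>I. f i x"] by simp
qed

lemma ldiff_Th:
  assumes "regz x z"
  shows "ldiff (\<lambda>x. Th 0 (tau x) (z - bpt x j)) c x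
     (hh (tau x) (z - bpt x j) * dT c - psi (tau x) (z - bpt x j) * dbpt j c)"
proof -
  have d: "pdiff (\<lambda>x. z - bpt x j) c x = - dbpt j c"
    by (subst pdiff_diff) (auto simp: pdiff_bpt)
  have h: "holo_on (\<lambda>x. z - bpt x j) {x}" by auto
  have nz: "Im (tau x) > 0" "Th 0 (tau x) (z - bpt x j) ~= 0" using assms by (auto simp: regz_def)
  have "pdiff (\<lambda>x. Th 0 (tau x) (z - bpt x j)) c x
      = Th (0 + 2) (tau x) (z - bpt x j) / (4 * of_real pi * \<i>) * pdiff tau c x
        + Th (Suc 0) (tau x) (z - bpt x j) * pdiff (\<lambda>x. z - bpt x j) c x"
    by (rule holo_Th_at(2)) (use h nz in auto)
  also have "... = Th 0 (tau x) (z - bpt x j) * (hh (tau x) (z - bpt x j) * dT c - psi (tau x) (z - bpt x j) * dbpt j c)"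
    using nz(2) unfolding d by (simp add: hh_def psi_def dT_def pdiff_component numeral_2_eq_2 field_simps)
  finally show ?thesis
    using holo_Th_at(1)[OF holo_on_component[of Xtau "{x}"] h nz(1), of 0] by (simp add: ldiff_def)
qed

text \<open>The logarithmic differential of the superpotential in \<open>x\<close>. Its
  tau-component expresses the heat equation for every theta factor.\<close>

definition ell :: "'n::finite point => complex => 'n idx => complex" where
  "ell x z = co (\<lambda>j. psi (tau x) (z - bpt x j)) (- 2 * of_real pi * \<i>)
     (EE (\<lambda>j. hh (tau x) (z - bpt x j)) / tpi)"

lemma lam_bpt: "lam x z = exp (- 2 * of_real pi * \<i> * x $ X0) * (\<Prod>i\<in>UNIV. Th 0 (tau x) (z - bpt x (Some (Some i))))
     / (Th 0 (tau x) (z - bpt x None) ^ CARD('n) * Th 0 (tau x) (z - bpt (x :: 'n::finite point) (Some None)))"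
  by (simp add: lam_def bpt_def algebra_simps)

lemma pdiff_lam:
  assumes "regz x z"
  shows "holo_on (\<lambda>x. lam x z) {x}" "pdiff (\<lambda>x. lam x z) c x = lam x z * ell x z c"
proof -
  have e: "ldiff (\<lambda>x. exp (- 2 * of_real pi * \<i> * x $ X0)) c x (if c = X0 then - 2 * of_real pi * \<i> else 0)"
  proof -
    have "pdiff (\<lambda>x. exp (- 2 * of_real pi * \<i> * x $ X0)) c x
       = exp (- 2 * of_real pi * \<i> * x $ X0) * pdiff (\<lambda>x. - 2 * of_real pi * \<i> * x $ X0) c x"
      by (rule pdiff_compose1[where F=exp]) (intro holo_on_mult holo_on_const holo_on_component DERIV_exp)+
    also have "pdiff (\<lambda>x. - 2 * of_real pi * \<i> * x $ X0) c x = - 2 * of_real pi * \<i> * pdiff (\<lambda>x. x $ X0) c x"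
      by (rule pdiff_cmult) auto
    finally show ?thesis
      unfolding ldiff_def by (intro conjI holo_on_exp holo_on_mult holo_on_const holo_on_component) (simp add: pdiff_component)
  qed
  have nz: "Th 0 (tau x) (z - bpt x j) ~= 0" for j using assms by (auto simp: regz_def)
  have "ldiff (\<lambda>x. lam x z) c x ((if c = X0 then - 2 * of_real pi * \<i> else 0)
     + (\<Sum>!i. hh (tau x) (z - bpt x (Some (Some i))) * dT c - psi (tau x) (z - bpt x (Some (Some i))) * dbpt (Some (Some i)) c)
     - (of_nat CARD('a) * (hh (tau x) (z - bpt x None) * dT c - psi (tau x) (z - bpt x None) * dbpt None c)
       + (hh (tau x) (z - bpt x (Some None)) * dT c - psi (tau x) (z - bpt x (Some None)) * dbpt (Some None) c)))"
    unfolding lam_bpt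
    by (intro ldiff_divide ldiff_mult ldiff_power ldiff_prod ldiff_Th[OF assms] e) (use nz in auto)
  also have "(if c = X0 then - 2 * of_real pi * \<i> else 0)
     + (\<Sum>!i. hh (tau x) (z - bpt x (Some (Some i))) * dT c - psi (tau x) (z - bpt x (Some (Some i))) * dbpt (Some (Some i)) c)
     - (of_nat CARD('a) * (hh (tau x) (z - bpt x None) * dT c - psi (tau x) (z - bpt x None) * dbpt None c)
       + (hh (tau x) (z - bpt x (Some None)) * dT c - psi (tau x) (z - bpt x (Some None)) * dbpt (Some None) c))
    = ell x z c"
  proof -
    have "ell x z c = EE (\<lambda>j. dT c * hh (tau x) (z - bpt x j) - psi (tau x) (z - bpt x j) * dbpt j c)
        + (if c = X0 then - 2 * of_real pi * \<i> else 0)"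
      unfolding EE_diff EE_cmult by (simp add: ell_def co_def dT_def)
    thus ?thesis by (simp add: EE_def algebra_simps)
  qed
  finally show "holo_on (\<lambda>x. lam x z) {x}" "pdiff (\<lambda>x. lam x z) c x = lam x z * ell x z c"
    by (auto simp: ldiff_def)
qed

text \<open>\<open>LE\<close> is the logarithmic derivative of the superpotential in
  \<open>z\<close>, and \<open>dLE\<close> is the derivative of \<open>LE\<close> in
  \<open>x\<close>.\<close>

definition LE :: "'n::finite point => complex => complex" where
  "LE x z = EE (\<lambda>j. psi (tau x) (z - bpt x j))"

definition dLE :: "'n::finite point => complex => 'n idx => complex" where
  "dLE x z c = EE (\<lambda>j. hh1 (tau x) (z - bpt x j) * dT c - psi1 (tau x) (z - bpt x j) * dbpt j c)"

text \<open>\<open>lamd\<close> is the derivative of the superpotential with respect to \<open>z\<close>.\<close>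
definition lamd :: "'n::finite point => complex => complex" where
  "lamd x z = lam x z * LE x z"

lemma holo_psib: "regz x z ==> holo_on (\<lambda>x. psi (tau x) (z - bpt x j)) {x}"
  by (rule holo_on_psi) (auto simp: regz_def)

lemma holo_hhb: "regz x z ==> holo_on (\<lambda>x. hh (tau x) (z - bpt x j)) {x}"
  by (rule holo_on_hh) (auto simp: regz_def)

lemma pdiff_LE:
  assumes "regz x z"
  shows "holo_on (\<lambda>x. LE x z) {x}" "pdiff (\<lambda>x. LE x z) c x = dLE x z c"
  unfolding LE_def using holo_psib[OF assms]
  by (auto intro!: holo_EE simp: pdiff_EE dLE_def pdiff_psib[OF assms])

lemma pdiff_lamd:
  assumes "regz x z"
  shows "holo_on (\<lambda>x. lamd x z) {x}"
    "pdiff (\<lambda>x. lamd x z) c x = lam x z * (ell x z c * LE x z + dLE x z c)"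
  unfolding lamd_def using pdiff_LE[OF assms] pdiff_lam[OF assms]
  by (auto simp: pdiff_mult algebra_simps)

lemma holo_on_eq: "holo_on f W ==> (\<And>x. g x = f x) ==> holo_on g W"
  by (metis ext)

lemma holo_ell:
  assumes "regz x z" shows "holo_on (\<lambda>x. ell x z b) {x}"
proof -
  have "holo_on (\<lambda>x. - EE (\<lambda>j. psi (tau x) (z - bpt x j) * dbpt j b) + (if b = X0 then - 2 * of_real pi * \<i> else 0)
      + (if b = Xtau then 1 / tpi else 0) * EE (\<lambda>j. hh (tau x) (z - bpt x j))) {x}"
    by (intro holo_on_add holo_on_minus holo_EE holo_on_mult holo_on_const holo_psib[OF assms] holo_hhb[OF assms])
  thus ?thesis unfolding ell_def co_def by (rule holo_on_eq) auto
qed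

lemma pdiff_ell:
  assumes "regz x z"
  shows "pdiff (\<lambda>x. ell x z b) c x
    = co (\<lambda>j. hh1 (tau x) (z - bpt x j) * dT c - psi1 (tau x) (z - bpt x j) * dbpt j c) 0
        (EE (\<lambda>j. (hh2 (tau x) (z - bpt x j) / 2 + psi (tau x) (z - bpt x j) * hh1 (tau x) (z - bpt x j)) * dT c
      - hh1 (tau x) (z - bpt x j) * dbpt j c) / tpi) b"
proof -
  define f where "f = (\<lambda>x. EE (\<lambda>j. psi (tau x) (z - bpt x j) * dbpt j b))"
  define g where "g = (\<lambda>x. EE (\<lambda>j. hh (tau x) (z - bpt (x::'a point) j)))"
  define k where "k = (if b = Xtau then 1 / tpi else 0 :: complex)"
  have f: "holo_on f {x}" unfolding f_def by (intro holo_EE holo_on_mult holo_on_const holo_psib[OF assms])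
  have g: "holo_on g {x}" unfolding g_def by (intro holo_EE holo_hhb[OF assms])
  have 0: "(\<lambda>x. ell x z b) = (\<lambda>x. (if b = X0 then - 2 * of_real pi * \<i> else 0) - f x + k * g x)"
    by (auto simp: ell_def co_def f_def g_def k_def)
  have "pdiff (\<lambda>x. ell x z b) c x = - pdiff f c x + k * pdiff g c x"
    unfolding 0
    by (subst pdiff_add, intro holo_on_diff holo_on_const f, intro holo_on_mult holo_on_const g,
        subst pdiff_diff, rule holo_on_const, rule f, subst pdiff_cmult, rule g) simp
  moreover have "pdiff f c x = EE (\<lambda>j. (hh1 (tau x) (z - bpt x j) * dT c - psi1 (tau x) (z - bpt x j) * dbpt j c) * dbpt j b)"
    unfolding f_def
    by (subst pdiff_EE, intro holo_on_mult holo_on_const holo_psib[OF assms],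
        subst pdiff_mult[OF holo_psib[OF assms] holo_on_const]) (simp add: pdiff_psib[OF assms])
  moreover have "pdiff g c x = EE (\<lambda>j. (hh2 (tau x) (z - bpt x j) / 2 + psi (tau x) (z - bpt x j) * hh1 (tau x) (z - bpt x j)) * dT c
      - hh1 (tau x) (z - bpt x j) * dbpt j c)"
    unfolding g_def by (subst pdiff_EE, rule holo_hhb[OF assms]) (simp add: pdiff_hhb[OF assms])
  ultimately show ?thesis by (simp add: co_def k_def)
qed

lemma bpt_None [simp]: "bpt x None = 0"
  by (simp add: bpt_def)

text \<open>\<open>fay\<close> with x = p - b_j and y = q - b_j has coefficients depending on q - p
  only, so \<open>EE\<close> passes through them and kills the constant. The two remaining sums of
  hh cancel against the mixed terms in u and tau, where - 2 pi i meets 1 / (2 pi i).\<close>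

lemma gf_ell:
  fixes x :: "'n::finite point"
  assumes "regz x p" "regz x q" "Th 0 (tau x) (q - p) ~= 0"
  shows "gf (ell x p) (ell x q) = (psi (tau x) (q - p) - psi (tau x) q) * LE x p
     - (psi (tau x) (q - p) + psi (tau x) p) * LE x q - LE x p * LE x q / of_nat CARD('n)"
proof -
  define t where "t = x $ Xtau"
  have tau: "Im t > 0" using assms by (simp add: regz_def t_def)
  have f: "psi t (p - bpt x j) * psi t (q - bpt x j) = psi t (q - p) * psi t (p - bpt x j)
       - psi t (q - p) * psi t (q - bpt x j) + hh t (p - bpt x j) + hh t (q - bpt x j) + (hh t (q - p) - fay_const t)" for j
    using fay[OF tau, of "p - bpt x j" "q - bpt x j"] assms by (simp add: regz_def t_def algebra_simps)
  have E: "EE (\<lambda>j. psi t (p - bpt x j) * psi t (q - bpt x j)) = psi t (q - p) * LE x p - psi t (q - p) * LE x q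
      + EE (\<lambda>j. hh t (p - bpt x j)) + EE (\<lambda>j. hh t (q - bpt x j))"
    unfolding f EE_add EE_diff EE_cmult EE_const by (simp add: LE_def t_def)
  have pi: "complex_of_real pi ~= 0" by simp
  show ?thesis
    unfolding ell_def gf_co using E pi by (simp add: t_def LE_def algebra_simps)
qed

text \<open>The cancellation of \<open>gf_ell\<close> one derivative later, with
  \<open>fay_deriv\<close> for the motion of the divisor points and \<open>fay_hh1\<close> for tau.
  The sums of \<open>X j\<close>, which contain second derivatives of hh, cancel against the mixed
  terms in u and tau.\<close>

lemma gf_ell_pdiff:
  fixes x :: "'n::finite point"
  assumes "regz x p" "regz x q" "Th 0 (tau x) (q - p) ~= 0"
  shows "gf (ell x p) (\<lambda>b. pdiff (\<lambda>x. ell x q b) c x)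
    = - (psi (tau x) (q - p) + psi (tau x) p + LE x p / of_nat CARD('n)) * dLE x q c
      + psi1 (tau x) (q - p) * (ell x p c - ell x q c)
      + LE x p * (hh1 (tau x) (q - p) - hh1 (tau x) q) * dT c"
proof -
  define t where "t = x $ Xtau"
  define s where "s = q - p"
  define X where "X = (\<lambda>j. hh2 t (q - bpt x j) / 2 + psi t (q - bpt x j) * hh1 t (q - bpt x j))"
  define Y where "Y = hh2 t s / 2 + psi1 t s * (hh t s - fay_const t)"
  have tau: "Im t > 0" using assms by (simp add: regz_def t_def)
  have nz: "Th 0 t (p - bpt x j) ~= 0" "Th 0 t (q - bpt x j) ~= 0" "Th 0 t ((q - bpt x j) - (p - bpt x j)) ~= 0"
    "(q - bpt x j) - (p - bpt x j) = s" for j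
    using assms by (auto simp: regz_def t_def s_def)
  have f1: "psi t (p - bpt x j) * psi1 t (q - bpt x j) = psi1 t s * (psi t (p - bpt x j) - psi t (q - bpt x j))
      - psi t s * psi1 t (q - bpt x j) + hh1 t (q - bpt x j) + hh1 t s" for j
    using fay_deriv[OF tau nz(1-3)] by (simp only: nz(4))
  have f2: "psi t (p - bpt x j) * hh1 t (q - bpt x j) = hh1 t s * psi t (p - bpt x j) - psi t s * hh1 t (q - bpt x j)
      + X j + psi1 t s * (hh t (p - bpt x j) - hh t (q - bpt x j)) + Y" for j
    using fay_hh1[OF tau nz(1-3)] unfolding nz(4) X_def Y_def .
  have f: "psi t (p - bpt x j) * (hh1 t (q - bpt x j) * dT c - psi1 t (q - bpt x j) * dbpt j c)
     = - psi t s * (hh1 t (q - bpt x j) * dT c - psi1 t (q - bpt x j) * dbpt j c)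
       + dT c * hh1 t s * psi t (p - bpt x j) + (X j * dT c - hh1 t (q - bpt x j) * dbpt j c)
       + dT c * psi1 t s * hh t (p - bpt x j) - dT c * psi1 t s * hh t (q - bpt x j) + dT c * Y
       - psi1 t s * (psi t (p - bpt x j) * dbpt j c) + psi1 t s * (psi t (q - bpt x j) * dbpt j c) - hh1 t s * dbpt j c" for j
    using f1[of j] f2[of j] by algebra
  have E: "EE (\<lambda>j. psi t (p - bpt x j) * (hh1 t (q - bpt x j) * dT c - psi1 t (q - bpt x j) * dbpt j c))
     = - psi t s * dLE x q c + dT c * hh1 t s * LE x p + EE (\<lambda>j. X j * dT c - hh1 t (q - bpt x j) * dbpt j c)
       + psi1 t s * (ell x p c - ell x q c)"
  proof -
    have e: "psi1 t s * (ell x p c - ell x q c) = dT c * psi1 t s * EE (\<lambda>j. hh t (p - bpt x j)) - dT c * psi1 t s * EE (\<lambda>j. hh t (q - bpt x j))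
        - psi1 t s * EE (\<lambda>j. psi t (p - bpt x j) * dbpt j c) + psi1 t s * EE (\<lambda>j. psi t (q - bpt x j) * dbpt j c)"
      by (simp add: ell_def co_def dT_def t_def algebra_simps)
    show ?thesis
      unfolding e unfolding f EE_add EE_diff[of "\<lambda>j. _ j + _ j"] EE_cmult EE_const LE_def dLE_def
      by (simp only: EE_add EE_diff EE_cmult EE_const EE_dbpt t_def) algebra
  qed
  have pi: "complex_of_real pi ~= 0" by simp
  have "gf (ell x p) (\<lambda>b. pdiff (\<lambda>x. ell x q b) c x)
    = EE (\<lambda>j. psi t (p - bpt x j) * (hh1 t (q - bpt x j) * dT c - psi1 t (q - bpt x j) * dbpt j c))
      - psi t p * dLE x q c - (hh1 t q * dT c) * LE x p - LE x p * dLE x q c / of_nat CARD('n)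
      - EE (\<lambda>j. X j * dT c - hh1 t (q - bpt x j) * dbpt j c)"
    unfolding pdiff_ell[OF assms(2)] unfolding ell_def gf_co using pi
    by (simp add: LE_def dLE_def X_def t_def dbpt_def[of None])
  thus ?thesis unfolding E by (simp add: s_def t_def algebra_simps)
qed

lemma open_regz: "open {x :: 'n::finite point. regz x z}"
proof -
  have "{x :: 'n point. regz x z} = {x. Im (tau x) > 0} \<inter> (\<Inter>j. {x \<in> {x. Im (tau x) > 0}. Th 0 (tau x) (z - bpt x j) ~= 0})"
    by (auto simp: regz_def)
  moreover have "open \<dots>"
    by (intro open_Int open_INT finite ballI open_Im_pos open_Th_nonzero holo_on_component holo_on_diff holo_on_const holo_shift_full) auto
  ultimately show ?thesis by simp
qed

section \<open>The metric and its flat connection on pairs of functions\<close>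

lemma gf_scale: "gf (\<lambda>a. k * f a) h = k * gf f h" "gf f (\<lambda>a. k * h a) = k * gf f h"
  by (simp_all add: gf_def sum_distrib_left algebra_simps)

lemma gf_add: "gf f (\<lambda>a. h a + k a) = gf f h + gf f k"
  by (simp add: gf_def sum.distrib algebra_simps)

lemma g_star_sym: "g_star $ a $ b = g_star $ b $ a"
  by (cases a; cases b) auto

lemma gf_sym: "gf f h = gf h f"
proof -
  have "gf f h = (\<Sum>!b a. g_star $ a $ b * f a * h b)" unfolding gf_def by (rule sum.swap)
  also have "... = gf h f" unfolding gf_def by (intro sum.cong refl, subst g_star_sym) (simp add: algebra_simps)
  finally show ?thesis .
qed

definition gform :: "('n::finite point => complex) => ('n point => complex) => 'n point => complex" where
  "gform f h x = gf (\<lambda>a. pdiff f a x) (\<lambda>b. pdiff h b x)"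

text \<open>The coordinates of \<Omega> are flat for \<open>g_star\<close>, so the covariant
  derivative of dh in direction \<open>c\<close> is a row of the Hessian; here it is paired with
  df.\<close>

definition gconn :: "('n::finite point => complex) => ('n point => complex) => 'n idx => 'n point => complex" where
  "gconn f h c x = gf (\<lambda>a. pdiff f a x) (\<lambda>b. pdiff (pdiff h b) c x)"

lemma gform_sym: "gform f h x = gform h f x"
  unfolding gform_def by (rule gf_sym)

text \<open>No summand contains \<open>lam x p * lam x q\<close>: the undifferentiated values enter
  at most linearly. Affinity in the distinguished coordinate rests on this.\<close>

lemma gform_lam:
  fixes x :: "'n::finite point"
  assumes "regz x p" "regz x q" "Th 0 (tau x) (q - p) ~= 0"
  shows "gform (\<lambda>x. lam x p) (\<lambda>x. lam x q) x = (psi (tau x) (q - p) - psi (tau x) q) * (lamd x p * lam x q)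
     - (psi (tau x) (q - p) + psi (tau x) p) * (lam x p * lamd x q) - lamd x p * lamd x q / of_nat CARD('n)"
  unfolding gform_def pdiff_lam(2)[OF assms(1)] pdiff_lam(2)[OF assms(2)] gf_scale gf_ell[OF assms]
  by (simp add: lamd_def algebra_simps)

text \<open>The second derivative of \<lambda>(q) is \<lambda>(q) times a product of two components
  of \<open>ell\<close> plus a derivative of \<open>ell\<close>; the first part is paired by
  \<open>gf_ell\<close>, the second by \<open>gf_ell_pdiff\<close>. Again the undifferentiated
  values enter at most linearly.\<close>

lemma gconn_lam:
  fixes x :: "'n::finite point"
  assumes "regz x p" "regz x q" "Th 0 (tau x) (q - p) ~= 0"
  shows "gconn (\<lambda>x. lam x p) (\<lambda>x. lam x q) c x
     = (psi (tau x) (q - p) - psi (tau x) q) * (lamd x p * pdiff (\<lambda>x. lam x q) c x)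
     - (psi (tau x) (q - p) + psi (tau x) p) * (lam x p * pdiff (\<lambda>x. lamd x q) c x)
     - lamd x p * pdiff (\<lambda>x. lamd x q) c x / of_nat CARD('n)
     + psi1 (tau x) (q - p) * (lam x q * pdiff (\<lambda>x. lam x p) c x - lam x p * pdiff (\<lambda>x. lam x q) c x)
     + lamd x p * lam x q * (hh1 (tau x) (q - p) - hh1 (tau x) q) * dT c"
proof -
  have "pdiff (pdiff (\<lambda>x. lam x q) b) c x = lam x q * (ell x q c * ell x q b + pdiff (\<lambda>x. ell x q b) c x)" for b
  proof -
    have "pdiff (pdiff (\<lambda>x. lam x q) b) c x = pdiff (\<lambda>x. lam x q * ell x q b) c x"
      by (rule pdiff_cong[OF open_regz[of q]]) (use assms in \<open>auto simp: pdiff_lam\<close>)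
    also have "... = pdiff (\<lambda>x. lam x q) c x * ell x q b + lam x q * pdiff (\<lambda>x. ell x q b) c x"
      by (rule pdiff_mult[OF pdiff_lam(1)[OF assms(2)] holo_ell[OF assms(2)]])
    finally show ?thesis by (simp add: pdiff_lam[OF assms(2)] algebra_simps)
  qed
  hence "gconn (\<lambda>x. lam x p) (\<lambda>x. lam x q) c x
    = lam x p * (lam x q * (ell x q c * gf (ell x p) (ell x q) + gf (ell x p) (\<lambda>b. pdiff (\<lambda>x. ell x q b) c x)))"
    unfolding gconn_def by (simp only: pdiff_lam(2)[OF assms(1)] gf_scale gf_add)
  thus ?thesis
    unfolding gf_ell[OF assms] gf_ell_pdiff[OF assms] pdiff_lam(2)[OF assms(1)] pdiff_lam(2)[OF assms(2)] pdiff_lamd(2)[OF assms(2)]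
    by (simp add: lamd_def algebra_simps add_divide_distrib)
qed

lemma EE_delta: "EE (\<lambda>j. (if j = Some None then - 1 else 0) * f j) = f (Some None)" "EE (\<lambda>j. if j = Some None then - 1 else 0) = 1"
  by (simp_all add: EE_def)

lemma pdiff_shift_v: "pdiff shift_v a x = co (\<lambda>j. if j = Some None then - 1 else 0) 0 0 a"
proof -
  have "pdiff shift_v a x = - pdiff (\<lambda>x. bpt x (Some None)) a x"
    unfolding bpt_def by (simp add: pdiff_minus)
  also have "... = co (\<lambda>j. if j = Some None then - 1 else 0) 0 0 a"
    unfolding pdiff_bpt by (simp add: co_def EE_def)
  finally show ?thesis .
qed

lemma pdiff_Xtau: "pdiff tau a x = co (\<lambda>_. 0) 0 1 a"
  by (simp add: co_def pdiff_component EE_const)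

lemma gform_shift_lam:
  fixes x :: "'n::finite point"
  assumes "regz x q"
  shows "gform shift_v (\<lambda>x. lam x q) x = - (psi (tau x) q - psi (tau x) (q + shift_v x)) * lam x q
     - lamd x q / of_nat CARD('n)"
proof -
  have "gform shift_v (\<lambda>x. lam x q) x = lam x q * gf (co (\<lambda>j. if j = Some None then - 1 else 0) 0 0) (ell x q)"
    unfolding gform_def by (simp only: pdiff_lam(2)[OF assms] pdiff_shift_v gf_scale)
  also have "... = lam x q * (psi (tau x) (q + shift_v x) - psi (tau x) q - LE x q / of_nat CARD('n))"
    unfolding ell_def gf_co EE_delta by (simp add: LE_def bpt_def[of x "Some None"])
  finally show ?thesis by (simp add: lamd_def algebra_simps)
qed

lemma gform_tau_lam:
  assumes "regz x q"
  shows "gform tau (\<lambda>x. lam x q) x = - 2 * of_real pi * \<i> * lam x q"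
proof -
  have "gform tau (\<lambda>x. lam x q) x = lam x q * gf (co (\<lambda>_. 0) 0 1) (ell x q)"
    unfolding gform_def by (simp only: pdiff_lam(2)[OF assms] pdiff_Xtau gf_scale)
  thus ?thesis by (simp add: ell_def gf_co EE_const)
qed

lemma gform_shift_tau:
  "gform shift_v shift_v (x :: 'n::finite point) = - 1 - 1 / of_nat CARD('n)"
  "gform shift_v tau x = 0" "gform tau tau x = 0"
  by (simp_all add: gform_def pdiff_shift_v pdiff_Xtau gf_co EE_def)

text \<open>A constant gradient can be moved through the derivative of the pairing, and it has no
  Hessian. This covers w and tau.\<close>

lemma gconn_linear:
  assumes "\<And>a y. pdiff f a y = k a" "holo_on h V" "open V" "x \<in> V"
  shows "gconn f h c x = pdiff (gform f h) c x" "gconn h f c x = 0"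
proof -
  have h: "holo_on (pdiff h b) {x}" for b
    by (rule holo_at[OF holo_on_pdiff[OF assms(2,3)] assms(4)])
  have "gform f h = (\<lambda>x. \<Sum>!a b. (g_star $ a $ b * k a) * pdiff h b x)"
    by (rule ext) (simp add: gform_def gf_def assms(1))
  hence "pdiff (gform f h) c x = pdiff (\<lambda>x. \<Sum>!a b. (g_star $ a $ b * k a) * pdiff h b x) c x"
    by simp
  also have "... = (\<Sum>!a. pdiff (\<lambda>x. \<Sum>!b. (g_star $ a $ b * k a) * pdiff h b x) c x)"
    by (rule pdiff_sum) (intro holo_on_sum holo_on_mult holo_on_const h)
  also have "... = (\<Sum>!a b. pdiff (\<lambda>x. (g_star $ a $ b * k a) * pdiff h b x) c x)"
    by (intro sum.cong refl, rule pdiff_sum) (intro holo_on_sum holo_on_mult holo_on_const h)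
  also have "... = gconn f h c x"
    by (simp add: gconn_def gf_def assms(1) pdiff_cmult[OF h])
  finally show "gconn f h c x = pdiff (gform f h) c x" by simp
  have "pdiff f b = (\<lambda>x. k b)" for b by (rule ext) (rule assms(1))
  thus "gconn h f c x = 0" by (simp add: gconn_def gf_def)
qed

section \<open>Flat pencils from data affine in one coordinate\<close>

lemma inverse_sums:
  fixes G :: "complex ^ 'm::finite ^ 'm"
  assumes "invertible G"
  shows "(\<Sum>!i. matrix_inv G $ u $ i * (\<Sum>!s. G $ i $ s * f s)) = f u"
    and "(\<Sum>!i. G $ u $ i * (\<Sum>!s. matrix_inv G $ i $ s * f s)) = f u"
proof -
  have *: "(\<Sum>!i. A $ u $ i * (\<Sum>!s. B $ i $ s * f s)) = f u" if "A ** B = mat 1" for A B :: "complex ^ 'm ^ 'm"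
  proof -
    have "(A *v (B *v (\<chi> s. f s))) $ u = f u"
      by (simp add: matrix_vector_mul_assoc that)
    thus ?thesis by (simp add: matrix_vector_mult_def)
  qed
  show "(\<Sum>!i. matrix_inv G $ u $ i * (\<Sum>!s. G $ i $ s * f s)) = f u"
    by (rule *) (rule matrix_inv_left[OF assms])
  show "(\<Sum>!i. G $ u $ i * (\<Sum>!s. matrix_inv G $ i $ s * f s)) = f u"
    by (rule *) (rule matrix_inv_right[OF assms])
qed

lemma matrix_inv_sym:
  fixes G :: "complex ^ 'm::finite ^ 'm"
  assumes "transpose G = G" "invertible G"
  shows "matrix_inv G $ i $ j = matrix_inv G $ j $ i"
proof -
  have "transpose (matrix_inv G) ** G = mat 1"
    using arg_cong[OF matrix_inv_right[OF assms(2)], of transpose] assms(1)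
    by (simp add: matrix_transpose_mul)
  hence "transpose (matrix_inv G) ** (G ** matrix_inv G) = matrix_inv G"
    by (simp add: matrix_mul_assoc)
  hence "transpose (matrix_inv G) = matrix_inv G" by (simp add: matrix_inv_right[OF assms(2)])
  hence "transpose (matrix_inv G) $ j $ i = matrix_inv G $ j $ i" by simp
  thus ?thesis by (simp add: transpose_def)
qed

text \<open>Obtained by differentiating the product of \<open>g\<close> with its inverse, which is
  constant.\<close>

lemma pdiff_matrix_inv:
  fixes g :: "(complex, 'k::finite) vec => complex ^ 'm::finite ^ 'm"
  assumes "open V" "p \<in> V" "\<And>q. q \<in> V ==> invertible (g q)" "\<And>i j. holo_on (\<lambda>q. g q $ i $ j) V"
  shows "pdiff (\<lambda>q. matrix_inv (g q) $ a $ b) s p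
    = - (\<Sum>!e. matrix_inv (g p) $ a $ e * (\<Sum>!v. pdiff (\<lambda>q. g q $ e $ v) s p * matrix_inv (g p) $ v $ b))"
proof -
  have hg: "holo_on (\<lambda>q. g q $ i $ j) {p}" for i j by (rule holo_at[OF assms(4,2)])
  have hi: "holo_on (\<lambda>q. matrix_inv (g q) $ i $ j) {p}" for i j
    by (rule holo_at[OF holo_on_matrix_inv[OF assms(4,3,1)] assms(2)])
  have "(\<Sum>!v. g p $ e $ v * pdiff (\<lambda>q. matrix_inv (g q) $ v $ b) s p)
     = - (\<Sum>!v. pdiff (\<lambda>q. g q $ e $ v) s p * matrix_inv (g p) $ v $ b)" for e
  proof -
    have "pdiff (\<lambda>q. \<Sum>!v. g q $ e $ v * matrix_inv (g q) $ v $ b) s p = pdiff (\<lambda>q. if e = b then 1 else 0) s p"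
    proof (rule pdiff_cong[OF assms(1,2)])
      fix q assume "q \<in> V"
      hence "(g q ** matrix_inv (g q)) $ e $ b = (mat 1 :: complex ^ 'm ^ 'm) $ e $ b"
        using matrix_inv_right[OF assms(3)] by simp
      thus "(\<Sum>!v. g q $ e $ v * matrix_inv (g q) $ v $ b) = (if e = b then 1 else 0)"
        by (simp add: matrix_matrix_mult_def mat_def)
    qed
    hence "0 = pdiff (\<lambda>q. \<Sum>!v. g q $ e $ v * matrix_inv (g q) $ v $ b) s p" by simp
    also have "... = (\<Sum>!v. pdiff (\<lambda>q. g q $ e $ v * matrix_inv (g q) $ v $ b) s p)"
      by (rule pdiff_sum) (intro holo_on_mult hg hi)
    also have "... = (\<Sum>!v. pdiff (\<lambda>q. g q $ e $ v) s p * matrix_inv (g p) $ v $ b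
        + g p $ e $ v * pdiff (\<lambda>q. matrix_inv (g q) $ v $ b) s p)"
      by (intro sum.cong refl pdiff_mult hg hi)
    finally show ?thesis by (simp add: sum.distrib eq_neg_iff_add_eq_0 add.commute)
  qed
  hence "(\<Sum>!e. matrix_inv (g p) $ a $ e * (\<Sum>!v. g p $ e $ v * pdiff (\<lambda>q. matrix_inv (g q) $ v $ b) s p))
     = (\<Sum>!e. matrix_inv (g p) $ a $ e * - (\<Sum>!v. pdiff (\<lambda>q. g q $ e $ v) s p * matrix_inv (g p) $ v $ b))"
    by simp
  thus ?thesis unfolding inverse_sums(1)[OF assms(3)[OF assms(2)]] by (simp add: sum_negf)
qed

section \<open>Contravariant Christoffel symbols and raised curvature\<close>

definition symc :: "('m::finite => 'm => complex) => ('m => 'm => 'm => complex) => bool" where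
  "symc g c \<longleftrightarrow> (\<forall>i j k. (\<Sum>!s. g i s * c j k s) = (\<Sum>!s. g j s * c i k s))"

text \<open>Vanishing of the curvature with raised indices; \<open>d i j k s\<close> is the derivative of \<open>c i j k\<close> in direction \<open>s\<close>.\<close>
definition flatc :: "('m::finite => 'm => complex) => ('m => 'm => 'm => complex) => ('m => 'm => 'm => 'm => complex) => bool" where
  "flatc g c d \<longleftrightarrow> (\<forall>i j k l. (\<Sum>!s. g i s * (d j k l s - d j k s l)
     - c i j s * c s k l + c i k s * c s j l) = 0)"

text \<open>Uniqueness of the Levi-Civita connection in contravariant form: \<open>comp\<close> is
  compatibility with the metric, and \<open>symc\<close> is the vanishing of torsion after raising
  an index.\<close>

lemma levi_civita_unique:
  fixes g :: "(complex, 'm::finite) vec => complex ^ 'm ^ 'm"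
  assumes V: "open V" "p \<in> V" "\<And>q. q \<in> V ==> invertible (g q)" "\<And>e k. holo_on (\<lambda>q. g q $ e $ k) V"
    and sym: "transpose (g p) = g p"
    and comp: "\<And>e k l. pdiff (\<lambda>q. g q $ e $ k) l p = c e k l + c k e l"
    and tors: "symc (\<lambda>e k. g p $ e $ k) c"
  shows "levi_civita g p k s l = - (\<Sum>!w. matrix_inv (g p) $ s $ w * c w k l)" (is ?L)
    and "levi_civita g p k s l = levi_civita g p k l s"
    and "contra_christoffel g p e k l = c e k l"
proof -
  define h where "h = (\<lambda>i j. matrix_inv (g p) $ i $ j)"
  define G where "G = (\<lambda>i j. g p $ i $ j)"
  note inv = V(3)[OF V(2)]
  have hs: "h i j = h j i" for i j unfolding h_def by (rule matrix_inv_sym[OF sym inv])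
  have hG: "(\<Sum>!e. h u e * (\<Sum>!s. G e s * f s)) = f u"
    and Gh: "(\<Sum>!e. G u e * (\<Sum>!s. h e s * f s)) = f u" for f u
    unfolding h_def G_def by (rule inverse_sums[OF inv])+
  \<comment> \<open>Up to sign \<open>B y s n\<close> is the Christoffel symbol with upper index
    \<open>y\<close>; \<open>Bsym\<close> says that there is no torsion.\<close>
  define B where "B = (\<lambda>y s n. \<Sum>!k. h n k * c k y s)"
  have R: "(\<Sum>!s. G e s * c k l s) = (\<Sum>!s. G k s * c e l s)" for e k l
    using tors unfolding symc_def G_def by blast
  have Bsym: "B l u v = B l v u" for l u v
  proof -
    have "B l u v = (\<Sum>!k. h v k * (\<Sum>!e. h u e * (\<Sum>!s. G e s * c k l s)))"
      unfolding B_def hG ..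
    also have "... = (\<Sum>!k e. h v k * h u e * (\<Sum>!s. G k s * c e l s))"
      unfolding R[of _ _ l] by (simp add: sum_distrib_left mult.assoc)
    also have "... = (\<Sum>!e k. h v k * h u e * (\<Sum>!s. G k s * c e l s))"
      by (rule sum.swap)
    also have "... = (\<Sum>!e. h u e * (\<Sum>!k. h v k * (\<Sum>!s. G k s * c e l s)))"
      by (simp add: sum_distrib_left mult.assoc mult.left_commute)
    also have "... = B l v u" unfolding hG B_def ..
    finally show ?thesis .
  qed
  have dh: "pdiff (\<lambda>q. matrix_inv (g q) $ n $ l) s p = - (\<Sum>!y. B y s n * h y l) - (\<Sum>!y. B y s l * h y n)" for n l s
  proof -
    have "pdiff (\<lambda>q. matrix_inv (g q) $ n $ l) s p = - (\<Sum>!w. h n w * (\<Sum>!y. (c w y s + c y w s) * h y l))"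
      using pdiff_matrix_inv[OF V, of n l s] by (simp only: h_def comp)
    also have "... = - (\<Sum>!w y. h n w * c w y s * h y l) - (\<Sum>!w. h n w * (\<Sum>!y. h y l * c y w s))"
      by (simp add: sum_distrib_left sum.distrib algebra_simps)
    also have "(\<Sum>!w y. h n w * c w y s * h y l) = (\<Sum>!y w. h n w * c w y s * h y l)"
      by (rule sum.swap)
    also have "... = (\<Sum>!y. B y s n * h y l)" by (simp add: B_def sum_distrib_right)
    also have "(\<Sum>!w. h n w * (\<Sum>!y. h y l * c y w s)) = (\<Sum>!y. B y s l * h y n)"
      by (simp add: B_def hs[of _ l] hs[of _ n] mult.commute)
    finally show ?thesis .
  qed
  have L: "levi_civita g p k s l = - B k l s" for k s l
  proof -
    define S where "S = (\<lambda>a b d. \<Sum>!y. B y a b * h y d)"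
    have S: "S a b d = S b a d" for a b d unfolding S_def by (subst Bsym) simp
    have Sh: "S s l n = (\<Sum>!y. h n y * B y s l)" for n
      unfolding S_def by (intro sum.cong refl) (subst hs, simp add: mult.commute)
    have "levi_civita g p k s l = 1/2 * (\<Sum>!n. G k n * ((- S s n l - S s l n) + (- S l n s - S l s n) - (- S n s l - S n l s)))"
      unfolding levi_civita_def Let_def dh G_def S_def ..
    also have "... = 1/2 * (\<Sum>!n. G k n * (- 2 * (\<Sum>!y. h n y * B y s l)))"
    proof -
      \<comment> \<open>Four of the six terms of the Koszul formula cancel by the symmetry of
        \<open>S\<close> in its first two arguments; the other two coincide.\<close>
      have "(- S s n l - S s l n) + (- S l n s - S l s n) - (- S n s l - S n l s) = - 2 * S s l n" for n
        using S[of s n l] S[of l n s] S[of l s n] by simp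
      thus ?thesis by (simp only: Sh)
    qed
    also have "... = - (\<Sum>!n. G k n * (\<Sum>!y. h n y * B y s l))"
      by (simp add: sum_distrib_left sum_negf algebra_simps)
    also have "... = - B k s l" unfolding Gh ..
    also have "... = - B k l s" by (subst Bsym) (rule refl)
    finally show ?thesis .
  qed
  show ?L unfolding L B_def h_def ..
  show "levi_civita g p k s l = levi_civita g p k l s" unfolding L by (subst Bsym) (rule refl)
  show "contra_christoffel g p e k l = c e k l"
    using Gh[of e "\<lambda>w. c w k l"] by (simp add: contra_christoffel_def L B_def G_def sum_negf)
qed

context
  fixes g :: "(complex, 'm::finite) vec => complex ^ 'm ^ 'm" and c :: "'m => 'm => 'm => (complex, 'm) vec => complex" and V
  assumes W: "open V" "\<And>q. q \<in> V ==> invertible (g q)" "\<And>d k. holo_on (\<lambda>q. g q $ d $ k) V"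
    and sym: "\<And>q. q \<in> V ==> transpose (g q) = g q"
    and hc: "\<And>d k e. holo_on (c d k e) V"
    and comp: "\<And>q d k e. q \<in> V ==> pdiff (\<lambda>q. g q $ d $ k) e q = c d k e q + c k d e q"
    and tors: "\<And>q. q \<in> V ==> symc (\<lambda>d k. g q $ d $ k) (\<lambda>d k e. c d k e q)"
begin

text \<open>With two indices raised the curvature is a polynomial in \<open>g\<close>,
  \<open>c\<close> and the first derivatives of \<open>c\<close>, without an inverse of the metric,
  so its vanishing can be compared coefficientwise along a pencil.\<close>

lemma riemann_raised:
  assumes p: "p \<in> V"
  shows "(\<Sum>!s. g p $ d $ s * (pdiff (c k e n) s p - pdiff (c k e s) n p) - c d k s p * c s e n p + c d e s p * c s k n p)
    = - (\<Sum>!s. g p $ d $ s * (\<Sum>!u. g p $ k $ u * riemann g p e u s n))"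
proof -
  note V = W(1) p W(2,3)
  define L where "L = (\<lambda>d k e q. levi_civita g q d k e)"
  define G where "G = (\<lambda>i j. g p $ i $ j)"
  note lc = levi_civita_unique[OF V(1) _ V(3,4) sym comp tors]
  have Leq: "L d k e q = - (\<Sum>!v. matrix_inv (g q) $ k $ v * c v d e q)" if "q \<in> V" for d k e q
    unfolding L_def by (rule lc(1)) (rule that | assumption)+
  have Lsym: "L d k e q = L d e k q" if "q \<in> V" for d k e q
    unfolding L_def by (rule lc(2)) (rule that | assumption)+
  have cL: "c k e n q = - (\<Sum>!v. g q $ k $ v * L e v n q)" if "q \<in> V" for k e n q
  proof -
    have "contra_christoffel g q k e n = c k e n q" by (rule lc(3)) (rule that | assumption)+
    thus ?thesis unfolding contra_christoffel_def L_def by simp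
  qed
  have hL: "holo_on (L d k e) V" for d k e
    by (rule holo_on_cong[OF _ V(1) Leq]) (intro holo_on_minus holo_on_sum holo_on_mult holo_on_matrix_inv V hc)
  have hg: "holo_on (\<lambda>q. g q $ d $ k) {p}" for d k by (rule holo_at[OF V(4,2)])
  have hLp: "holo_on (L d k e) {p}" for d k e by (rule holo_at[OF hL V(2)])
  define C where "C = (\<lambda>d k e. c d k e p)"
  define l where "l = (\<lambda>d k e. L d k e p)"
  define dl where "dl = (\<lambda>d k e s. pdiff (L d k e) s p)"
  have C: "C k e n = - (\<Sum>!v. G k v * l e v n)" for k e n
    unfolding C_def G_def l_def by (rule cL[OF V(2)])
  have R: "(\<Sum>!s. G d s * C k e s) = (\<Sum>!s. G k s * C d e s)" for d k e
    using tors[OF V(2)] unfolding symc_def G_def C_def by blast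
  have ls: "l d k e = l d e k" for d k e unfolding l_def by (rule Lsym[OF V(2)])
  have dls: "dl d k e s = dl d e k s" for d k e s
    unfolding dl_def by (rule pdiff_cong[OF V(1,2) Lsym])
  have dc: "pdiff (c k e n) s p = - (\<Sum>!v. (C k v s + C v k s) * l e v n + G k v * dl e v n s)" for k e n s
  proof -
    have "pdiff (c k e n) s p = pdiff (\<lambda>q. - (\<Sum>!v. g q $ k $ v * L e v n q)) s p"
      by (rule pdiff_cong[OF V(1,2) cL])
    also have "... = - pdiff (\<lambda>q. \<Sum>!v. g q $ k $ v * L e v n q) s p"
      by (rule pdiff_minus) (intro holo_on_sum holo_on_mult hg hLp)
    also have "pdiff (\<lambda>q. \<Sum>!v. g q $ k $ v * L e v n q) s p = (\<Sum>!v. pdiff (\<lambda>q. g q $ k $ v * L e v n q) s p)"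
      by (rule pdiff_sum) (intro holo_on_mult hg hLp)
    also have "... = (\<Sum>!v. (C k v s + C v k s) * l e v n + G k v * dl e v n s)"
      unfolding C_def l_def dl_def G_def comp[OF V(2), symmetric] by (intro sum.cong refl pdiff_mult hg hLp)
    finally show ?thesis .
  qed
  have rie: "riemann g p e u s n = dl e n u s - dl e s u n + (\<Sum>!v. l e s v * l v n u - l e n v * l v s u)" for e u s n
    unfolding riemann_def dl_def l_def L_def ..
  have CC: "(\<Sum>!s. C d k s * C s e n) = - (\<Sum>!s. G d s * (\<Sum>!v. C v k s * l e v n))" for k e
  proof -
    have Gs: "G a b = G b a" for a b
    proof -
      have "transpose (g p) $ a $ b = g p $ a $ b" using sym[OF V(2)] by simp
      thus ?thesis by (simp add: transpose_def G_def)
    qed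
    have "(\<Sum>!s. C d k s * C s e n) = - (\<Sum>!s v. C d k s * G s v * l e v n)"
      unfolding C[of _ e n] by (simp add: sum_distrib_left sum_negf mult.assoc)
    also have "(\<Sum>!s v. C d k s * G s v * l e v n) = (\<Sum>!v s. C d k s * G s v * l e v n)"
      by (rule sum.swap)
    also have "... = (\<Sum>!v. (\<Sum>!s. G v s * C d k s) * l e v n)"
      unfolding sum_distrib_right by (intro sum.cong refl) (subst Gs, simp)
    also have "... = (\<Sum>!v s. G d s * C v k s * l e v n)"
      unfolding R[of _ d k] by (simp add: sum_distrib_right)
    also have "... = (\<Sum>!s v. G d s * C v k s * l e v n)"
      by (rule sum.swap)
    finally show ?thesis by (simp add: sum_distrib_left mult.assoc)
  qed
  have Cl: "(\<Sum>!v. C k v s * l e v n) = - (\<Sum>!u. G k u * (\<Sum>!v. l e n v * l v s u))" for s n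
  proof -
    have "(\<Sum>!v. C k v s * l e v n) = - (\<Sum>!v u. G k u * l v u s * l e v n)"
      unfolding C[of k _ s] by (simp add: sum_distrib_right sum_negf)
    also have "(\<Sum>!v u. G k u * l v u s * l e v n) = (\<Sum>!u v. G k u * l v u s * l e v n)"
      by (rule sum.swap)
    also have "... = (\<Sum>!u. G k u * (\<Sum>!v. l e n v * l v s u))"
      by (simp add: sum_distrib_left ls[of _ _ s] ls[of e _ n] mult.assoc mult.commute[of "l e n _"])
    finally show ?thesis .
  qed
  have 1: "pdiff (c k e n) s p - pdiff (c k e s) n p
     = - (\<Sum>!u. G k u * riemann g p e u s n) - (\<Sum>!v. C v k s * l e v n) + (\<Sum>!v. C v k n * l e v s)" for s
  proof -
    have "pdiff (c k e n) s p - pdiff (c k e s) n p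
      = - (\<Sum>!v. C k v s * l e v n) + (\<Sum>!v. C k v n * l e v s)
        - (\<Sum>!u. G k u * (dl e u n s - dl e u s n))
        - (\<Sum>!v. C v k s * l e v n) + (\<Sum>!v. C v k n * l e v s)"
      unfolding dc by (simp add: sum.distrib sum_subtractf algebra_simps)
    also have "- (\<Sum>!v. C k v s * l e v n) + (\<Sum>!v. C k v n * l e v s)
        - (\<Sum>!u. G k u * (dl e u n s - dl e u s n)) = - (\<Sum>!u. G k u * riemann g p e u s n)"
      unfolding Cl rie sum_subtractf dls[of e _ n] dls[of e _ s]
      by (simp add: sum.distrib sum_subtractf algebra_simps)
    finally show ?thesis .
  qed
  have "(\<Sum>!s. G d s * (pdiff (c k e n) s p - pdiff (c k e s) n p))
     = - (\<Sum>!s. G d s * (\<Sum>!u. G k u * riemann g p e u s n))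
       - (\<Sum>!s. G d s * (\<Sum>!v. C v k s * l e v n)) + (\<Sum>!s v. G d s * (C v k n * l e v s))"
    unfolding 1 by (simp add: sum.distrib sum_subtractf sum_negf sum_distrib_left algebra_simps)
  also have "(\<Sum>!s v. G d s * (C v k n * l e v s)) = (\<Sum>!v s. G d s * (C v k n * l e v s))"
    by (rule sum.swap)
  also have "... = - (\<Sum>!v. C d e v * C v k n)"
    unfolding C[of d e] mult_minus_left sum_negf minus_minus sum_distrib_right
    by (intro sum.cong refl) (subst ls, simp)
  finally show ?thesis
    using CC[of k e] unfolding C_def G_def by (simp add: sum.distrib sum_subtractf algebra_simps)
qed

lemma flat_from_data:
  assumes p: "p \<in> V"
    and flat: "flatc (\<lambda>i j. g p $ i $ j) (\<lambda>i j k. c i j k p) (\<lambda>i j k s. pdiff (c i j k) s p)"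
  shows "flat_at g p" "contra_christoffel g p i j k = c i j k p"
proof -
  note V = W(1) p W(2,3)
  note inv = V(3)[OF V(2)]
  have z: "(\<Sum>!s. g p $ i $ s * (\<Sum>!u. g p $ j $ u * riemann g p k u s l)) = 0" for i j k l
    using riemann_raised[OF p, of i j k l] flat unfolding flatc_def by simp
  \<comment> \<open>The two raised indices are lowered one after the other by invertibility of the
    metric.\<close>
  have cancel: "f u = 0" if "\<And>i. (\<Sum>!s. g p $ i $ s * f s) = 0" for f u
    using inverse_sums(1)[OF inv, of u f] by (simp add: that)
  have "riemann g p k u s l = 0" for k u s l
    by (rule cancel[of "\<lambda>u. riemann g p k u s l"],
        rule cancel[of "\<lambda>s. \<Sum>!u. g p $ j $ u * riemann g p k u s l" for j]) (rule z)
  thus "flat_at g p" by (simp add: flat_at_def)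
  show "contra_christoffel g p i j k = c i j k p"
    by (rule levi_civita_unique(3)[OF V sym[OF V(2)] comp[OF V(2)] tors[OF V(2)]])
qed

end

section \<open>Polynomial dependence on the pencil parameter\<close>

lemma quadratic_zero:
  fixes a b c :: complex
  assumes "d > 0" "\<And>e. norm e < d ==> a + e * b + e\<^sup>2 * c = 0"
  shows "a = 0" "b = 0" "c = 0"
proof -
  define t where "t = complex_of_real (d / 2)"
  have t: "t ~= 0" "norm t < d" "norm (- t) < d" using assms(1) by (auto simp: t_def)
  show a: "a = 0" using assms(2)[of 0] assms(1) by simp
  have "t * b + t\<^sup>2 * c = 0" "- t * b + t\<^sup>2 * c = 0" using assms(2)[OF t(2)] assms(2)[OF t(3)] a by auto
  hence "2 * t * b = 0" "2 * t\<^sup>2 * c = 0" by algebra+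
  thus "b = 0" "c = 0" using t(1) by auto
qed

text \<open>The condition is bilinear in metric and symbols, so along the affine family it is a
  quadratic polynomial in the parameter. Vanishing for small parameters kills all three
  coefficients, and the top one is the condition for \<open>g'\<close> and
  \<open>c'\<close>.\<close>

lemma symc_affine:
  assumes "d > 0"
    "\<And>u. norm u < d ==> symc (\<lambda>i j. g i j + u * g' i j) (\<lambda>i j k. c i j k + u * c' i j k)"
  shows "symc (\<lambda>i j. g i j + K * g' i j) (\<lambda>i j k. c i j k + K * c' i j k)" "symc g' c'"
proof -
  define A where "A = (\<lambda>(g :: 'a => 'a => complex) (c :: 'a => 'a => 'a => complex) i j k. \<Sum>!m. g i m * c j k m - g j m * c i k m)"
  have s: "symc g c \<longleftrightarrow> (\<forall>i j k. A g c i j k = 0)" for g c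
    by (simp add: symc_def A_def sum_subtractf)
  have e: "A (\<lambda>i j. g i j + u * g' i j) (\<lambda>i j k. c i j k + u * c' i j k) i j k
     = A g c i j k + u * (A g c' i j k + A g' c i j k) + u\<^sup>2 * A g' c' i j k" for u i j k
    unfolding A_def sum_distrib_left sum.distrib[symmetric]
    by (intro sum.cong refl) (simp add: algebra_simps power2_eq_square)
  have "A g c i j k + u * (A g c' i j k + A g' c i j k) + u\<^sup>2 * A g' c' i j k = 0" if "norm u < d" for u i j k
    using assms(2)[OF that] unfolding s e by blast
  note z = quadratic_zero[OF assms(1) this]
  show "symc (\<lambda>i j. g i j + K * g' i j) (\<lambda>i j k. c i j k + K * c' i j k)" "symc g' c'"
    unfolding s e by (simp_all add: z)
qed

text \<open>Metric times derivative and symbol times symbol are both quadratic along the affine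
  family, so the argument of \<open>symc_affine\<close> applies.\<close>

lemma flatc_affine:
  assumes "d > 0"
    "\<And>v. norm v < d ==> flatc (\<lambda>i j. g i j + v * g' i j) (\<lambda>i j l. c i j l + v * c' i j l)
        (\<lambda>i j l m. D i j l m + v * D' i j l m)"
  shows "flatc (\<lambda>i j. g i j + K * g' i j) (\<lambda>i j l. c i j l + K * c' i j l)
        (\<lambda>i j l m. D i j l m + K * D' i j l m)" "flatc g' c' D'"
proof -
  define A where "A = (\<lambda>(g :: 'a => 'a => complex) (c :: 'a => 'a => 'a => complex) (k :: 'a => 'a => 'a => complex) (D :: 'a => 'a => 'a => 'a => complex) i j l m.
    \<Sum>!u. g i u * (D j l m u - D j l u m) - c i j u * k u l m + c i l u * k u j m)"
  have s: "flatc g c D \<longleftrightarrow> (\<forall>i j l m. A g c c D i j l m = 0)" for g c D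
    by (simp add: flatc_def A_def)
  have e: "A (\<lambda>i j. g i j + v * g' i j) (\<lambda>i j l. c i j l + v * c' i j l) (\<lambda>i j l. c i j l + v * c' i j l)
       (\<lambda>i j l m. D i j l m + v * D' i j l m) i j l m
     = A g c c D i j l m + v * (A g c c' D' i j l m + A g' c' c D i j l m) + v\<^sup>2 * A g' c' c' D' i j l m" for v i j l m
    unfolding A_def sum_distrib_left sum.distrib[symmetric]
    by (intro sum.cong refl) (simp add: algebra_simps power2_eq_square)
  have "A g c c D i j l m + v * (A g c c' D' i j l m + A g' c' c D i j l m) + v\<^sup>2 * A g' c' c' D' i j l m = 0"
    if "norm v < d" for v i j l m
    using assms(2)[OF that] unfolding s e by blast
  note z = quadratic_zero[OF assms(1) this]
  show "flatc (\<lambda>i j. g i j + K * g' i j) (\<lambda>i j l. c i j l + K * c' i j l)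
        (\<lambda>i j l m. D i j l m + K * D' i j l m)" "flatc g' c' D'"
    unfolding s e by (simp_all add: z)
qed

lemma line_affine:
  assumes f: "holo_on f W" "open W" and b: "ball p d \<subseteq> W" and z: "\<And>q. q \<in> W ==> pdiff (pdiff f e) e q = 0"
    and n: "norm v < d"
  shows "f (p + axis e v) = f p + v * pdiff f e p"
proof -
  have inW: "p + axis e s \<in> W" if "norm s < d" for s
    using b that by (auto simp: dist_norm norm_axis intro!: subsetD[OF b])
  have d: "d > 0" using n norm_ge_zero[of v] by linarith
  have const: "\<exists>k. \<forall>s\<in>ball 0 d. u s = k" if "\<And>s. norm s < d ==> DERIV u s :> 0" for u :: "complex => complex"
    by (rule has_field_derivative_zero_constant) (auto intro: has_field_derivative_at_within that)
  have "\<exists>k. \<forall>s\<in>ball 0 d. pdiff f e (p + axis e s) = k"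
  proof (rule const)
    fix s :: complex assume "norm s < d"
    thus "DERIV (\<lambda>s. pdiff f e (p + axis e s)) s :> 0"
      using holo_on_line[OF holo_on_pdiff[OF f] inW] z[OF inW] by metis
  qed
  then obtain k where k: "\<And>s. norm s < d ==> pdiff f e (p + axis e s) = k" by auto
  have "\<exists>m. \<forall>s\<in>ball 0 d. f (p + axis e s) - s * k = m"
  proof (rule const)
    fix s :: complex assume s: "norm s < d"
    show "DERIV (\<lambda>s. f (p + axis e s) - s * k) s :> 0"
      using holo_on_line[OF f(1) inW[OF s]] k[OF s] by (auto intro!: derivative_eq_intros)
  qed
  then obtain m where m: "\<And>s. norm s < d ==> f (p + axis e s) - s * k = m" by auto
  have 0: "p + axis e 0 = p" by (simp add: axis_def vec_eq_iff)
  have "f p = m" "pdiff f e p = k" using m[of 0] k[of 0] d unfolding 0 by simp_all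
  thus ?thesis using m[OF n] by (simp add: algebra_simps)
qed

text \<open>The metrics \<open>g\<close>, \<eta> and the members of the pencil are each passed to
  \<open>flat_from_data\<close>, with symbols \<open>c\<close>, \<open>c'\<close> and c + K c'.
  Affinity alone does not make \<eta> invertible, so this enters as the separate hypothesis
  \<open>einv\<close>.\<close>

theorem affine_flat_pencil:
  fixes g :: "(complex, 'm::finite) vec => complex ^ 'm ^ 'm" and c :: "'m => 'm => 'm => (complex, 'm) vec => complex"
    and e :: 'm
  defines "\<eta> \<equiv> \<lambda>p. \<chi> j k. pdiff (\<lambda>q. g q $ j $ k) e p"
  assumes W: "open W" and inv: "\<And>q. q \<in> W ==> invertible (g q)" and hg: "\<And>j k. holo_on (\<lambda>q. g q $ j $ k) W"
    and sym: "\<And>q. q \<in> W ==> transpose (g q) = g q"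
    and hc: "\<And>j k l. holo_on (c j k l) W"
    and comp: "\<And>q j k l. q \<in> W ==> pdiff (\<lambda>q. g q $ j $ k) l q = c j k l q + c k j l q"
    and tors: "\<And>q. q \<in> W ==> symc (\<lambda>j k. g q $ j $ k) (\<lambda>j k l. c j k l q)"
    and flat: "\<And>q. q \<in> W ==> flatc (\<lambda>j k. g q $ j $ k) (\<lambda>j k l. c j k l q) (\<lambda>j k l u. pdiff (c j k l) u q)"
    and ag: "\<And>q j k. q \<in> W ==> pdiff (pdiff (\<lambda>q. g q $ j $ k) e) e q = 0"
    and ac: "\<And>q j k l. q \<in> W ==> pdiff (pdiff (c j k l) e) e q = 0"
    and einv: "\<And>q. q \<in> W ==> invertible (\<eta> q)"
  shows "flat_pencil W g \<eta>"
    and "p \<in> W ==> contra_christoffel \<eta> p j k l = pdiff (\<lambda>q. contra_christoffel g q j k l) e p"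
proof -
  define c' where "c' = (\<lambda>j k l. pdiff (c j k l) e)"
  have \<eta>: "\<eta> q $ j $ k = pdiff (\<lambda>q. g q $ j $ k) e q" for q j k by (simp add: \<eta>_def)
  have h\<eta>: "holo_on (\<lambda>q. \<eta> q $ j $ k) W" for j k unfolding \<eta> by (rule holo_on_pdiff[OF hg W])
  have hc': "holo_on (c' j k l) W" for j k l unfolding c'_def by (rule holo_on_pdiff[OF hc W])
  have esym: "transpose (\<eta> q) = \<eta> q" if "q \<in> W" for q
  proof -
    have "g q $ a $ b = g q $ b $ a" if "q \<in> W" for q a b
    proof -
      have "transpose (g q) $ a $ b = g q $ a $ b" using sym[OF that] by simp
      thus ?thesis by (simp add: transpose_def)
    qed
    hence "pdiff (\<lambda>q. g q $ a $ b) e q = pdiff (\<lambda>q. g q $ b $ a) e q" for a b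
      by (intro pdiff_cong[OF W that])
    thus ?thesis by (simp add: vec_eq_iff transpose_def \<eta>)
  qed
  have ecomp: "pdiff (\<lambda>q. \<eta> q $ j $ k) l q = c' j k l q + c' k j l q" if q: "q \<in> W" for q j k l
  proof -
    have "pdiff (\<lambda>q. \<eta> q $ j $ k) l q = pdiff (pdiff (\<lambda>q. g q $ j $ k) l) e q"
      unfolding \<eta> by (rule pdiff_commute[OF hg W q])
    also have "... = pdiff (\<lambda>q. c j k l q + c k j l q) e q" by (rule pdiff_cong[OF W q comp])
    also have "... = c' j k l q + c' k j l q"
      unfolding c'_def by (rule pdiff_add[OF holo_at[OF hc q] holo_at[OF hc q]])
    finally show ?thesis .
  qed
  have adc: "pdiff (pdiff (pdiff (c j k l) u) e) e q = 0" if q: "q \<in> W" for j k l u q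
  proof -
    have 1: "pdiff (pdiff (c j k l) u) e q = pdiff (pdiff (c j k l) e) u q" if "q \<in> W" for q
      by (rule pdiff_commute[OF hc W that])
    have "pdiff (pdiff (pdiff (c j k l) u) e) e q = pdiff (pdiff (pdiff (c j k l) e) u) e q"
      by (rule pdiff_cong[OF W q 1])
    also have "... = pdiff (pdiff (pdiff (c j k l) e) e) u q"
      by (rule pdiff_commute[OF holo_on_pdiff[OF hc W] W q])
    also have "... = pdiff (\<lambda>_. 0) u q" by (rule pdiff_cong[OF W q ac])
    finally show ?thesis by simp
  qed
  have shift: "\<exists>d>0. \<forall>v. norm v < d \<longrightarrow> q + axis e v \<in> W \<and>
      (\<forall>j k. g (q + axis e v) $ j $ k = g q $ j $ k + v * \<eta> q $ j $ k) \<and>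
      (\<forall>j k l. c j k l (q + axis e v) = c j k l q + v * c' j k l q) \<and>
      (\<forall>j k l u. pdiff (c j k l) u (q + axis e v) = pdiff (c j k l) u q + v * pdiff (c' j k l) u q)" if q: "q \<in> W" for q
  proof -
    obtain d where d: "d > 0" "ball q d \<subseteq> W" using openE[OF W q] by blast
    have 1: "q + axis e v \<in> W" if "norm v < d" for v
      using that by (intro subsetD[OF d(2)]) (simp add: dist_norm norm_axis)
    have com: "pdiff (c' j k l) u q = pdiff (pdiff (c j k l) u) e q" for j k l u
      unfolding c'_def by (rule pdiff_commute[OF hc W q])
    show ?thesis
      unfolding \<eta> com unfolding c'_def
      by (intro exI[of _ d] conjI allI impI d 1 line_affine[OF hg W d(2) ag] line_affine[OF hc W d(2) ac]
          line_affine[OF holo_on_pdiff[OF hc W] W d(2) adc])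
  qed
  have data: "symc (\<lambda>j k. g q $ j $ k + K * \<eta> q $ j $ k) (\<lambda>j k l. c j k l q + K * c' j k l q)" (is ?s1)
    "symc (\<lambda>j k. \<eta> q $ j $ k) (\<lambda>j k l. c' j k l q)" (is ?s2)
    "flatc (\<lambda>j k. g q $ j $ k + K * \<eta> q $ j $ k) (\<lambda>j k l. c j k l q + K * c' j k l q)
        (\<lambda>j k l u. pdiff (c j k l) u q + K * pdiff (c' j k l) u q)" (is ?f1)
    "flatc (\<lambda>j k. \<eta> q $ j $ k) (\<lambda>j k l. c' j k l q) (\<lambda>j k l u. pdiff (c' j k l) u q)" (is ?f2)
    if q: "q \<in> W" for q K
  proof -
    obtain d where d: "d > 0" and sh: "\<And>v. norm v < d ==> q + axis e v \<in> W"
      "\<And>v j k. norm v < d ==> g (q + axis e v) $ j $ k = g q $ j $ k + v * \<eta> q $ j $ k"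
      "\<And>v j k l. norm v < d ==> c j k l (q + axis e v) = c j k l q + v * c' j k l q"
      "\<And>v j k l u. norm v < d ==> pdiff (c j k l) u (q + axis e v) = pdiff (c j k l) u q + v * pdiff (c' j k l) u q"
      using shift[OF q] by meson
    have s: "symc (\<lambda>j k. g q $ j $ k + v * \<eta> q $ j $ k) (\<lambda>j k l. c j k l q + v * c' j k l q)" if "norm v < d" for v
      using tors[OF sh(1)[OF that]] unfolding sh(2,3)[OF that] .
    have f: "flatc (\<lambda>j k. g q $ j $ k + v * \<eta> q $ j $ k) (\<lambda>j k l. c j k l q + v * c' j k l q)
        (\<lambda>j k l u. pdiff (c j k l) u q + v * pdiff (c' j k l) u q)" if "norm v < d" for v
      using flat[OF sh(1)[OF that]] unfolding sh(2,3,4)[OF that] .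
    show ?s1 ?s2 by (rule symc_affine[OF d s], assumption)+
    show ?f1 ?f2 by (rule flatc_affine[OF d f], assumption)+
  qed
  have ceta: "contra_christoffel \<eta> q j k l = c' j k l q" if "q \<in> W" for q j k l
    by (rule flat_from_data(2)[OF W einv h\<eta> esym hc' ecomp data(2) that data(4)[OF that]])
  have cg: "contra_christoffel g q j k l = c j k l q" if "q \<in> W" for q j k l
    by (rule flat_from_data(2)[OF W inv hg sym hc comp tors that flat[OF that]])
  have pen: "flat_at (pencil g \<eta> K) q \<and> (\<forall>j k l. contra_christoffel (pencil g \<eta> K) q j k l = c j k l q + K * c' j k l q)"
    if q: "q \<in> W" and i: "invertible (pencil g \<eta> K q)" for q K
  proof -
    \<comment> \<open>Levi-Civita data need an invertible metric in a neighbourhood, so the argument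
      takes place on the open part of \<open>W\<close> where this member of the pencil is
      nondegenerate.\<close>
    define V where "V = {q \<in> W. invertible (pencil g \<eta> K q)}"
    have p: "pencil g \<eta> K q $ j $ k = g q $ j $ k + K * \<eta> q $ j $ k" for q j k by (simp add: pencil_def)
    have hp: "holo_on (\<lambda>q. pencil g \<eta> K q $ j $ k) W" for j k
      unfolding p by (intro holo_on_add holo_on_mult holo_on_const hg h\<eta>)
    have V: "open V" "q \<in> V" "V \<subseteq> W" "\<And>q. q \<in> V ==> invertible (pencil g \<eta> K q)"
      unfolding V_def using q i by (auto intro!: open_invertible hp W)
    have psym: "transpose (pencil g \<eta> K q) = pencil g \<eta> K q" if "q \<in> V" for q
    proof -
      have "transpose (g q) $ a $ b = g q $ a $ b" "transpose (\<eta> q) $ a $ b = \<eta> q $ a $ b" for a b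
        using sym esym that V(3) by auto
      thus ?thesis by (simp add: vec_eq_iff transpose_def p)
    qed
    have pc: "holo_on (\<lambda>q. c j k l q + K * c' j k l q) V" for j k l
      by (rule holo_on_subset[OF _ V(3)]) (intro holo_on_add holo_on_mult holo_on_const hc hc')
    have pcomp: "pdiff (\<lambda>q. pencil g \<eta> K q $ j $ k) l q = (c j k l q + K * c' j k l q) + (c k j l q + K * c' k j l q)" if "q \<in> V" for q j k l
    proof -
      have qW: "q \<in> W" using that V(3) by blast
      have "pdiff (\<lambda>q. pencil g \<eta> K q $ j $ k) l q = pdiff (\<lambda>q. g q $ j $ k) l q + pdiff (\<lambda>q. K * \<eta> q $ j $ k) l q"
        unfolding p by (rule pdiff_add) (intro holo_on_mult holo_on_const holo_at[OF hg qW] holo_at[OF h\<eta> qW])+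
      also have "pdiff (\<lambda>q. K * \<eta> q $ j $ k) l q = K * pdiff (\<lambda>q. \<eta> q $ j $ k) l q"
        by (rule pdiff_cmult) (rule holo_at[OF h\<eta> qW])
      finally show ?thesis using comp[OF qW, of j k l] ecomp[OF qW, of j k l] by (simp add: algebra_simps)
    qed
    have dc: "pdiff (\<lambda>q. c j k l q + K * c' j k l q) u q = pdiff (c j k l) u q + K * pdiff (c' j k l) u q" for j k l u
      by (subst pdiff_add, rule holo_at[OF hc q], intro holo_on_mult holo_on_const holo_at[OF hc' q],
          subst pdiff_cmult, rule holo_at[OF hc' q]) (rule refl)
    have ps: "symc (\<lambda>j k. pencil g \<eta> K q $ j $ k) (\<lambda>j k l. c j k l q + K * c' j k l q)" if "q \<in> V" for q
      unfolding p by (rule data(1)) (use that V(3) in blast)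
    have pf: "flatc (\<lambda>j k. pencil g \<eta> K q $ j $ k) (\<lambda>j k l. c j k l q + K * c' j k l q)
       (\<lambda>j k l u. pdiff (\<lambda>q. c j k l q + K * c' j k l q) u q)"
      unfolding p dc by (rule data(3)[OF q])
    show ?thesis
      using flat_from_data[OF V(1,4) holo_on_subset[OF hp V(3)] psym pc pcomp ps V(2) pf] by blast
  qed
  show "flat_pencil W g \<eta>"
    unfolding flat_pencil_def contra_metric_on_def
    using W hg sym inv h\<eta> esym einv pen cg ceta by simp
  show "contra_christoffel \<eta> p j k l = pdiff (\<lambda>q. contra_christoffel g q j k l) e p" if p: "p \<in> W"
  proof -
    have "pdiff (\<lambda>q. contra_christoffel g q j k l) e p = pdiff (c j k l) e p"
      by (rule pdiff_cong[OF W p cg])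
    thus ?thesis using ceta[OF p] by (simp add: c'_def)
  qed
qed

subsection \<open>Pull-back of a constant metric\<close>

text \<open>The symmetry hypothesis expresses that the rows of \<open>J\<close> are gradients with respect to the flat coordinates.\<close>
lemma pullback_data:
  fixes J :: "(complex, 'm::finite) vec => complex ^ 'm ^ 'm" and k :: "'m => 'm => complex"
  defines "g \<equiv> \<lambda>q i e. \<Sum>!a b. k a b * J q $ i $ a * J q $ e $ b"
    and "c \<equiv> \<lambda>i e l q. \<Sum>!a b. k a b * J q $ i $ a * pdiff (\<lambda>q. J q $ e $ b) l q"
  assumes W: "open W" and hJ: "\<And>i a. holo_on (\<lambda>q. J q $ i $ a) W" and ks: "\<And>a b. k a b = k b a"
    and H: "\<And>q e a b. q \<in> W ==> (\<Sum>!s. J q $ s $ b * pdiff (\<lambda>q. J q $ e $ a) s q)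
         = (\<Sum>!s. J q $ s $ a * pdiff (\<lambda>q. J q $ e $ b) s q)"
    and q: "q \<in> W"
  shows "holo_on (c i e l) W" "pdiff (\<lambda>q. g q i e) l q = c i e l q + c e i l q"
    "symc (g q) (\<lambda>i e l. c i e l q)"
    "flatc (g q) (\<lambda>i e l. c i e l q) (\<lambda>i e l s. pdiff (c i e l) s q)"
proof -
  define j where "j = (\<lambda>i a. J q $ i $ a)"
  define dj where "dj = (\<lambda>i a l. pdiff (\<lambda>q. J q $ i $ a) l q)"
  \<comment> \<open>Contraction with \<open>J\<close> turns derivatives in the given coordinates
    into derivatives along the flat ones; \<open>h e a b\<close> is the Hessian of the
    \<open>e\<close>-th coordinate there, symmetric by \<open>H\<close>.\<close>
  define h where "h = (\<lambda>e a b. \<Sum>!s. j s b * dj e a s)"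
  have hs: "h e a b = h e b a" for e a b unfolding h_def j_def dj_def by (rule H[OF q])
  have hd: "holo_on (pdiff (\<lambda>q. J q $ e $ b) l) W" for e b l by (rule holo_on_pdiff[OF hJ W])
  have Jq: "holo_on (\<lambda>q. J q $ e $ b) {q}" and dq: "holo_on (pdiff (\<lambda>q. J q $ e $ b) l) {q}" for e b l
    by (rule holo_at[OF hJ q], rule holo_at[OF hd q])
  show hc: "holo_on (c i e l) W" for i e l
    unfolding c_def by (intro holo_on_sum holo_on_mult holo_on_const hJ hd)
  have swap: "(\<Sum>!a b. k a b * f a * f' b) = (\<Sum>!a b. k a b * f' a * f b)" for f f'
  proof -
    have "(\<Sum>!a b. k a b * f a * f' b) = (\<Sum>!b a. k a b * f a * f' b)" by (rule sum.swap)
    also have "... = (\<Sum>!a b. k a b * f' a * f b)"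
      by (intro sum.cong refl) (subst ks, simp)
    finally show ?thesis .
  qed
  show "pdiff (\<lambda>q. g q i e) l q = c i e l q + c e i l q"
  proof -
    have "pdiff (\<lambda>q. g q i e) l q = (\<Sum>!a. pdiff (\<lambda>q. \<Sum>!b. k a b * J q $ i $ a * J q $ e $ b) l q)"
      unfolding g_def by (rule pdiff_sum) (intro holo_on_sum holo_on_mult holo_on_const Jq)
    also have "... = (\<Sum>!a b. pdiff (\<lambda>q. (k a b * J q $ i $ a) * J q $ e $ b) l q)"
      by (intro sum.cong refl, rule pdiff_sum) (intro holo_on_sum holo_on_mult holo_on_const Jq)
    also have "... = (\<Sum>!a b. k a b * dj i a l * j e b + k a b * j i a * dj e b l)"
      by (intro sum.cong refl, subst pdiff_mult, intro holo_on_mult holo_on_const Jq, rule Jq,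
          subst pdiff_cmult, rule Jq) (simp add: j_def dj_def)
    also have "... = (\<Sum>!a b. k a b * j e a * dj i b l) + (\<Sum>!a b. k a b * j i a * dj e b l)"
      unfolding sum.distrib swap[of "\<lambda>a. dj i a l"] ..
    finally show ?thesis by (simp add: c_def j_def dj_def)
  qed
  have gh: "(\<Sum>!s. g q i s * dj e b s) = (\<Sum>!a d. k a d * j i a * h e b d)" for i e b
  proof -
    have "(\<Sum>!s. g q i s * dj e b s) = (\<Sum>!s a d. k a d * j i a * (j s d * dj e b s))"
      by (simp add: g_def j_def sum_distrib_right mult.assoc)
    also have "... = (\<Sum>!a s d. k a d * j i a * (j s d * dj e b s))"
      by (rule sum.swap)
    also have "... = (\<Sum>!a d s. k a d * j i a * (j s d * dj e b s))"
      by (intro sum.cong refl sum.swap)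
    finally show ?thesis by (simp add: h_def sum_distrib_left)
  qed
  have cj: "(\<Sum>!s. c i e s q * j s b) = (\<Sum>!a d. k a d * j i a * h e d b)" for i e b
  proof -
    have "(\<Sum>!s. c i e s q * j s b) = (\<Sum>!s a d. k a d * j i a * (j s b * dj e d s))"
      by (simp add: c_def j_def dj_def sum_distrib_right mult.assoc mult.commute[of "pdiff _ _ _"])
    also have "... = (\<Sum>!a s d. k a d * j i a * (j s b * dj e d s))"
      by (rule sum.swap)
    also have "... = (\<Sum>!a d s. k a d * j i a * (j s b * dj e d s))"
      by (intro sum.cong refl sum.swap)
    finally show ?thesis by (simp add: h_def sum_distrib_left)
  qed
  \<comment> \<open>Both sides contract row \<open>i\<close> with the Hessian of the
    \<open>e\<close>-th coordinate through the constant metric; they differ only in the Hessian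
    index that is contracted.\<close>
  have key: "(\<Sum>!s. g q i s * dj e b s) = (\<Sum>!s. c i e s q * j s b)" for i e b
    unfolding gh cj by (intro sum.cong refl) (subst hs, simp)
  show "symc (g q) (\<lambda>i e l. c i e l q)"
    unfolding symc_def
  proof (intro allI)
    fix i e l
    have 1: "(\<Sum>!s. g q i s * c e l s q) = (\<Sum>!a b. k a b * j e a * (\<Sum>!s. g q i s * dj l b s))" for i e
    proof -
      have "(\<Sum>!s. g q i s * c e l s q) = (\<Sum>!s a b. k a b * j e a * (g q i s * dj l b s))"
        unfolding c_def j_def dj_def sum_distrib_left by (intro sum.cong refl) simp
      also have "... = (\<Sum>!a s b. k a b * j e a * (g q i s * dj l b s))" by (rule sum.swap)
      also have "... = (\<Sum>!a b s. k a b * j e a * (g q i s * dj l b s))"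
        by (intro sum.cong refl sum.swap)
      finally show ?thesis by (simp add: sum_distrib_left)
    qed
    define u where "u = (\<lambda>i d. \<Sum>!a. k a d * j i a)"
    have 2: "(\<Sum>!a b. k a b * j i a * F b) = (\<Sum>!b. u i b * F b)" for i F
      unfolding u_def sum_distrib_right by (rule sum.swap)
    have 3: "(\<Sum>!s. g q i s * c e l s q) = (\<Sum>!b d. u e b * u i d * h l b d)" for i e
      unfolding 1 gh 2 by (simp add: sum_distrib_left mult.assoc)
    have "(\<Sum>!b d. u e b * u i d * h l b d) = (\<Sum>!d b. u e b * u i d * h l b d)"
      by (rule sum.swap)
    also have "... = (\<Sum>!b d. u i b * u e d * h l b d)"
      by (intro sum.cong refl) (subst hs, simp)
    finally show "(\<Sum>!s. g q i s * c e l s q) = (\<Sum>!s. g q e s * c i l s q)" unfolding 3 .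
  qed
  show "flatc (g q) (\<lambda>i e l. c i e l q) (\<lambda>i e l s. pdiff (c i e l) s q)"
    unfolding flatc_def
  proof (intro allI)
    fix i e l n
    define d2 where "d2 = (\<lambda>e b l s. pdiff (pdiff (\<lambda>q. J q $ e $ b) l) s q)"
    have d2s: "d2 e b l s = d2 e b s l" for e b l s unfolding d2_def by (rule pdiff_commute[OF hJ W q])
    have dc: "pdiff (c e l n) s q = (\<Sum>!a b. k a b * dj e a s * dj l b n) + (\<Sum>!a b. k a b * j e a * d2 l b n s)" for s n
    proof -
      have "pdiff (c e l n) s q = (\<Sum>!a. pdiff (\<lambda>q. \<Sum>!b. k a b * J q $ e $ a * pdiff (\<lambda>q. J q $ l $ b) n q) s q)"
        unfolding c_def by (rule pdiff_sum) (intro holo_on_sum holo_on_mult holo_on_const Jq dq)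
      also have "... = (\<Sum>!a b. pdiff (\<lambda>q. (k a b * J q $ e $ a) * pdiff (\<lambda>q. J q $ l $ b) n q) s q)"
        by (intro sum.cong refl, rule pdiff_sum) (intro holo_on_sum holo_on_mult holo_on_const Jq dq)
      also have "... = (\<Sum>!a b. k a b * dj e a s * dj l b n + k a b * j e a * d2 l b n s)"
        by (intro sum.cong refl, subst pdiff_mult, intro holo_on_mult holo_on_const Jq, rule dq,
            subst pdiff_cmult, rule Jq) (simp add: j_def dj_def d2_def)
      finally show ?thesis by (simp add: sum.distrib)
    qed
    \<comment> \<open>The second derivatives of \<open>J\<close> are symmetric in the last two
      indices and drop out; the remaining products of first derivatives match the quadratic terms of
      \<open>flatc\<close> by \<open>key\<close>.\<close>
    have 1: "pdiff (c e l n) s q - pdiff (c e l s) n q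
       = (\<Sum>!a b. k a b * dj e a s * dj l b n) - (\<Sum>!a b. k a b * dj l a s * dj e b n)" for s
      unfolding dc d2s[of l _ n s] swap[of "\<lambda>a. dj e a n"] by simp
    have 2: "(\<Sum>!s. g q i s * (\<Sum>!a b. k a b * dj e a s * dj l b n)) = (\<Sum>!s. c i e s q * c s l n q)" for e l
    proof -
      have sw: "(\<Sum>!s. F s * (\<Sum>!a b. k a b * E a s * dj l b n))
         = (\<Sum>!a b. k a b * (\<Sum>!s. F s * E a s) * dj l b n)" for F E
      proof -
        have "(\<Sum>!s. F s * (\<Sum>!a b. k a b * E a s * dj l b n))
          = (\<Sum>!s a b. k a b * (F s * E a s) * dj l b n)"
          unfolding sum_distrib_left by (intro sum.cong refl) simp
        also have "... = (\<Sum>!a s b. k a b * (F s * E a s) * dj l b n)" by (rule sum.swap)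
        also have "... = (\<Sum>!a b s. k a b * (F s * E a s) * dj l b n)"
          by (intro sum.cong refl sum.swap)
        finally show ?thesis by (simp add: sum_distrib_left sum_distrib_right)
      qed
      have "(\<Sum>!s. g q i s * (\<Sum>!a b. k a b * dj e a s * dj l b n))
        = (\<Sum>!s. c i e s q * (\<Sum>!a b. k a b * j s a * dj l b n))"
        unfolding sw[of "g q i" "\<lambda>a. dj e a"] sw[of "\<lambda>s. c i e s q" "\<lambda>a s. j s a"] key ..
      thus ?thesis by (simp add: c_def j_def dj_def)
    qed
    show "(\<Sum>!s. g q i s * (pdiff (c e l n) s q - pdiff (c e l s) n q) - c i e s q * c s l n q + c i l s q * c s e n q) = 0"
      unfolding 1 right_diff_distrib sum.distrib sum_subtractf 2 by simp
  qed
qed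

subsection \<open>Functions constant or affine in one coordinate\<close>

text \<open>Openness and holomorphy belong to the predicate so that the closure rules compose. For
  \<open>aff\<close> the derivative along \<open>e\<close> is required to be \<open>cst\<close>,
  that is, the second derivative along \<open>e\<close> vanishes.\<close>

definition cst :: "'m::finite => (complex, 'm) vec set => ((complex, 'm) vec => complex) => bool" where
  "cst e V f \<longleftrightarrow> open V \<and> holo_on f V \<and> (\<forall>p\<in>V. pdiff f e p = 0)"

definition aff :: "'m::finite => (complex, 'm) vec set => ((complex, 'm) vec => complex) => bool" where
  "aff e V f \<longleftrightarrow> open V \<and> holo_on f V \<and> cst e V (pdiff f e)"

lemma cst_cong: "cst e V f ==> (\<And>q. q \<in> V ==> g q = f q) ==> cst e V g"
  unfolding cst_def using holo_on_cong pdiff_cong by metis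

lemma cst_add: "cst e V f ==> cst e V g ==> cst e V (\<lambda>q. f q + g q)"
  unfolding cst_def by (auto simp: pdiff_add[OF holo_at holo_at])

lemma cst_mult: "cst e V f ==> cst e V g ==> cst e V (\<lambda>q. f q * g q)"
  unfolding cst_def by (auto simp: pdiff_mult[OF holo_at holo_at])

lemma cst_const: "open V ==> cst e V (\<lambda>q. k)"
  unfolding cst_def by auto

lemma cst_minus: "cst e V f ==> cst e V (\<lambda>q. - f q)"
  unfolding cst_def by (auto simp: pdiff_minus[OF holo_at])

lemma cst_diff: "cst e V f ==> cst e V g ==> cst e V (\<lambda>q. f q - g q)"
  using cst_add[of e V f "\<lambda>q. - g q"] cst_minus[of e V g] by simp

lemma cst_inverse: "cst e V f ==> (\<And>q. q \<in> V ==> f q ~= 0) ==> cst e V (\<lambda>q. inverse (f q))"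
  unfolding cst_def by (auto simp: pdiff_inverse[OF holo_at])

lemma cst_divide: "cst e V f ==> cst e V g ==> (\<And>q. q \<in> V ==> g q ~= 0) ==> cst e V (\<lambda>q. f q / g q)"
  unfolding divide_inverse by (rule cst_mult[OF _ cst_inverse])

lemma cst_sum: "open V ==> (\<And>i. i \<in> I ==> cst e V (f i)) ==> cst e V (\<lambda>q. \<Sum>i\<in>I. f i q)"
  by (induction I rule: infinite_finite_induct) (auto intro: cst_const cst_add)

lemma cst_prod: "open V ==> (\<And>i. i \<in> I ==> cst e V (f i)) ==> cst e V (\<lambda>q. \<Prod>i\<in>I. f i q)"
  by (induction I rule: infinite_finite_induct) (auto intro: cst_const cst_mult)

lemma cst_pdiff:
  assumes "cst e V f" shows "cst e V (pdiff f c)"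
proof -
  have f: "open V" "holo_on f V" "\<And>p. p \<in> V ==> pdiff f e p = 0" using assms by (auto simp: cst_def)
  have "pdiff (pdiff f c) e p = 0" if p: "p \<in> V" for p
  proof -
    have "pdiff (pdiff f c) e p = pdiff (pdiff f e) c p" by (rule pdiff_commute[OF f(2,1) p])
    also have "... = pdiff (\<lambda>_. 0) c p" by (rule pdiff_cong[OF f(1) p f(3)])
    finally show ?thesis by simp
  qed
  thus ?thesis using f holo_on_pdiff[OF f(2,1)] by (simp add: cst_def)
qed

lemma cst_matrix_inv:
  fixes K :: "(complex, 'k::finite) vec => complex ^ 'm::finite ^ 'm"
  assumes "open V" "\<And>i j. cst e V (\<lambda>q. K q $ i $ j)" "\<And>q. q \<in> V ==> invertible (K q)"
  shows "cst e V (\<lambda>q. matrix_inv (K q) $ i $ j)"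
proof (rule cst_cong[OF _ matrix_inv_cramer[OF assms(3)]])
  have det: "cst e V (\<lambda>q. det (N q))" if "\<And>i j. cst e V (\<lambda>q. N q $ i $ j)" for N :: "(complex, 'k::finite) vec => complex ^ 'm ^ 'm"
    unfolding det_def by (intro cst_sum cst_mult cst_prod cst_const assms(1) that)
  show "cst e V (\<lambda>q. det (\<chi> k l. if l = i then (if k = j then 1 else 0) else K q $ k $ l) / det (K q))"
  proof (intro cst_divide det)
    show "cst e V (\<lambda>q. (\<chi> k l. if l = i then (if k = j then 1 else 0) else K q $ k $ l) $ a $ b)" for a b
      using assms(2)[of a b] cst_const[OF assms(1)] by (cases "b = i") simp_all
  qed (use assms invertible_det_nz in auto)
qed

lemma aff_cong: "aff e V f ==> (\<And>q. q \<in> V ==> g q = f q) ==> aff e V g"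
  unfolding aff_def
  by (elim conjE, intro conjI, assumption, erule (1) holo_on_cong, assumption, erule cst_cong, rule pdiff_cong)

lemma cst_imp_aff: "cst e V f ==> aff e V f"
  using cst_pdiff[of e V f e] by (auto simp: aff_def cst_def)

lemma aff_add: "aff e V f ==> aff e V g ==> aff e V (\<lambda>q. f q + g q)"
  unfolding aff_def
  by (elim conjE, intro conjI holo_on_add, assumption+, rule cst_cong[OF cst_add], assumption+)
     (rule pdiff_add[OF holo_at holo_at])

lemma aff_cmult:
  assumes "cst e V f" "aff e V g" shows "aff e V (\<lambda>q. f q * g q)"
proof -
  have f: "open V" "holo_on f V" "\<And>p. p \<in> V ==> pdiff f e p = 0" using assms by (auto simp: cst_def)
  have g: "holo_on g V" "cst e V (pdiff g e)" using assms by (auto simp: aff_def)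
  have "cst e V (pdiff (\<lambda>q. f q * g q) e)"
    by (rule cst_cong[OF cst_mult[OF assms(1) g(2)]]) (simp add: pdiff_mult[OF holo_at[OF f(2)] holo_at[OF g(1)]] f(3))
  thus ?thesis using f g by (auto simp: aff_def)
qed

lemma aff_multc: "aff e V f ==> cst e V g ==> aff e V (\<lambda>q. f q * g q)"
  using aff_cmult[of e V g f] by (simp add: mult.commute)

lemma aff_minus: "aff e V f ==> aff e V (\<lambda>q. - f q)"
  using aff_cmult[OF cst_const[of V e "-1"], of f] by (simp add: aff_def)

lemma aff_diff: "aff e V f ==> aff e V g ==> aff e V (\<lambda>q. f q - g q)"
  using aff_add[of e V f "\<lambda>q. - g q"] aff_minus[of e V g] by simp

lemma aff_sum: "open V ==> (\<And>i. i \<in> I ==> aff e V (f i)) ==> aff e V (\<lambda>q. \<Sum>i\<in>I. f i q)"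
  by (induction I rule: infinite_finite_induct) (auto intro: cst_imp_aff cst_const aff_add)

lemma aff_pdiff:
  assumes "aff e V f" shows "aff e V (pdiff f c)"
proof -
  have f: "open V" "holo_on f V" "cst e V (pdiff f e)" using assms by (auto simp: aff_def)
  have "cst e V (pdiff (pdiff f c) e)"
    by (rule cst_cong[OF cst_pdiff[OF f(3), of c]]) (rule pdiff_commute[OF f(2,1)])
  thus ?thesis using f holo_on_pdiff[OF f(2,1)] by (simp add: aff_def)
qed

text \<open>The matrix elements are solved for \<open>G\<close> by the inverses of two frames that
  do not depend on \<open>e\<close>. The frames may differ, since the available pairings are between
  different families of points.\<close>

lemma aff_transfer:
  fixes K K' :: "(complex, 'm::finite) vec => complex ^ 'm ^ 'm"
  assumes V: "open V" and K: "\<And>i j. cst e V (\<lambda>q. K q $ i $ j)" "\<And>q. q \<in> V ==> invertible (K q)"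
    and K': "\<And>i j. cst e V (\<lambda>q. K' q $ i $ j)" "\<And>q. q \<in> V ==> invertible (K' q)"
    and M: "\<And>i j. aff e V (\<lambda>q. \<Sum>!a k. K q $ i $ a * G a k q * K' q $ j $ k)"
  shows "aff e V (G a k)"
proof -
  have "aff e V (\<lambda>q. \<Sum>!j. matrix_inv (K' q) $ k $ j * (\<Sum>!i. matrix_inv (K q) $ a $ i *
     (\<Sum>!a k. K q $ i $ a * G a k q * K' q $ j $ k)))"
    by (intro aff_sum V aff_cmult cst_matrix_inv K K' M)
  thus ?thesis
  proof (rule aff_cong)
    fix q assume q: "q \<in> V"
    have "(\<Sum>!i. matrix_inv (K q) $ a $ i * (\<Sum>!a k. K q $ i $ a * G a k q * K' q $ j $ k))
      = (\<Sum>!k. K' q $ j $ k * G a k q)" for j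
    proof -
      have "(\<Sum>!a k. K q $ i $ a * G a k q * K' q $ j $ k)
        = (\<Sum>!a. K q $ i $ a * (\<Sum>!k. K' q $ j $ k * G a k q))" for i
        unfolding sum_distrib_left by (intro sum.cong refl) simp
      thus ?thesis using inverse_sums(1)[OF K(2)[OF q], of a "\<lambda>a. \<Sum>!k. K' q $ j $ k * G a k q"] by simp
    qed
    thus "G a k q = (\<Sum>!j. matrix_inv (K' q) $ k $ j * (\<Sum>!i. matrix_inv (K q) $ a $ i *
     (\<Sum>!a k. K q $ i $ a * G a k q * K' q $ j $ k)))"
      using inverse_sums(1)[OF K'(2)[OF q], of k "\<lambda>k. G a k q"] by simp
  qed
qed

section \<open>The flat coordinates\<close>

text \<open>The tangent vector \<open>v\<close> at \<open>x\<close> annihilates \<open>f\<close>.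
  Comparing the vectors that annihilate the invariants with those that annihilate the coordinates
  \<open>t\<close> avoids inverting the formulas for \<open>t\<close> explicitly.\<close>

definition kill :: "(complex, 'm::finite) vec set => (complex, 'm) vec => (complex, 'm) vec => ((complex, 'm) vec => complex) => bool" where
  "kill U x v f \<longleftrightarrow> open U \<and> x \<in> U \<and> holo_on f U \<and> Dsum f x v = 0"

lemma kill_cong:
  assumes "kill U x v f" "\<And>y. y \<in> U ==> g y = f y" shows "kill U x v g"
proof -
  have U: "open U" "x \<in> U" "holo_on f U" "Dsum f x v = 0" using assms(1) by (auto simp: kill_def)
  have "Dsum g x v = Dsum f x v"
    unfolding Dsum_def using pdiff_cong[OF U(1,2) assms(2)] by simp
  thus ?thesis using U holo_on_cong[OF U(3,1) assms(2)] by (simp add: kill_def)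
qed

context
  fixes U :: "(complex, 'm::finite) vec set" and x v :: "(complex, 'm) vec"
  assumes Ux: "open U" "x \<in> U"
begin

lemma kill_const: "kill U x v (\<lambda>y. k)"
  using Ux by (simp add: kill_def Dsum_def)

lemma kill_add: "kill U x v f ==> kill U x v g ==> kill U x v (\<lambda>y. f y + g y)"
  using Ux by (auto simp: kill_def Dsum_def pdiff_add[OF holo_at holo_at] sum.distrib algebra_simps)

lemma kill_mult:
  assumes "kill U x v f" "kill U x v g" shows "kill U x v (\<lambda>y. f y * g y)"
proof -
  have h: "holo_on f U" "holo_on g U" "Dsum f x v = 0" "Dsum g x v = 0" using assms by (auto simp: kill_def)
  have "Dsum (\<lambda>y. f y * g y) x v = Dsum f x v * g x + f x * Dsum g x v"
    unfolding Dsum_def pdiff_mult[OF holo_at[OF h(1) Ux(2)] holo_at[OF h(2) Ux(2)]]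
    by (simp add: sum_distrib_left sum_distrib_right sum.distrib algebra_simps)
  thus ?thesis using h Ux by (auto simp: kill_def)
qed

lemma kill_inverse:
  assumes "kill U x v f" "\<And>y. y \<in> U ==> f y ~= 0" shows "kill U x v (\<lambda>y. inverse (f y))"
proof -
  have h: "holo_on f U" "Dsum f x v = 0" using assms by (auto simp: kill_def)
  have "Dsum (\<lambda>y. inverse (f y)) x v = - Dsum f x v / (f x)\<^sup>2"
    unfolding Dsum_def pdiff_inverse[OF holo_at[OF h(1) Ux(2)] assms(2)[OF Ux(2)]]
    by (simp add: sum_negf sum_divide_distrib)
  thus ?thesis using h Ux assms(2) by (auto simp: kill_def)
qed

lemma kill_divide: "kill U x v f ==> kill U x v g ==> (\<And>y. y \<in> U ==> g y ~= 0) ==> kill U x v (\<lambda>y. f y / g y)"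
  unfolding divide_inverse by (rule kill_mult[OF _ kill_inverse])

lemma kill_power: "kill U x v f ==> kill U x v (\<lambda>y. f y ^ k)"
  by (induction k) (auto intro: kill_const kill_mult)

lemma kill_sum: "(\<And>i. i \<in> I ==> kill U x v (f i)) ==> kill U x v (\<lambda>y. \<Sum>i\<in>I. f i y)"
  by (induction I rule: infinite_finite_induct) (auto intro: kill_const kill_add)

lemma kill_prod_list: "(\<And>k. k \<in> set ks ==> kill U x v (f k)) ==> kill U x v (\<lambda>y. \<Prod>k\<leftarrow>ks. f k y)"
  by (induction ks) (auto intro: kill_const kill_mult)

end

lemma kill_root:
  assumes "kill U x v f" "holo_on r U" "\<And>y. y \<in> U ==> r y ^ n = f y" "r x ~= 0" "n > 0"
  shows "kill U x v r"
proof -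
  have U: "open U" "x \<in> U" using assms(1) by (auto simp: kill_def)
  have "kill U x v (\<lambda>y. r y ^ n)" by (rule kill_cong[OF assms(1,3)])
  hence "0 = Dsum (\<lambda>y. r y ^ n) x v" by (simp add: kill_def)
  also have "... = of_nat n * r x ^ (n - 1) * Dsum r x v"
    unfolding Dsum_def by (simp add: pdiff_power[OF holo_at[OF assms(2) U(2)]] sum_distrib_left algebra_simps)
  finally show ?thesis using U assms by (auto simp: kill_def)
qed

text \<open>With at least two positive parts no part is the whole; so in the formula for
  \<open>t\<close> the invariant of lowest index occurs in the term \<open>d = 1\<close>
  only.\<close>

lemma composition_parts:
  assumes "length ks = d" "sum_list ks = m" "\<forall>k\<in>set ks. k \<ge> 1" "k \<in> set ks" "d ~= 1"
  shows "1 \<le> k \<and> k < (m :: nat)"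
proof -
  have "length ks ~= 0" using assms(4) by auto
  hence "length (remove1 k ks) \<ge> 1" using assms by (simp add: length_remove1)
  then obtain j where j: "j \<in> set (remove1 k ks)" by (cases "remove1 k ks") auto
  hence "j \<ge> 1" using assms(3) notin_set_remove1 by metis
  have "j \<le> sum_list (remove1 k ks)" using j by (intro member_le_sum_list) auto
  moreover have "sum_list ks = k + sum_list (remove1 k ks)" using assms(4) by (simp add: sum_list_map_remove1[of k ks id, simplified])
  ultimately show ?thesis using \<open>j \<ge> 1\<close> assms by auto
qed

definition comps :: "nat => nat => nat list set" where
  "comps d m = {ks. length ks = d \<and> sum_list ks = m \<and> (\<forall>k\<in>set ks. k \<ge> 1)}"

lemma comps_1: "m \<ge> 1 ==> comps 1 m = {[m]}"
  by (auto simp: comps_def length_Suc_conv)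

lemma t_pos_eq:
  fixes x :: "'n::finite point"
  shows "t_pos r i x = of_nat CARD('n) / of_nat (CARD('n) + 1 - i) * r x ^ (CARD('n) + 1 - i)
        * (\<Sum>d\<le>CARD('n) - i. ((of_nat (CARD('n) + 1 - i) / of_nat CARD('n)) gchoose d)
            * (\<Sum>ks\<in>comps d (CARD('n) - i). \<Prod>k\<leftarrow>ks. phi x (CARD('n) - k) / phi x CARD('n)))"
  by (simp add: t_pos_def Let_def comps_def)

lemma t_zero_eq:
  assumes "Im (tau x) > 0"
  shows "t_zero x = phi x 0 + psi (tau x) (shift_v x) * phi x 1 + 4 * of_real pi * \<i> * g1 (tau x) * phi x 2"
proof -
  have "theta1 (tau x) = Th 0 (tau x)" using theta1_eq_Th[OF assms] by auto
  hence "deriv (theta1 (tau x)) (shift_v x) = Th 1 (tau x) (shift_v x)"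
    using DERIV_imp_deriv[OF Th_deriv_z[OF assms, of 0]] by simp
  thus ?thesis using theta1_eq_Th[OF assms] by (simp add: t_zero_def psi_def)
qed

lemma Dsum_wt:
  assumes "\<And>x y :: 'n::finite point. x $ Xv = y $ Xv ==> x $ Xtau = y $ Xtau ==> f x = f y"
    and "v $ Xv = 0" "v $ Xtau = 0"
  shows "Dsum f x v = 0"
proof -
  have "v $ a * pdiff f a x = 0" for a
  proof (cases "a = Xv \<or> a = Xtau")
    case False
    hence "(\<lambda>s. f (x + axis a s)) = (\<lambda>s. f x)" by (intro ext assms(1)) (auto simp: axis_def)
    thus ?thesis by (simp add: pdiff_def)
  qed (use assms in auto)
  thus ?thesis unfolding Dsum_def by (intro sum.neutral ballI)
qed

section \<open>Jacobian and candidate Christoffel symbols in the coordinates t\<close>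

abbreviation tinv :: "'n::{finite,linorder} point set => ('n point => complex) => 'n point => 'n point" where
  "tinv U r \<equiv> inv_into U (t_coord r)"

definition Jt :: "'n::{finite,linorder} point set => ('n point => complex) => 'n point => complex ^ 'n idx ^ 'n idx" where
  "Jt U r p = jacobian (t_coord r) (tinv U r p)"

text \<open>The pairing of the differential of the \<open>i\<close>-th coordinate with the
  derivative, along the \<open>k\<close>-th, of the differential of the \<open>j\<close>-th. In the
  sign convention of \<open>contra_christoffel\<close> these turn out to be the Christoffel symbols
  of \<open>g_t\<close>.\<close>

definition Ct :: "'n::{finite,linorder} point set => ('n point => complex) => 'n idx => 'n idx => 'n idx => 'n point => complex" where
  "Ct U r i j k p = (\<Sum>!a b. g_star $ a $ b * Jt U r p $ i $ a * pdiff (\<lambda>q. Jt U r q $ j $ b) k p)"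

lemma gf_sum1: "gf (\<lambda>a. \<Sum>i\<in>A. F i * J i a) h = (\<Sum>i\<in>A. F i * gf (J i) h)"
proof -
  have 0: "gf (\<lambda>a. 0) h = 0" by (simp add: gf_def)
  have "gf (\<lambda>a. f a + k a) h = gf f h + gf k h" for f k
    by (simp add: gf_def sum.distrib algebra_simps)
  thus ?thesis by (induction A rule: infinite_finite_induct) (simp_all add: 0 gf_scale)
qed

lemma gf_sum2: "gf f (\<lambda>b. \<Sum>j\<in>A. H j * K j b) = (\<Sum>j\<in>A. H j * gf f (K j))"
  using gf_sum1[where F=H and J=K and A=A and h=f] by (simp add: gf_sym[of f])

lemma Ct_gf: "Ct U r i j k p = gf (\<lambda>a. Jt U r p $ i $ a) (\<lambda>b. pdiff (\<lambda>q. Jt U r q $ j $ b) k p)"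
  by (simp add: Ct_def gf_def)

lemma Jt_nth: "Jt U r p $ i $ a = pdiff (\<lambda>y. t_coord r y $ i) a (tinv U r p)"
  by (simp add: Jt_def jacobian_def)

lemma g_t_nth: "g_t U r p $ i $ j = (\<Sum>!a b. g_star $ a $ b * Jt U r p $ i $ a * Jt U r p $ j $ b)"
proof -
  have "g_t U r p $ i $ j = (\<Sum>!b a. g_star $ a $ b * Jt U r p $ i $ a * Jt U r p $ j $ b)"
    by (simp add: g_t_def Let_def Jt_def matrix_matrix_mult_def transpose_def sum_distrib_left sum_distrib_right mult.commute)
  thus ?thesis by (subst sum.swap)
qed

lemma g_t_gf: "g_t U r p $ i $ j = gf (\<lambda>a. Jt U r p $ i $ a) (\<lambda>b. Jt U r p $ j $ b)"
  by (simp add: g_t_nth gf_def)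

section \<open>The z-derivative of the superpotential and of its expansion\<close>

definition dbas :: "nat => complex => complex => complex => complex" where
  "dbas k t w z = (if k = 0 then 0 else if k = 1 then psid 1 t z - psid 1 t (z + w)
     else (-1) ^ k / fact (k - 1) * (- psid k t z))"

lemma bas_deriv:
  assumes tau: "Im t > 0" and z: "Th 0 t z ~= 0" "Th 0 t (z + w) ~= 0"
  shows "DERIV (bas k t w) z :> dbas k t w z"
proof -
  consider "k = 0" | "k = 1" | "k \<ge> 2" by linarith
  thus ?thesis
  proof cases
    case 1
    have "bas 0 t w = (\<lambda>z. 1)" by (rule ext) (simp add: bas_def)
    thus ?thesis using 1 by (simp add: dbas_def)
  next
    case 2
    have b: "bas 1 t w = (\<lambda>z. psid 0 t z - psid 0 t (z + w) + psi t w)" by (rule ext) (simp add: bas_def psid_def)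
    have "DERIV (\<lambda>z. psid 0 t (z + w)) z :> psid (Suc 0) t (z + w)"
      using psid_deriv[OF tau z(2), of 0] by (simp add: DERIV_shift)
    hence "DERIV (\<lambda>z. psid 0 t z - psid 0 t (z + w) + psi t w) z :> psid (Suc 0) t z - psid (Suc 0) t (z + w) + 0"
      by (intro DERIV_add DERIV_diff psid_deriv[OF tau z(1)] DERIV_const)
    thus ?thesis using 2 b by (simp add: dbas_def)
  next
    case 3
    hence b: "bas k t w = (\<lambda>z. (-1) ^ k / fact (k - 1) * (- psid (k - 1) t z - (if k = 2 then wp_const t else 0)))"
      by (intro ext) (simp add: bas_def)
    have "DERIV (\<lambda>z. (-1) ^ k / fact (k - 1) * (- psid (k - 1) t z - (if k = 2 then wp_const t else 0))) z :> (-1) ^ k / fact (k - 1) * (- psid (Suc (k - 1)) t z - 0)"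
      by (intro DERIV_cmult DERIV_diff DERIV_minus psid_deriv[OF tau z(1)] DERIV_const)
    thus ?thesis using 3 b by (simp add: dbas_def)
  qed
qed

definition zld :: "(complex => complex) => complex => complex => bool" where
  "zld f z l \<longleftrightarrow> DERIV f z :> f z * l"

lemma zld_mult: "zld f z l ==> zld g z m ==> zld (\<lambda>z. f z * g z) z (l + m)"
  unfolding zld_def by (drule (1) DERIV_mult) (simp add: algebra_simps)

lemma zld_divide: "zld f z l ==> zld g z m ==> g z ~= 0 ==> zld (\<lambda>z. f z / g z) z (l - m)"
proof -
  assume f: "zld f z l" and g: "zld g z m" and nz: "g z ~= 0"
  have "DERIV (\<lambda>z. f z / g z) z :> (f z * l * g z - f z * (g z * m)) / (g z * g z)"
    by (rule DERIV_divide[OF f[unfolded zld_def] g[unfolded zld_def] nz])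
  also have "(f z * l * g z - f z * (g z * m)) / (g z * g z) = f z / g z * (l - m)" using nz by (simp add: field_simps)
  finally show ?thesis by (simp add: zld_def)
qed

lemma zld_const: "zld (\<lambda>z. c) z 0"
  by (simp add: zld_def)

lemma zld_power: "zld f z l ==> zld (\<lambda>z. f z ^ n) z (of_nat n * l)"
proof (induction n)
  case 0
  thus ?case using zld_const[of 1] by simp
next
  case (Suc n)
  thus ?case using zld_mult[of f z l "\<lambda>z. f z ^ n" "of_nat n * l"] by (simp add: algebra_simps)
qed

lemma zld_prod: "finite I ==> (\<And>i. i \<in> I ==> zld (f i) z (l i)) ==> zld (\<lambda>z. \<Prod>i\<in>I. f i z) z (\<Sum>i\<in>I. l i)"
proof (induction I rule: finite_induct)
  case empty
  thus ?case using zld_const[of 1] by simp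
next
  case (insert i I)
  thus ?case using zld_mult[of "f i" z "l i" "\<lambda>z. \<Prod>i\<in>I. f i z"] by simp
qed

lemma lam_deriv:
  fixes x :: "'n::finite point"
  assumes "regz x z"
  shows "DERIV (lam x) z :> lamd x z"
proof -
  have nz: "Im (tau x) > 0" "Th 0 (tau x) (z - bpt x j) ~= 0" for j using assms by (auto simp: regz_def)
  have t: "zld (\<lambda>z. Th 0 (tau x) (z - bpt x j)) z (psi (tau x) (z - bpt x j))" for j
    using DERIV_shift[of "Th 0 (tau x)" _ z "- bpt x j"] Th_deriv_z[OF nz(1), of 0 "z - bpt x j"] nz(2)[of j]
    by (simp add: zld_def psi_def)
  have "zld (\<lambda>z. exp (- 2 * of_real pi * \<i> * x $ X0) * (\<Prod>i\<in>UNIV. Th 0 (tau x) (z - bpt x (Some (Some i))))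
     / (Th 0 (tau x) (z - bpt x None) ^ CARD('n) * Th 0 (tau x) (z - bpt x (Some None)))) z
     ((0 + (\<Sum>!i. psi (tau x) (z - bpt x (Some (Some i)))))
       - (of_nat CARD('n) * psi (tau x) (z - bpt x None) + psi (tau x) (z - bpt x (Some None))))"
    by (intro zld_divide zld_mult zld_const zld_power zld_prod t) (use nz(2) in \<open>auto simp del: bpt_None\<close>)
  hence "zld (lam x) z (LE x z)"
    unfolding lam_bpt[abs_def] by (simp add: LE_def EE_def algebra_simps)
  thus ?thesis by (simp add: zld_def lamd_def)
qed

lemma regz_goodz:
  assumes "regz x z" shows "Im (tau x) > 0" "Th 0 (tau x) z ~= 0" "Th 0 (tau x) (z + shift_v x) ~= 0"
proof -
  have r: "Im (tau x) > 0" "Th 0 (tau x) (z - bpt x j) ~= 0" for j using assms by (auto simp: regz_def)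
  show "Im (tau x) > 0" "Th 0 (tau x) z ~= 0" "Th 0 (tau x) (z + shift_v x) ~= 0"
    using r(1) r(2)[of None] r(2)[of "Some None"] by (simp_all add: bpt_def)
qed

lemma lam_expand:
  fixes x :: "'n::finite point"
  assumes "reg_x x" "regz x z"
  shows "lam x z = (\<Sum>k\<le>CARD('n). phi x k * bas k (tau x) (shift_v x) z)"
    "lamd x z = (\<Sum>k\<le>CARD('n). phi x k * dbas k (tau x) (shift_v x) z)"
proof -
  note tw = reg_tau[OF assms(1)] reg_w[OF assms(1)]
  have g: "goodz (tau x) (shift_v x) z"
    using regz_goodz[OF assms(2)] by (simp add: goodz_def[OF tw])
  thus "lam x z = (\<Sum>k\<le>CARD('n). phi x k * bas k (tau x) (shift_v x) z)"
    by (rule phi_props(2)[OF assms(1)])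
  have "((\<lambda>z. \<Sum>k\<le>CARD('n). phi x k * bas k (tau x) (shift_v x) z) has_field_derivative
      (\<Sum>k\<le>CARD('n). phi x k * dbas k (tau x) (shift_v x) z)) (at z)"
    by (intro DERIV_sum DERIV_cmult bas_deriv regz_goodz[OF assms(2)])
  hence "DERIV (lam x) z :> (\<Sum>k\<le>CARD('n). phi x k * dbas k (tau x) (shift_v x) z)"
    by (rule has_field_derivative_transform_within_open[OF _ open_goodz[OF tw]])
       (use g phi_props(2)[OF assms(1)] in auto)
  thus "lamd x z = (\<Sum>k\<le>CARD('n). phi x k * dbas k (tau x) (shift_v x) z)"
    by (rule DERIV_unique[OF lam_deriv[OF assms(2)]])
qed

lemma holo_on_dbas:
  assumes "holo_on f W" "holo_on g W" "\<And>x. x \<in> W ==> Im (f x) > 0"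
    "\<And>x. x \<in> W ==> Th 0 (f x) z ~= 0" "\<And>x. x \<in> W ==> Th 0 (f x) (z + g x) ~= 0"
  shows "holo_on (\<lambda>x. dbas k (f x) (g x) z) W"
proof -
  consider "k = 0" | "k = 1" | "k > 1" by linarith
  thus ?thesis
    by cases (auto simp: dbas_def simp del: One_nat_def intro!: holo_on_diff holo_on_add holo_on_mult holo_on_minus holo_on_psid assms)
qed

lemma cst_subset: "cst e V f ==> V' \<subseteq> V ==> open V' ==> cst e V' f"
  unfolding cst_def using holo_on_subset by blast

lemma aff_unit:
  assumes "open V" "holo_on f V" "\<And>p. p \<in> V ==> pdiff f e p = k"
  shows "aff e V f" "cst e V (pdiff f c)"
proof -
  show "aff e V f"
    unfolding aff_def using assms cst_cong[OF cst_const[OF assms(1)], of "pdiff f e" k] by auto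
  have "pdiff (pdiff f c) e p = 0" if p: "p \<in> V" for p
  proof -
    have "pdiff (pdiff f c) e p = pdiff (pdiff f e) c p" by (rule pdiff_commute[OF assms(2,1) p])
    also have "... = pdiff (\<lambda>_. k) c p" by (rule pdiff_cong[OF assms(1) p assms(3)])
    finally show ?thesis by simp
  qed
  thus "cst e V (pdiff f c)" using assms holo_on_pdiff[OF assms(2,1)] by (simp add: cst_def)
qed

section \<open>Values of the superpotential as coordinates\<close>

definition ycoord :: "('n::finite option => complex) => 'n idx => 'n point => complex" where
  "ycoord p i = (case i of X0 => (\<lambda>x. lam x (p None)) | XN k => (\<lambda>x. lam x (p (Some k)))
     | Xv => shift_v | Xtau => tau)"

lemma ycoord_cases:
  obtains j where "ycoord p i = (\<lambda>x. lam x (p j))" | "ycoord p i = shift_v" | "ycoord p i = tau"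
  by (cases i) (auto simp: ycoord_def)

lemma ev_regz: "Im (tau x) > 0 ==> eventually (regz x) (at 0)"
  unfolding regz_def using ev_Th0_shift[of "x $ Xtau" "- bpt x j" 0 for j]
  by (auto intro!: eventually_conj eventually_all_finite)

text \<open>The pairing of two values of the superpotential contains psi(q - p), so the two families
  must stay apart modulo the lattice. Invertibility of the matrices makes each family, together with
  w and tau, a coordinate system.\<close>

definition good_region :: "'n::{finite,linorder} point set => ('n option => complex) => ('n option => complex) => 'n point set" where
  "good_region U p q = {x \<in> U. (\<forall>j. regz x (p j)) \<and> (\<forall>j. regz x (q j)) \<and> (\<forall>i j. Th 0 (tau x) (q j - p i) ~= 0)
     \<and> invertible (Bmat x p) \<and> invertible (Bmat x q)}"

lemma invertible_iff_ker:
  fixes A :: "complex ^ 'm::finite ^ 'm"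
  shows "invertible A \<longleftrightarrow> (\<forall>v. A *v v = 0 \<longrightarrow> v = 0)"
  by (simp only: invertible_left_inverse matrix_left_invertible_ker)

lemma holo_bas_x:
  assumes "\<And>x. x \<in> V ==> reg_x x" "\<And>x. x \<in> V ==> regz x z"
  shows "holo_on (\<lambda>x. bas k (tau x) (shift_v x) z) V"
proof (rule holo_on_bas[OF holo_on_component holo_shift_v])
  fix x assume "x \<in> V"
  hence x: "reg_x x" "regz x z" by (rule assms)+
  show "Im (tau x) > 0" "Th 0 (tau x) z ~= 0" "Th 0 (tau x) (z + shift_v x) ~= 0"
    by (rule regz_goodz[OF x(2)])+
  show "Th 0 (tau x) (shift_v x) ~= 0" using x(1) by (simp add: reg_x_def)
qed

lemma shift_v_linear: "pdiff shift_v a y = pdiff shift_v a x"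
  by (simp add: pdiff_shift_v)

lemma tau_linear: "pdiff tau a y = pdiff tau a x"
  by (simp add: pdiff_component)

section \<open>Nondegeneracy of the second metric\<close>

lemma higher_deriv_chain:
  fixes F :: "nat => complex => complex"
  assumes "open S" "\<And>j z. z \<in> S ==> DERIV (F j) z :> F (Suc j) z" "z \<in> S"
  shows "(deriv ^^ j) (F 0) z = F j z"
  using assms(3)
proof (induction j arbitrary: z)
  case (Suc j)
  have "DERIV ((deriv ^^ j) (F 0)) z :> F (Suc j) z"
    by (rule has_field_derivative_transform_within_open[OF assms(2)[OF Suc.prems] assms(1) Suc.prems]) (simp add: Suc.IH)
  thus ?case by (simp add: DERIV_imp_deriv)
qed simp

text \<open>A finite limit of F / q^n makes F equal to q^n times a holomorphic function near 0, so
  the derivatives of order below n vanish there.\<close>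

lemma order_vanish:
  fixes F :: "nat => complex => complex"
  assumes S: "open S" "0 \<in> S" and F: "\<And>j z. z \<in> S ==> DERIV (F j) z :> F (Suc j) z"
    and lim: "(\<lambda>q. F 0 q / q ^ n) \<midarrow>0\<rightarrow> l" and j: "j < n"
  shows "F j 0 = 0"
proof -
  have hF: "F 0 holomorphic_on S" using F by (auto simp: holomorphic_on_open[OF S(1)])
  have "(\<lambda>q. F 0 q / q ^ n) holomorphic_on S - {0}"
    by (intro holomorphic_intros holomorphic_on_subset[OF hF]) auto
  moreover have "((\<lambda>q. (q - 0) * (F 0 q / q ^ n)) \<longlongrightarrow> 0) (at 0)"
    using tendsto_mult[OF tendsto_ident_at lim] by simp
  ultimately obtain g where g: "g holomorphic_on S" "\<And>q. q \<in> S - {0} ==> g q = F 0 q / q ^ n"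
    using holomorphic_on_extend_lim[of "\<lambda>q. F 0 q / q ^ n" S 0] S by (auto simp: interior_open)
  have hp: "(\<lambda>q. (q - 0) ^ n * g q) holomorphic_on S" by (intro holomorphic_intros g)
  have eq: "F 0 q = (q - 0) ^ n * g q" if "q \<in> S" for q
  proof (cases "q = 0")
    case True
    have "(\<lambda>q. q ^ n * (F 0 q / q ^ n)) \<midarrow>0\<rightarrow> 0 ^ n * l"
      by (intro tendsto_mult tendsto_power tendsto_ident_at lim)
    moreover have "eventually (\<lambda>q. q ^ n * (F 0 q / q ^ n) = F 0 q) (at 0)"
      by (auto simp: eventually_at_filter)
    ultimately have "F 0 \<midarrow>0\<rightarrow> 0 ^ n * l" by (rule Lim_transform_eventually)
    moreover have "F 0 \<midarrow>0\<rightarrow> F 0 0" using DERIV_isCont[OF F[OF S(2)]] by (simp add: isCont_def)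
    ultimately have "F 0 0 = 0 ^ n * l" by (rule LIM_unique[rotated])
    thus ?thesis using True j by simp
  qed (use g(2) that in auto)
  have "F j 0 = (deriv ^^ j) (F 0) 0" by (rule higher_deriv_chain[where F=F, OF S(1) F S(2), symmetric])
  also have "... = (deriv ^^ j) (\<lambda>q. (q - 0) ^ n * g q) 0"
    by (rule higher_deriv_transform_within_open[OF hF hp S eq])
  also have "... = (\<Sum>i = 0..j. of_nat (j choose i) * (deriv ^^ i) (\<lambda>q. (q - 0) ^ n) 0 * (deriv ^^ (j - i)) g 0)"
    by (rule higher_deriv_mult[OF _ g(1) S]) (intro holomorphic_intros)
  also have "... = 0"
    by (rule sum.neutral) (use j in \<open>auto simp only: higher_deriv_power atLeastAtMost_iff; simp\<close>)
  finally show ?thesis .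
qed

lemma tendsto_power_times:
  fixes f :: "complex => complex"
  assumes "f \<midarrow>0\<rightarrow> l" "m > 0"
  shows "(\<lambda>z. z ^ m * f z) \<midarrow>0\<rightarrow> 0"
proof -
  have "(\<lambda>z::complex. z ^ m) \<midarrow>0\<rightarrow> 0 ^ m" by (intro tendsto_intros)
  moreover have "(0::complex) ^ m = 0" using assms(2) by (simp add: zero_power)
  ultimately show ?thesis using tendsto_mult[of "\<lambda>z. z ^ m" 0 "at 0" f l] assms(1) by simp
qed

lemma psid_limit:
  assumes tau: "Im t > 0" and w: "Th 0 t w ~= 0"
  shows "(\<lambda>z. z ^ Suc k * psid k t z) \<midarrow>0\<rightarrow> (-1) ^ k * fact k"
proof -
  obtain U m where U: "open U" "0 \<in> U" "m holomorphic_on U"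
    and m: "\<And>z j. z \<in> U - {0} ==> psid j t z = (-1) ^ j * fact j / z ^ Suc j + (deriv ^^ j) m z"
    using psid_principal_part[OF tau w] by metis
  have "isCont ((deriv ^^ k) m) 0"
    using holomorphic_on_imp_continuous_on[OF holomorphic_higher_deriv[OF U(3,1)]] U
    by (simp add: continuous_on_eq_continuous_at)
  hence "(\<lambda>z. z ^ Suc k * (deriv ^^ k) m z) \<midarrow>0\<rightarrow> 0"
    by (intro tendsto_power_times[of _ "(deriv ^^ k) m 0"]) (auto simp: isCont_def)
  hence "(\<lambda>z. (-1) ^ k * fact k + z ^ Suc k * (deriv ^^ k) m z) \<midarrow>0\<rightarrow> (-1) ^ k * fact k + 0"
    by (intro tendsto_add tendsto_const)
  moreover have "eventually (\<lambda>z. (-1) ^ k * fact k + z ^ Suc k * (deriv ^^ k) m z = z ^ Suc k * psid k t z) (at 0)"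
  proof -
    have "eventually (\<lambda>z. z \<in> U - {0}) (at 0)"
      using U(1,2) eventually_at_topological by blast
    thus ?thesis by eventually_elim (simp add: m distrib_left)
  qed
  ultimately show ?thesis by (simp add: Lim_transform_eventually)
qed

lemma dbas_limit:
  assumes tau: "Im t > 0" and w: "Th 0 t w ~= 0" and k: "k \<ge> 1"
  shows "(\<lambda>z. z ^ Suc k * dbas k t w z) \<midarrow>0\<rightarrow> - of_nat k"
proof (cases "k = 1")
  case True
  have "isCont (psid 1 t) w" using psid_deriv[OF tau w] by (rule DERIV_isCont)
  hence "(\<lambda>z. psid 1 t (z + w)) \<midarrow>0\<rightarrow> psid 1 t w"
    using isCont_tendsto_compose[of w "psid 1 t" "\<lambda>z. z + w" "at 0"] tendsto_add[OF tendsto_ident_at tendsto_const[of w], of 0 UNIV] by simp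
  hence "(\<lambda>z. z ^ Suc 1 * psid 1 t z - z ^ Suc 1 * psid 1 t (z + w)) \<midarrow>0\<rightarrow> (-1) ^ 1 * fact 1 - 0"
    by (intro tendsto_diff psid_limit[OF tau w] tendsto_power_times) auto
  thus ?thesis using True by (simp add: dbas_def right_diff_distrib)
next
  case False
  hence k2: "k \<ge> 2" using k by simp
  have "(\<lambda>z. ((-1) ^ k / fact (k - 1) * (-1)) * (z ^ Suc k * psid k t z)) \<midarrow>0\<rightarrow> ((-1) ^ k / fact (k - 1) * (-1)) * ((-1) ^ k * fact k)"
    by (intro tendsto_mult tendsto_const psid_limit[OF tau w])
  also have "((-1) ^ k / fact (k - 1) * (-1)) * ((-1) ^ k * fact k) = (- of_nat k :: complex)"
    using k by (simp add: fact_reduce[of k] flip: power_mult_distrib)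
  also have "(\<lambda>z. ((-1) ^ k / fact (k - 1) * (-1)) * (z ^ Suc k * psid k t z)) = (\<lambda>z. z ^ Suc k * dbas k t w z)"
    using k2 by (auto simp: dbas_def)
  finally show ?thesis .
qed

text \<open>Only the summand k = n of the expansion reaches order n + 1 at 0, and the derivative of
  z^(-n) contributes the factor - n.\<close>

lemma lamd_limit:
  fixes x :: "'n::finite point"
  assumes "reg_x x"
  shows "(\<lambda>z. z ^ (CARD('n) + 1) * lamd x z) \<midarrow>0\<rightarrow> - of_nat CARD('n) * phi x CARD('n)"
proof -
  note tw = reg_tau[OF assms] reg_w[OF assms]
  define n where "n = CARD('n)"
  have n: "n \<ge> 1" by (simp add: n_def Suc_le_eq)
  have t: "(\<lambda>z. z ^ (n + 1) * dbas k (tau x) (shift_v x) z) \<midarrow>0\<rightarrow> (if k = n then - of_nat n else 0)" if kn: "k \<le> n" for k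
  proof -
    consider "k = 0" | "k = n" | "1 \<le> k" "k < n" using kn by linarith
    thus ?thesis
    proof cases
      case 1
      thus ?thesis using n by (simp add: dbas_def)
    next
      case 2
      thus ?thesis using dbas_limit[OF tw n] by simp
    next
      case 3
      have "(\<lambda>z. z ^ (n - k) * (z ^ Suc k * dbas k (tau x) (shift_v x) z)) \<midarrow>0\<rightarrow> 0"
        by (rule tendsto_power_times[OF dbas_limit[OF tw 3(1)]]) (use 3 in simp)
      moreover have "n + 1 = (n - k) + Suc k" using 3 by simp
      hence "z ^ (n + 1) = z ^ (n - k) * z ^ Suc k" for z :: complex by (simp only: power_add)
      hence "(\<lambda>z. z ^ (n + 1) * dbas k (tau x) (shift_v x) z) = (\<lambda>z. z ^ (n - k) * (z ^ Suc k * dbas k (tau x) (shift_v x) z))"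
        by (simp only: mult.assoc)
      ultimately show ?thesis using 3 by simp
    qed
  qed
  have "(\<lambda>z. \<Sum>k\<le>n. phi x k * (z ^ (n + 1) * dbas k (tau x) (shift_v x) z)) \<midarrow>0\<rightarrow> (\<Sum>k\<le>n. phi x k * (if k = n then - of_nat n else 0))"
    by (intro tendsto_sum tendsto_mult tendsto_const t) simp
  also have "(\<Sum>k\<le>n. phi x k * (if k = n then - of_nat n else 0)) = - of_nat n * phi x n"
    by (simp add: if_distrib[of "\<lambda>x. _ * x"] cong: if_cong)
  finally have 1: "(\<lambda>z. \<Sum>k\<le>n. phi x k * (z ^ (n + 1) * dbas k (tau x) (shift_v x) z)) \<midarrow>0\<rightarrow> - of_nat n * phi x n" .
  have "eventually (\<lambda>z. (\<Sum>k\<le>n. phi x k * (z ^ (n + 1) * dbas k (tau x) (shift_v x) z)) = z ^ (n + 1) * lamd x z) (at 0)"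
    using ev_regz[OF tw(1)]
    by eventually_elim (simp add: lam_expand(2)[OF assms] n_def sum_distrib_left mult_ac)
  from Lim_transform_eventually[OF 1 this] show ?thesis unfolding n_def .
qed

text \<open>Here \<open>c\<close>, \<open>cw\<close> and \<open>ct\<close> are the components of a
  null covector of \<eta> in the coframe of the values \<lambda>(p_j), w and tau; \<open>c0\<close>,
  \<open>c1\<close> and \<open>E\<close> pair it with dtau, dw and d\<lambda>(q). Relation
  \<open>E\<close> reads F(q) \<lambda>'(q) = R(q), where R has at most a simple pole at 0, so F
  vanishes there to order n. Its Taylor coefficients are sums of c_j against derivatives of psi at
  p_j.\<close>

lemma nondegenerate_core:
  fixes x :: "'n::{finite,linorder} point" and c p :: "'n option => complex"
  assumes reg: "reg_x x" and p: "\<And>j. regz x (p j)" and B: "invertible (Bmat x p)" and \<phi>: "phi x CARD('n) ~= 0"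
    and c0: "(\<Sum>!j. c j) = 0"
    and c1: "(\<Sum>!j. c j * (psi (tau x) (p j) - psi (tau x) (p j + shift_v x))) = 0"
    and E: "\<And>q. regz x q ==> (\<And>j. Th 0 (tau x) (q - p j) ~= 0) ==>
      (\<Sum>!j. c j * ((psi (tau x) (q - p j) - psi (tau x) q) * lamd x (p j) - (psi (tau x) (q - p j) + psi (tau x) (p j)) * lamd x q))
      - cw * (psi (tau x) q - psi (tau x) (q + shift_v x)) - 2 * of_real pi * \<i> * ct = 0"
  shows "\<And>j. c j = 0" "cw = 0" "ct = 0"
proof -
  note tw = reg_tau[OF reg] reg_w[OF reg]
  define t w n where "t = x $ Xtau" and "w = shift_v x" and "n = CARD('n)"
  have tau: "Im t > 0" and w: "Th 0 t w ~= 0" using tw by (simp_all add: t_def w_def)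
  have n: "n \<ge> 1" by (simp add: n_def Suc_le_eq)
  have pnz: "Th 0 t (p j) ~= 0" for j using regz_goodz[OF p] by (simp add: t_def)
  have pmnz: "Th 0 t (0 - p j) ~= 0" for j using pnz[of j] Th0_minus_iff[OF tau, of "p j"] by simp
  define S where "S = (\<Inter>j. {q. Th 0 t (p j - q) ~= 0})"
  have oS: "open S"
  proof -
    have "{q. Th 0 t (p j - q) ~= 0} = {q. Th 0 t (q + (- p j)) ~= 0}" for j
      using Th0_minus_iff[OF tau, of "p j - _"] by auto
    thus ?thesis unfolding S_def by (intro open_INT finite ballI) (simp only: open_Th0_shift[OF tau])
  qed
  have S0: "0 \<in> S" using pnz by (simp add: S_def)
  \<comment> \<open>\<open>F i\<close> is the \<open>i\<close>-th derivative of \<open>F 0\<close>;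
    the constant, the sum of the c_j psi(p_j), is present for i = 0 only. The arguments p_j - q make
    the values at q = 0 appear at the points p_j.\<close>
  define F where "F = (\<lambda>i q. (if i = 0 then \<Sum>!j. c j * psi t (p j) else 0) - (-1) ^ i * (\<Sum>!j. c j * psid i t (p j - q)))"
  have dF: "DERIV (F i) q :> F (Suc i) q" if "q \<in> S" for i q
  proof -
    have d: "DERIV (\<lambda>q. psid i t (p j - q)) q :> psid (Suc i) t (p j - q) * (- 1)" for j
      by (rule DERIV_chain2[OF psid_deriv[OF tau]]) (use that in \<open>auto simp: S_def intro!: derivative_eq_intros\<close>)
    have "DERIV (F i) q :> 0 - (-1) ^ i * (\<Sum>!j. c j * (psid (Suc i) t (p j - q) * (- 1)))"
      unfolding F_def by (intro DERIV_diff DERIV_const DERIV_cmult DERIV_sum d)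
    thus ?thesis by (simp add: F_def sum_negf)
  qed
  have F0: "F 0 q = (\<Sum>!j. c j * (psi t (q - p j) + psi t (p j)))" for q
    using psi_minus[OF tau, of "p j - q" for j] by (simp add: F_def psid_def sum_subtractf right_diff_distrib)
  define R where "R = (\<lambda>q. (\<Sum>!j. c j * (psi t (q - p j) - psi t q) * lamd x (p j)) - cw * (psi t q - psi t (q + w)) - 2 * of_real pi * \<i> * ct)"
  have gen: "eventually (\<lambda>q. regz x q \<and> (\<forall>j. Th 0 t (q - p j) ~= 0)) (at 0)"
    using ev_Th0_shift[OF tau, of "- p j" 0 for j] ev_regz[OF tw(1)] by (auto intro!: eventually_conj eventually_all_finite)
  have AR: "F 0 q * lamd x q = R q" if "regz x q \<and> (\<forall>j. Th 0 t (q - p j) ~= 0)" for q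
    using E[of q] that unfolding F0 R_def t_def w_def
    by (simp add: sum_distrib_right sum_distrib_left sum.distrib sum_subtractf algebra_simps)
  have psi0: "(\<lambda>q. q * psi t q) \<midarrow>0\<rightarrow> 1"
    using psid_limit[OF tau w, of 0] by (simp add: psid_def)
  have cont: "(\<lambda>q. q * psi t (q + a)) \<midarrow>0\<rightarrow> 0" if "Th 0 t a ~= 0" for a
  proof -
    have "isCont (psi t) a" using psi_deriv[OF tau that] by (rule DERIV_isCont)
    hence "(\<lambda>q. psi t (q + a)) \<midarrow>0\<rightarrow> psi t a"
      using isCont_tendsto_compose[of a "psi t" "\<lambda>z. z + a" "at 0"] tendsto_add[OF tendsto_ident_at tendsto_const[of a], of 0 UNIV] by simp
    from tendsto_power_times[OF this, of 1] show ?thesis by simp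
  qed
  have qR: "\<exists>b. (\<lambda>q. q * R q) \<midarrow>0\<rightarrow> b"
  proof -
    have "(\<lambda>q. (\<Sum>!j. c j * (q * psi t (q + (0 - p j)) - q * psi t q) * lamd x (p j)) - cw * (q * psi t q - q * psi t (q + w)) - q * (tpi * ct))
      \<midarrow>0\<rightarrow> (\<Sum>!j. c j * (0 - 1) * lamd x (p j)) - cw * (1 - 0) - 0 * (tpi * ct)"
      by (intro tendsto_diff tendsto_sum tendsto_mult tendsto_const tendsto_ident_at psi0 cont pmnz w)
    moreover have "(\<lambda>q. (\<Sum>!j. c j * (q * psi t (q + (0 - p j)) - q * psi t q) * lamd x (p j)) - cw * (q * psi t q - q * psi t (q + w)) - q * (tpi * ct))
      = (\<lambda>q. q * R q)"
      by (rule ext) (simp add: R_def sum_distrib_left algebra_simps)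
    ultimately show ?thesis by auto
  qed
  then obtain b where b: "(\<lambda>q. q * R q) \<midarrow>0\<rightarrow> b" by blast
  define L where "L = - of_nat n * phi x n"
  have L0: "L ~= 0" using n \<phi> by (auto simp: L_def n_def)
  have lim: "(\<lambda>q. q ^ (n + 1) * lamd x q) \<midarrow>0\<rightarrow> L" unfolding L_def n_def by (rule lamd_limit[OF reg])
  have FL: "(\<lambda>q. F 0 q / q ^ n) \<midarrow>0\<rightarrow> b / L"
  proof (rule Lim_transform_eventually[OF tendsto_divide[OF b lim L0]])
    have ev: "eventually (\<lambda>q. q ^ (n + 1) * lamd x q ~= 0) (at 0)"
      by (rule tendsto_imp_eventually_ne[OF lim L0])
    have "eventually (\<lambda>q::complex. q ~= 0) (at 0)" by (auto simp: eventually_at_filter)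
    with ev gen show "eventually (\<lambda>q. q * R q / (q ^ (n + 1) * lamd x q) = F 0 q / q ^ n) (at 0)"
    proof eventually_elim
      case (elim q)
      show ?case using AR[OF elim(2), symmetric] elim by (simp add: field_simps)
    qed
  qed
  have Fz: "F i 0 = 0" if "i < n" for i
    by (rule order_vanish[of S F n "b / L"], rule oS, rule S0, rule dF, assumption, rule FL, rule that)
  have ps: "(\<Sum>!j. c j * psid i t (p j)) = 0" if "1 \<le> i" "i < n" for i
    using Fz[OF that(2)] that(1) by (simp add: F_def)
  \<comment> \<open>For 2 \<le> k \<le> n the function bas k uses the derivative of psi of order k -
    1, which lies between 1 and n - 1; bas 0 and bas 1 are covered by \<open>c0\<close> and
    \<open>c1\<close>.\<close>
  have bz: "(\<Sum>!j. c j * bas k t w (p j)) = 0" if "k \<le> n" for k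
  proof -
    consider "k = 0" | "k = 1" | "k \<ge> 2" by linarith
    thus ?thesis
    proof cases
      case 1
      thus ?thesis using c0 by (simp add: bas_def)
    next
      case 2
      have "(\<Sum>!j. c j * bas k t w (p j)) = (\<Sum>!j. c j * (psi t (p j) - psi t (p j + w))) + (\<Sum>!j. c j) * psi t w"
        using 2 by (simp add: bas_def sum_distrib_right sum.distrib[symmetric] algebra_simps)
      thus ?thesis using c0 c1 by (simp add: t_def w_def)
    next
      case 3
      define K where "K = ((-1) ^ k / fact (k - 1) :: complex)"
      define C where "C = (if k = 2 then wp_const t else 0)"
      have "c j * bas k t w (p j) = (- K) * (c j * psid (k - 1) t (p j)) - (K * C) * c j" for j
        using 3 by (simp add: bas_def K_def C_def algebra_simps)
      hence "(\<Sum>!j. c j * bas k t w (p j)) = (- K) * (\<Sum>!j. c j * psid (k - 1) t (p j)) - (K * C) * (\<Sum>!j. c j)"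
        by (simp only: sum_subtractf sum_distrib_left)
      also have "... = 0" using ps[of "k - 1"] 3 that c0 by simp
      finally show ?thesis .
    qed
  qed
  have "transpose (Bmat x p) *v (\<chi> j. c j) = 0"
  proof -
    have "(\<Sum>!j. c j * bas (kidx k) t w (p j)) = 0" for k :: "'n option"
      by (rule bz) (use bspec[OF bij_betwE[OF kidx_bij], of k] in \<open>simp add: n_def\<close>)
    thus ?thesis
      by (simp add: vec_eq_iff matrix_vector_mult_def transpose_def Bmat_def mult.commute t_def w_def)
  qed
  moreover have "invertible (transpose (Bmat x p))" using B by (simp add: invertible_det_nz det_transpose)
  ultimately have "(\<chi> j. c j) = 0" unfolding invertible_iff_ker by (elim allE impE)
  thus cz: "c j = 0" for j by (simp add: vec_eq_iff)
  \<comment> \<open>Once all c_j vanish, \<open>E\<close> is a linear relation between bas 1 and bas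
    0, after moving psi(w) into the constant.\<close>
  define d where "d = (\<lambda>k::nat. if k = 0 then 2 * of_real pi * \<i> * ct - cw * psi t w else cw)"
  have "eventually (\<lambda>q. (\<Sum>k\<le>1. d k * bas k t w q) = 0) (at 0)"
    using gen
  proof eventually_elim
    case (elim q)
    have "cw * (psi t q - psi t (q + w)) + tpi * ct = 0"
      using E[of q] elim by (simp add: cz t_def w_def algebra_simps)
    thus ?case by (simp add: d_def bas_def algebra_simps)
  qed
  hence d: "d k = 0" if "k \<le> 1" for k by (rule bas_independent[OF tau w _ that])
  from d[of 1] show cw: "cw = 0" by (simp add: d_def)
  from d[of 0] show "ct = 0" by (simp add: d_def cw)
qed

lemma pdiff_cst_mult:
  assumes "cst e V a" "holo_on f V" "t \<in> V"
  shows "pdiff (\<lambda>t. a t * f t) e t = a t * pdiff f e t"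
proof -
  have a: "holo_on a V" "pdiff a e t = 0" using assms(1,3) by (auto simp: cst_def)
  show ?thesis by (subst pdiff_mult[OF holo_at[OF a(1) assms(3)] holo_at[OF assms(2,3)]]) (simp add: a(2))
qed

lemma cst_holo: "cst e V f ==> holo_on f V" "cst e V f ==> t \<in> V ==> pdiff f e t = 0"
  by (auto simp: cst_def)

section \<open>Charts of the orbit space\<close>

context
  fixes U :: "'n::{finite,linorder} point set" and r :: "'n point => complex"
  assumes chart: "orbit_chart U r"
begin

abbreviation (input) pt :: "'n point => 'n point" where
  "pt \<equiv> inv_into U (t_coord r)"

abbreviation (input) TU :: "'n point set" where
  "TU \<equiv> t_coord r ` U"

lemma open_U: "open U"
  using chart by (simp add: orbit_chart_def)

lemma reg_U: "x \<in> U ==> reg_x x"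
  using chart Th0_eq_0_iff by (auto simp: orbit_chart_def Omega_def reg_x_def)

lemma holo_phi_U: "holo_on (\<lambda>x. phi x k) U"
  by (rule holo_on_subset[OF holo_phi]) (use reg_U in auto)

lemma r_U: "x \<in> U ==> r x ~= 0" "x \<in> U ==> r x ^ CARD('n) = phi x CARD('n)"
  using chart by (auto simp: orbit_chart_def)

lemma phi_n_nonzero: "x \<in> U ==> phi x CARD('n) ~= 0"
  using r_U by (metis power_not_zero)

lemma holo_r: "holo_on r U"
  by (rule holo_root[OF open_U _ holo_phi_U[of "CARD('n)"]]) (use chart in \<open>auto simp: orbit_chart_def\<close>)

lemma holo_prod_list: "(\<And>k. k \<in> set ks ==> holo_on (f k) W) ==> holo_on (\<lambda>y. \<Prod>k\<leftarrow>ks. f k y) W"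
  by (induction ks) auto

lemma holo_t_pos: "holo_on (t_pos r i) U"
  unfolding t_pos_eq[abs_def]
  by (intro holo_on_mult holo_on_sum holo_on_const holo_on_power holo_r holo_prod_list holo_on_divide holo_phi_U phi_n_nonzero)

lemma holo_g1: "holo_on (\<lambda>x. g1 (tau x)) U"
  by (rule holo_on_compose1[OF holo_on_component holomorphic_g1])
     (use reg_U in \<open>auto simp: reg_x_def intro!: open_Collect_less continuous_intros\<close>)

lemma holo_t_zero: "holo_on t_zero U"
proof (rule holo_on_cong[OF _ open_U t_zero_eq])
  show "holo_on (\<lambda>x. phi x 0 + psi (tau x) (shift_v x) * phi x 1 + 4 * of_real pi * \<i> * g1 (tau x) * phi x 2) U"
    by (intro holo_on_add holo_on_mult holo_on_const holo_phi_U holo_on_psi holo_on_component holo_shift_v holo_g1)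
       (use reg_U in \<open>auto simp: reg_x_def\<close>)
qed (use reg_U in \<open>auto simp: reg_x_def\<close>)

lemma holo_t: "holo_on (\<lambda>x. t_coord r x $ i) U"
  by (cases i) (auto simp: t_coord_def holo_t_zero holo_t_pos)

text \<open>For i \<ge> 1 the compositions involve only the root \<open>r\<close> and invariants of
  index at least 1.\<close>

lemma kill_t_pos:
  assumes "\<And>k. k \<ge> 1 ==> kill U x v (\<lambda>y. phi y k)" "x \<in> U" "i \<ge> 1"
  shows "kill U x v (t_pos r i)"
proof -
  note Ux = open_U assms(2)
  have n: "CARD('n) \<ge> 1" by (simp add: Suc_le_eq)
  have kr: "kill U x v r" by (rule kill_root[OF assms(1)[OF n] holo_r r_U(2) r_U(1)[OF Ux(2)]]) auto
  show ?thesis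
    unfolding t_pos_eq[abs_def]
  proof (intro kill_mult kill_sum kill_const kill_power kr kill_prod_list kill_divide assms(1) n phi_n_nonzero Ux)
    fix d ks k assume "ks \<in> comps d (CARD('n) - i)" "k \<in> set ks"
    hence "k \<le> CARD('n) - i" using member_le_sum_list[of k ks] by (auto simp: comps_def)
    thus "CARD('n) - k \<ge> 1" using assms(3) n by linarith
  qed
qed

text \<open>The formulas for \<open>t\<close> are triangular. The coordinate with superscript n is n
  r, so \<open>r\<close> and the top invariant are annihilated. Downward induction follows: the term
  \<open>d = 1\<close> contains the invariant of index k linearly, and all other terms involve
  larger indices only.\<close>

lemma kill_phi:
  assumes "\<And>j. 1 \<le> j ==> j \<le> CARD('n) ==> kill U x v (t_pos r j)" "x \<in> U" "k \<ge> 1"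
  shows "kill U x v (\<lambda>y. phi y k)"
proof -
  note Ux = open_U assms(2)
  define n where "n = CARD('n)"
  have n: "n \<ge> 1" by (simp add: n_def Suc_le_eq)
  have kr: "kill U x v r"
  proof -
    have "kill U x v (\<lambda>y. 1 / of_nat n * t_pos r n y)"
      by (intro kill_mult kill_const Ux) (use assms(1)[of n] n in \<open>auto simp: n_def\<close>)
    thus ?thesis
    proof (rule kill_cong)
      have "comps 0 0 = {[]}" by (auto simp: comps_def)
      thus "r y = 1 / of_nat n * t_pos r n y" for y
        using n by (simp add: t_pos_eq flip: n_def)
    qed
  qed
  have kn: "kill U x v (\<lambda>y. phi y n)"
    by (rule kill_cong[OF kill_power[OF Ux kr, of n]]) (simp add: r_U(2) n_def)
  have "k \<le> n ==> k \<ge> 1 ==> kill U x v (\<lambda>y. phi y k)" for k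
  proof (induction "n - k" arbitrary: k rule: less_induct)
    case less
    show ?case
    proof (cases "k = n")
      case False
      hence k: "1 \<le> k" "k < n" using less.prems by auto
      define m where "m = n + 1 - k"
      define q where "q = (of_nat m / of_nat n :: complex)"
      define S where "S = (\<lambda>d (y :: 'n point). (q gchoose d) * (\<Sum>ks\<in>comps d (n - k). \<Prod>i\<leftarrow>ks. phi y (n - i) / phi y n))"
      have "m ~= 0" using k by (simp add: m_def)
      hence nz: "of_nat n ~= (0::complex)" "of_nat m ~= (0::complex)" using n by auto
      have kS: "kill U x v (S d)" if "d ~= 1" for d
        unfolding S_def
      proof (intro kill_mult kill_sum kill_const kill_prod_list kill_divide kn Ux)
        fix ks i assume "ks \<in> comps d (n - k)" "i \<in> set ks"
        hence i: "1 \<le> i" "i < n - k" using composition_parts[of ks d "n - k" i] that by (auto simp: comps_def)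
        show "kill U x v (\<lambda>y. phi y (n - i))" by (rule less.hyps) (use i k in auto)
      next
        fix y assume "y \<in> U" thus "phi y n ~= 0" unfolding n_def by (rule phi_n_nonzero)
      qed
      \<comment> \<open>The formula for the coordinate with superscript k, solved for the invariant
        of index k.\<close>
      have "kill U x v (\<lambda>y. (t_pos r k y / (of_nat n / of_nat m * r y ^ m) + (-1) * (\<Sum>d\<in>{..n - k} - {1}. S d y)) * (1 / q) * phi y n)"
        by (intro kill_mult kill_add kill_divide kill_sum kS kill_power kill_const kr kn assms(1) Ux)
           (use k nz in \<open>auto simp: n_def r_U\<close>)
      thus ?thesis
      proof (rule kill_cong)
        fix y assume y: "y \<in> U"
        have "t_pos r k y = (of_nat n / of_nat m * r y ^ m) * (\<Sum>d\<le>n - k. S d y)"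
          unfolding t_pos_eq S_def q_def m_def n_def ..
        hence "t_pos r k y / (of_nat n / of_nat m * r y ^ m) = (\<Sum>d\<le>n - k. S d y)"
          using nz r_U(1)[OF y] by simp
        also have "... = S 1 y + (\<Sum>d\<in>{..n - k} - {1}. S d y)"
          using k by (intro sum.remove) auto
        also have "S 1 y = q * (phi y k / phi y n)" using k by (simp add: S_def comps_1 del: One_nat_def)
        finally have "(t_pos r k y / (of_nat n / of_nat m * r y ^ m) + (-1) * (\<Sum>d\<in>{..n - k} - {1}. S d y)) * (1 / q) * phi y n
          = q * (phi y k / phi y n) * (1 / q) * phi y n" by simp
        also have "... = phi y k" using nz phi_n_nonzero[OF y] by (simp add: q_def n_def)
        finally show "phi y k = (t_pos r k y / (of_nat n / of_nat m * r y ^ m) + (-1) * (\<Sum>d\<in>{..n - k} - {1}. S d y)) * (1 / q) * phi y n" ..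
      qed
    qed (simp add: kn)
  qed
  moreover have "kill U x v (\<lambda>y. phi y k)" if "k > n"
    by (rule kill_cong[OF kill_const[OF Ux, of v 0]]) (use that phi_props(1)[OF reg_U] in \<open>auto simp: n_def\<close>)
  ultimately show ?thesis using assms(3) by (cases "k \<le> n") auto
qed

text \<open>\<open>t_zero\<close> differs from the invariant of index 0 by multiples of the
  invariants of index 1 and 2, whose coefficients depend only on tau and on v with subscript n +
  1.\<close>

lemma Dsum_t_zero:
  assumes "\<And>k. k \<ge> 1 ==> kill U x v (\<lambda>y. phi y k)" "x \<in> U" "v $ Xv = 0" "v $ Xtau = 0"
  shows "Dsum t_zero x v = Dsum (\<lambda>y. phi y 0) x v"
proof -
  note Ux = open_U assms(2)
  have kg: "kill U x v (\<lambda>x. g1 (tau x))" using holo_g1 Ux Dsum_wt[OF _ assms(3,4), of "\<lambda>x. g1 (tau x)"] by (simp add: kill_def)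
  have p: "holo_on (\<lambda>x. psi (tau x) (shift_v x)) U"
    by (intro holo_on_psi holo_on_component holo_shift_v) (use reg_U in \<open>auto simp: reg_x_def\<close>)
  have kp: "kill U x v (\<lambda>x. psi (tau x) (shift_v x))"
    using p Ux Dsum_wt[OF _ assms(3,4), of "\<lambda>x. psi (tau x) (shift_v x)"] by (simp add: kill_def shift_v_def)
  have "kill U x v (\<lambda>y. psi (y $ Xtau) (shift_v y) * phi y 1 + 4 * of_real pi * \<i> * g1 (y $ Xtau) * phi y 2)"
    by (intro kill_add kill_mult kill_const assms(1) kg kp Ux) auto
  hence k: "kill U x v (\<lambda>y. t_zero y - phi y 0)"
  proof (rule kill_cong)
    fix y assume "y \<in> U"
    hence "Im (y $ Xtau) > 0" using reg_U by (simp add: reg_x_def)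
    from t_zero_eq[OF this]
    show "t_zero y - phi y 0 = psi (y $ Xtau) (shift_v y) * phi y 1 + 4 * of_real pi * \<i> * g1 (y $ Xtau) * phi y 2" by simp
  qed
  have "Dsum (\<lambda>y. t_zero y - phi y 0) x v = Dsum t_zero x v - Dsum (\<lambda>y. phi y 0) x v"
    unfolding Dsum_def pdiff_diff[OF holo_at[OF holo_t_zero Ux(2)] holo_at[OF holo_phi_U Ux(2)]]
    by (simp add: sum_subtractf right_diff_distrib)
  thus ?thesis using k by (simp add: kill_def)
qed

lemma rank_range: "1 \<le> j ==> j \<le> CARD('n) ==> \<exists>i::'n. rank i = j"
proof -
  assume "1 \<le> j" "j \<le> CARD('n)"
  hence "j \<in> rank ` (UNIV :: 'n set)" using bij_betw_imp_surj_on[OF rank_bij] by auto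
  thus ?thesis by auto
qed

lemma rank_ge_1: "rank (i :: 'n) \<ge> 1"
  using bspec[OF bij_betwE[OF rank_bij], of i] by auto

text \<open>Meant for the coordinate vector of \<open>t\<close> with superscript 0: along it tau, w
  and all invariants of positive index are constant to first order, and the invariant of index 0
  changes at the same rate as this coordinate.\<close>

lemma t_killed:
  assumes "x \<in> U" "\<And>j. j ~= X0 ==> Dsum (\<lambda>y. t_coord r y $ j) x v = 0"
  shows "v $ Xv = 0" "v $ Xtau = 0" "k \<ge> 1 ==> kill U x v (\<lambda>y. phi y k)"
    "Dsum (\<lambda>y. phi y 0) x v = Dsum (\<lambda>y. t_coord r y $ X0) x v"
proof -
  have "Dsum (\<lambda>y. t_coord r y $ a) x v = v $ a" if "a = Xv \<or> a = Xtau" for a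
    using that by (auto simp: t_coord_def Dsum_def pdiff_component if_distrib[of "\<lambda>x. _ * x"] cong: if_cong)
  thus v: "v $ Xv = 0" "v $ Xtau = 0" using assms(2) by force+
  show k: "kill U x v (\<lambda>y. phi y k)" if "k \<ge> 1" for k
  proof (rule kill_phi[OF _ assms(1) that])
    fix j assume "1 \<le> j" "j \<le> CARD('n)"
    then obtain i :: 'n where "rank i = j" using rank_range by blast
    thus "kill U x v (t_pos r j)"
      using assms(2)[of "XN i"] open_U assms(1) holo_t_pos by (simp add: kill_def t_coord_def)
  qed
  show "Dsum (\<lambda>y. phi y 0) x v = Dsum (\<lambda>y. t_coord r y $ X0) x v"
    using Dsum_t_zero[OF k assms(1) v] by (simp add: t_coord_def)
qed

lemma t_killed_conv:
  assumes "x \<in> U" "v $ Xv = 0" "v $ Xtau = 0" "\<And>k. Dsum (\<lambda>y. phi y k) x v = 0"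
  shows "Dsum (\<lambda>y. t_coord r y $ j) x v = 0"
proof (cases j)
  have k: "kill U x v (\<lambda>y. phi y k)" for k using assms open_U holo_phi_U by (simp add: kill_def)
  case X0
  thus ?thesis using Dsum_t_zero[OF k assms(1-3)] assms(4) by (simp add: t_coord_def)
next
  have k: "kill U x v (\<lambda>y. phi y k)" for k using assms open_U holo_phi_U by (simp add: kill_def)
  case (XN i)
  thus ?thesis using kill_t_pos[OF k assms(1) rank_ge_1, of i] by (simp add: t_coord_def kill_def)
qed (use assms in \<open>auto simp: t_coord_def Dsum_def pdiff_component if_distrib[of "\<lambda>x. _ * x"] cong: if_cong\<close>)

subsection \<open>The intersection form in flat coordinates\<close>

lemma inj_t: "inj_on (t_coord r) U" and inv_jac: "x \<in> U ==> invertible (jacobian (t_coord r) x)"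
  using chart by (auto simp: orbit_chart_def)

lemma open_W: "open TU"
  by (rule holo_inverse_function(1)[OF open_U holo_t inj_t inv_jac])

lemma holo_tinv: "holo_on (\<lambda>p. pt p $ i) TU"
  by (rule holo_inverse_function(2)[OF open_U holo_t inj_t inv_jac])

lemma tinv_in: "p \<in> TU ==> pt p \<in> U"
  by (rule inv_into_into)

lemma t_tinv: "p \<in> TU ==> t_coord r (pt p) = p"
  by (rule f_inv_into_f)

lemma tinv_t: "x \<in> U ==> pt (t_coord r x) = x"
  by (rule inv_into_f_f[OF inj_t])

text \<open>The part of the coordinate domain lying over \<open>V\<close>, where functions on
  \<open>V\<close> become functions of \<open>t\<close>.\<close>

definition sheet :: "'n point set => 'n point set" where
  "sheet V = {p \<in> TU. pt p \<in> V}"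

lemma open_sheet: "open V ==> open (sheet V)"
proof -
  assume V: "open V"
  have "continuous_on TU (\<lambda>p. \<chi> i. pt p $ i)"
    by (rule continuous_on_vec_lambda) (rule holo_on_imp_continuous_on[OF holo_tinv])
  hence "continuous_on TU (pt)" by simp
  hence "open (TU \<inter> pt -` V)"
    by (rule continuous_open_preimage[OF _ open_W V])
  moreover have "TU \<inter> pt -` V = sheet V" by (auto simp: sheet_def)
  ultimately show ?thesis by simp
qed

lemma sheet_W: "p \<in> sheet V ==> p \<in> TU" "p \<in> sheet V ==> pt p \<in> V"
  by (auto simp: sheet_def)

lemma holo_tinv_at: "p \<in> TU ==> holo_on (\<lambda>p. pt p $ i) {p}"
  by (rule holo_at[OF holo_tinv])

lemma holo_sheet: "holo_on f V ==> holo_on (\<lambda>p. f (pt p)) (sheet V)"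
  by (rule holo_on_compose[OF _ holo_on_subset[OF holo_tinv]]) (auto simp: sheet_def)

lemma pdiff_tinv:
  assumes "holo_on f {pt p}" "p \<in> TU"
  shows "pdiff (\<lambda>p. f (pt p)) k p = (\<Sum>!c. pdiff f c (pt p) * pdiff (\<lambda>p. pt p $ c) k p)"
  by (rule holo_compose_at(2)[OF assms(1) holo_tinv_at[OF assms(2)]])

text \<open>Push-forward of the tangent vector \<open>v\<close> under the inverse chart.\<close>

definition push :: "'n point => 'n point => 'n point" where
  "push p v = (\<chi> c. Dsum (\<lambda>p. pt p $ c) p v)"

lemma Dsum_push:
  assumes "holo_on f {pt p}" "p \<in> TU"
  shows "Dsum f (pt p) (push p v) = Dsum (\<lambda>p. f (pt p)) p v"
proof -
  have "Dsum (\<lambda>p. f (pt p)) p v = (\<Sum>!k c. v $ k * pdiff (\<lambda>p. pt p $ c) k p * pdiff f c (pt p))"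
    unfolding Dsum_def pdiff_tinv[OF assms] sum_distrib_left by (intro sum.cong refl) simp
  also have "... = (\<Sum>!c k. v $ k * pdiff (\<lambda>p. pt p $ c) k p * pdiff f c (pt p))"
    by (rule sum.swap)
  finally show ?thesis by (simp add: push_def Dsum_def sum_distrib_right)
qed

lemma Dsum_t_push:
  assumes "p \<in> TU"
  shows "Dsum (\<lambda>y. t_coord r y $ i) (pt p) (push p v) = v $ i"
proof -
  have "Dsum (\<lambda>y. t_coord r y $ i) (pt p) (push p v) = Dsum (\<lambda>p. t_coord r (pt p) $ i) p v"
    by (rule Dsum_push[OF holo_at[OF holo_t tinv_in[OF assms]] assms])
  also have "... = Dsum (\<lambda>p. p $ i) p v"
    unfolding Dsum_def by (intro sum.cong refl arg_cong[where f="\<lambda>x. _ * x"] pdiff_cong[OF open_W assms]) (simp add: t_tinv)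
  also have "... = v $ i" by (simp add: Dsum_def pdiff_component if_distrib[of "\<lambda>x. _ * x"] cong: if_cong)
  finally show ?thesis .
qed

lemma pdiff_via_t:
  assumes "holo_on f V" "open V" "V \<subseteq> U" "p \<in> sheet V"
  shows "pdiff f a (pt p) = (\<Sum>!j. pdiff (\<lambda>p. f (pt p)) j p * Jt U r p $ j $ a)"
proof -
  note p = sheet_W[OF assms(4)]
  have 1: "holo_on (\<lambda>p. f (pt p)) {t_coord r (pt p)}"
    unfolding t_tinv[OF p(1)] by (rule holo_at[OF holo_sheet[OF assms(1)] assms(4)])
  have 2: "holo_on (\<lambda>y. t_coord r y $ i) {pt p}" for i
    by (rule holo_at[OF holo_t tinv_in[OF p(1)]])
  have "pdiff f a (pt p) = pdiff (\<lambda>y. f (pt (t_coord r y))) a (pt p)"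
    by (rule pdiff_cong[OF assms(2) p(2)]) (use tinv_t assms(3) in auto)
  also have "... = (\<Sum>!j. pdiff (\<lambda>p. f (pt p)) j (t_coord r (pt p)) * pdiff (\<lambda>y. t_coord r y $ j) a (pt p))"
    by (rule holo_compose_at(2)[OF 1 2])
  finally show ?thesis by (simp add: t_tinv[OF p(1)] Jt_nth)
qed

lemma sheet_U: "sheet U = TU"
  by (auto simp: sheet_def tinv_in)

lemma holo_Jt: "holo_on (\<lambda>p. Jt U r p $ i $ a) TU"
  unfolding Jt_nth sheet_U[symmetric]
  by (rule holo_sheet[OF holo_on_pdiff[OF holo_t open_U]])

lemma Jt_sym:
  assumes p: "p \<in> TU"
  shows "(\<Sum>!s. Jt U r p $ s $ b * pdiff (\<lambda>q. Jt U r q $ j $ a) s p)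
       = (\<Sum>!s. Jt U r p $ s $ a * pdiff (\<lambda>q. Jt U r q $ j $ b) s p)"
proof -
  let ?h = "\<lambda>a. pdiff (\<lambda>y. t_coord r y $ j) a"
  have hh: "holo_on (?h a) U" for a by (rule holo_on_pdiff[OF holo_t open_U])
  have 1: "(\<Sum>!s. Jt U r p $ s $ b * pdiff (\<lambda>q. Jt U r q $ j $ a) s p) = pdiff (?h a) b (pt p)" for a b
    using pdiff_via_t[OF hh open_U order_refl, of p a b] p
    unfolding Jt_nth[of _ _ _ j] by (simp add: sheet_U mult.commute)
  show ?thesis unfolding 1 by (rule pdiff_commute[OF holo_t open_U tinv_in[OF p]])
qed

lemma g_t_data:
  assumes "p \<in> TU"
  shows "holo_on (Ct U r i j c) TU"
    "pdiff (\<lambda>q. g_t U r q $ i $ j) c p = Ct U r i j c p + Ct U r j i c p"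
    "symc (\<lambda>i j. g_t U r p $ i $ j) (\<lambda>i j c. Ct U r i j c p)"
    "flatc (\<lambda>i j. g_t U r p $ i $ j) (\<lambda>i j c. Ct U r i j c p) (\<lambda>i j c s. pdiff (Ct U r i j c) s p)"
  unfolding g_t_nth Ct_def[abs_def]
  using pullback_data[where k="\<lambda>a b. g_star $ a $ b" and J="Jt U r", OF open_W holo_Jt g_star_sym Jt_sym assms] by blast+

lemma holo_g_t: "holo_on (\<lambda>p. g_t U r p $ i $ j) TU"
  unfolding g_t_nth by (intro holo_on_sum holo_on_mult holo_on_const holo_Jt)

lemma g_t_sym: "transpose (g_t U r p) = g_t U r p"
proof -
  have s: "transpose (g_star :: complex ^ 'n idx ^ 'n idx) = g_star"
    by (simp add: vec_eq_iff transpose_def g_star_sym[symmetric])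
  show ?thesis by (simp add: g_t_def Let_def matrix_transpose_mul s matrix_mul_assoc)
qed

lemma invertible_g_star: "invertible (g_star :: complex ^ 'n idx ^ 'n idx)"
proof -
  have n: "(of_nat CARD('n) :: complex) ~= 0" "(of_nat CARD('n) + 1 :: complex) ~= 0"
    by (simp, metis of_nat_Suc of_nat_eq_0_iff nat.distinct(1) add.commute)
  have "v = 0" if z: "g_star *v v = 0" for v :: "complex ^ 'n idx"
  proof -
    have c: "(\<Sum>!b. g_star $ a $ b * v $ b) = 0" for a
      using arg_cong[OF z, of "\<lambda>x. x $ a"] by (simp add: matrix_vector_mult_def)
    have tau: "v $ Xtau = 0" using c[of X0] by (simp add: sum_idx)
    have x0: "v $ X0 = 0" using c[of Xtau] by (simp add: sum_idx)
    have xv: "v $ Xv = 0" using c[of Xv] n by (simp add: sum_idx)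
    define S where "S = (\<Sum>!k. v $ XN k)"
    have vk: "v $ XN k = S / (of_nat CARD('n) + 1)" for k
    proof -
      have "(\<Sum>!j. ((if k = j then 1 else 0) - 1 / (of_nat CARD('n) + 1)) * v $ XN j) = 0"
        using c[of "XN k"] by (simp add: sum_idx)
      moreover have "(\<Sum>!j. ((if k = j then 1 else 0) - 1 / (of_nat CARD('n) + 1)) * v $ XN j)
         = (\<Sum>!j. (if k = j then v $ XN j else 0) - 1 / (of_nat CARD('n) + 1) * v $ XN j)"
        by (intro sum.cong refl) (auto simp: algebra_simps)
      ultimately show ?thesis by (simp add: sum_subtractf S_def sum_divide_distrib)
    qed
    have "(\<Sum>!k. v $ XN k) = (\<Sum>k\<in>(UNIV :: 'n set). S / (of_nat CARD('n) + 1))"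
      by (intro sum.cong refl vk)
    hence "S = of_nat CARD('n) * (S / (of_nat CARD('n) + 1))" unfolding S_def[symmetric] by simp
    hence "S * (of_nat CARD('n) + 1) = of_nat CARD('n) * S" using n(2) by (simp add: field_simps)
    hence "S = 0" by (simp add: algebra_simps)
    hence "v $ XN k = 0" for k using vk by simp
    hence "v $ a = 0" for a using tau x0 xv by (cases a) auto
    thus ?thesis by (simp add: vec_eq_iff)
  qed
  thus ?thesis by (simp add: invertible_left_inverse matrix_left_invertible_ker)
qed

lemma invertible_g_t: "p \<in> TU ==> invertible (g_t U r p)"
proof -
  assume p: "p \<in> TU"
  have "invertible (transpose M)" if "invertible M" for M :: "complex ^ 'n idx ^ 'n idx"
    using that by (simp add: invertible_det_nz det_transpose)
  thus ?thesis
    unfolding g_t_def Let_def using inv_jac[OF tinv_in[OF p]]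
    by (intro invertible_mult invertible_g_star) auto
qed

lemma gform_via_t:
  assumes "holo_on f V" "holo_on h V" "open V" "V \<subseteq> U" "p \<in> sheet V"
  shows "gform f h (pt p) = (\<Sum>!i. \<Sum>j\<in>UNIV.
     pdiff (\<lambda>p. f (pt p)) i p * g_t U r p $ i $ j * pdiff (\<lambda>p. h (pt p)) j p)"
  unfolding gform_def pdiff_via_t[OF assms(1,3-5)] pdiff_via_t[OF assms(2-5)] gf_sum1 gf_sum2 g_t_gf
  by (simp add: sum_distrib_left mult_ac)

text \<open>The transformation law of the connection. Writing dh as a combination of the coordinate
  differentials and differentiating gives one term with derivatives of the components, paired by
  \<open>g_t\<close>, and one with derivatives of the differentials, paired by
  \<open>Ct\<close>.\<close>

lemma gconn_via_t:
  assumes "holo_on f V" "holo_on h V" "open V" "V \<subseteq> U" "p \<in> sheet V"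
  shows "(\<Sum>!c. gconn f h c (pt p) * pdiff (\<lambda>p. pt p $ c) k p) = (\<Sum>!i. \<Sum>j\<in>UNIV.
     pdiff (\<lambda>p. f (pt p)) i p * (g_t U r p $ i $ j * pdiff (pdiff (\<lambda>p. h (pt p)) j) k p
       + Ct U r i j k p * pdiff (\<lambda>p. h (pt p)) j p))"
proof -
  note p = sheet_W[OF assms(5)]
  define H where "H = (\<lambda>j. pdiff (\<lambda>p. h (pt p)) j)"
  have os: "open (sheet V)" by (rule open_sheet[OF assms(3)])
  have hH: "holo_on (H j) {p}" for j
    unfolding H_def by (rule holo_at[OF holo_on_pdiff[OF holo_sheet[OF assms(2)] os] assms(5)])
  have hJ: "holo_on (\<lambda>q. Jt U r q $ j $ b) {p}" for j b by (rule holo_at[OF holo_Jt p(1)])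
  have hb: "holo_on (pdiff h b) V" for b by (rule holo_on_pdiff[OF assms(2,3)])
  have 1: "(\<Sum>!c. pdiff (\<lambda>p. pt p $ c) k p * pdiff (pdiff h b) c (pt p))
     = (\<Sum>!j. pdiff (H j) k p * Jt U r p $ j $ b) + (\<Sum>!j. H j p * pdiff (\<lambda>q. Jt U r q $ j $ b) k p)" for b
  proof -
    have "(\<Sum>!c. pdiff (\<lambda>p. pt p $ c) k p * pdiff (pdiff h b) c (pt p)) = pdiff (\<lambda>p. pdiff h b (pt p)) k p"
      unfolding pdiff_tinv[OF holo_at[OF hb p(2)] p(1)] by (simp add: mult.commute)
    also have "... = pdiff (\<lambda>p. \<Sum>!j. H j p * Jt U r p $ j $ b) k p"
      unfolding H_def by (rule pdiff_cong[OF os assms(5) pdiff_via_t[OF assms(2-4)]])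
    also have "... = (\<Sum>!j. pdiff (\<lambda>p. H j p * Jt U r p $ j $ b) k p)"
      by (rule pdiff_sum) (intro holo_on_mult hH hJ)
    finally show ?thesis by (simp add: pdiff_mult[OF hH hJ] sum.distrib)
  qed
  have "(\<Sum>!c. gconn f h c (pt p) * pdiff (\<lambda>p. pt p $ c) k p)
    = gf (\<lambda>a. pdiff f a (pt p)) (\<lambda>b. \<Sum>!c. pdiff (\<lambda>p. pt p $ c) k p * pdiff (pdiff h b) c (pt p))"
    unfolding gf_sum2 gconn_def by (simp add: mult.commute)
  also have "... = (\<Sum>!i. pdiff (\<lambda>p. f (pt p)) i p * ((\<Sum>!j. pdiff (H j) k p * g_t U r p $ i $ j)
      + (\<Sum>!j. H j p * Ct U r i j k p)))"
    unfolding pdiff_via_t[OF assms(1,3-5)] 1 gf_sum1 gf_add gf_sum2 g_t_gf Ct_gf ..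
  finally show ?thesis by (simp add: H_def sum_distrib_left sum.distrib algebra_simps)
qed

subsection \<open>Linearity in the distinguished coordinate\<close>

lemma unit_push:
  assumes "p \<in> TU"
  shows "\<And>i. i ~= X0 ==> Dsum (\<lambda>y. t_coord r y $ i) (pt p) (push p (axis X0 1)) = 0"
    "Dsum (\<lambda>y. t_coord r y $ X0) (pt p) (push p (axis X0 1)) = 1"
  using Dsum_t_push[OF assms] by (auto simp: axis_def)

lemma pdiff_X0:
  assumes "holo_on f {pt p}" "p \<in> TU"
  shows "pdiff (\<lambda>p. f (pt p)) X0 p = Dsum f (pt p) (push p (axis X0 1))"
  using Dsum_push[OF assms, of "axis X0 1"] by simp

lemma cst_phi:
  assumes "k \<ge> 1" shows "cst X0 TU (\<lambda>p. phi (pt p) k)"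
proof -
  have "pdiff (\<lambda>p. phi (pt p) k) X0 p = 0" if p: "p \<in> TU" for p
    using pdiff_X0[OF holo_at[OF holo_phi_U tinv_in[OF p]] p, of k]
      t_killed(3)[OF tinv_in[OF p] unit_push(1)[OF p] assms] by (simp add: kill_def)
  thus ?thesis
    using open_W holo_sheet[OF holo_phi_U, of k] by (simp add: cst_def sheet_U)
qed

lemma pdiff_phi0:
  assumes p: "p \<in> TU" shows "pdiff (\<lambda>p. phi (pt p) 0) X0 p = 1"
  using pdiff_X0[OF holo_at[OF holo_phi_U tinv_in[OF p]] p, of 0]
      t_killed(4)[OF tinv_in[OF p] unit_push(1)[OF p]] unit_push(2)[OF p] by simp

lemma cst_wt:
  assumes "holo_on f V" "open V" "V \<subseteq> U"
    "\<And>x y :: 'n point. x $ Xv = y $ Xv ==> x $ Xtau = y $ Xtau ==> f x = f y"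
  shows "cst X0 (sheet V) (\<lambda>p. f (pt p))"
proof -
  have "pdiff (\<lambda>p. f (pt p)) X0 p = 0" if p: "p \<in> sheet V" for p
  proof -
    note pW = sheet_W[OF p]
    have "pdiff (\<lambda>p. f (pt p)) X0 p = Dsum f (pt p) (push p (axis X0 1))"
      by (rule pdiff_X0[OF holo_at[OF assms(1) pW(2)] pW(1)])
    also have "... = 0"
      by (rule Dsum_wt[OF assms(4)]) (use t_killed(1,2)[OF tinv_in[OF pW(1)] unit_push(1)[OF pW(1)]] in auto)
    finally show ?thesis .
  qed
  thus ?thesis using open_sheet[OF assms(2)] holo_sheet[OF assms(1)] by (simp add: cst_def)
qed

section \<open>The superpotential along the distinguished coordinate\<close>

context
  fixes V z
  assumes V: "open V" "V \<subseteq> U" and z: "\<And>x. x \<in> V ==> regz x z"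
begin

lemma reg_V: "x \<in> V ==> reg_x x"
  using reg_U V by blast

lemma holo_lam_V: "holo_on (\<lambda>x. lam x z) V" "holo_on (\<lambda>x. lamd x z) V"
  using pdiff_lam(1)[OF z] pdiff_lamd(1)[OF z] by (auto simp: holo_on_pointwise[of _ V])

lemma cst_phi_V: "k \<ge> 1 ==> cst X0 (sheet V) (\<lambda>p. phi (pt p) k)"
  by (rule cst_subset[OF cst_phi]) (use sheet_W(1) open_sheet[OF V(1)] in auto)

text \<open>In the expansion only the invariant of index 0 varies along this coordinate, and its
  basis function is 1.\<close>

lemma lam_unit:
  assumes "p \<in> sheet V" shows "pdiff (\<lambda>p. lam (pt p) z) X0 p = 1"
proof -
  have hb: "holo_on (\<lambda>x. bas k (tau x) (shift_v x) z) V" for k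
    by (intro holo_on_bas holo_on_component holo_shift_v) (use regz_goodz[OF z] reg_V in \<open>auto simp: reg_x_def\<close>)
  have cb: "cst X0 (sheet V) (\<lambda>p. bas k (pt p $ Xtau) (shift_v (pt p)) z)" for k
    by (rule cst_wt[OF hb V]) (simp add: shift_v_def)
  have os: "open (sheet V)" by (rule open_sheet[OF V(1)])
  have c: "cst X0 (sheet V) (\<lambda>p. \<Sum>k\<in>{1..CARD('n)}. phi (pt p) k * bas k (pt p $ Xtau) (shift_v (pt p)) z)"
    by (intro cst_sum os cst_mult cb cst_phi_V) auto
  have e: "lam (pt p) z = phi (pt p) 0
     + (\<Sum>k\<in>{1..CARD('n)}. phi (pt p) k * bas k (pt p $ Xtau) (shift_v (pt p)) z)" if "p \<in> sheet V" for p
  proof -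
    have "pt p \<in> V" by (rule sheet_W(2)[OF that])
    hence "lam (pt p) z = (\<Sum>k\<le>CARD('n). phi (pt p) k * bas k (pt p $ Xtau) (shift_v (pt p)) z)"
      by (intro lam_expand(1) reg_V z)
    also have "{..CARD('n)} = insert 0 {1..CARD('n)}" by auto
    finally show ?thesis by (simp add: bas_def)
  qed
  have h0: "holo_on (\<lambda>p. phi (pt p) 0) {p}"
    by (rule holo_at[OF holo_sheet[OF holo_on_subset[OF holo_phi_U V(2)]] assms])
  have "pdiff (\<lambda>p. lam (pt p) z) X0 p = pdiff (\<lambda>p. phi (pt p) 0
     + (\<Sum>k\<in>{1..CARD('n)}. phi (pt p) k * bas k (pt p $ Xtau) (shift_v (pt p)) z)) X0 p"
    by (rule pdiff_cong[OF os assms e])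
  also have "... = 1 + 0"
    using c assms by (subst pdiff_add[OF h0]) (auto simp: cst_def pdiff_phi0[OF sheet_W(1)[OF assms]] intro: holo_at)
  finally show ?thesis by simp
qed

lemma aff_lam: "aff X0 (sheet V) (\<lambda>p. lam (pt p) z)"
  and cst_pdiff_lam: "cst X0 (sheet V) (pdiff (\<lambda>p. lam (pt p) z) k)"
  using aff_unit[OF open_sheet[OF V(1)] holo_sheet[OF holo_lam_V(1)] lam_unit] by auto

text \<open>\<open>dbas 0\<close> is zero, so the only invariant that varies is absent from the
  derivative of the expansion.\<close>

lemma cst_lamd: "cst X0 (sheet V) (\<lambda>p. lamd (pt p) z)"
proof -
  have hb: "holo_on (\<lambda>x. dbas k (tau x) (shift_v x) z) V" for k
    by (intro holo_on_dbas holo_on_component holo_shift_v) (use regz_goodz[OF z] in auto)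
  have cb: "cst X0 (sheet V) (\<lambda>p. dbas k (pt p $ Xtau) (shift_v (pt p)) z)" for k
    by (rule cst_wt[OF hb V]) (simp add: shift_v_def)
  have os: "open (sheet V)" by (rule open_sheet[OF V(1)])
  have "cst X0 (sheet V) (\<lambda>p. \<Sum>k\<in>{1..CARD('n)}. phi (pt p) k * dbas k (pt p $ Xtau) (shift_v (pt p)) z)"
    by (intro cst_sum os cst_mult cb cst_phi_V) auto
  thus ?thesis
  proof (rule cst_cong)
    fix p assume "p \<in> sheet V"
    hence "pt p \<in> V" by (rule sheet_W(2))
    hence "lamd (pt p) z = (\<Sum>k\<le>CARD('n). phi (pt p) k * dbas k (pt p $ Xtau) (shift_v (pt p)) z)"
      by (intro lam_expand(2) reg_V z)
    also have "{..CARD('n)} = insert 0 {1..CARD('n)}" by auto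
    finally show "lamd (pt p) z = (\<Sum>k\<in>{1..CARD('n)}. phi (pt p) k * dbas k (pt p $ Xtau) (shift_v (pt p)) z)"
      by (simp add: dbas_def)
  qed
qed

end

section \<open>Affinity of the pairings of two values of the superpotential\<close>

context
  fixes V p q
  assumes V: "open V" "V \<subseteq> U" and p: "\<And>x. x \<in> V ==> regz x p" and q: "\<And>x. x \<in> V ==> regz x q"
    and pq: "\<And>x. x \<in> V ==> Th 0 (tau x) (q - p) ~= 0"
begin

lemma cst_special:
  shows "cst X0 (sheet V) (\<lambda>t. psi (pt t $ Xtau) (q - p))" "cst X0 (sheet V) (\<lambda>t. psi (pt t $ Xtau) p)"
    "cst X0 (sheet V) (\<lambda>t. psi (pt t $ Xtau) q)" "cst X0 (sheet V) (\<lambda>t. psi1 (pt t $ Xtau) (q - p))"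
    "cst X0 (sheet V) (\<lambda>t. hh1 (pt t $ Xtau) (q - p))" "cst X0 (sheet V) (\<lambda>t. hh1 (pt t $ Xtau) q)"
    "cst X0 (sheet V) (\<lambda>t. psi (pt t $ Xtau) (q + shift_v (pt t)))"
    "cst X0 (sheet V) (\<lambda>t. pt t $ Xtau)" "cst X0 (sheet V) (\<lambda>t. shift_v (pt t))"
proof -
  note nz = regz_goodz[OF p] regz_goodz[OF q] pq
  have 1: "holo_on (\<lambda>x. psi (tau x) (q - p)) V" "holo_on (\<lambda>x. psi (tau x) p) V" "holo_on (\<lambda>x. psi (tau x) q) V"
    "holo_on (\<lambda>x. psi1 (tau x) (q - p)) V" "holo_on (\<lambda>x. hh1 (tau x) (q - p)) V" "holo_on (\<lambda>x. hh1 (tau x) q) V"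
    "holo_on (\<lambda>x. psi (tau x) (q + shift_v x)) V"
    by (intro holo_on_psi holo_on_psi1 holo_on_hh1 holo_on_component holo_on_const holo_on_add holo_shift_v; simp add: nz)+
  show "cst X0 (sheet V) (\<lambda>t. psi (pt t $ Xtau) (q - p))" by (rule cst_wt[OF 1(1) V]) simp
  show "cst X0 (sheet V) (\<lambda>t. psi (pt t $ Xtau) p)" by (rule cst_wt[OF 1(2) V]) simp
  show "cst X0 (sheet V) (\<lambda>t. psi (pt t $ Xtau) q)" by (rule cst_wt[OF 1(3) V]) simp
  show "cst X0 (sheet V) (\<lambda>t. psi1 (pt t $ Xtau) (q - p))" by (rule cst_wt[OF 1(4) V]) simp
  show "cst X0 (sheet V) (\<lambda>t. hh1 (pt t $ Xtau) (q - p))" by (rule cst_wt[OF 1(5) V]) simp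
  show "cst X0 (sheet V) (\<lambda>t. hh1 (pt t $ Xtau) q)" by (rule cst_wt[OF 1(6) V]) simp
  show "cst X0 (sheet V) (\<lambda>t. psi (pt t $ Xtau) (q + shift_v (pt t)))"
    by (rule cst_wt[OF 1(7) V]) (simp add: shift_v_def)
  show "cst X0 (sheet V) (\<lambda>t. pt t $ Xtau)" by (rule cst_wt[OF _ V]) auto
  show "cst X0 (sheet V) (\<lambda>t. shift_v (pt t))" by (rule cst_wt[OF _ V]) (auto simp: shift_v_def)
qed

lemma os_V: "open (sheet V)" by (rule open_sheet[OF V(1)])

lemmas lam_facts =
  aff_lam[OF V p] aff_lam[OF V q] cst_lamd[OF V p] cst_lamd[OF V q]
  cst_pdiff_lam[OF V p] cst_pdiff_lam[OF V q]

lemma aff_gform_lam: "aff X0 (sheet V) (\<lambda>t. gform (\<lambda>x. lam x p) (\<lambda>x. lam x q) (pt t))"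
proof (rule aff_cong)
  show "aff X0 (sheet V) (\<lambda>t. (psi (pt t $ Xtau) (q - p) - psi (pt t $ Xtau) q) * (lamd (pt t) p * lam (pt t) q)
     - (psi (pt t $ Xtau) (q - p) + psi (pt t $ Xtau) p) * (lam (pt t) p * lamd (pt t) q)
     - inverse (of_nat CARD('n)) * (lamd (pt t) p * lamd (pt t) q))"
    by (intro aff_diff aff_cmult aff_multc cst_imp_aff[OF cst_mult] cst_imp_aff[OF cst_lamd[OF V p]] cst_diff cst_add cst_mult cst_const os_V cst_special lam_facts)
qed (simp add: gform_lam[OF p q pq] sheet_W(2) divide_inverse mult.commute)

lemma aff_gconn_lam:
  "aff X0 (sheet V) (\<lambda>t. \<Sum>!c. gconn (\<lambda>x. lam x p) (\<lambda>x. lam x q) c (pt t) * pdiff (\<lambda>t. pt t $ c) k t)"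
proof -
  \<comment> \<open>\<open>gconn_lam\<close> contracted with the Jacobian of the inverse chart: by
    the chain rule every \<open>c\<close>-derivative becomes a derivative along the coordinate
    \<open>k\<close>.\<close>
  define R where "R = (\<lambda>t. (psi (pt t $ Xtau) (q - p) - psi (pt t $ Xtau) q) * (lamd (pt t) p * pdiff (\<lambda>t. lam (pt t) q) k t)
     - (psi (pt t $ Xtau) (q - p) + psi (pt t $ Xtau) p) * (lam (pt t) p * pdiff (\<lambda>t. lamd (pt t) q) k t)
     - inverse (of_nat CARD('n)) * (lamd (pt t) p * pdiff (\<lambda>t. lamd (pt t) q) k t)
     + psi1 (pt t $ Xtau) (q - p) * (lam (pt t) q * pdiff (\<lambda>t. lam (pt t) p) k t - lam (pt t) p * pdiff (\<lambda>t. lam (pt t) q) k t)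
     + lamd (pt t) p * (lam (pt t) q * ((hh1 (pt t $ Xtau) (q - p) - hh1 (pt t $ Xtau) q) * (inverse tpi * pdiff (\<lambda>t. pt t $ Xtau) k t))))"
  have "aff X0 (sheet V) R"
    unfolding R_def by (intro aff_diff aff_add aff_cmult[OF cst_diff] aff_cmult[OF cst_add] aff_cmult[OF cst_const] aff_cmult[OF cst_special(4)]
        aff_cmult[OF cst_lamd[OF V p]] aff_multc cst_imp_aff[OF cst_mult] cst_diff cst_add cst_mult cst_const os_V
        cst_special lam_facts cst_pdiff[OF cst_lamd[OF V q]] cst_imp_aff[OF cst_pdiff_lam[OF V q]] cst_pdiff[OF cst_special(8)])
  moreover have "(\<Sum>!c. gconn (\<lambda>x. lam x p) (\<lambda>x. lam x q) c (pt t) * pdiff (\<lambda>t. pt t $ c) k t) = R t" if t: "t \<in> sheet V" for t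
  proof -
  define x where "x = pt t"
  have x: "x \<in> V" unfolding x_def by (rule sheet_W(2)[OF t])
  have tW: "t \<in> TU" by (rule sheet_W(1)[OF t])
  define S where "S = (\<lambda>c. pdiff (\<lambda>t. pt t $ c) k t)"
  have l: "pdiff (\<lambda>t. lam (pt t) z) k t = (\<Sum>!c. pdiff (\<lambda>x. lam x z) c x * S c)"
    "pdiff (\<lambda>t. lamd (pt t) z) k t = (\<Sum>!c. pdiff (\<lambda>x. lamd x z) c x * S c)" if "regz x z" for z
    unfolding x_def S_def
    by (rule pdiff_tinv[OF pdiff_lam(1)[OF that, unfolded x_def] tW],
        rule pdiff_tinv[OF pdiff_lamd(1)[OF that, unfolded x_def] tW])
  have T: "(\<Sum>!c. dT c * S c) = inverse tpi * S Xtau"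
  proof -
    have "dT c * S c = (if c = Xtau then inverse tpi * S Xtau else 0)" for c
      by (cases "c = Xtau") (simp_all only: dT_def inverse_eq_divide if_True if_False mult_zero_left refl)
    thus ?thesis by (simp only: sum.delta finite UNIV_I if_True)
  qed
  note z = p[OF x] q[OF x] pq[OF x]
  have "(\<Sum>!c. gconn (\<lambda>x. lam x p) (\<lambda>x. lam x q) c x * S c)
    = (\<Sum>!c. ((psi (tau x) (q - p) - psi (tau x) q) * lamd x p) * (pdiff (\<lambda>x. lam x q) c x * S c)
     - ((psi (tau x) (q - p) + psi (tau x) p) * lam x p) * (pdiff (\<lambda>x. lamd x q) c x * S c)
     - (inverse (of_nat CARD('n)) * lamd x p) * (pdiff (\<lambda>x. lamd x q) c x * S c)
     + (psi1 (tau x) (q - p) * lam x q) * (pdiff (\<lambda>x. lam x p) c x * S c) - (psi1 (tau x) (q - p) * lam x p) * (pdiff (\<lambda>x. lam x q) c x * S c)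
     + (lamd x p * lam x q * (hh1 (tau x) (q - p) - hh1 (tau x) q)) * (dT c * S c))"
    unfolding gconn_lam[OF z] by (intro sum.cong refl) (simp add: algebra_simps divide_inverse)
  also have "... = R t"
    unfolding R_def x_def[symmetric] fun_cong[OF S_def, of Xtau, symmetric] sum.distrib sum_subtractf sum_distrib_left[symmetric] l(1)[OF z(1), symmetric] l(1)[OF z(2), symmetric] l(2)[OF z(2), symmetric] T
    by (simp add: algebra_simps)
  finally show ?thesis by (simp only: x_def S_def)
  qed
  ultimately show ?thesis by (rule aff_cong)
qed

lemma aff_gform_shift_lam: "aff X0 (sheet V) (\<lambda>t. gform shift_v (\<lambda>x. lam x q) (pt t))"
proof (rule aff_cong)
  show "aff X0 (sheet V) (\<lambda>t. - (psi (pt t $ Xtau) q - psi (pt t $ Xtau) (q + shift_v (pt t))) * lam (pt t) q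
     - lamd (pt t) q * inverse (of_nat CARD('n)))"
    by (intro aff_diff aff_cmult cst_minus cst_diff cst_special cst_imp_aff[OF cst_mult] lam_facts cst_const os_V)
qed (simp add: gform_shift_lam[OF q[OF sheet_W(2)]] divide_inverse)

lemma aff_gform_tau_lam: "aff X0 (sheet V) (\<lambda>t. gform tau (\<lambda>x. lam x q) (pt t))"
proof (rule aff_cong)
  show "aff X0 (sheet V) (\<lambda>t. (- 2 * of_real pi * \<i>) * lam (pt t) q)"
    by (intro aff_cmult lam_facts cst_const os_V)
qed (simp add: gform_tau_lam[OF q[OF sheet_W(2)]])

text \<open>The derivative along the distinguished coordinate replaces the factor \<lambda> of each
  summand by 1 and annihilates the summands without such a factor.\<close>

lemma dgform_values:
  assumes t: "t \<in> sheet V"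
  defines "x \<equiv> pt t"
  shows "pdiff (\<lambda>t. gform (\<lambda>x. lam x p) (\<lambda>x. lam x q) (pt t)) X0 t
      = (psi (tau x) (q - p) - psi (tau x) q) * lamd x p - (psi (tau x) (q - p) + psi (tau x) p) * lamd x q" (is ?a)
    "pdiff (\<lambda>t. gform shift_v (\<lambda>x. lam x q) (pt t)) X0 t = - (psi (tau x) q - psi (tau x) (q + shift_v x))" (is ?b)
    "pdiff (\<lambda>t. gform tau (\<lambda>x. lam x q) (pt t)) X0 t = - 2 * of_real pi * \<i>" (is ?c)
proof -
  define W where "W = sheet V"
  have W: "open W" "t \<in> W" unfolding W_def using open_sheet[OF V(1)] t by auto
  note WV = sheet_W(2)[of _ V, folded W_def]
  note sp = cst_special[folded W_def]
  note ld = cst_lamd[OF V p, folded W_def] cst_lamd[OF V q, folded W_def]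
  have hl: "holo_on (\<lambda>t. lam (pt t) p) W" "holo_on (\<lambda>t. lam (pt t) q) W"
    unfolding W_def by (rule holo_sheet[OF holo_lam_V(1)[OF V p]], assumption, rule holo_sheet[OF holo_lam_V(1)[OF V q]], assumption)
  have u: "pdiff (\<lambda>t. lam (pt t) p) X0 t = 1" "pdiff (\<lambda>t. lam (pt t) q) X0 t = 1"
    by (rule lam_unit[OF V p t], assumption, rule lam_unit[OF V q t], assumption)
  show ?a
  proof -
    define A where "A = (\<lambda>t. (psi (pt t $ Xtau) (q - p) - psi (pt t $ Xtau) q) * lamd (pt t) p)"
    define B where "B = (\<lambda>t. (psi (pt t $ Xtau) (q - p) + psi (pt t $ Xtau) p) * lamd (pt t) q)"
    define C where "C = (\<lambda>t. inverse (of_nat CARD('n)) * (lamd (pt t) p * lamd (pt t) q))"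
    have c: "cst X0 W A" "cst X0 W B" "cst X0 W C"
      unfolding A_def B_def C_def by (intro cst_mult cst_diff cst_add cst_const W(1) sp ld | assumption)+
    have h: "holo_on (\<lambda>t. A t * lam (pt t) q) {t}" "holo_on (\<lambda>t. B t * lam (pt t) p) {t}" "holo_on C {t}"
      by (rule holo_at[OF _ W(2)]; intro holo_on_mult cst_holo(1)[OF c(1)] cst_holo(1)[OF c(2)] cst_holo(1)[OF c(3)] hl)+
    have "pdiff (\<lambda>t. gform (\<lambda>x. lam x p) (\<lambda>x. lam x q) (pt t)) X0 t
       = pdiff (\<lambda>t. A t * lam (pt t) q - B t * lam (pt t) p - C t) X0 t"
      by (rule pdiff_cong[OF W], subst gform_lam[OF p[OF WV] q[OF WV] pq[OF WV]], assumption+)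
         (simp add: A_def B_def C_def divide_inverse mult_ac)
    also have "... = A t * 1 - B t * 1 - 0"
      by (simp add: pdiff_diff h holo_on_diff pdiff_cst_mult[OF c(1) hl(2) W(2)] pdiff_cst_mult[OF c(2) hl(1) W(2)] u cst_holo(2)[OF c(3) W(2)])
    finally show ?thesis by (simp add: A_def B_def x_def)
  qed
  show ?b
  proof -
    define A where "A = (\<lambda>t. - (psi (pt t $ Xtau) q - psi (pt t $ Xtau) (q + shift_v (pt t))))"
    define C where "C = (\<lambda>t. inverse (of_nat CARD('n)) * lamd (pt t) q)"
    have c: "cst X0 W A" "cst X0 W C"
      unfolding A_def C_def by (intro cst_mult cst_diff cst_minus cst_const W(1) sp ld | assumption)+
    have h: "holo_on (\<lambda>t. A t * lam (pt t) q) {t}" "holo_on C {t}"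
      by (rule holo_at[OF _ W(2)]; intro holo_on_mult cst_holo(1)[OF c(1)] cst_holo(1)[OF c(2)] hl)+
    have "pdiff (\<lambda>t. gform shift_v (\<lambda>x. lam x q) (pt t)) X0 t = pdiff (\<lambda>t. A t * lam (pt t) q - C t) X0 t"
      by (rule pdiff_cong[OF W], subst gform_shift_lam[OF q[OF WV]], assumption)
         (simp add: A_def C_def divide_inverse mult_ac)
    also have "... = A t * 1 - 0"
      by (simp add: pdiff_diff h pdiff_cst_mult[OF c(1) hl(2) W(2)] u cst_holo(2)[OF c(2) W(2)])
    finally show ?thesis by (simp add: A_def x_def)
  qed
  show ?c
  proof -
    have "pdiff (\<lambda>t. gform tau (\<lambda>x. lam x q) (pt t)) X0 t = pdiff (\<lambda>t. (- 2 * of_real pi * \<i>) * lam (pt t) q) X0 t"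
      by (rule pdiff_cong[OF W], rule gform_tau_lam[OF q[OF WV]])
    also have "... = (- 2 * of_real pi * \<i>) * pdiff (\<lambda>t. lam (pt t) q) X0 t"
      by (rule pdiff_cmult[OF holo_at[OF hl(2) W(2)]])
    finally show ?thesis by (simp add: u)
  qed
qed

end

section \<open>Regions with two families of evaluation points\<close>

lemma open_good_region: "open (good_region U p q)"
proof -
  define V where "V = U \<inter> (\<Inter>j. {x. regz x (p j)}) \<inter> (\<Inter>j. {x. regz x (q j)})
     \<inter> (\<Inter>i. \<Inter>j. {x \<in> {x. Im (tau x) > 0}. Th 0 (tau x) (q j - p i) ~= 0})"
  have V: "open V" unfolding V_def
    by (intro open_Int open_INT finite ballI open_U open_regz open_Th_nonzero open_Im_pos holo_on_component holo_on_const) auto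
  have B: "holo_on (\<lambda>x. Bmat x p $ i $ j) V" "holo_on (\<lambda>x. Bmat x q $ i $ j) V" for i j
    unfolding Bmat_def vec_lambda_beta
    by (rule holo_bas_x, rule reg_U, auto simp: V_def)+
  have "open ({x \<in> V. invertible (Bmat x p)} \<inter> {x \<in> V. invertible (Bmat x q)})"
    by (intro open_Int open_invertible B V)
  moreover have "{x \<in> V. invertible (Bmat x p)} \<inter> {x \<in> V. invertible (Bmat x q)} = good_region U p q"
    unfolding V_def good_region_def by (auto simp: regz_def)
  ultimately show ?thesis by simp
qed

lemma exists_good_region:
  assumes "x \<in> U"
  shows "\<exists>p q. x \<in> good_region U p q"
proof -
  note reg = reg_U[OF assms]
  have tau: "Im (tau x) > 0" using reg by (simp add: reg_x_def)
  obtain p where p: "\<And>j::'n option. regz x (p j)" "invertible (Bmat x p)"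
    using exists_points[OF reg ev_regz[OF tau]] by blast
  have "eventually (\<lambda>z. regz x z \<and> (\<forall>i. Th 0 (tau x) (z - p i) ~= 0)) (at 0)"
    using ev_Th0_shift[OF tau, of "- p i" 0 for i] by (auto intro!: eventually_conj eventually_all_finite ev_regz tau)
  from exists_points[OF reg this] obtain q where q: "\<And>j::'n option. regz x (q j) \<and> (\<forall>i. Th 0 (tau x) (q j - p i) ~= 0)" "invertible (Bmat x q)"
    by blast
  have "x \<in> good_region U p q" using assms p q by (auto simp: good_region_def)
  thus ?thesis by blast
qed

context
  fixes p q :: "'n option => complex" and V
  defines "V \<equiv> good_region U p q"
begin

lemma V_facts:
  shows "open V" "V \<subseteq> U" "x \<in> V ==> regz x (p j)" "x \<in> V ==> regz x (q j)"
    "x \<in> V ==> Th 0 (tau x) (q j - p i) ~= 0" "x \<in> V ==> Th 0 (tau x) (p i - q j) ~= 0"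
    "x \<in> V ==> invertible (Bmat x p)" "x \<in> V ==> invertible (Bmat x q)"
proof -
  show "open V" unfolding V_def by (rule open_good_region)
  show 1: "V \<subseteq> U" "x \<in> V ==> regz x (p j)" "x \<in> V ==> regz x (q j)" "x \<in> V ==> Th 0 (tau x) (q j - p i) ~= 0"
    "x \<in> V ==> invertible (Bmat x p)" "x \<in> V ==> invertible (Bmat x q)" for x i j
    by (auto simp: V_def good_region_def)
  show "Th 0 (tau x) (p i - q j) ~= 0" if "x \<in> V"
    using 1(4)[OF that, of j i] 1(2)[OF that, of i] Th0_minus_iff[of "x $ Xtau" "q j - p i"] by (simp add: regz_def)
qed

lemma holo_ycoord: "holo_on (ycoord p i) V" "holo_on (ycoord q i) V"
proof -
  have "holo_on (\<lambda>x. lam x (p j)) V" "holo_on (\<lambda>x. lam x (q j)) V" for j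
    by (rule holo_lam_V(1)[OF V_facts(1,2)], rule V_facts, assumption)+
  thus "holo_on (ycoord p i) V" "holo_on (ycoord q i) V"
    by (cases rule: ycoord_cases[of p i]; simp) (cases rule: ycoord_cases[of q i]; simp add: \<open>\<And>j. holo_on (\<lambda>x. lam x (q j)) V\<close>)
qed

lemma os: "open (sheet V)"
  by (rule open_sheet[OF V_facts(1)])

lemma cst_pdiff_ycoord:
  "cst X0 (sheet V) (pdiff (\<lambda>t. ycoord p i (pt t)) a)"
  "cst X0 (sheet V) (pdiff (\<lambda>t. ycoord q i (pt t)) a)"
proof -
  have 1: "cst X0 (sheet V) (pdiff (\<lambda>t. lam (pt t) (p j)) a)" "cst X0 (sheet V) (pdiff (\<lambda>t. lam (pt t) (q j)) a)" for j
    by (rule cst_pdiff_lam[OF V_facts(1,2)], rule V_facts, assumption)+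
  note 2 = cst_special[OF V_facts(1,2,3,4,5)]
  show "cst X0 (sheet V) (pdiff (\<lambda>t. ycoord p i (pt t)) a)"
    by (cases rule: ycoord_cases[of p i]) (simp_all add: 1 cst_pdiff[OF 2(8)] cst_pdiff[OF 2(9)])
  show "cst X0 (sheet V) (pdiff (\<lambda>t. ycoord q i (pt t)) a)"
    by (cases rule: ycoord_cases[of q i]) (simp_all add: 1 cst_pdiff[OF 2(8)] cst_pdiff[OF 2(9)])
qed

lemma aff_gform_ycoord: "aff X0 (sheet V) (\<lambda>t. gform (ycoord p i) (ycoord q j) (pt t))"
proof -
  note pq = V_facts(1,2,3,4,5) and qp = V_facts(1,2,4,3,6)
  have s: "gform (\<lambda>x. lam x z) shift_v = gform shift_v (\<lambda>x. lam x z)" "gform (\<lambda>x. lam x z) tau = gform tau (\<lambda>x. lam x z)"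
    "gform tau shift_v = gform shift_v (tau :: 'n point => complex)" for z :: complex
    by (rule ext, rule gform_sym)+
  show ?thesis
    by (cases rule: ycoord_cases[of p i]; cases rule: ycoord_cases[of q j])
       (simp_all only: s gform_shift_tau aff_gform_lam[OF pq] aff_gform_shift_lam[OF pq] aff_gform_shift_lam[OF qp]
          aff_gform_tau_lam[OF pq] aff_gform_tau_lam[OF qp] cst_imp_aff[OF cst_const[OF os]])
qed

lemma aff_gconn_ycoord:
  "aff X0 (sheet V) (\<lambda>t. \<Sum>!c. gconn (ycoord p i) (ycoord q j) c (pt t) * pdiff (\<lambda>t. pt t $ c) m t)"
proof -
  \<comment> \<open>w and tau have constant gradients on \<Omega>: in the first slot the connection
    becomes a derivative of the pairing, in the second slot it vanishes.\<close>
  have lin1: ?thesis if l: "\<And>a y. pdiff (ycoord p i) a y = k a" for k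
  proof (rule aff_cong[OF aff_pdiff[OF aff_gform_ycoord[of i j], of m]])
    fix t assume t: "t \<in> sheet V"
    have h: "holo_on (gform (ycoord p i) (ycoord q j)) V"
      unfolding gform_def[abs_def] gf_def
      by (intro holo_on_sum holo_on_mult holo_on_const holo_on_pdiff holo_ycoord V_facts(1))
    show "(\<Sum>!c. gconn (ycoord p i) (ycoord q j) c (pt t) * pdiff (\<lambda>t. pt t $ c) m t)
       = pdiff (\<lambda>t. gform (ycoord p i) (ycoord q j) (pt t)) m t"
      unfolding pdiff_tinv[OF holo_at[OF h sheet_W(2)[OF t]] sheet_W(1)[OF t]]
        gconn_linear(1)[OF l holo_ycoord(2) V_facts(1) sheet_W(2)[OF t]] ..
  qed
  have lin2: ?thesis if l: "\<And>a y. pdiff (ycoord q j) a y = k a" for k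
    by (rule aff_cong[OF cst_imp_aff[OF cst_const[OF os, of _ 0]]])
       (simp add: gconn_linear(2)[OF l holo_ycoord(1) V_facts(1) sheet_W(2)])
  show ?thesis
  proof (cases rule: ycoord_cases[of p i])
    case (1 a)
    note c1 = 1
    show ?thesis
    proof (cases rule: ycoord_cases[of q j])
      case (1 b)
      show ?thesis unfolding c1 1 by (rule aff_gconn_lam[OF V_facts(1,2,3,4,5)])
    next
      case 2
      show ?thesis by (rule lin2[of "\<lambda>a. pdiff shift_v a undefined"]) (unfold 2, rule shift_v_linear)
    next
      case 3
      show ?thesis by (rule lin2[of "\<lambda>a. pdiff tau a undefined"]) (unfold 3, rule tau_linear)
    qed
  next
    case 2
    show ?thesis by (rule lin1[of "\<lambda>a. pdiff shift_v a undefined"]) (unfold 2, rule shift_v_linear)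
  next
    case 3
    show ?thesis by (rule lin1[of "\<lambda>a. pdiff tau a undefined"]) (unfold 3, rule tau_linear)
  qed
qed

end

text \<open>The push-forward X of a kernel vector has no component along tau and v with subscript n
  + 1, so the basis functions do not vary along X, and d\<lambda>(p_j)(X) is \<open>Bmat\<close>
  applied to the derivatives of the invariants. Invertibility makes these zero, and then all
  \<open>t\<close>-components vanish.\<close>

lemma ycoord_jacobian_invertible:
  assumes t: "t \<in> TU" and p: "\<And>j. regz (pt t) (p j)" and B: "invertible (Bmat (pt t) p)"
  shows "invertible ((\<chi> i b. pdiff (\<lambda>t. ycoord p i (pt t)) b t) :: complex ^ 'n idx ^ 'n idx)" (is "invertible ?K")
proof -
  define x where "x = pt t"
  have xU: "x \<in> U" unfolding x_def by (rule tinv_in[OF t])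
  define V where "V = U \<inter> (\<Inter>j. {x. regz x (p j)})"
  have V: "open V" "V \<subseteq> U" "x \<in> V" "\<And>x j. x \<in> V ==> regz x (p j)"
    using p xU unfolding V_def x_def by (auto intro!: open_Int open_INT open_regz open_U)
  have "v = 0" if z: "?K *v v = 0" for v
  proof -
    define X where "X = push t v"
    have "holo_on (ycoord p i) {x}" for i
      by (cases rule: ycoord_cases[of p i]) (use pdiff_lam(1)[OF V(4)[OF V(3)]] in auto)
    hence "Dsum (ycoord p i) x X = (?K *v v) $ i" for i
      using Dsum_push[OF _ t, of "ycoord p i" v]
      by (simp add: x_def X_def Dsum_def matrix_vector_mult_def mult.commute)
    hence d0: "Dsum (ycoord p i) x X = 0" for i using z by simp
    have n1: "(of_nat CARD('n) + 1 :: complex) ~= 0" by (metis of_nat_Suc of_nat_eq_0_iff nat.distinct(1) add.commute)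
    have "pdiff shift_v a x = (of_nat CARD('n) + 1) * pdiff (\<lambda>x. x $ Xv) a x" for a :: "'n idx"
      unfolding shift_v_def by (rule pdiff_cmult) auto
    hence "Dsum shift_v x X = (of_nat CARD('n) + 1) * X $ Xv"
      by (simp add: Dsum_def pdiff_component if_distrib[of "\<lambda>x. _ * x"] cong: if_cong)
    hence Xv: "X $ Xv = 0" using d0[of Xv] n1 by (simp add: ycoord_def)
    have "Dsum tau x X = X $ Xtau"
      by (simp add: Dsum_def pdiff_component if_distrib[of "\<lambda>x. _ * x"] cong: if_cong)
    hence Xt: "X $ Xtau = 0" using d0[of Xtau] by (simp add: ycoord_def)
    define d where "d = (\<lambda>k. Dsum (\<lambda>y. phi y k) x X)"
    have lam0: "Dsum (\<lambda>x. lam x (p j)) x X = 0" for j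
      using d0[of X0] d0[of "XN k" for k] by (cases j) (auto simp: ycoord_def)
    have "(\<Sum>k\<le>CARD('n). d k * bas k (tau x) (shift_v x) (p j)) = 0" for j
    proof -
      have hb: "holo_on (\<lambda>x. bas k (tau x) (shift_v x) (p j)) V" for k
        by (rule holo_bas_x[OF reg_U V(4)]) (use V(2) in auto)
      have hp: "holo_on (\<lambda>y. phi y k) V" for k by (rule holo_on_subset[OF holo_phi_U V(2)])
      have "pdiff (\<lambda>x. lam x (p j)) a x = (\<Sum>k\<le>CARD('n). pdiff (\<lambda>y. phi y k) a x * bas k (tau x) (shift_v x) (p j)
         + phi x k * pdiff (\<lambda>x. bas k (tau x) (shift_v x) (p j)) a x)" for a
      proof -
        have "pdiff (\<lambda>x. lam x (p j)) a x = pdiff (\<lambda>x. \<Sum>k\<le>CARD('n). phi x k * bas k (tau x) (shift_v x) (p j)) a x"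
          by (rule pdiff_cong[OF V(1,3)], rule lam_expand(1)) (use V reg_U in auto)
        also have "... = (\<Sum>k\<le>CARD('n). pdiff (\<lambda>x. phi x k * bas k (tau x) (shift_v x) (p j)) a x)"
          by (rule pdiff_sum) (intro holo_on_mult holo_at[OF hp V(3)] holo_at[OF hb V(3)])
        finally show ?thesis by (simp add: pdiff_mult[OF holo_at[OF hp V(3)] holo_at[OF hb V(3)]])
      qed
      hence "Dsum (\<lambda>x. lam x (p j)) x X = (\<Sum>!a. \<Sum>k\<le>CARD('n). X $ a * (pdiff (\<lambda>y. phi y k) a x * bas k (tau x) (shift_v x) (p j)
         + phi x k * pdiff (\<lambda>x. bas k (tau x) (shift_v x) (p j)) a x))"
        by (simp add: Dsum_def sum_distrib_left)
      also have "... = (\<Sum>k\<le>CARD('n). \<Sum>!a. X $ a * (pdiff (\<lambda>y. phi y k) a x * bas k (tau x) (shift_v x) (p j)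
         + phi x k * pdiff (\<lambda>x. bas k (tau x) (shift_v x) (p j)) a x))"
        by (rule sum.swap)
      also have "... = (\<Sum>k\<le>CARD('n). d k * bas k (tau x) (shift_v x) (p j) + phi x k * Dsum (\<lambda>x. bas k (tau x) (shift_v x) (p j)) x X)"
        by (simp add: d_def Dsum_def sum_distrib_left sum_distrib_right sum.distrib algebra_simps)
      also have "... = (\<Sum>k\<le>CARD('n). d k * bas k (tau x) (shift_v x) (p j))"
        using Dsum_wt[OF _ Xv Xt, of "\<lambda>x. bas k (tau x) (shift_v x) (p j)" for k] by (simp add: shift_v_def)
      finally show ?thesis using lam0 by simp
    qed
    moreover have "(\<Sum>k\<in>(UNIV :: 'n option set). d (kidx k) * bas (kidx k) (tau x) (shift_v x) (p j))
       = (\<Sum>k\<le>CARD('n). d k * bas k (tau x) (shift_v x) (p j))" for j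
      by (rule sum_kidx)
    ultimately have "(\<Sum>!k. Bmat x p $ j $ k * d (kidx k)) = 0" for j
      by (simp add: Bmat_def mult.commute)
    hence "Bmat x p *v (\<chi> k. d (kidx k)) = 0" by (simp add: vec_eq_iff matrix_vector_mult_def)
    hence "(\<chi> k. d (kidx k)) = (0 :: complex ^ 'n option)" using B unfolding x_def[symmetric] invertible_iff_ker by (elim allE impE)
    hence dk: "d (kidx k) = 0" for k :: "'n option" by (simp add: vec_eq_iff)
    have "d k = 0" for k
    proof (cases "k \<le> CARD('n)")
      case True
      then obtain j :: "'n option" where "k = kidx j" using bij_betw_imp_surj_on[OF kidx_bij] by auto
      thus ?thesis using dk by simp
    next
      case False
      have "pdiff (\<lambda>y. phi y k) a x = pdiff (\<lambda>_. 0) a x" for a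
        by (rule pdiff_cong[OF open_U xU]) (use False phi_props(1)[OF reg_U] in auto)
      thus ?thesis by (simp add: d_def Dsum_def)
    qed
    hence "Dsum (\<lambda>y. t_coord r y $ b) x X = 0" for b
      using t_killed_conv[OF xU Xv Xt] by (simp add: d_def)
    hence "v $ b = 0" for b using Dsum_t_push[OF t, of b v] by (simp add: x_def X_def)
    thus ?thesis by (simp add: vec_eq_iff)
  qed
  thus ?thesis unfolding invertible_iff_ker by (intro allI impI)
qed

lemma aff_data:
  assumes x: "x \<in> U"
  shows "\<exists>W. t_coord r x \<in> W \<and> (\<forall>a k. aff X0 W (\<lambda>t. g_t U r t $ a $ k)) \<and> (\<forall>a k l. aff X0 W (Ct U r a k l))"
proof -
  obtain p q where pq: "x \<in> good_region U p q" using exists_good_region[OF x] by blast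
  define V where "V = good_region U p q"
  note Vf = V_facts[where p=p and q=q, folded V_def]
  note V = Vf(1,2)
  define W where "W = sheet V"
  have W: "open W" unfolding W_def by (rule open_sheet[OF V(1)])
  have WW: "t \<in> TU" "pt t \<in> V" if "t \<in> W" for t using sheet_W that unfolding W_def by auto
  have xW: "t_coord r x \<in> W" using x pq by (simp add: W_def sheet_def tinv_t V_def)
  define K where "K = (\<lambda>p t. (\<chi> i a. pdiff (\<lambda>t. ycoord p i (pt t)) a t) :: complex ^ 'n idx ^ 'n idx)"
  have Kn: "K p t $ i $ a = pdiff (\<lambda>t. ycoord p i (pt t)) a t" for p t i a by (simp add: K_def)
  have cK: "cst X0 W (\<lambda>t. K p t $ i $ a)" "cst X0 W (\<lambda>t. K q t $ i $ a)" for i a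
    unfolding Kn W_def V_def by (rule cst_pdiff_ycoord)+
  have iK: "invertible (K p t)" "invertible (K q t)" if "t \<in> W" for t
    unfolding K_def by (rule ycoord_jacobian_invertible; use WW[OF that] Vf in blast)+
  have hy: "holo_on (ycoord p i) V" "holo_on (ycoord q i) V" for i unfolding V_def by (rule holo_ycoord)+
  have ag: "aff X0 W (\<lambda>t. g_t U r t $ a $ k)" for a k
  proof (rule aff_transfer[OF W cK(1) iK(1) cK(2) iK(2)])
    fix i j
    show "aff X0 W (\<lambda>t. \<Sum>!a k. K p t $ i $ a * g_t U r t $ a $ k * K q t $ j $ k)"
    proof (rule aff_cong)
      show "aff X0 W (\<lambda>t. gform (ycoord p i) (ycoord q j) (pt t))"
        unfolding W_def V_def by (rule aff_gform_ycoord)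
      show "(\<Sum>!a k. K p t $ i $ a * g_t U r t $ a $ k * K q t $ j $ k) = gform (ycoord p i) (ycoord q j) (pt t)" if "t \<in> W" for t
        unfolding Kn by (rule gform_via_t[OF hy(1) hy(2) V that[unfolded W_def], symmetric])
    qed
  qed
  \<comment> \<open>The transformation law \<open>gconn_via_t\<close> contains an extra term with
    the derivative of the second frame; it is affine by the result for the metric and is
    subtracted.\<close>
  have ac: "aff X0 W (Ct U r a k l)" for a k l
  proof (rule aff_transfer[OF W cK(1) iK(1) cK(2) iK(2), where G="\<lambda>a k. Ct U r a k l"])
    fix i j
    show "aff X0 W (\<lambda>t. \<Sum>!a k. K p t $ i $ a * Ct U r a k l t * K q t $ j $ k)"
    proof (rule aff_cong)
      show "aff X0 W (\<lambda>t. (\<Sum>!c. gconn (ycoord p i) (ycoord q j) c (pt t) * pdiff (\<lambda>t. pt t $ c) l t)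
         - (\<Sum>!a k. K p t $ i $ a * (g_t U r t $ a $ k * pdiff (\<lambda>t. K q t $ j $ k) l t)))"
      proof (rule aff_diff)
        show "aff X0 W (\<lambda>t. \<Sum>!c. gconn (ycoord p i) (ycoord q j) c (pt t) * pdiff (\<lambda>t. pt t $ c) l t)"
          unfolding W_def V_def by (rule aff_gconn_ycoord)
        show "aff X0 W (\<lambda>t. \<Sum>!a k. K p t $ i $ a * (g_t U r t $ a $ k * pdiff (\<lambda>t. K q t $ j $ k) l t))"
          by (intro aff_sum W aff_cmult[OF cK(1)] aff_multc[OF ag] cst_pdiff cK)
      qed
      show "(\<Sum>!a k. K p t $ i $ a * Ct U r a k l t * K q t $ j $ k)
        = (\<Sum>!c. gconn (ycoord p i) (ycoord q j) c (pt t) * pdiff (\<lambda>t. pt t $ c) l t)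
         - (\<Sum>!a k. K p t $ i $ a * (g_t U r t $ a $ k * pdiff (\<lambda>t. K q t $ j $ k) l t))" if "t \<in> W" for t
        unfolding gconn_via_t[OF hy(1) hy(2) V that[unfolded W_def]] Kn
        by (simp add: sum_subtractf[symmetric] algebra_simps)
    qed
  qed
  show ?thesis using xW ag ac by (intro exI[of _ W]) simp
qed

section \<open>Nondegeneracy of the second metric in the chart\<close>

lemma eta_t_sym: "p \<in> TU ==> eta_t U r p $ i $ j = eta_t U r p $ j $ i"
proof -
  have "g_t U r q $ i $ j = g_t U r q $ j $ i" for q
  proof -
    have "transpose (g_t U r q) $ i $ j = g_t U r q $ i $ j" by (simp only: g_t_sym)
    thus ?thesis by (simp add: transpose_def)
  qed
  thus ?thesis by (simp add: eta_t_def)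
qed

text \<open>The differentials have components independent of the distinguished coordinate, so its
  derivative falls on \<open>g_t\<close> alone and produces \<open>eta_t\<close>.\<close>

lemma dgform_eta:
  assumes V: "open V" "V \<subseteq> U" and f: "holo_on f V" "\<And>i. cst X0 (sheet V) (pdiff (\<lambda>t. f (pt t)) i)"
    and h: "holo_on h V" "\<And>i. cst X0 (sheet V) (pdiff (\<lambda>t. h (pt t)) i)" and t: "t \<in> sheet V"
  shows "pdiff (\<lambda>t. gform f h (pt t)) X0 t
    = (\<Sum>!i j. pdiff (\<lambda>t. f (pt t)) i t * eta_t U r t $ i $ j * pdiff (\<lambda>t. h (pt t)) j t)"
proof -
  define F H where "F = (\<lambda>i. pdiff (\<lambda>t. f (pt t)) i)" and "H = (\<lambda>j. pdiff (\<lambda>t. h (pt t)) j)"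
  define W where "W = sheet V"
  have W: "open W" "t \<in> W" unfolding W_def using open_sheet[OF V(1)] t by auto
  have cF: "cst X0 W (F i)" and cH: "cst X0 W (H i)" for i unfolding F_def H_def W_def by (rule f h)+
  have hG: "holo_on (\<lambda>t. g_t U r t $ i $ j) W" for i j
    by (rule holo_on_subset[OF holo_g_t]) (use sheet_W(1) in \<open>auto simp: W_def\<close>)
  have hFG: "holo_on (\<lambda>t. (F i t * H j t) * g_t U r t $ i $ j) {t}" for i j
    by (rule holo_at[OF _ W(2)]) (intro holo_on_mult cst_holo(1)[OF cF] cst_holo(1)[OF cH] hG)
  have "pdiff (\<lambda>t. gform f h (pt t)) X0 t = pdiff (\<lambda>t. \<Sum>!i j. (F i t * H j t) * g_t U r t $ i $ j) X0 t"
  proof (rule pdiff_cong[OF W])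
    fix s assume "s \<in> W"
    hence "gform f h (pt s) = (\<Sum>!i j. F i s * g_t U r s $ i $ j * H j s)"
      unfolding F_def H_def W_def by (rule gform_via_t[OF f(1) h(1) V])
    thus "gform f h (pt s) = (\<Sum>!i j. (F i s * H j s) * g_t U r s $ i $ j)"
      by (simp add: mult_ac)
  qed
  also have "... = (\<Sum>!i. pdiff (\<lambda>t. \<Sum>!j. (F i t * H j t) * g_t U r t $ i $ j) X0 t)"
    by (rule pdiff_sum) (intro holo_on_sum hFG)
  also have "... = (\<Sum>!i j. pdiff (\<lambda>t. (F i t * H j t) * g_t U r t $ i $ j) X0 t)"
    by (intro sum.cong refl pdiff_sum hFG)
  also have "... = (\<Sum>!i j. F i t * eta_t U r t $ i $ j * H j t)"
    by (intro sum.cong refl) (simp add: pdiff_cst_mult[OF cst_mult[OF cF cH] hG W(2)] eta_t_def)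
  finally show ?thesis by (simp only: F_def H_def)
qed

lemma invertible_eta:
  assumes T: "T \<in> TU"
  shows "invertible (eta_t U r T)"
proof -
  define x where "x = pt T"
  let ?D = "\<lambda>f h. pdiff (\<lambda>t. gform f h (pt t)) X0 T"
  have xU: "x \<in> U" unfolding x_def by (rule tinv_in[OF T])
  obtain p q0 where g: "x \<in> good_region U p q0" using exists_good_region[OF xU] by blast
  have p: "regz x (p j)" for j using g by (simp add: good_region_def)
  have B: "invertible (Bmat x p)" using g by (simp add: good_region_def)
  define K where "K = ((\<chi> i a. pdiff (\<lambda>t. ycoord p i (pt t)) a T) :: complex ^ 'n idx ^ 'n idx)"
  have iK: "invertible K" unfolding K_def
    by (rule ycoord_jacobian_invertible[OF T]) (use p B in \<open>simp_all add: x_def\<close>)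
  have "u = 0" if z: "eta_t U r T *v u = 0" for u
  proof -
    have iKt: "invertible (transpose K)" using iK by (simp add: invertible_det_nz det_transpose)
    \<comment> \<open>The components of the null covector \<open>u\<close> in the coframe of the
      differentials of \<open>ycoord p i\<close>.\<close>
    define c where "c = matrix_inv (transpose K) *v u"
    have u: "u = transpose K *v c"
      unfolding c_def by (simp add: matrix_vector_mul_assoc matrix_inv_right[OF iKt])
    have \<omega>\<alpha>: "u $ a = (\<Sum>!i. c $ i * K $ i $ a)" for a
      by (subst u) (simp add: matrix_vector_mult_def transpose_def mult.commute)
    have e0: "(\<Sum>!a. u $ a * eta_t U r T $ a $ b) = 0" for b
    proof -
      have "(\<Sum>!a. eta_t U r T $ b $ a * u $ a) = 0"
        using arg_cong[OF z, of "\<lambda>v. v $ b"] by (simp add: matrix_vector_mult_def)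
      thus ?thesis by (subst eta_t_sym[OF T]) (simp add: mult.commute)
    qed
    have main: "(\<Sum>!i. c $ i * ?D (ycoord p i) h) = 0"
      if V: "open V" "V \<subseteq> U" "x \<in> V" "\<And>x j. x \<in> V ==> regz x (p j)"
        and h: "holo_on h V" "\<And>a. cst X0 (sheet V) (pdiff (\<lambda>t. h (pt t)) a)" for V h
    proof -
      have TV: "T \<in> sheet V" using T V(3) by (simp add: sheet_def x_def)
      have hy: "holo_on (ycoord p i) V" for i
        by (cases rule: ycoord_cases[of p i]) (use holo_lam_V(1)[OF V(1,2,4)] in auto)
      have cy: "cst X0 (sheet V) (pdiff (\<lambda>t. ycoord p i (pt t)) a)" for i a
      proof (cases rule: ycoord_cases[of p i])
        case (1 j)
        show ?thesis unfolding 1 by (rule cst_pdiff_lam[OF V(1,2,4)])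
      next
        case 2
        have "cst X0 (sheet V) (\<lambda>t. shift_v (pt t))" by (rule cst_wt[OF _ V(1,2)]) (auto simp: shift_v_def)
        thus ?thesis unfolding 2 by (rule cst_pdiff)
      next
        case 3
        have "cst X0 (sheet V) (\<lambda>t. pt t $ Xtau)" by (rule cst_wt[OF _ V(1,2)]) auto
        thus ?thesis unfolding 3 by (rule cst_pdiff)
      qed
      define H where "H = (\<lambda>b. pdiff (\<lambda>t. h (pt t)) b T)"
      have "(\<Sum>!i. c $ i * ?D (ycoord p i) h)
        = (\<Sum>!i a b. c $ i * K $ i $ a * (eta_t U r T $ a $ b * H b))"
        unfolding dgform_eta[OF V(1,2) hy cy h TV] by (simp add: sum_distrib_left K_def H_def mult.assoc)
      also have "... = (\<Sum>!a i b. c $ i * K $ i $ a * (eta_t U r T $ a $ b * H b))" by (rule sum.swap)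
      also have "... = (\<Sum>!a b i. c $ i * K $ i $ a * (eta_t U r T $ a $ b * H b))"
        by (intro sum.cong refl sum.swap)
      also have "... = (\<Sum>!a b. u $ a * eta_t U r T $ a $ b * H b)"
        by (simp add: \<omega>\<alpha> sum_distrib_right mult.assoc)
      also have "... = (\<Sum>!b a. u $ a * eta_t U r T $ a $ b * H b)" by (rule sum.swap)
      also have "... = (\<Sum>!b. (\<Sum>!a. u $ a * eta_t U r T $ a $ b) * H b)" by (simp add: sum_distrib_right)
      finally show ?thesis by (simp add: e0)
    qed
    define cc where "cc = (\<lambda>j :: 'n option. case j of None => c $ X0 | Some k => c $ XN k)"
    have split: "(\<Sum>!i. c $ i * f (ycoord p i)) = (\<Sum>!j. cc j * f (\<lambda>x. lam x (p j))) + c $ Xv * f shift_v + c $ Xtau * f tau"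
      for f :: "('n point => complex) => complex"
      by (simp add: sum_idx sum_option cc_def ycoord_def)
    define V0 where "V0 = U \<inter> (\<Inter>j. {x. regz x (p j)})"
    have V0: "open V0" "V0 \<subseteq> U" "x \<in> V0" "\<And>x j. x \<in> V0 ==> regz x (p j)"
      using p xU unfolding V0_def by (auto intro!: open_Int open_INT open_regz open_U)
    have Ts: "T \<in> sheet V" if "x \<in> V" for V using T that by (simp add: sheet_def x_def)
    \<comment> \<open>The points of \<open>q0\<close> serve as the auxiliary first point in
      \<open>dgform_values\<close>, with \<open>p j\<close> in the second slot.\<close>
    note G = V_facts[where p=p and q=q0]
    have dtau: "?D (\<lambda>x. lam x (p j)) tau = - 2 * of_real pi * \<i>"
      and dshift: "?D (\<lambda>x. lam x (p j)) shift_v = - (psi (tau x) (p j) - psi (tau x) (p j + shift_v x))" for j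
    proof -
      show "?D (\<lambda>x. lam x (p j)) tau = - 2 * of_real pi * \<i>"
        using dgform_values(3)[OF G(1,2) G(4)[of _ j] G(3)[of _ j] G(6)[of _ j j] Ts[OF g]] by (simp add: gform_sym[of "\<lambda>x. lam x (p j)"])
      show "?D (\<lambda>x. lam x (p j)) shift_v = - (psi (tau x) (p j) - psi (tau x) (p j + shift_v x))"
        using dgform_values(2)[OF G(1,2) G(4)[of _ j] G(3)[of _ j] G(6)[of _ j j] Ts[OF g]] by (simp add: gform_sym[of "\<lambda>x. lam x (p j)"] x_def)
    qed
    have d0: "?D shift_v shift_v = 0" "?D shift_v tau = 0"
      "?D tau shift_v = 0" "?D tau tau = 0"
      by (simp_all add: gform_shift_tau gform_sym[of "\<lambda>x. x $ Xtau" shift_v])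
    have 1: "(\<Sum>!j. cc j) = 0"
    proof -
      have "cst X0 (sheet V0) (\<lambda>t. pt t $ Xtau)" by (rule cst_wt[OF _ V0(1,2)]) auto
      hence "(\<Sum>!i. c $ i * ?D (ycoord p i) tau) = 0"
        by (intro main[OF V0]) (auto intro: cst_pdiff)
      hence "(\<Sum>!j. cc j * (- 2 * of_real pi * \<i>)) = 0"
        unfolding split[of "\<lambda>f. ?D f tau"] by (simp add: dtau d0)
      hence "(\<Sum>!j. cc j) * (- 2 * of_real pi * \<i>) = 0" by (simp only: sum_distrib_right)
      thus ?thesis by simp
    qed
    have 2: "(\<Sum>!j. cc j * (psi (tau x) (p j) - psi (tau x) (p j + shift_v x))) = 0"
    proof -
      have "cst X0 (sheet V0) (\<lambda>t. shift_v (pt t))" by (rule cst_wt[OF _ V0(1,2)]) (auto simp: shift_v_def)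
      hence "(\<Sum>!i. c $ i * ?D (ycoord p i) shift_v) = 0"
        by (intro main[OF V0]) (auto intro: cst_pdiff)
      hence "(\<Sum>!j. cc j * - (psi (tau x) (p j) - psi (tau x) (p j + shift_v x))) = 0"
        unfolding split[of "\<lambda>f. ?D f shift_v"] by (simp only: dshift d0 mult_zero_right add_0_right)
      hence "- (\<Sum>!j. cc j * (psi (tau x) (p j) - psi (tau x) (p j + shift_v x))) = 0"
        by (simp only: sum_negf mult_minus_right)
      thus ?thesis by (simp only: neg_equal_0_iff_equal)
    qed
    have 3: "(\<Sum>!j. cc j * ((psi (tau x) (q - p j) - psi (tau x) q) * lamd x (p j) - (psi (tau x) (q - p j) + psi (tau x) (p j)) * lamd x q))
      - c $ Xv * (psi (tau x) q - psi (tau x) (q + shift_v x)) - 2 * of_real pi * \<i> * c $ Xtau = 0"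
      if q: "regz x q" "\<And>j. Th 0 (tau x) (q - p j) ~= 0" for q
    proof -
      \<comment> \<open>The core argument lets \<open>q\<close> vary, so the neighbourhood of
        \<open>x\<close> is shrunk for each \<open>q\<close> separately.\<close>
      define V where "V = V0 \<inter> {x. regz x q} \<inter> (\<Inter>j. {x \<in> {x. Im (tau x) > 0}. Th 0 (tau x) (q - p j) ~= 0})"
      have oV: "open V" unfolding V_def
        by (intro open_Int open_INT finite ballI V0 open_regz open_Th_nonzero open_Im_pos holo_on_component holo_on_const) auto
      have xV: "x \<in> V" using V0(3) q by (auto simp: V_def regz_def)
      have VU: "V \<subseteq> U" using V0(2) by (auto simp: V_def)
      have rp: "regz y (p j)" and rq: "regz y q" and rn: "Th 0 (y $ Xtau) (q - p j) ~= 0" if "y \<in> V" for y j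
        using that V0(4) by (auto simp: V_def)
      have hl: "holo_on (\<lambda>x. lam x q) V" by (rule holo_lam_V(1)[OF oV VU rq])
      have dv: "?D (\<lambda>x. lam x (p j)) (\<lambda>x. lam x q)
          = (psi (tau x) (q - p j) - psi (tau x) q) * lamd x (p j) - (psi (tau x) (q - p j) + psi (tau x) (p j)) * lamd x q"
        "?D shift_v (\<lambda>x. lam x q) = - (psi (tau x) q - psi (tau x) (q + shift_v x))"
        "?D tau (\<lambda>x. lam x q) = - 2 * of_real pi * \<i>" for j
        by (rule dgform_values[OF oV VU rp rq rn Ts[OF xV], folded x_def]; assumption)+
      have "(\<Sum>!i. c $ i * ?D (ycoord p i) (\<lambda>x. lam x q)) = 0"
        by (rule main[OF oV VU xV rp hl cst_pdiff_lam[OF oV VU rq]])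
      hence "(\<Sum>!j. cc j * ((psi (tau x) (q - p j) - psi (tau x) q) * lamd x (p j) - (psi (tau x) (q - p j) + psi (tau x) (p j)) * lamd x q))
        + c $ Xv * - (psi (tau x) q - psi (tau x) (q + shift_v x)) + c $ Xtau * (- 2 * of_real pi * \<i>) = 0"
        unfolding split[of "\<lambda>f. ?D f (\<lambda>x. lam x q)"] dv .
      thus ?thesis by (simp add: algebra_simps)
    qed
    note core = nondegenerate_core[OF reg_U[OF xU] p B phi_n_nonzero[OF xU] 1 2 3]
    have cc0: "cc j = 0" for j by (rule core(1))
    have "c $ X0 = 0" "c $ XN k = 0" for k using cc0[of None] cc0[of "Some k"] by (simp_all add: cc_def)
    moreover have "c $ Xv = 0" by (rule core(2))
    moreover have "c $ Xtau = 0" by (rule core(3))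
    ultimately have "c $ i = 0" for i by (cases i) auto
    thus ?thesis using \<omega>\<alpha> by (simp add: vec_eq_iff)
  qed
  thus ?thesis unfolding invertible_iff_ker by (intro allI impI)
qed

end

theorem lemma4p53:
  fixes U :: "'n::{finite,linorder} point set" and r :: "'n point \<Rightarrow> complex"
  assumes "orbit_chart U r"
  shows "flat_pencil (t_coord r ` U) (g_t U r) (eta_t U r) \<and>
    (\<forall>p \<in> t_coord r ` U. \<forall>\<alpha> \<beta> \<gamma>.
       contra_christoffel (eta_t U r) p \<alpha> \<beta> \<gamma> =
       pdiff (\<lambda>q. contra_christoffel (g_t U r) q \<alpha> \<beta> \<gamma>) X0 p)"
proof -
  note chart = assms
  have eta: "eta_t U r = (\<lambda>p. \<chi> \<alpha> \<beta>. pdiff (\<lambda>q. g_t U r q $ \<alpha> $ \<beta>) X0 p)"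
    by (rule ext) (simp add: eta_t_def)
  \<comment> \<open>\<open>aff_data\<close> gives affinity only near each point. This suffices,
    because the condition on second derivatives is pointwise.\<close>
  have lin: "pdiff (pdiff (\<lambda>q. g_t U r q $ \<alpha> $ \<beta>) X0) X0 p = 0" "pdiff (pdiff (Ct U r \<alpha> \<beta> \<gamma>) X0) X0 p = 0"
    if p: "p \<in> t_coord r ` U" for p \<alpha> \<beta> \<gamma>
  proof -
    obtain x where x: "x \<in> U" "p = t_coord r x" using p by (rule imageE)
    obtain W where W: "p \<in> W" "\<forall>\<alpha> \<beta>. aff X0 W (\<lambda>t. g_t U r t $ \<alpha> $ \<beta>)" "\<forall>\<alpha> \<beta> \<gamma>. aff X0 W (Ct U r \<alpha> \<beta> \<gamma>)"
      using aff_data[OF chart x(1)] unfolding x(2) by (elim exE conjE)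
    thus "pdiff (pdiff (\<lambda>q. g_t U r q $ \<alpha> $ \<beta>) X0) X0 p = 0" "pdiff (pdiff (Ct U r \<alpha> \<beta> \<gamma>) X0) X0 p = 0"
      by (auto simp: aff_def cst_def)
  qed
  have hC: "holo_on (Ct U r \<alpha> \<beta> \<gamma>) (t_coord r ` U)" for \<alpha> \<beta> \<gamma>
    by (subst holo_on_pointwise) (intro ballI, rule holo_at[OF g_t_data(1)[OF chart]])
  have inv: "invertible (\<chi> \<alpha> \<beta>. pdiff (\<lambda>q. g_t U r q $ \<alpha> $ \<beta>) X0 p)" if "p \<in> t_coord r ` U" for p
    using invertible_eta[OF chart that] unfolding eta_t_def .
  note data = open_W[OF chart] invertible_g_t[OF chart] holo_g_t[OF chart] g_t_sym[OF chart] hC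
      g_t_data(2)[OF chart] g_t_data(3)[OF chart] g_t_data(4)[OF chart] lin inv
  show ?thesis
    unfolding eta
    by (intro conjI ballI allI affine_flat_pencil[where c="Ct U r"]) (rule data | assumption)+
qed

end
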